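(* Let $S$ be a real-analytic function on a neighborhood of the origin in $\mathbb{R}^2$, not identically zero, with $S(0)=0$ and $\nabla S(0)=0$. Let $d$ be its Newton distance, $C(S)$ its central face and $k=\dim C(S)$. (a) The growth index of $|S|$ at the origin is equal to $\frac1d$ if and only if $C(S)$ is not a compact edge of $N(S)$ such that $S_{C(S)}$ has a zero on $(\mathbb{R}-\{0\})^2$ of order greater than $d$. If $C(S)$ is a compact edge such that $S_{C(S)}$ has a zero on $(\mathbb{R}-\{0\})^2$ of order greater than $d$, then the growth index of $|S|$ at the origin is less than $\frac1d$. (b) When the growth index of $|S|$ at the origin is $\frac1d$, the multiplicity of this index is equal to $1-k$, unless $C(S)$ is compact and $S_{C(S)}$ has a zero on $(\mathbb{R}-\{0\})^2$ of order $d$, in which case the multiplicity is equal to $1$.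
   Context: Write the Taylor expansion of $S$ at the origin as $S(x)=\sum_\alpha s_\alpha x^\alpha$; here $n=2$. The Newton polyhedron $N(S)$ is the convex hull of the union, over all $\alpha$ with $s_\alpha\neq 0$, of the quadrants $Q_\alpha=\{x\in\mathbb{R}^n: x_i\ge\alpha_i \text{ for all } i\}$. Its faces can be compact or unbounded; a vertex is a compact face of dimension $0$. For a compact face $F$ of $N(S)$, $S_F(x)=\sum_{\alpha\in F}s_\alpha x^\alpha$. The Newton distance is $d=\inf\{t:(t,\dots,t)\in N(S)\}$. The central face $C(S)$ is the face (compact or not) of $N(S)$ whose relative interior contains $(d,\dots,d)$ (a vertex, with $k=0$, if the line $\{(t,\dots,t)\}$ meets $N(S)$ at a vertex). The order of a zero $p$ of a function $P$ is the smallest order of a partial derivative of $P$ that is nonzero at $p$. Growth index and multiplicity: for a real-analytic $f\not\equiv0$ near $0\in\mathbb{R}^n$ with $f(0)=0$, and smooth $\phi\ge0$ with $\phi(0)>0$ supported in a sufficiently small neighborhood of $0$, the integral $I_{f,\phi}(\epsilon)=\int_{\{0<f(x)<\epsilon\}}\phi(x)\,dx$ has an asymptotic expansion $\sum_{j\ge0}\sum_{i=0}^{n-1}c_{ij}(\phi)(\ln\epsilon)^i\epsilon^{r_j}$ as $\epsilon\to0^+$, with $\{r_j\}$ an increasing arithmetic progression of positive rationals independent of $\phi$. The growth index of $f$ at $0$ is the smallest $r_j$ for which some $c_{ij}(\phi)\ne0$, and its multiplicity is the largest $i$ with $c_{ij}(\phi)\neq0$ for this $j$ (both are independent of $\phi$;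 the index is $+\infty$ if all coefficients vanish). The growth index of $|f|$ at $0$ is the minimum of the growth indices of $f$ and $-f$; its multiplicity is the multiplicity for whichever of $f,-f$ attains the minimum, and the maximum of the two multiplicities if both attain it. *)

theory Defs
  imports "HOL-Analysis.Analysis" "HOL-Library.Landau_Symbols"
begin

section \<open>Partial derivatives and orders of zeros\<close>

definition partial_deriv :: "'n::finite \<Rightarrow> (real^'n \<Rightarrow> real) \<Rightarrow> real^'n \<Rightarrow> real" where
  "partial_deriv i f x = deriv (\<lambda>t. f (x + t *\<^sub>R axis i 1)) 0"

definition iter_partial :: "'n::finite list \<Rightarrow> (real^'n \<Rightarrow> real) \<Rightarrow> real^'n \<Rightarrow> real" where
  "iter_partial js f = foldr partial_deriv js f"

definition smooth :: "(real^'n::finite \<Rightarrow> real) \<Rightarrow> bool" where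
  "smooth f \<longleftrightarrow> (\<forall>js x. iter_partial js f differentiable (at x))"

definition zero_order :: "(real^'n::finite \<Rightarrow> real) \<Rightarrow> real^'n \<Rightarrow> nat" where
  "zero_order P p = (LEAST k. \<exists>js. length js = k \<and> iter_partial js P p \<noteq> 0)"

section \<open>Real-analytic functions and Taylor coefficients\<close>

definition monomial :: "('n::finite \<Rightarrow> nat) \<Rightarrow> real^'n \<Rightarrow> real" where
  "monomial \<alpha> x = (\<Prod>i\<in>UNIV. (x $ i) ^ \<alpha> i)"

definition has_power_series_at ::
    "(real^'n::finite \<Rightarrow> real) \<Rightarrow> (('n \<Rightarrow> nat) \<Rightarrow> real) \<Rightarrow> real^'n \<Rightarrow> bool" where
  "has_power_series_at f c a \<longleftrightarrow>
     (\<exists>e>0. \<forall>h\<in>ball 0 e. ((\<lambda>\<alpha>. c \<alpha> * monomial \<alpha> h) has_sum f (a + h)) UNIV)"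

definition real_analytic_on :: "(real^'n::finite \<Rightarrow> real) \<Rightarrow> (real^'n) set \<Rightarrow> bool" where
  "real_analytic_on f U \<longleftrightarrow> (\<forall>a\<in>U. \<exists>c. has_power_series_at f c a)"

text \<open>The coefficients of a convergent power series are unique, so for \<open>f\<close> analytic at the
  origin the description below is proper.\<close>

definition taylor_coeff :: "(real^'n::finite \<Rightarrow> real) \<Rightarrow> ('n \<Rightarrow> nat) \<Rightarrow> real" where
  "taylor_coeff f = (THE c. has_power_series_at f c 0)"

section \<open>Newton polyhedra\<close>

definition exponent_point :: "('n::finite \<Rightarrow> nat) \<Rightarrow> real^'n" where
  "exponent_point \<alpha> = (\<chi> i. real (\<alpha> i))"

definition quadrant :: "('n::finite \<Rightarrow> nat) \<Rightarrow> (real^'n) set" where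
  "quadrant \<alpha> = {x. \<forall>i. x $ i \<ge> real (\<alpha> i)}"

definition newton_polyhedron :: "(real^'n::finite \<Rightarrow> real) \<Rightarrow> (real^'n) set" where
  "newton_polyhedron f = convex hull (\<Union>\<alpha>\<in>{\<alpha>. taylor_coeff f \<alpha> \<noteq> 0}. quadrant \<alpha>)"

definition newton_distance :: "(real^'n::finite \<Rightarrow> real) \<Rightarrow> real" where
  "newton_distance f = Inf {t. (\<chi> i. t) \<in> newton_polyhedron f}"

text \<open>The relative interiors of the faces partition the polyhedron, so the face is unique; a
  singleton is its own relative interior, which covers the case of a vertex.\<close>

definition central_face :: "(real^'n::finite \<Rightarrow> real) \<Rightarrow> (real^'n) set" where
  "central_face f =
     (THE F. F face_of newton_polyhedron f \<and> (\<chi> i. newton_distance f) \<in> rel_interior F)"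

text \<open>Only meaningful for compact \<open>F\<close>, for which the index set of the sum is finite.\<close>

definition face_part :: "(real^'n::finite \<Rightarrow> real) \<Rightarrow> (real^'n) set \<Rightarrow> real^'n \<Rightarrow> real" where
  "face_part f F x = (\<Sum>\<alpha> | exponent_point \<alpha> \<in> F. taylor_coeff f \<alpha> * monomial \<alpha> x)"

section \<open>Growth index and multiplicity\<close>

definition growth_integral ::
    "(real^'n::finite \<Rightarrow> real) \<Rightarrow> (real^'n \<Rightarrow> real) \<Rightarrow> real \<Rightarrow> real" where
  "growth_integral f \<phi> \<epsilon> = (LINT x:{x. 0 < f x \<and> f x < \<epsilon>}|lborel. \<phi> x)"

definition test_function :: "(real^'n::finite) set \<Rightarrow> (real^'n \<Rightarrow> real) \<Rightarrow> bool" where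
  "test_function V \<phi> \<longleftrightarrow> smooth \<phi> \<and> (\<forall>x. \<phi> x \<ge> 0) \<and> \<phi> 0 > 0 \<and>
     compact (closure {x. \<phi> x \<noteq> 0}) \<and> closure {x. \<phi> x \<noteq> 0} \<subseteq> V"

definition pos_rat_progression :: "(nat \<Rightarrow> real) \<Rightarrow> bool" where
  "pos_rat_progression r \<longleftrightarrow>
     (\<exists>a b. a \<in> \<rat> \<and> b \<in> \<rat> \<and> a > 0 \<and> b > 0 \<and> (\<forall>j. r j = a + real j * b))"

text \<open>\<open>c i j\<close> is the coefficient of \<open>(ln \<epsilon>)\<^sup>i \<epsilon>\<^bsup>r j\<^esup>\<close>. The remainder after
  all terms with exponent at most \<open>r N\<close> is of smaller order than \<open>\<epsilon>\<^bsup>r N\<^esup>\<close>,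
  for every \<open>N\<close>.\<close>

definition growth_expansion :: "(real^'n::finite \<Rightarrow> real) \<Rightarrow> (real^'n \<Rightarrow> real) \<Rightarrow>
    (nat \<Rightarrow> real) \<Rightarrow> (nat \<Rightarrow> nat \<Rightarrow> real) \<Rightarrow> bool" where
  "growth_expansion f \<phi> r c \<longleftrightarrow>
     (\<forall>N. (\<lambda>\<epsilon>. growth_integral f \<phi> \<epsilon> -
              (\<Sum>j\<le>N. \<Sum>i<CARD('n). c i j * ln \<epsilon> ^ i * \<epsilon> powr r j))
            \<in> o[at_right 0](\<lambda>\<epsilon>. \<epsilon> powr r N))"

text \<open>\<open>leading_exponent n r c\<close> is \<open>\<infinity>\<close> if all coefficients vanish; the multiplicity,
  which is then irrelevant, is \<open>0\<close> by convention.\<close>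

definition leading_exponent :: "nat \<Rightarrow> (nat \<Rightarrow> real) \<Rightarrow> (nat \<Rightarrow> nat \<Rightarrow> real) \<Rightarrow> ereal" where
  "leading_exponent n r c = Inf {ereal (r j) | i j. i < n \<and> c i j \<noteq> 0}"

definition leading_multiplicity :: "nat \<Rightarrow> (nat \<Rightarrow> real) \<Rightarrow> (nat \<Rightarrow> nat \<Rightarrow> real) \<Rightarrow> nat" where
  "leading_multiplicity n r c =
     (if leading_exponent n r c = \<infinity> then 0
      else Max {i. i < n \<and> (\<exists>j. ereal (r j) = leading_exponent n r c \<and> c i j \<noteq> 0)})"

text \<open>\<open>f\<close> has growth index \<open>\<rho>\<close> with multiplicity \<open>m\<close> at the origin. The neighbourhood \<open>V\<close>
  and the progression \<open>r\<close> do not depend on \<open>\<phi>\<close>, the coefficients \<open>c\<close> do. At most one pair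
  \<open>(\<rho>, m)\<close> satisfies this, since asymptotic coefficients are unique.\<close>

definition has_growth_index :: "(real^'n::finite \<Rightarrow> real) \<Rightarrow> ereal \<Rightarrow> nat \<Rightarrow> bool" where
  "has_growth_index f \<rho> m \<longleftrightarrow>
     (\<exists>V r. open V \<and> 0 \<in> V \<and> pos_rat_progression r \<and>
        (\<forall>\<phi>. test_function V \<phi> \<longrightarrow>
           (\<exists>c. growth_expansion f \<phi> r c \<and>
                \<rho> = leading_exponent CARD('n) r c \<and>
                m = leading_multiplicity CARD('n) r c)))"

definition has_abs_growth_index :: "(real^'n::finite \<Rightarrow> real) \<Rightarrow> ereal \<Rightarrow> nat \<Rightarrow> bool" where
  "has_abs_growth_index f \<rho> m \<longleftrightarrow>
     (\<exists>\<rho>1 m1 \<rho>2 m2.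
        has_growth_index f \<rho>1 m1 \<and> has_growth_index (\<lambda>x. - f x) \<rho>2 m2 \<and>
        \<rho> = min \<rho>1 \<rho>2 \<and>
        m = (if \<rho>1 < \<rho>2 then m1 else if \<rho>2 < \<rho>1 then m2 else max m1 m2))"

end

theory Submission
  imports Defs
begin

text \<open>
  Up to a factor, the two growth integrals together are the measure of \<open>{\<bar>S\<bar> < \<epsilon>}\<close> in a small
  box, so the expansion assumed in the hypothesis reduces the theorem to matching upper and lower
  bounds for this measure.

  Upper bounds. Let \<open>a + s b = e\<close>, with \<open>e = d (1 + s)\<close>, be a supporting line of the Newton
  polyhedron through \<open>(d, d)\<close>. On the slice \<open>x = t\<close>, with \<open>y = t\<^sup>s u\<close>, the function
  \<open>t\<^bsup>-e\<^esup> S(t, t\<^sup>s u)\<close> converges with all its \<open>u\<close>-derivatives to the restriction of the edge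
  polynomial to \<open>x = 1\<close>. If at each point some \<open>u\<close>-derivative of order \<open>k \<le> 1/q\<close> of the limit is
  nonzero, a van der Corput type estimate bounds the slices uniformly by \<open>(\<epsilon> t\<^bsup>-e\<^esup>)\<^sup>q\<close>, and
  integration over \<open>t\<close> gives \<open>\<epsilon>\<^bsup>1/d\<^esup>\<close> for \<open>q > 1/d\<close> and \<open>\<epsilon>\<^bsup>1/d\<^esup> \<bar>ln \<epsilon>\<bar>\<close> for \<open>q = 1/d\<close>. The region
  not covered by these slices is treated by exchanging \<open>x\<close> and \<open>y\<close>. Euler's identity for
  quasihomogeneous polynomials shows that the order of a zero off the axes is already seen by the
  derivatives in one variable.

  Lower bounds. A box with sides \<open>\<epsilon>\<^bsup>w1\<^esup>\<close>, \<open>\<epsilon>\<^bsup>w2\<^esup>\<close> given by supporting weights yields \<open>\<epsilon>\<^bsup>1/d\<^esup>\<close>; at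
  a vertex there are two supporting lines and the union of the boxes for the intermediate weights
  yields the logarithm. A zero of order \<open>K \<ge> d\<close> of the edge polynomial propagates along a curve
  \<open>y = u t\<^sup>s\<close>, and the set of points near this curve yields the logarithm for \<open>K = d\<close> and a smaller
  exponent for \<open>K > d\<close>.
\<close>

text \<open>Uniformity over the slices comes from a gap in the weights: no lattice point has weight
  strictly between \<open>e\<close> and \<open>e + \<theta>\<close>, so the rescaled slices differ
  from the edge polynomial by a multiple of \<open>t powr \<theta>\<close> in every derivative, and
  one constant serves all small \<open>t\<close>. Orders of zeros are integers: if all relevant ones
  are below \<open>d\<close>, some \<open>q > 1/d\<close> still admits them, and this strictness
  removes the logarithm from the upper bound; at order exactly \<open>d\<close> only
  \<open>q = 1/d\<close> is left. If an order exceeds \<open>d\<close>, the sharp exponent is out of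
  reach in the given coordinates, but only a strict inequality is claimed. A lower bound then
  suffices, together with a crude upper bound whose sole purpose is to make the zero set of
  \<open>S\<close> null. This nullity is always needed, since the growth integrals of
  \<open>S\<close> and \<open>- S\<close> both leave out the points with \<open>S = 0\<close>.
  Nonnegativity of the integrals makes the leading constants positive, so that nothing cancels in
  their sum.\<close>

section \<open>Uniform sublevel estimates in one variable\<close>

text \<open>
  The mean value theorem is applied in every other gap, so that the \<open>2\<^sup>k\<^sup>-\<^sup>1\<close> intermediate points are
  again \<open>h\<close>-separated.
\<close>

lemma derivative_small_of_separated_points:
  fixes D :: "nat \<Rightarrow> real \<Rightarrow> real" and x :: "nat \<Rightarrow> real"
  assumes "\<And>i u. i < k \<Longrightarrow> u \<in> {a..b} \<Longrightarrow> (D i has_real_derivative D (Suc i) u) (at u)"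
    and "\<And>i. i < 2 ^ k \<Longrightarrow> x i \<in> {a..b} \<and> \<bar>D 0 (x i)\<bar> \<le> \<eta>"
    and "\<And>i. Suc i < 2 ^ k \<Longrightarrow> x i + h \<le> x (Suc i)" and "h > 0"
  shows "\<exists>u\<in>{a..b}. \<bar>D k u\<bar> \<le> 2 ^ k * \<eta> / h ^ k"
  using assms
proof (induction k arbitrary: D x \<eta>)
  case 0
  then show ?case by (intro bexI[of _ "x 0"]) auto
next
  case (Suc k)
  have "\<exists>\<xi>. x (2*i) < \<xi> \<and> \<xi> < x (2*i+1) \<and> \<bar>D 1 \<xi>\<bar> \<le> 2 * \<eta> / h" if i: "i < 2 ^ k" for i
  proof -
    have b: "2*i+1 < 2 ^ Suc k" using i by auto
    have sep: "x (2*i) + h \<le> x (2*i+1)" using Suc.prems(3)[of "2*i"] b by simp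
    have pts: "x (2*i) \<in> {a..b}" "\<bar>D 0 (x (2*i))\<bar> \<le> \<eta>"
      "x (2*i+1) \<in> {a..b}" "\<bar>D 0 (x (2*i+1))\<bar> \<le> \<eta>"
      using Suc.prems(2)[of "2*i"] Suc.prems(2)[of "2*i+1"] b by auto
    have lt: "x (2*i) < x (2*i+1)" using sep \<open>h > 0\<close> by linarith
    obtain \<xi> where \<xi>: "x (2*i) < \<xi>" "\<xi> < x (2*i+1)"
      "D 0 (x (2*i+1)) - D 0 (x (2*i)) = (x (2*i+1) - x (2*i)) * D 1 \<xi>"
      using MVT2[OF lt, of "D 0" "D 1"] Suc.prems(1)[of 0] pts by auto
    have "h * \<bar>D 1 \<xi>\<bar> \<le> \<bar>(x (2*i+1) - x (2*i)) * D 1 \<xi>\<bar>"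
      unfolding abs_mult using sep lt by (intro mult_right_mono) auto
    also have "\<dots> \<le> 2 * \<eta>" using pts unfolding \<xi>(3)[symmetric] by linarith
    finally have "\<bar>D 1 \<xi>\<bar> \<le> 2 * \<eta> / h" using \<open>h > 0\<close> by (simp add: field_simps)
    with \<xi> show ?thesis by auto
  qed
  then obtain \<xi> where \<xi>: "\<And>i. i < 2 ^ k \<Longrightarrow> x (2*i) < \<xi> i \<and> \<xi> i < x (2*i+1) \<and> \<bar>D 1 (\<xi> i)\<bar> \<le> 2 * \<eta> / h"
    by metis
  have "\<exists>u\<in>{a..b}. \<bar>D (Suc k) u\<bar> \<le> 2 ^ k * (2 * \<eta> / h) / h ^ k"
  proof (rule Suc.IH[of "\<lambda>i. D (Suc i)" \<xi> "2 * \<eta> / h"])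
    fix i u assume "i < k" "u \<in> {a..b}"
    then show "(D (Suc i) has_real_derivative D (Suc (Suc i)) u) (at u)" using Suc.prems(1) by auto
  next
    fix i :: nat assume i: "i < 2 ^ k"
    then have b: "2*i < 2 ^ Suc k" "2*i+1 < 2 ^ Suc k" by auto
    show "\<xi> i \<in> {a..b} \<and> \<bar>D (Suc 0) (\<xi> i)\<bar> \<le> 2 * \<eta> / h"
      using \<xi>[OF i] Suc.prems(2)[OF b(1)] Suc.prems(2)[OF b(2)] by auto
  next
    fix i :: nat assume i: "Suc i < 2 ^ k"
    then have "x (2*i+1) + h \<le> x (2 * Suc i)" using Suc.prems(3)[of "2*i+1"] by simp
    then show "\<xi> i + h \<le> \<xi> (Suc i)" using \<xi>[of i] \<xi>[OF i] i by auto
  qed (use \<open>h > 0\<close> in auto)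
  then show ?case by (simp add: field_simps)
qed

text \<open>Greedy choice: a point \<open>z\<close> of \<open>E\<close> within \<open>h\<close> of
  \<open>Inf E\<close> would prolong any \<open>n\<close> separated points beyond
  \<open>z + h\<close>, so the part of \<open>E\<close> beyond \<open>z + h\<close> satisfies the
  hypothesis for \<open>n\<close>, and the rest lies in an interval of length \<open>2 * h\<close>.
  The cover is measurable while \<open>E\<close> is arbitrary.\<close>

lemma cover_if_no_separated_points:
  fixes E :: "real set" and h :: real
  assumes "h > 0" and "bdd_below E"
    and "\<not> (\<exists>x::nat \<Rightarrow> real. (\<forall>i<n. x i \<in> E) \<and> (\<forall>i. Suc i < n \<longrightarrow> x i + h \<le> x (Suc i)))"
  shows "\<exists>B\<in>sets lborel. E \<subseteq> B \<and> emeasure lborel B \<le> ennreal (2 * h * real n)"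
  using assms(2,3)
proof (induction n arbitrary: E)
  case 0
  then show ?case by simp
next
  case (Suc n)
  show ?case
  proof (cases "E = {}")
    case True
    then show ?thesis by (intro bexI[of _ "{}"]) auto
  next
    case False
    then obtain z where z: "z \<in> E" "z < Inf E + h"
      using cInf_lessD[of E "Inf E + h"] \<open>h > 0\<close> by auto
    have low: "z - h < y" if "y \<in> E" for y
      using cInf_lower[OF that Suc.prems(1)] z by linarith
    define E' where "E' = E \<inter> {z + h..}"
    have "\<not> (\<exists>x::nat \<Rightarrow> real. (\<forall>i<n. x i \<in> E') \<and> (\<forall>i. Suc i < n \<longrightarrow> x i + h \<le> x (Suc i)))"
    proof
      assume "\<exists>x::nat \<Rightarrow> real. (\<forall>i<n. x i \<in> E') \<and> (\<forall>i. Suc i < n \<longrightarrow> x i + h \<le> x (Suc i))"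
      then obtain x :: "nat \<Rightarrow> real" where x: "\<forall>i<n. x i \<in> E'" "\<forall>i. Suc i < n \<longrightarrow> x i + h \<le> x (Suc i)"
        by blast
      define y where "y i = (case i of 0 \<Rightarrow> z | Suc j \<Rightarrow> x j)" for i
      have "y i \<in> E" if "i < Suc n" for i
        using that x z unfolding y_def E'_def by (auto split: nat.splits)
      moreover have "y i + h \<le> y (Suc i)" if "Suc i < Suc n" for i
        using that x z unfolding y_def E'_def by (auto split: nat.splits)
      ultimately show False using Suc.prems(2) by blast
    qed
    moreover have "bdd_below E'" using Suc.prems(1) unfolding E'_def by (auto intro: bdd_below_mono)
    ultimately obtain B where B: "B \<in> sets lborel" "E' \<subseteq> B" "emeasure lborel B \<le> ennreal (2 * h * real n)"
      using Suc.IH by blast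
    have "emeasure lborel ({z - h..z + h} \<union> B) \<le> emeasure lborel {z - h..z + h} + emeasure lborel B"
      using B by (intro emeasure_subadditive) auto
    also have "\<dots> \<le> ennreal (2 * h) + ennreal (2 * h * real n)"
      using B \<open>h > 0\<close> by (intro add_mono) auto
    also have "\<dots> = ennreal (2 * h * real (Suc n))"
      using \<open>h > 0\<close> by (subst ennreal_plus[symmetric]) (auto simp: algebra_simps)
    finally have m: "emeasure lborel ({z - h..z + h} \<union> B) \<le> ennreal (2 * h * real (Suc n))" .
    have "E \<subseteq> {z - h..z + h} \<union> B"
    proof
      fix y assume y: "y \<in> E"
      show "y \<in> {z - h..z + h} \<union> B"
        using low[OF y] y B(2) unfolding E'_def by (cases "y \<ge> z + h") auto
    qed
    with m B(1) show ?thesis by (intro bexI[of _ "{z - h..z + h} \<union> B"]) auto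
  qed
qed

text \<open>\<open>C\<close> is chosen before \<open>D\<close> and \<open>\<eta>\<close>, because
  one constant has to serve infinitely many slices. If the sublevel set contained
  \<open>2 ^ k\<close> points separated by \<open>h\<close>, the k-th derivative would be small
  somewhere; hence the set is covered by \<open>2 ^ k\<close> intervals of length
  \<open>2 * h\<close>.\<close>

lemma sublevel_estimate:
  fixes a b c q :: real and k :: nat
  assumes "a \<le> b" "c > 0" "q > 0" and kq: "k = 0 \<or> q * real k \<le> 1"
  shows "\<exists>C\<ge>0. \<forall>(D :: nat \<Rightarrow> real \<Rightarrow> real) \<eta>. \<eta> > 0 \<longrightarrow>
     (\<forall>i<k. \<forall>u\<in>{a..b}. (D i has_real_derivative D (Suc i) u) (at u)) \<longrightarrow>
     (\<forall>u\<in>{a..b}. c \<le> \<bar>D k u\<bar>) \<longrightarrow>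
     emeasure lborel {u\<in>{a..b}. \<bar>D 0 u\<bar> < \<eta>} \<le> ennreal (C * \<eta> powr q)"
proof -
  define C where "C = (if k = 0 then (b - a) * c powr - q else
     (b - a) + 2 * (2 * (2 / c) powr (1 / k)) * 2 ^ k)"
  have triv: "emeasure lborel {u\<in>{a..b}. \<bar>D u\<bar> < \<eta>} \<le> ennreal (b - a)" for D :: "real \<Rightarrow> real" and \<eta>
  proof -
    have "emeasure lborel {u\<in>{a..b}. \<bar>D u\<bar> < \<eta>} \<le> emeasure lborel {a..b}"
      by (intro emeasure_mono) auto
    then show ?thesis using \<open>a \<le> b\<close> by simp
  qed
  have C0: "C \<ge> 0" unfolding C_def using assms by auto
  have "emeasure lborel {u\<in>{a..b}. \<bar>D 0 u\<bar> < \<eta>} \<le> ennreal (C * \<eta> powr q)"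
    if \<eta>: "\<eta> > 0" and der: "\<forall>i<k. \<forall>u\<in>{a..b}. (D i has_real_derivative D (Suc i) u) (at u)"
      and low: "\<forall>u\<in>{a..b}. c \<le> \<bar>D k u\<bar>" for D :: "nat \<Rightarrow> real \<Rightarrow> real" and \<eta>
  proof (cases "k = 0")
    case True
    show ?thesis
    proof (cases "\<eta> \<le> c")
      case True
      then have "{u\<in>{a..b}. \<bar>D 0 u\<bar> < \<eta>} = {}" using low \<open>k = 0\<close> by force
      then show ?thesis by (simp only:) simp
    next
      case False
      have "(b - a) * 1 \<le> (b - a) * (c powr - q * \<eta> powr q)"
      proof (intro mult_left_mono)
        have "c powr q \<le> \<eta> powr q" using False assms by (intro powr_mono2) auto
        then show "1 \<le> c powr - q * \<eta> powr q"
          using \<open>c > 0\<close> by (simp add: powr_minus field_simps)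
      qed (use assms in auto)
      then have "ennreal (b - a) \<le> ennreal (C * \<eta> powr q)"
        unfolding C_def using True by (intro ennreal_leI) (simp add: mult_ac)
      then show ?thesis using triv order_trans by blast
    qed
  next
    case False
    \<comment> \<open>With \<open>h ^ k = 2 ^ k * (2 / c) * \<eta>\<close> the bound of
      \<open>derivative_small_of_separated_points\<close> becomes \<open>c / 2\<close>,
      contradicting the lower bound \<open>c\<close>.\<close>
    define h where "h = 2 * (2 / c) powr (1 / k) * \<eta> powr (1 / k)"
    have h: "h > 0" unfolding h_def using assms \<eta> by simp
    have hk: "h ^ k = 2 ^ k * (2 / c) * \<eta>"
      unfolding h_def power_mult_distrib using False assms \<eta>
      by (simp add: powr_realpow[symmetric] powr_powr)
    \<comment> \<open>For \<open>\<eta> \<le> 1\<close> the exponent \<open>1 / k\<close> may be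
      lowered to \<open>q\<close>; for larger \<open>\<eta>\<close> the length of the interval
      suffices.\<close>
    show ?thesis
    proof (cases "\<eta> \<le> 1")
      case True
      define E where "E = {u\<in>{a..b}. \<bar>D 0 u\<bar> < \<eta>}"
      have "\<not> (\<exists>x::nat \<Rightarrow> real. (\<forall>i<2^k. x i \<in> E) \<and> (\<forall>i. Suc i < 2^k \<longrightarrow> x i + h \<le> x (Suc i)))"
      proof
        assume "\<exists>x::nat \<Rightarrow> real. (\<forall>i<2^k. x i \<in> E) \<and> (\<forall>i. Suc i < 2^k \<longrightarrow> x i + h \<le> x (Suc i))"
        then obtain x :: "nat \<Rightarrow> real" where x: "\<forall>i<2^k. x i \<in> E" "\<forall>i. Suc i < 2^k \<longrightarrow> x i + h \<le> x (Suc i)"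
          by blast
        have "\<exists>u\<in>{a..b}. \<bar>D k u\<bar> \<le> 2 ^ k * \<eta> / h ^ k"
          by (rule derivative_small_of_separated_points[where x = x and h = h])
            (use der x h in \<open>auto simp: E_def intro: less_imp_le\<close>)
        then show False using low \<eta> \<open>c > 0\<close> unfolding hk by force
      qed
      moreover have "bdd_below E" unfolding E_def by (rule bdd_belowI[of _ a]) auto
      ultimately obtain B where B: "B \<in> sets lborel" "E \<subseteq> B" "emeasure lborel B \<le> ennreal (2 * h * real (2^k))"
        using cover_if_no_separated_points[OF h, of E "2^k"] by blast
      have "emeasure lborel E \<le> emeasure lborel B" using B by (intro emeasure_mono) auto
      also have "\<dots> \<le> ennreal (2 * h * real (2^k))" by fact
      also have "\<dots> \<le> ennreal (C * \<eta> powr q)"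
      proof (intro ennreal_leI)
        have "\<eta> powr (1 / k) \<le> \<eta> powr q"
          using kq False True \<eta> by (intro powr_mono') (auto simp: field_simps)
        then have "2 * h * real (2^k) \<le> (2 * (2 * (2 / c) powr (1 / k)) * 2 ^ k) * \<eta> powr q"
          unfolding h_def by (simp add: mult_left_mono)
        also have "\<dots> \<le> C * \<eta> powr q"
          unfolding C_def using False \<open>a \<le> b\<close> by (simp add: algebra_simps mult_right_mono)
        finally show "2 * h * real (2^k) \<le> C * \<eta> powr q" .
      qed
      finally show ?thesis unfolding E_def .
    next
      case False
      have "b - a \<le> C * 1" unfolding C_def using \<open>k \<noteq> 0\<close> assms by simp
      also have "\<dots> \<le> C * \<eta> powr q"
        using False C0 assms by (intro mult_left_mono ge_one_powr_ge_zero) auto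
      finally have "ennreal (b - a) \<le> ennreal (C * \<eta> powr q)" by (rule ennreal_leI)
      then show ?thesis using triv order_trans by blast
    qed
  qed
  with C0 show ?thesis by blast
qed

section \<open>Perturbation of power series together with all their derivatives\<close>

definition powser_deriv :: "(nat \<Rightarrow> real) \<Rightarrow> nat \<Rightarrow> real \<Rightarrow> real" where
  "powser_deriv \<gamma> k u = (\<Sum>b. (diffs ^^ k) \<gamma> b * u ^ b)"

lemma summable_powser_deriv:
  fixes \<gamma> :: "nat \<Rightarrow> real"
  assumes "\<And>z. \<bar>z\<bar> < R \<Longrightarrow> summable (\<lambda>b. \<gamma> b * z ^ b)" and "\<bar>u\<bar> < R"
  shows "summable (\<lambda>b. (diffs ^^ k) \<gamma> b * u ^ b)"
  using assms(2)
proof (induction k arbitrary: u)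
  case 0
  then show ?case using assms(1) by simp
next
  case (Suc k)
  then show ?case using termdiff_converges[of u R "(diffs ^^ k) \<gamma>"] by simp
qed

lemma DERIV_powser_deriv:
  fixes \<gamma> :: "nat \<Rightarrow> real"
  assumes "\<And>z. \<bar>z\<bar> < R \<Longrightarrow> summable (\<lambda>b. \<gamma> b * z ^ b)" and "\<bar>u\<bar> < R"
  shows "(powser_deriv \<gamma> k has_real_derivative powser_deriv \<gamma> (Suc k) u) (at u)"
  using termdiffs_strong'[of R "(diffs ^^ k) \<gamma>" u] summable_powser_deriv[OF assms(1)] assms(2)
  unfolding powser_deriv_def by simp

lemma summable_of_geometric_bound:
  fixes \<gamma> :: "nat \<Rightarrow> real"
  assumes "\<And>b. \<bar>\<gamma> b\<bar> \<le> K / R ^ b" "R > 0" "\<bar>z\<bar> < R"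
  shows "summable (\<lambda>b. \<gamma> b * z ^ b)"
proof (rule summable_comparison_test')
  show "summable (\<lambda>b. K * (\<bar>z\<bar> / R) ^ b)"
    using assms by (intro summable_mult summable_geometric) auto
  show "norm (\<gamma> b * z ^ b) \<le> K * (\<bar>z\<bar> / R) ^ b" for b
    using mult_right_mono[OF assms(1)[of b], of "\<bar>z\<bar> ^ b"]
    by (simp add: abs_mult power_abs power_divide)
qed

text \<open>\<open>diffs\<close> is linear with nonnegative factors, so a coefficientwise majorant
  survives each application.\<close>

lemma abs_iterated_diffs_diff_le:
  fixes \<gamma> \<gamma>' \<beta> :: "nat \<Rightarrow> real"
  assumes "\<And>b. \<bar>\<gamma> b - \<gamma>' b\<bar> \<le> \<beta> b"
  shows "\<bar>(diffs ^^ k) \<gamma> b - (diffs ^^ k) \<gamma>' b\<bar> \<le> (diffs ^^ k) \<beta> b"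
proof (induction k arbitrary: b)
  case 0
  then show ?case using assms by simp
next
  case (Suc k)
  have "\<bar>real (Suc b) * ((diffs ^^ k) \<gamma> (Suc b) - (diffs ^^ k) \<gamma>' (Suc b))\<bar>
    \<le> real (Suc b) * (diffs ^^ k) \<beta> (Suc b)"
    unfolding abs_mult using Suc.IH[of "Suc b"] by (intro mult_mono) auto
  then show ?case
    by (simp add: diffs_def[of "(diffs ^^ k) \<gamma>"] diffs_def[of "(diffs ^^ k) \<gamma>'"]
        diffs_def[of "(diffs ^^ k) \<beta>"] right_diff_distrib del: of_nat_Suc)
qed

lemma iterated_diffs_scale: "(diffs ^^ k) (\<lambda>b. t * \<beta> b :: real) = (\<lambda>b. t * (diffs ^^ k) \<beta> b)"
  by (induction k) (auto simp: diffs_def fun_eq_iff)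

text \<open>Coefficients that are close relative to a geometric majorant give functions whose
  derivatives are all close on a smaller disc; the factor is the k-th derivative of the majorant
  series at \<open>r\<close>.\<close>

lemma powser_deriv_perturb:
  fixes \<gamma> \<gamma>' :: "nat \<Rightarrow> real"
  assumes "0 \<le> r" "r < R" "K \<ge> 0"
    and g: "\<And>b. \<bar>\<gamma> b\<bar> \<le> K' / R ^ b" and gg: "\<And>b. \<bar>\<gamma>' b - \<gamma> b\<bar> \<le> \<tau> * (K / R ^ b)" and "\<tau> \<ge> 0"
    and u: "\<bar>u\<bar> \<le> r"
  shows "\<bar>powser_deriv \<gamma>' k u - powser_deriv \<gamma> k u\<bar> \<le> \<tau> * powser_deriv (\<lambda>b. K / R ^ b) k r"
proof -
  have R: "R > 0" using assms by auto
  define \<beta> where "\<beta> b = K / R ^ b" for b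
  have g': "\<bar>\<gamma>' b\<bar> \<le> (K' + \<tau> * K) / R ^ b" for b
    using g[of b] gg[of b] R by (simp add: add_divide_distrib)
  have s1: "summable (\<lambda>b. (diffs ^^ k) \<gamma> b * u ^ b)"
    using summable_of_geometric_bound[OF g R] u \<open>r < R\<close> by (intro summable_powser_deriv[of R]) auto
  have s2: "summable (\<lambda>b. (diffs ^^ k) \<gamma>' b * u ^ b)"
    using summable_of_geometric_bound[OF g' R] u \<open>r < R\<close> by (intro summable_powser_deriv[of R]) auto
  have s3: "summable (\<lambda>b. (diffs ^^ k) \<beta> b * r ^ b)"
    using summable_of_geometric_bound[OF _ R, of \<beta> K] u \<open>r < R\<close> \<open>0 \<le> r\<close> \<open>K \<ge> 0\<close> R
    by (intro summable_powser_deriv[of R]) (auto simp: \<beta>_def)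
  have le: "\<bar>(diffs ^^ k) \<gamma>' b - (diffs ^^ k) \<gamma> b\<bar> \<le> \<tau> * (diffs ^^ k) \<beta> b" for b
    using abs_iterated_diffs_diff_le[of \<gamma>' \<gamma> "\<lambda>b. \<tau> * \<beta> b" k b] gg
    unfolding iterated_diffs_scale \<beta>_def by simp
  have "powser_deriv \<gamma>' k u - powser_deriv \<gamma> k u =
      (\<Sum>b. ((diffs ^^ k) \<gamma>' b - (diffs ^^ k) \<gamma> b) * u ^ b)"
    unfolding powser_deriv_def using suminf_diff[OF s2 s1] by (simp add: algebra_simps)
  moreover have "\<bar>\<Sum>b. ((diffs ^^ k) \<gamma>' b - (diffs ^^ k) \<gamma> b) * u ^ b\<bar> \<le> (\<Sum>b. \<tau> * ((diffs ^^ k) \<beta> b * r ^ b))"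
    unfolding real_norm_def[symmetric]
  proof (rule norm_suminf_le)
    show "norm (((diffs ^^ k) \<gamma>' b - (diffs ^^ k) \<gamma> b) * u ^ b) \<le> \<tau> * ((diffs ^^ k) \<beta> b * r ^ b)" for b
    proof -
      have "\<bar>u ^ b\<bar> \<le> r ^ b" unfolding power_abs using u by (intro power_mono) auto
      then have "\<bar>(diffs ^^ k) \<gamma>' b - (diffs ^^ k) \<gamma> b\<bar> * \<bar>u ^ b\<bar> \<le> (\<tau> * (diffs ^^ k) \<beta> b) * r ^ b"
        using le[of b] by (intro mult_mono) auto
      then show ?thesis by (simp add: abs_mult mult_ac)
    qed
    show "summable (\<lambda>b. \<tau> * ((diffs ^^ k) \<beta> b * r ^ b))" by (intro summable_mult s3)
  qed
  moreover have "(\<Sum>b. \<tau> * ((diffs ^^ k) \<beta> b * r ^ b)) = \<tau> * powser_deriv \<beta> k r"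
    unfolding powser_deriv_def by (rule suminf_mult[OF s3])
  ultimately show ?thesis unfolding \<beta>_def by simp
qed

text \<open>Compactness argument. Near each point some admissible derivative is bounded away from 0,
  and this survives small perturbations of the coefficients; bisection of the interval glues the
  local estimates. The order \<open>k\<close> may vary from point to point while \<open>q\<close>
  stays the same.\<close>

lemma uniform_sublevel_estimate:
  fixes \<gamma> :: "nat \<Rightarrow> real"
  assumes r: "0 < r" "r < R" and K: "K \<ge> 0" and g: "\<And>b. \<bar>\<gamma> b\<bar> \<le> K / R ^ b" and "q > 0"
    and ord: "\<And>u. \<bar>u\<bar> \<le> r \<Longrightarrow> \<exists>k. (k = 0 \<or> q * real k \<le> 1) \<and> powser_deriv \<gamma> k u \<noteq> 0"
  shows "\<exists>C\<ge>0. \<exists>\<tau>0>0. \<forall>\<gamma>' \<tau> \<eta>. 0 \<le> \<tau> \<longrightarrow> \<tau> \<le> \<tau>0 \<longrightarrow> \<eta> > 0 \<longrightarrow>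
     (\<forall>b. \<bar>\<gamma>' b - \<gamma> b\<bar> \<le> \<tau> * (K / R ^ b)) \<longrightarrow>
     emeasure lborel {u\<in>{-r..r}. \<bar>powser_deriv \<gamma>' 0 u\<bar> < \<eta>} \<le> ennreal (C * \<eta> powr q)"
proof -
  have R: "R > 0" using r by auto
  have summ: "summable (\<lambda>b. \<gamma>' b * z ^ b)"
    if "\<forall>b. \<bar>\<gamma>' b - \<gamma> b\<bar> \<le> \<tau> * (K / R ^ b)" "\<bar>z\<bar> < R" for \<gamma>' \<tau> z
  proof -
    have "\<bar>\<gamma>' b\<bar> \<le> (K + \<tau> * K) / R ^ b" for b
      using g[of b] that(1)[rule_format, of b] R by (simp add: add_divide_distrib)
    then show ?thesis using that R by (intro summable_of_geometric_bound[of _ "K + \<tau> * K" R])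
  qed
  define est where "est a b C \<tau>0 \<longleftrightarrow> (\<forall>\<gamma>' \<tau> \<eta>. 0 \<le> \<tau> \<longrightarrow> \<tau> \<le> \<tau>0 \<longrightarrow> \<eta> > 0 \<longrightarrow>
     (\<forall>b. \<bar>\<gamma>' b - \<gamma> b\<bar> \<le> \<tau> * (K / R ^ b)) \<longrightarrow>
     emeasure lborel {u\<in>{a..b}. \<bar>powser_deriv \<gamma>' 0 u\<bar> < \<eta>} \<le> ennreal (C * \<eta> powr q))"
    for a b C \<tau>0
  define P where "P a b \<longleftrightarrow> (-r \<le> a \<and> b \<le> r \<longrightarrow> (\<exists>C\<ge>0. \<exists>\<tau>0>0. est a b C \<tau>0))" for a b
  have "-r \<le> r" using r by simp
  then have "P (-r) r"
  proof (induction rule: Bolzano)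
    case (trans a b c)
    show ?case unfolding P_def
    proof
      assume "-r \<le> a \<and> c \<le> r"
      then obtain C1 t1 C2 t2 where 1: "C1 \<ge> 0" "t1 > 0" "est a b C1 t1"
        and 2: "C2 \<ge> 0" "t2 > 0" "est b c C2 t2"
        using trans unfolding P_def by auto
      show "\<exists>C\<ge>0. \<exists>\<tau>0>0. est a c C \<tau>0" unfolding est_def
      proof (intro exI conjI allI impI)
        show "C1 + C2 \<ge> 0" "min t1 t2 > 0" using 1 2 by auto
        fix \<gamma>' :: "nat \<Rightarrow> real" and \<tau> \<eta> :: real
        assume a: "0 \<le> \<tau>" "\<tau> \<le> min t1 t2" "\<eta> > 0" "\<forall>b. \<bar>\<gamma>' b - \<gamma> b\<bar> \<le> \<tau> * (K / R ^ b)"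
        have cont: "continuous_on {-r..r} (powser_deriv \<gamma>' 0)"
          by (intro continuous_at_imp_continuous_on ballI DERIV_isCont[OF DERIV_powser_deriv[of R]])
            (use summ[OF a(4)] r in auto)
        have meas: "{u\<in>{x..y}. \<bar>powser_deriv \<gamma>' 0 u\<bar> < \<eta>} \<in> sets lborel" if "-r \<le> x" "y \<le> r" for x y
        proof -
          have "continuous_on {x..y} (\<lambda>u. \<bar>powser_deriv \<gamma>' 0 u\<bar>)"
            by (intro continuous_intros continuous_on_subset[OF cont]) (use that in auto)
          then have "(\<lambda>u. \<bar>powser_deriv \<gamma>' 0 u\<bar>) \<in> borel_measurable (restrict_space borel {x..y})"
            by (rule borel_measurable_continuous_on_restrict)
          then have "{u\<in>space (restrict_space borel {x..y}). \<bar>powser_deriv \<gamma>' 0 u\<bar> < \<eta>} \<in> sets (restrict_space borel {x..y})"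
            by measurable
          then show ?thesis by (auto simp: space_restrict_space sets_restrict_space_iff)
        qed
        have "{u\<in>{a..c}. \<bar>powser_deriv \<gamma>' 0 u\<bar> < \<eta>} \<subseteq>
            {u\<in>{a..b}. \<bar>powser_deriv \<gamma>' 0 u\<bar> < \<eta>} \<union> {u\<in>{b..c}. \<bar>powser_deriv \<gamma>' 0 u\<bar> < \<eta>}" by auto
        then have "emeasure lborel {u\<in>{a..c}. \<bar>powser_deriv \<gamma>' 0 u\<bar> < \<eta>} \<le>
            emeasure lborel ({u\<in>{a..b}. \<bar>powser_deriv \<gamma>' 0 u\<bar> < \<eta>} \<union> {u\<in>{b..c}. \<bar>powser_deriv \<gamma>' 0 u\<bar> < \<eta>})"
          using trans \<open>-r \<le> a \<and> c \<le> r\<close> by (intro emeasure_mono sets.Un meas) auto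
        also have "\<dots> \<le> emeasure lborel {u\<in>{a..b}. \<bar>powser_deriv \<gamma>' 0 u\<bar> < \<eta>} + emeasure lborel {u\<in>{b..c}. \<bar>powser_deriv \<gamma>' 0 u\<bar> < \<eta>}"
          using trans \<open>-r \<le> a \<and> c \<le> r\<close> by (intro emeasure_subadditive meas) auto
        also have "\<dots> \<le> ennreal (C1 * \<eta> powr q) + ennreal (C2 * \<eta> powr q)"
          using a 1(3) 2(3) unfolding est_def by (intro add_mono) auto
        also have "\<dots> = ennreal ((C1 + C2) * \<eta> powr q)"
          using 1 2 by (subst ennreal_plus[symmetric]) (auto simp: algebra_simps)
        finally show "emeasure lborel {u\<in>{a..c}. \<bar>powser_deriv \<gamma>' 0 u\<bar> < \<eta>} \<le> ennreal ((C1 + C2) * \<eta> powr q)" .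
      qed
    qed
  next
    case (local x)
    then have x: "\<bar>x\<bar> \<le> r" by auto
    obtain k where k: "k = 0 \<or> q * real k \<le> 1" "powser_deriv \<gamma> k x \<noteq> 0" using ord[OF x] by blast
    have "isCont (powser_deriv \<gamma> k) x"
      by (intro DERIV_isCont[OF DERIV_powser_deriv[of R]] summ[of _ 0]) (use x r in auto)
    then obtain \<delta> where \<delta>: "\<delta> > 0" "\<And>u. \<bar>u - x\<bar> < \<delta> \<Longrightarrow> \<bar>powser_deriv \<gamma> k u - powser_deriv \<gamma> k x\<bar> < \<bar>powser_deriv \<gamma> k x\<bar> / 2"
      using k(2) unfolding continuous_at_eps_delta by (metis dist_real_def zero_less_abs_iff half_gt_zero)
    \<comment> \<open>A quarter, since continuity near \<open>x\<close> costs up to half of the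
      derivative at \<open>x\<close> and the perturbation up to another quarter.\<close>
    define c where "c = \<bar>powser_deriv \<gamma> k x\<bar> / 4"
    have c: "c > 0" using k unfolding c_def by simp
    define M where "M = powser_deriv (\<lambda>b. K / R ^ b) k r"
    have "P a b" if ab: "a \<le> x" "x \<le> b" "b - a < \<delta>" for a b
      unfolding P_def
    proof
      assume ab': "-r \<le> a \<and> b \<le> r"
      obtain C where C: "C \<ge> 0" "\<And>(D :: nat \<Rightarrow> real \<Rightarrow> real) \<eta>. \<eta> > 0 \<Longrightarrow>
         (\<forall>i<k. \<forall>u\<in>{a..b}. (D i has_real_derivative D (Suc i) u) (at u)) \<Longrightarrow>
         (\<forall>u\<in>{a..b}. c \<le> \<bar>D k u\<bar>) \<Longrightarrow>
         emeasure lborel {u\<in>{a..b}. \<bar>D 0 u\<bar> < \<eta>} \<le> ennreal (C * \<eta> powr q)"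
        using sublevel_estimate[of a b c q k] ab c \<open>q > 0\<close> k(1) by (smt (verit))
      show "\<exists>C\<ge>0. \<exists>\<tau>0>0. est a b C \<tau>0" unfolding est_def
      \<comment> \<open>This threshold for \<open>\<tau>\<close> keeps the perturbation of the k-th
        derivative, at most \<open>\<tau> * M\<close>, below \<open>c\<close>.\<close>
      proof (rule exI[of _ C], intro conjI, rule C(1), rule exI[of _ "c / (\<bar>M\<bar> + 1)"], intro conjI allI impI)
        show "c / (\<bar>M\<bar> + 1) > 0" using c by simp
        fix \<gamma>' :: "nat \<Rightarrow> real" and \<tau> \<eta> :: real
        assume a: "0 \<le> \<tau>" "\<tau> \<le> c / (\<bar>M\<bar> + 1)" "\<eta> > 0" "\<forall>b. \<bar>\<gamma>' b - \<gamma> b\<bar> \<le> \<tau> * (K / R ^ b)"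
        have "emeasure lborel {u\<in>{a..b}. \<bar>powser_deriv \<gamma>' 0 u\<bar> < \<eta>} \<le> ennreal (C * \<eta> powr q)"
        proof (rule C(2)[OF \<open>\<eta> > 0\<close>])
          show "\<forall>i<k. \<forall>u\<in>{a..b}. (powser_deriv \<gamma>' i has_real_derivative powser_deriv \<gamma>' (Suc i) u) (at u)"
            using ab' r by (intro allI impI ballI DERIV_powser_deriv[of R] summ[OF a(4)]) auto
          show "\<forall>u\<in>{a..b}. c \<le> \<bar>powser_deriv \<gamma>' k u\<bar>"
          proof
            fix u assume u: "u \<in> {a..b}"
            then have "\<bar>u - x\<bar> < \<delta>" using ab by auto
            note d = \<delta>(2)[OF this]
            have "\<bar>powser_deriv \<gamma>' k u - powser_deriv \<gamma> k u\<bar> \<le> \<tau> * M" unfolding M_def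
              by (rule powser_deriv_perturb[OF _ r(2) K g]) (use a u ab' r in auto)
            also have "\<tau> * M \<le> \<tau> * (\<bar>M\<bar> + 1)" using a by (intro mult_left_mono) auto
            also have "\<dots> \<le> c" using a by (simp add: field_simps)
            finally show "c \<le> \<bar>powser_deriv \<gamma>' k u\<bar>" using d unfolding c_def by linarith
          qed
        qed
        then show "emeasure lborel {u\<in>{a..b}. \<bar>powser_deriv \<gamma>' 0 u\<bar> < \<eta>} \<le> ennreal (C * \<eta> powr q)" .
      qed
    qed
    with \<delta>(1) show ?case by blast
  qed
  then show ?thesis unfolding P_def est_def by simp
qed

section \<open>Rescaled double power series\<close>

definition double_sum :: "(nat \<times> nat \<Rightarrow> real) \<Rightarrow> real \<Rightarrow> real \<Rightarrow> real" where
  "double_sum c x y = (\<Sum>\<^sub>\<infinity>p. c p * x ^ fst p * y ^ snd p)"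

definition column_sum :: "(nat \<times> nat \<Rightarrow> real) \<Rightarrow> nat \<Rightarrow> real \<Rightarrow> real" where
  "column_sum c b x = (\<Sum>a. c (a, b) * x ^ a)"

text \<open>
  These are the coefficients of the edge polynomial restricted to \<open>x = 1\<close>; the sum has at most one
  term.
\<close>

definition edge_coeff :: "(nat \<times> nat \<Rightarrow> real) \<Rightarrow> real \<Rightarrow> real \<Rightarrow> nat \<Rightarrow> real" where
  "edge_coeff c s e b = (\<Sum>a | real a + s * real b = e. c (a, b))"

lemma finite_edge_row: "finite {a::nat. real a + v = e}"
proof (rule finite_subset)
  show "{a::nat. real a + v = e} \<subseteq> {nat \<lfloor>e - v\<rfloor>}" by auto
qed simp

text \<open>Only finitely many values of \<open>a + s * b\<close> are at most \<open>e + 1\<close>,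
  so the smallest one above \<open>e\<close> keeps a distance. The gap \<open>\<theta>\<close>
  becomes the rate \<open>t powr \<theta>\<close> at which the rescaled slices converge.\<close>

lemma weight_gap:
  fixes s e :: real
  assumes "s \<ge> 0" "e > 0"
  shows "\<exists>\<theta>>0. \<forall>a b :: nat. real a + s * real b > e \<longrightarrow> real a + s * real b \<ge> e + \<theta>"
proof -
  \<comment> \<open>For \<open>s = 0\<close> the weight does not see \<open>b\<close>, and
    \<open>b = 0\<close> represents every value.\<close>
  define W where "W = (\<lambda>(a, b). real a + s * real b) `
      ({..nat \<lceil>e + 1\<rceil>} \<times> (if s = 0 then {0::nat} else {..nat \<lceil>(e + 1) / s\<rceil>}))"
  define V where "V = insert (e + 1) (W \<inter> {v. v > e})"
  have "finite W" unfolding W_def by (intro finite_imageI finite_cartesian_product) auto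
  then have fin: "finite V" unfolding V_def by simp
  have ne: "V \<noteq> {}" unfolding V_def by simp
  have gt: "v > e" if "v \<in> V" for v using that unfolding V_def by auto
  have "Min V > e" using gt[OF Min_in[OF fin ne]] .
  moreover have "Min V \<le> real a + s * real b" if *: "real a + s * real b > e" for a b :: nat
  proof (cases "real a + s * real b \<le> e + 1")
    case True
    have "0 \<le> s * real b" using \<open>s \<ge> 0\<close> by simp
    with True have a: "a \<le> nat \<lceil>e + 1\<rceil>" by linarith
    have "real a + s * real b \<in> W"
    proof (cases "s = 0")
      case True
      with a show ?thesis unfolding W_def by (intro image_eqI[of _ _ "(a, 0)"]) simp_all
    next
      case False
      have "s * real b \<le> e + 1" using True by linarith
      then have "real b \<le> (e + 1) / s" using False \<open>s \<ge> 0\<close> by (simp add: field_simps)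
      then have "b \<le> nat \<lceil>(e + 1) / s\<rceil>" by linarith
      with a False show ?thesis unfolding W_def by (intro image_eqI[of _ _ "(a, b)"]) simp_all
    qed
    with * show ?thesis by (intro Min_le fin) (simp add: V_def)
  next
    case False
    have "Min V \<le> e + 1" by (intro Min_le fin) (simp add: V_def)
    with False show ?thesis by linarith
  qed
  ultimately show ?thesis by (intro exI[of _ "Min V - e"]) force
qed

text \<open>Absolute convergence at the corner \<open>(R, R)\<close> dominates every point of the
  closed square; its sum \<open>total\<close> supplies the constants of the later bounds.\<close>

locale double_power_series =
  fixes c :: "nat \<times> nat \<Rightarrow> real" and R :: real
  assumes R_pos: "R > 0" and abs_summable: "(\<lambda>p. \<bar>c p\<bar> * R ^ (fst p + snd p)) summable_on UNIV"
begin

definition total :: real where "total = (\<Sum>\<^sub>\<infinity>p. \<bar>c p\<bar> * R ^ (fst p + snd p))"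

lemma total_nonneg: "total \<ge> 0"
  unfolding total_def using R_pos by (intro infsum_nonneg) auto

lemma abs_term_le:
  assumes "\<bar>x\<bar> \<le> R" "\<bar>y\<bar> \<le> R"
  shows "\<bar>c p * x ^ fst p * y ^ snd p\<bar> \<le> \<bar>c p\<bar> * R ^ (fst p + snd p)"
proof -
  have "\<bar>x\<bar> ^ fst p * \<bar>y\<bar> ^ snd p \<le> R ^ fst p * R ^ snd p"
    using assms R_pos by (intro mult_mono power_mono) auto
  then have "\<bar>c p\<bar> * (\<bar>x\<bar> ^ fst p * \<bar>y\<bar> ^ snd p) \<le> \<bar>c p\<bar> * (R ^ fst p * R ^ snd p)"
    by (rule mult_left_mono) simp
  then show ?thesis by (simp only: abs_mult power_abs power_add mult.assoc)
qed

lemma has_sum_double_sum: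
  assumes "\<bar>x\<bar> \<le> R" "\<bar>y\<bar> \<le> R"
  shows "((\<lambda>p. c p * x ^ fst p * y ^ snd p) has_sum double_sum c x y) UNIV"
proof -
  have "(\<lambda>p. norm (c p * x ^ fst p * y ^ snd p)) summable_on UNIV"
    by (rule Infinite_Sum.abs_summable_on_comparison_test'[OF abs_summable]) (use abs_term_le[OF assms] in simp)
  then show ?thesis unfolding double_sum_def by (rule has_sum_infsum[OF abs_summable_summable])
qed

lemma column_abs_summable:
  "(\<lambda>a. \<bar>c (a, b)\<bar> * R ^ a) summable_on UNIV"
  "(\<Sum>\<^sub>\<infinity>a. \<bar>c (a, b)\<bar> * R ^ a) \<le> total / R ^ b"
proof -
  have inj: "inj_on (\<lambda>a. (a, b)) (UNIV :: nat set)" by (auto intro: inj_onI)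
  have s: "(\<lambda>p. \<bar>c p\<bar> * R ^ (fst p + snd p)) summable_on range (\<lambda>a. (a, b))"
    using abs_summable by (rule summable_on_subset) auto
  have s2: "(\<lambda>a. \<bar>c (a, b)\<bar> * R ^ a * R ^ b) summable_on UNIV"
    using s summable_on_reindex[OF inj, of "\<lambda>p. \<bar>c p\<bar> * R ^ (fst p + snd p)"]
    by (simp add: o_def power_add mult.assoc)
  then show s3: "(\<lambda>a. \<bar>c (a, b)\<bar> * R ^ a) summable_on UNIV"
    using summable_on_cmult_left[OF s2, of "1 / R ^ b"] R_pos by simp
  have "(\<Sum>\<^sub>\<infinity>a. \<bar>c (a, b)\<bar> * R ^ a) * R ^ b = (\<Sum>\<^sub>\<infinity>a. \<bar>c (a, b)\<bar> * R ^ a * R ^ b)"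
    using s3 by (rule infsum_cmult_left[symmetric])
  also have "\<dots> = infsum (\<lambda>p. \<bar>c p\<bar> * R ^ (fst p + snd p)) (range (\<lambda>a. (a, b)))"
    by (subst infsum_reindex[OF inj]) (simp add: o_def power_add mult.assoc)
  also have "\<dots> \<le> total" unfolding total_def
    using s abs_summable R_pos by (intro infsum_mono2) auto
  finally show "(\<Sum>\<^sub>\<infinity>a. \<bar>c (a, b)\<bar> * R ^ a) \<le> total / R ^ b" using R_pos by (simp add: field_simps)
qed

lemma column_has_sum:
  assumes "\<bar>x\<bar> \<le> R"
  shows "((\<lambda>a. c (a, b) * x ^ a) has_sum column_sum c b x) UNIV"
proof -
  have "norm (c (a, b) * x ^ a) \<le> \<bar>c (a, b)\<bar> * R ^ a" for a
    unfolding real_norm_def abs_mult power_abs using assms by (intro mult_left_mono power_mono) auto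
  then have "(\<lambda>a. norm (c (a, b) * x ^ a)) summable_on UNIV"
    by (rule Infinite_Sum.abs_summable_on_comparison_test'[OF column_abs_summable(1)])
  then have "((\<lambda>a. c (a, b) * x ^ a) has_sum (\<Sum>\<^sub>\<infinity>a. c (a, b) * x ^ a)) UNIV"
    by (rule has_sum_infsum[OF abs_summable_summable])
  moreover from has_sum_imp_sums[OF this] have "(\<Sum>\<^sub>\<infinity>a. c (a, b) * x ^ a) = column_sum c b x"
    unfolding column_sum_def by (rule sums_unique)
  ultimately show ?thesis by simp
qed

lemma columns_sums_double_sum:
  assumes "\<bar>x\<bar> \<le> R" "\<bar>y\<bar> \<le> R"
  shows "(\<lambda>b. column_sum c b x * y ^ b) sums double_sum c x y"
proof (rule has_sum_imp_sums)
  have "((\<lambda>q. c (prod.swap q) * x ^ fst (prod.swap q) * y ^ snd (prod.swap q)) has_sum double_sum c x y) UNIV"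
    using has_sum_double_sum[OF assms]
      has_sum_reindex_bij_betw[OF bij_swap, of "\<lambda>p. c p * x ^ fst p * y ^ snd p" "double_sum c x y"] by simp
  then have "((\<lambda>q. c (prod.swap q) * x ^ fst (prod.swap q) * y ^ snd (prod.swap q)) has_sum double_sum c x y) (UNIV \<times> UNIV)"
    by simp
  then show "((\<lambda>b. column_sum c b x * y ^ b) has_sum double_sum c x y) UNIV"
    by (rule has_sum_SigmaD) (use has_sum_cmult_left[OF column_has_sum[OF assms(1)]] in simp)
qed

text \<open>Only exponents with nonzero coefficient have to satisfy the monomial bound; in this way
  the position of the support turns into smallness of the function.\<close>

lemma abs_double_sum_le_of_terms:
  assumes "\<bar>x\<bar> \<le> R" "\<bar>y\<bar> \<le> R" "B \<ge> 0"
    and "\<And>a b. c (a, b) \<noteq> 0 \<Longrightarrow> \<bar>x\<bar> ^ a * \<bar>y\<bar> ^ b \<le> B * R ^ (a + b)"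
  shows "\<bar>double_sum c x y\<bar> \<le> B * total"
proof -
  have le: "\<bar>c p * x ^ fst p * y ^ snd p\<bar> \<le> B * (\<bar>c p\<bar> * R ^ (fst p + snd p))" for p
  proof (cases "c p = 0")
    case False
    then have "\<bar>c p\<bar> * (\<bar>x\<bar> ^ fst p * \<bar>y\<bar> ^ snd p) \<le> \<bar>c p\<bar> * (B * R ^ (fst p + snd p))"
      using assms(4)[of "fst p" "snd p"] by (intro mult_left_mono) auto
    then show ?thesis by (simp add: abs_mult power_abs mult_ac)
  qed simp
  have s: "(\<lambda>p. B * (\<bar>c p\<bar> * R ^ (fst p + snd p))) summable_on UNIV"
    by (intro summable_on_cmult_right abs_summable)
  have s2: "(\<lambda>p. norm (c p * x ^ fst p * y ^ snd p)) summable_on UNIV"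
    by (rule Infinite_Sum.abs_summable_on_comparison_test'[OF abs_summable]) (use abs_term_le[OF assms(1,2)] in simp)
  have "\<bar>double_sum c x y\<bar> \<le> (\<Sum>\<^sub>\<infinity>p. \<bar>c p * x ^ fst p * y ^ snd p\<bar>)"
    unfolding double_sum_def using norm_infsum_bound[OF s2] by simp
  also have "\<dots> \<le> (\<Sum>\<^sub>\<infinity>p. B * (\<bar>c p\<bar> * R ^ (fst p + snd p)))"
    using s2 s le by (intro infsum_mono) auto
  also have "\<dots> = B * total" unfolding total_def by (rule infsum_cmult_right) (use abs_summable in auto)
  finally show ?thesis .
qed

text \<open>For \<open>s > 0\<close> the radius \<open>R / t0 powr s\<close> exceeds any prescribed
  \<open>r\<close> once \<open>t0\<close> is small, so \<open>u\<close> can range over a fixed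
  interval however small \<open>R\<close> is. The majorant has the form that also occurs in
  \<open>rescaled_coeff_close\<close>, so that both feed one perturbation argument.\<close>

lemma edge_coeff_bound:
  assumes "e > 0" "s \<ge> 0" "0 < t0" "t0 \<le> 1" "t0 \<le> R" "\<theta> > 0"
  shows "\<bar>edge_coeff c s e b\<bar> \<le> (t0 powr (- e - \<theta>) * total) / (R / t0 powr s) ^ b"
proof (cases "{a. real a + s * real b = e} = {}")
  case True
  then show ?thesis using assms total_nonneg R_pos by (simp add: edge_coeff_def)
next
  case False
  then obtain a where a: "real a + s * real b = e" by auto
  then have "{a. real a + s * real b = e} = {a}" by auto
  then have "\<bar>edge_coeff c s e b\<bar> = \<bar>c (a, b)\<bar>" by (simp add: edge_coeff_def)
  also have "\<dots> = (\<bar>c (a, b)\<bar> * R ^ (a + b)) * (1 / R ^ (a + b))" using R_pos by simp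
  also have "\<dots> \<le> total * (1 / R ^ (a + b))"
  proof (intro mult_right_mono)
    have "(\<Sum>p\<in>{(a, b)}. \<bar>c p\<bar> * R ^ (fst p + snd p)) \<le> total" unfolding total_def
      using abs_summable R_pos by (intro finite_sum_le_infsum) auto
    then show "\<bar>c (a, b)\<bar> * R ^ (a + b) \<le> total" by simp
  qed (use R_pos in auto)
  also have "\<dots> \<le> total * (t0 powr (- e - \<theta>) * (t0 powr s) ^ b / R ^ b)"
  proof (intro mult_left_mono total_nonneg)
    have "1 / R ^ a \<le> 1 / t0 ^ a" using assms by (intro divide_left_mono power_mono) auto
    also have "\<dots> = t0 powr (- real a)" using assms by (simp add: powr_minus powr_realpow field_simps)
    also have "\<dots> \<le> t0 powr (- e - \<theta> + s * real b)"
      using assms a by (intro powr_mono') auto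
    also have "\<dots> = t0 powr (- e - \<theta>) * (t0 powr s) ^ b"
      using assms by (simp add: powr_add powr_powr[symmetric] powr_realpow)
    finally have "1 / R ^ a \<le> t0 powr (- e - \<theta>) * (t0 powr s) ^ b" .
    then have "1 / R ^ a * (1 / R ^ b) \<le> t0 powr (- e - \<theta>) * (t0 powr s) ^ b * (1 / R ^ b)"
      using R_pos by (intro mult_right_mono) auto
    then show "1 / R ^ (a + b) \<le> t0 powr (- e - \<theta>) * (t0 powr s) ^ b / R ^ b" by (simp add: power_add)
  qed
  finally show ?thesis by (simp add: power_divide mult_ac)
qed

text \<open>Substituting \<open>y = t powr s * u\<close> and dividing by \<open>t powr e\<close>
  gives the monomial with exponent \<open>(a, b)\<close> the factor
  \<open>t powr (a + s * b - e)\<close>. It is 1 on the supporting line and of order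
  \<open>t powr \<theta>\<close> off it.\<close>

lemma rescaled_coeff_close:
  assumes "e > 0" "s \<ge> 0" "0 < t" "t \<le> t0" "t0 \<le> R" "\<theta> > 0"
    and supp: "\<And>a b. c (a, b) \<noteq> 0 \<Longrightarrow> real a + s * real b \<ge> e"
    and gap: "\<And>a b. real a + s * real b > e \<Longrightarrow> real a + s * real b \<ge> e + \<theta>"
  shows "\<bar>t powr (s * real b - e) * column_sum c b t - edge_coeff c s e b\<bar>
     \<le> t powr \<theta> * ((t0 powr (- e - \<theta>) * total) / (R / t0 powr s) ^ b)"
proof -
  have t0: "t0 > 0" using assms by auto
  define T where "T = {a. real a + s * real b = e}"
  have finT: "finite T" unfolding T_def by (rule finite_edge_row)
  have tR: "\<bar>t\<bar> \<le> R" using assms by auto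
  define w where "w = t powr (s * real b - e)"
  have hs: "((\<lambda>a. w * (c (a, b) * t ^ a)) has_sum (w * column_sum c b t)) UNIV"
    by (intro has_sum_cmult_right column_has_sum tR)
  have term_T: "w * (c (a, b) * t ^ a) = c (a, b)" if "a \<in> T" for a
  proof -
    have "w * t ^ a = t powr (s * real b - e + real a)"
      unfolding w_def using assms by (simp add: powr_add powr_realpow)
    also have "s * real b - e + real a = 0" using that by (simp add: T_def)
    also have "t powr 0 = 1" using assms by simp
    finally show ?thesis by (metis mult.left_commute mult.right_neutral)
  qed
  have "((\<lambda>a. w * (c (a, b) * t ^ a)) has_sum edge_coeff c s e b) T"
    using has_sum_finite[OF finT, of "\<lambda>a. w * (c (a, b) * t ^ a)"] term_T
    by (simp add: edge_coeff_def T_def)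
  then have hs2: "((\<lambda>a. w * (c (a, b) * t ^ a)) has_sum (w * column_sum c b t - edge_coeff c s e b)) (UNIV - T)"
    by (intro has_sum_Diff hs) auto
  \<comment> \<open>One factor \<open>t powr \<theta>\<close> is kept; by the gap the remaining
    exponent is nonnegative, so \<open>t\<close> may be replaced by \<open>t0\<close> there.\<close>
  define M where "M = t powr \<theta> * t0 powr (s * real b - e - \<theta>)"
  have le: "\<bar>w * (c (a, b) * t ^ a)\<bar> \<le> M * (\<bar>c (a, b)\<bar> * R ^ a)" if "a \<in> UNIV - T" for a
  proof (cases "c (a, b) = 0")
    case False
    from supp[OF this] that have "real a + s * real b > e" unfolding T_def by force
    from gap[OF this] have g: "real a + s * real b - e - \<theta> \<ge> 0" by simp
    have "w * t ^ a = t powr (s * real b - e + real a)"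
      unfolding w_def using assms by (simp add: powr_add powr_realpow)
    also have "\<dots> = t powr \<theta> * t powr (real a + s * real b - e - \<theta>)"
      using assms by (simp add: powr_add[symmetric] algebra_simps)
    also have "\<dots> \<le> t powr \<theta> * t0 powr (real a + s * real b - e - \<theta>)"
      using assms g by (intro mult_left_mono powr_mono2) auto
    also have "t0 powr (real a + s * real b - e - \<theta>) = t0 powr (s * real b - e - \<theta>) * t0 ^ a"
      using t0 by (simp add: powr_realpow[symmetric] powr_add[symmetric] algebra_simps)
    also have "t powr \<theta> * (t0 powr (s * real b - e - \<theta>) * t0 ^ a) \<le> M * R ^ a"
      unfolding M_def mult.assoc using assms t0 by (intro mult_left_mono power_mono) auto
    finally have "w * t ^ a \<le> M * R ^ a" .
    then have "\<bar>c (a, b)\<bar> * (w * t ^ a) \<le> \<bar>c (a, b)\<bar> * (M * R ^ a)" by (rule mult_left_mono) auto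
    then show ?thesis using assms by (simp add: abs_mult w_def mult_ac)
  qed simp
  have M0: "M \<ge> 0" unfolding M_def by simp
  have s1: "(\<lambda>a. M * (\<bar>c (a, b)\<bar> * R ^ a)) summable_on UNIV"
    by (intro summable_on_cmult_right column_abs_summable)
  have s2: "(\<lambda>a. M * (\<bar>c (a, b)\<bar> * R ^ a)) summable_on (UNIV - T)"
    using s1 by (rule summable_on_subset) auto
  have s3: "(\<lambda>a. norm (w * (c (a, b) * t ^ a))) summable_on (UNIV - T)"
    by (rule Infinite_Sum.abs_summable_on_comparison_test'[OF s2]) (use le in simp)
  have "\<bar>w * column_sum c b t - edge_coeff c s e b\<bar> = \<bar>\<Sum>\<^sub>\<infinity>a\<in>UNIV - T. w * (c (a, b) * t ^ a)\<bar>"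
    using infsumI[OF hs2] by simp
  also have "\<dots> \<le> (\<Sum>\<^sub>\<infinity>a\<in>UNIV - T. \<bar>w * (c (a, b) * t ^ a)\<bar>)"
    using norm_infsum_bound[OF s3] by simp
  also have "\<dots> \<le> (\<Sum>\<^sub>\<infinity>a\<in>UNIV - T. M * (\<bar>c (a, b)\<bar> * R ^ a))"
    using s3 s2 le by (intro infsum_mono) auto
  also have "\<dots> \<le> (\<Sum>\<^sub>\<infinity>a. M * (\<bar>c (a, b)\<bar> * R ^ a))"
    using s2 s1 M0 R_pos by (intro infsum_mono2) auto
  also have "\<dots> = M * (\<Sum>\<^sub>\<infinity>a. \<bar>c (a, b)\<bar> * R ^ a)"
    by (rule infsum_cmult_right) (use column_abs_summable in auto)
  also have "\<dots> \<le> M * (total / R ^ b)" by (intro mult_left_mono column_abs_summable M0)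
  also have "\<dots> = t powr \<theta> * ((t0 powr (- e - \<theta>) * total) / (R / t0 powr s) ^ b)"
  proof -
    have "t0 powr (s * real b - e - \<theta>) = t0 powr (- e - \<theta>) * (t0 powr s) ^ b"
      using t0 by (simp add: powr_realpow[symmetric] powr_powr powr_add[symmetric] algebra_simps)
    then show ?thesis unfolding M_def by (simp add: power_divide)
  qed
  finally show ?thesis unfolding w_def .
qed

lemma rescaled_double_sum:
  assumes "0 < t" "t \<le> R" "\<bar>t powr s * u\<bar> \<le> R"
  shows "(\<lambda>b. t powr (s * real b - e) * column_sum c b t * u ^ b) sums (t powr (- e) * double_sum c t (t powr s * u))"
proof -
  have "(\<lambda>b. t powr (- e) * (column_sum c b t * (t powr s * u) ^ b)) sums (t powr (- e) * double_sum c t (t powr s * u))"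
    by (intro sums_mult columns_sums_double_sum) (use assms in auto)
  moreover have "t powr (- e) * (column_sum c b t * (t powr s * u) ^ b) =
      t powr (s * real b - e) * column_sum c b t * u ^ b" for b
  proof -
    have "(t powr s) ^ b = t powr (s * real b)" using assms by (simp add: powr_realpow[symmetric] powr_powr)
    moreover have "t powr (s * real b - e) = t powr (s * real b) * t powr (- e)"
      by (simp add: powr_add[symmetric])
    ultimately show ?thesis by (simp add: power_mult_distrib mult_ac)
  qed
  ultimately show ?thesis by simp
qed

text \<open>For small \<open>t\<close> the rescaled slice is a perturbation of the edge series of
  relative size \<open>t powr \<theta>\<close>, so \<open>uniform_sublevel_estimate\<close> applies
  with constants independent of \<open>t\<close>.\<close>

lemma rescaled_sublevel_estimate:
  assumes e: "e > 0" and s: "s \<ge> 0" and r: "r > 0" and "s = 0 \<Longrightarrow> r < R" and q: "q > 0"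
    and supp: "\<And>a b. c (a, b) \<noteq> 0 \<Longrightarrow> real a + s * real b \<ge> e"
    and ord: "\<And>u. \<bar>u\<bar> \<le> r \<Longrightarrow> \<exists>k. (k = 0 \<or> q * real k \<le> 1) \<and> powser_deriv (edge_coeff c s e) k u \<noteq> 0"
  shows "\<exists>C\<ge>0. \<exists>t1>0. t1 \<le> 1 \<and> t1 \<le> R \<and> r * t1 powr s < R \<and> (\<forall>t \<eta>. 0 < t \<longrightarrow> t \<le> t1 \<longrightarrow> \<eta> > 0 \<longrightarrow>
     emeasure lborel {u\<in>{-r..r}. \<bar>t powr (- e) * double_sum c t (t powr s * u)\<bar> < \<eta>} \<le> ennreal (C * \<eta> powr q))"
proof -
  obtain \<theta> where \<theta>: "\<theta> > 0" "\<And>a b :: nat. real a + s * real b > e \<Longrightarrow> real a + s * real b \<ge> e + \<theta>"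
    using weight_gap[OF s e] by blast
  \<comment> \<open>The last condition puts \<open>r\<close> inside the radius of the majorant.
    Shrinking \<open>t0\<close> achieves it for \<open>s > 0\<close>; for \<open>s = 0\<close> it is
    the assumption on \<open>r\<close>.\<close>
  obtain t0 where t0: "0 < t0" "t0 \<le> 1" "t0 \<le> R" "r * t0 powr s < R"
  proof (cases "s = 0")
    case True
    then show ?thesis using that[of "min 1 R"] R_pos assms(4) by auto
  next
    case False
    define t0 where "t0 = min (min 1 R) ((R / (2 * r)) powr (1 / s))"
    have "t0 > 0" unfolding t0_def using R_pos r by auto
    have "t0 powr s \<le> ((R / (2 * r)) powr (1 / s)) powr s"
      using \<open>t0 > 0\<close> s by (intro powr_mono2) (auto simp: t0_def)
    also have "\<dots> = R / (2 * r)" using False R_pos r by (simp add: powr_powr)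
    finally have "r * t0 powr s < R" using r R_pos by (simp add: field_simps)
    then show ?thesis using that[of t0] \<open>t0 > 0\<close> unfolding t0_def by auto
  qed
  define \<rho> where "\<rho> = R / t0 powr s"
  define K where "K = t0 powr (- e - \<theta>) * total"
  have r\<rho>: "r < \<rho>" unfolding \<rho>_def using t0 by (simp add: field_simps)
  have K0: "K \<ge> 0" unfolding K_def using total_nonneg by simp
  have bnd: "\<bar>edge_coeff c s e b\<bar> \<le> K / \<rho> ^ b" for b
    unfolding K_def \<rho>_def by (rule edge_coeff_bound[OF e s t0(1-3) \<theta>(1)])
  have "\<exists>C\<ge>0. \<exists>\<tau>0>0. \<forall>\<gamma>' \<tau> \<eta>. 0 \<le> \<tau> \<longrightarrow> \<tau> \<le> \<tau>0 \<longrightarrow> \<eta> > 0 \<longrightarrow>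
     (\<forall>b. \<bar>\<gamma>' b - edge_coeff c s e b\<bar> \<le> \<tau> * (K / \<rho> ^ b)) \<longrightarrow>
     emeasure lborel {u\<in>{-r..r}. \<bar>powser_deriv \<gamma>' 0 u\<bar> < \<eta>} \<le> ennreal (C * \<eta> powr q)"
    by (rule uniform_sublevel_estimate[OF r r\<rho> K0 bnd q]) (rule ord)
  then obtain C \<tau>0 where C: "C \<ge> 0" "\<tau>0 > 0" "\<forall>\<gamma>' \<tau> \<eta>. 0 \<le> \<tau> \<longrightarrow> \<tau> \<le> \<tau>0 \<longrightarrow> \<eta> > 0 \<longrightarrow>
     (\<forall>b. \<bar>\<gamma>' b - edge_coeff c s e b\<bar> \<le> \<tau> * (K / \<rho> ^ b)) \<longrightarrow>
     emeasure lborel {u\<in>{-r..r}. \<bar>powser_deriv \<gamma>' 0 u\<bar> < \<eta>} \<le> ennreal (C * \<eta> powr q)"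
    by (elim exE conjE) (rule that)
  \<comment> \<open>The second term of the minimum turns \<open>t \<le> t1\<close> into
    \<open>t powr \<theta> \<le> \<tau>0\<close>.\<close>
  define t1 where "t1 = min t0 (\<tau>0 powr (1 / \<theta>))"
  have t1: "t1 > 0" "t1 \<le> t0" unfolding t1_def using t0 C by auto
  have sc: "r * t1 powr s < R"
  proof -
    have "t1 powr s \<le> t0 powr s" using t1 s by (intro powr_mono2) auto
    then have "r * t1 powr s \<le> r * t0 powr s" using r by simp
    then show ?thesis using t0 by linarith
  qed
  have "emeasure lborel {u\<in>{-r..r}. \<bar>t powr (- e) * double_sum c t (t powr s * u)\<bar> < \<eta>} \<le> ennreal (C * \<eta> powr q)"
    if t: "0 < t" "t \<le> t1" and \<eta>: "\<eta> > 0" for t \<eta>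
  proof -
    define \<gamma>' where "\<gamma>' b = t powr (s * real b - e) * column_sum c b t" for b
    have "t powr \<theta> \<le> (\<tau>0 powr (1 / \<theta>)) powr \<theta>"
      using t t1 \<theta> by (intro powr_mono2) (auto simp: t1_def)
    then have \<tau>: "t powr \<theta> \<le> \<tau>0" using \<theta> C by (simp add: powr_powr)
    have close: "\<bar>\<gamma>' b - edge_coeff c s e b\<bar> \<le> t powr \<theta> * (K / \<rho> ^ b)" for b
      unfolding \<gamma>'_def K_def \<rho>_def
      by (rule rescaled_coeff_close[OF e s t(1) _ t0(3) \<theta>(1) supp \<theta>(2)]) (use t t1 in auto)
    have "powser_deriv \<gamma>' 0 u = t powr (- e) * double_sum c t (t powr s * u)" if u: "u \<in> {-r..r}" for u
    proof -
      have "\<bar>t powr s * u\<bar> \<le> t1 powr s * r"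
        unfolding abs_mult using u t s by (intro mult_mono) (auto intro: powr_mono2)
      then have "\<bar>t powr s * u\<bar> \<le> R" using sc by (simp add: mult.commute)
      from rescaled_double_sum[OF t(1) _ this, of e] have
        "(\<lambda>b. \<gamma>' b * u ^ b) sums (t powr (- e) * double_sum c t (t powr s * u))"
        unfolding \<gamma>'_def using t t1 t0 by simp
      then show ?thesis unfolding powser_deriv_def by (simp add: sums_iff)
    qed
    then have "{u\<in>{-r..r}. \<bar>t powr (- e) * double_sum c t (t powr s * u)\<bar> < \<eta>} = {u\<in>{-r..r}. \<bar>powser_deriv \<gamma>' 0 u\<bar> < \<eta>}"
      by auto
    then show ?thesis using C(3)[rule_format, OF _ \<tau> \<eta> close] by simp
  qed
  moreover have "t1 \<le> 1" "t1 \<le> R" using t1 t0 by auto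
  ultimately show ?thesis using C(1) t1(1) sc by blast
qed

end

context double_power_series
begin

text \<open>Returning from \<open>u\<close> to \<open>y\<close> multiplies lengths by
  \<open>t powr s\<close> and rescales the threshold \<open>\<epsilon>\<close> by
  \<open>t powr (- e)\<close>. The trivial length stays in the minimum because it is the better
  bound for very small \<open>t\<close>.\<close>

lemma slice_sublevel_estimate:
  assumes e: "e > 0" and s: "s \<ge> 0" and r: "r > 0" and "s = 0 \<Longrightarrow> r < R" and q: "q > 0"
    and supp: "\<And>a b. c (a, b) \<noteq> 0 \<Longrightarrow> real a + s * real b \<ge> e"
    and ord: "\<And>u. \<bar>u\<bar> \<le> r \<Longrightarrow> \<exists>k. (k = 0 \<or> q * real k \<le> 1) \<and> powser_deriv (edge_coeff c s e) k u \<noteq> 0"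
  shows "\<exists>C\<ge>0. \<exists>t1>0. t1 \<le> 1 \<and> t1 \<le> R \<and> r * t1 powr s < R \<and> (\<forall>t \<epsilon>. 0 < t \<longrightarrow> t \<le> t1 \<longrightarrow> \<epsilon> > 0 \<longrightarrow>
     emeasure lborel {y. \<bar>y\<bar> \<le> r * t powr s \<and> \<bar>double_sum c t y\<bar> < \<epsilon>}
       \<le> ennreal (min (2 * r * t powr s) (C * \<epsilon> powr q * t powr (s - e * q))))"
proof -
  have "\<exists>C\<ge>0. \<exists>t1>0. t1 \<le> 1 \<and> t1 \<le> R \<and> r * t1 powr s < R \<and> (\<forall>t \<eta>. 0 < t \<longrightarrow> t \<le> t1 \<longrightarrow> \<eta> > 0 \<longrightarrow>
     emeasure lborel {u\<in>{-r..r}. \<bar>t powr (- e) * double_sum c t (t powr s * u)\<bar> < \<eta>} \<le> ennreal (C * \<eta> powr q))"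
    by (rule rescaled_sublevel_estimate[OF e s r _ q supp ord]) (use assms(4) in auto)
  then obtain C t1 where C: "C \<ge> 0" and t1: "t1 > 0" "t1 \<le> 1" "t1 \<le> R" "r * t1 powr s < R"
    and est: "\<forall>t \<eta>. 0 < t \<longrightarrow> t \<le> t1 \<longrightarrow> \<eta> > 0 \<longrightarrow>
     emeasure lborel {u\<in>{-r..r}. \<bar>t powr (- e) * double_sum c t (t powr s * u)\<bar> < \<eta>} \<le> ennreal (C * \<eta> powr q)"
    by (elim exE conjE) (rule that)
  have "emeasure lborel {y. \<bar>y\<bar> \<le> r * t powr s \<and> \<bar>double_sum c t y\<bar> < \<epsilon>}
       \<le> ennreal (min (2 * r * t powr s) (C * \<epsilon> powr q * t powr (s - e * q)))"
    if t: "0 < t" "t \<le> t1" and \<epsilon>: "\<epsilon> > 0" for t \<epsilon>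
  \<comment> \<open>A non-measurable set has \<open>emeasure\<close> 0 by convention, so
    measurability of the slice can be left open.\<close>
  proof (cases "{y. \<bar>y\<bar> \<le> r * t powr s \<and> \<bar>double_sum c t y\<bar> < \<epsilon>} \<in> sets borel")
    case False
    then have "emeasure lborel {y. \<bar>y\<bar> \<le> r * t powr s \<and> \<bar>double_sum c t y\<bar> < \<epsilon>} = 0"
      by (intro emeasure_notin_sets) (simp only: sets_lborel not_False_eq_True)
    then show ?thesis by (rule ord_eq_le_trans) (rule zero_le)
  next
    case True
    define A where "A = {y. \<bar>y\<bar> \<le> r * t powr s \<and> \<bar>double_sum c t y\<bar> < \<epsilon>}"
    define T where "T = t powr s"
    have T: "T > 0" unfolding T_def using t by simp
    have A: "A \<in> sets borel" using True unfolding A_def .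
    have "emeasure lborel A = (\<integral>\<^sup>+y. indicator A y \<partial>lborel)" using A by simp
    also have "\<dots> = ennreal \<bar>T\<bar> * (\<integral>\<^sup>+u. indicator A (0 + T * u) \<partial>lborel)"
      using T A by (intro nn_integral_real_affine) auto
    also have "(\<integral>\<^sup>+u. indicator A (0 + T * u) \<partial>lborel) = (\<integral>\<^sup>+u. indicator ((\<lambda>u. T * u) -` A) u \<partial>lborel)"
      by (intro nn_integral_cong) (auto simp: indicator_def)
    also have "\<dots> = emeasure lborel ((\<lambda>u. T * u) -` A)"
    proof (rule nn_integral_indicator)
      have "(\<lambda>u. T * u) -` A \<inter> space borel \<in> sets borel" by (rule measurable_sets[OF _ A]) simp
      then show "(\<lambda>u. T * u) -` A \<in> sets lborel" by simp
    qed
    also have "(\<lambda>u. T * u) -` A = {u\<in>{-r..r}. \<bar>t powr (- e) * double_sum c t (t powr s * u)\<bar> < \<epsilon> * t powr (- e)}"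
    proof -
      have "\<bar>T * u\<bar> \<le> r * T \<longleftrightarrow> u \<in> {-r..r}" for u
        using T by (auto simp: abs_mult abs_le_iff mult.commute)
      moreover have "\<bar>t powr (- e) * z\<bar> < \<epsilon> * t powr (- e) \<longleftrightarrow> \<bar>z\<bar> < \<epsilon>" for z
        using t by (simp add: abs_mult mult.commute)
      ultimately show ?thesis unfolding A_def T_def by auto
    qed
    finally have "emeasure lborel A = ennreal \<bar>T\<bar> *
        emeasure lborel {u\<in>{-r..r}. \<bar>t powr (- e) * double_sum c t (t powr s * u)\<bar> < \<epsilon> * t powr (- e)}" .
    also have "\<dots> \<le> ennreal \<bar>T\<bar> * ennreal (C * (\<epsilon> * t powr (- e)) powr q)"
      by (intro mult_left_mono est[rule_format]) (use t \<epsilon> in auto)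
    also have "\<dots> = ennreal (C * \<epsilon> powr q * t powr (s - e * q))"
    proof -
      have "T * (C * (\<epsilon> * t powr (- e)) powr q) = C * \<epsilon> powr q * t powr (s - e * q)"
      proof -
        have "(\<epsilon> * t powr (- e)) powr q = \<epsilon> powr q * t powr (- (e * q))"
          using \<epsilon> t by (simp add: powr_mult powr_powr)
        moreover have "t powr (s - e * q) = t powr s * t powr (- (e * q))"
          by (simp add: powr_add[symmetric])
        ultimately show ?thesis unfolding T_def by simp
      qed
      then show ?thesis using T C by (simp add: ennreal_mult''[symmetric])
    qed
    finally have 1: "emeasure lborel A \<le> ennreal (C * \<epsilon> powr q * t powr (s - e * q))" .
    have "emeasure lborel A \<le> emeasure lborel {- (r * T)..r * T}"
      unfolding A_def T_def by (intro emeasure_mono) auto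
    also have "\<dots> = ennreal (2 * r * T)" using r T by simp
    finally have "emeasure lborel A \<le> ennreal (2 * r * T)" .
    with 1 show ?thesis unfolding A_def T_def by (simp add: min_def)
  qed
  then show ?thesis using C t1 by blast
qed

end

section \<open>Integration of the slice bounds\<close>

lemma nn_integral_inverse_Icc:
  fixes a b :: real
  assumes "0 < a" "a \<le> b"
  shows "(\<integral>\<^sup>+t. ennreal (1 / t) * indicator {a..b} t \<partial>lborel) = ennreal (ln b - ln a)"
  by (rule nn_integral_FTC_Icc)
    (use assms in \<open>auto intro!: derivative_eq_intros simp: field_simps\<close>)

lemma nn_integral_powr_Icc_le:
  fixes a b \<kappa> :: real
  assumes "0 < a" "\<kappa> > 0"
  shows "(\<integral>\<^sup>+t. ennreal (t powr (- 1 - \<kappa>)) * indicator {a..b} t \<partial>lborel) \<le> ennreal (a powr (- \<kappa>) / \<kappa>)"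
proof (cases "a \<le> b")
  case True
  have "(\<integral>\<^sup>+t. ennreal (t powr (- 1 - \<kappa>)) * indicator {a..b} t \<partial>lborel)
      = ennreal (- (b powr (- \<kappa>)) / \<kappa> - - (a powr (- \<kappa>)) / \<kappa>)"
  proof (rule nn_integral_FTC_Icc[where F = "\<lambda>t. - (t powr (- \<kappa>)) / \<kappa>"])
    fix t assume "t \<in> {a..b}"
    then show "((\<lambda>t. - (t powr - \<kappa>) / \<kappa>) has_real_derivative t powr (- 1 - \<kappa>)) (at t)"
      using assms by (auto intro!: derivative_eq_intros simp: field_simps powr_diff powr_minus)
  qed (use True in auto)
  also have "\<dots> \<le> ennreal (a powr (- \<kappa>) / \<kappa>)" using assms by (intro ennreal_leI) auto
  finally show ?thesis .
qed simp

text \<open>The outcome of integrating slice bounds with exponent \<open>q\<close>. The factor is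
  \<open>1 - ln \<epsilon>\<close> instead of \<open>- ln \<epsilon>\<close> so that the rate still
  dominates \<open>\<epsilon> powr (1 / d)\<close> when \<open>\<epsilon>\<close> is close to
  1.\<close>

definition sublevel_rate :: "real \<Rightarrow> real \<Rightarrow> real \<Rightarrow> real" where
  "sublevel_rate d q \<epsilon> = (if q * d > 1 then \<epsilon> powr (1 / d) else \<epsilon> powr q * (1 - ln \<epsilon>))"

lemma sublevel_rate_nonneg:
  assumes "0 < \<epsilon>" "\<epsilon> < 1"
  shows "sublevel_rate d q \<epsilon> \<ge> 0"
  unfolding sublevel_rate_def using ln_less_zero[OF assms] by auto

text \<open>The two slice bounds balance at \<open>t = X\<close>, where
  \<open>t powr e = \<epsilon>\<close>. Below \<open>X\<close> the trivial one contributes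
  \<open>X powr (1 + s) = \<epsilon> powr (1 / d)\<close>, since \<open>e = d * (1 + s)\<close>.
  Above \<open>X\<close> the exponent \<open>\<sigma>\<close> is less than \<open>- 1\<close>
  exactly if \<open>q * d > 1\<close>; then the lower end governs the integral, otherwise a
  comparison with \<open>1 / t\<close> produces the logarithm. The constant adds the terms of both
  cases; at \<open>q * d = 1\<close> its last quotient is 0 by the convention for division by
  0.\<close>

lemma integrate_slice_bound:
  fixes m :: "real \<Rightarrow> ennreal"
  assumes d: "d > 0" and s: "s \<ge> 0" and r: "r > 0" and q: "q > 0" and C: "C \<ge> 0"
    and t1: "0 < t1" "t1 \<le> 1" and \<epsilon>: "0 < \<epsilon>" "\<epsilon> < 1"
    and m: "\<And>t. 0 < t \<Longrightarrow> t \<le> t1 \<Longrightarrow>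
      m t \<le> ennreal (min (2 * r * t powr s) (C * \<epsilon> powr q * t powr (s - d * (1 + s) * q)))"
  shows "(\<integral>\<^sup>+t. m t * indicator {0<..t1} t \<partial>lborel) \<le>
     ennreal ((2 * r + (C / (d * (1 + s)) + C / \<bar>d * (1 + s) * q - 1 - s\<bar>)) * sublevel_rate d q \<epsilon>)"
proof -
  define e where "e = d * (1 + s)"
  have e: "e > 0" unfolding e_def using d s by simp
  define X where "X = \<epsilon> powr (1 / e)"
  have X: "0 < X" "X < 1" unfolding X_def using \<epsilon> e powr_less_mono2[of "1 / e" \<epsilon> 1] by auto
  define \<sigma> where "\<sigma> = s - e * q"
  have Xs: "X * X powr s = \<epsilon> powr (1 / d)"
  proof -
    have "X * X powr s = X powr (1 + s)" using X by (simp add: powr_add)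
    also have "\<dots> = \<epsilon> powr ((1 + s) / e)" unfolding X_def by (simp add: powr_powr)
    also have "(1 + s) / e = 1 / d" using d s e by (simp add: e_def)
    finally show ?thesis .
  qed
  have Xq: "\<epsilon> powr q * X powr (1 + \<sigma>) = \<epsilon> powr (1 / d)"
  proof -
    have "\<epsilon> powr q * X powr (1 + \<sigma>) = \<epsilon> powr (q + (1 + \<sigma>) / e)"
      unfolding X_def using \<epsilon> by (simp only: powr_powr powr_add[symmetric]) simp
    also have "q + (1 + \<sigma>) / e = 1 / d" unfolding \<sigma>_def using e d s by (simp add: field_simps e_def)
    finally show ?thesis .
  qed
  have low: "(\<integral>\<^sup>+t. ennreal (2 * r * t powr s) * indicator {0<..X} t \<partial>lborel) \<le> ennreal (2 * r * \<epsilon> powr (1 / d))"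
  proof -
    have "(\<integral>\<^sup>+t. ennreal (2 * r * t powr s) * indicator {0<..X} t \<partial>lborel)
        \<le> (\<integral>\<^sup>+t. ennreal (2 * r * X powr s) * indicator {0<..X} t \<partial>lborel)"
      using r s by (intro nn_integral_mono)
        (auto simp: indicator_def intro!: ennreal_leI mult_left_mono powr_mono2)
    also have "\<dots> = ennreal (2 * r * X powr s) * ennreal X"
      using X by (subst nn_integral_cmult_indicator) auto
    also have "\<dots> = ennreal (2 * r * \<epsilon> powr (1 / d))"
      unfolding Xs[symmetric] using r X by (simp add: ennreal_mult''[symmetric] mult_ac)
    finally show ?thesis .
  qed
  have high: "(\<integral>\<^sup>+t. ennreal (C * \<epsilon> powr q * t powr \<sigma>) * indicator {X..t1} t \<partial>lborel)
      \<le> ennreal ((C / (d * (1 + s)) + C / \<bar>d * (1 + s) * q - 1 - s\<bar>) * sublevel_rate d q \<epsilon>)"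
  proof -
    have pull: "(\<integral>\<^sup>+t. ennreal (C * \<epsilon> powr q * g t) * indicator {X..t1} t \<partial>lborel)
       = ennreal (C * \<epsilon> powr q) * (\<integral>\<^sup>+t. ennreal (g t) * indicator {X..t1} t \<partial>lborel)"
      if [measurable]: "g \<in> borel_measurable borel" and "\<And>t. g t \<ge> 0" for g :: "real \<Rightarrow> real"
    proof -
      have "(\<integral>\<^sup>+t. ennreal (C * \<epsilon> powr q * g t) * indicator {X..t1} t \<partial>lborel)
        = (\<integral>\<^sup>+t. ennreal (C * \<epsilon> powr q) * (ennreal (g t) * indicator {X..t1} t) \<partial>lborel)"
        using that C by (intro nn_integral_cong) (simp add: ennreal_mult mult.assoc)
      also have "\<dots> = ennreal (C * \<epsilon> powr q) * (\<integral>\<^sup>+t. ennreal (g t) * indicator {X..t1} t \<partial>lborel)"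
        by (intro nn_integral_cmult) measurable
      finally show ?thesis .
    qed
    show ?thesis
    proof (cases "q * d > 1")
      case True
      define \<kappa> where "\<kappa> = e * q - 1 - s"
      have "(1 + s) * (q * d) > (1 + s) * 1" using True s by (intro mult_strict_left_mono) auto
      then have \<kappa>: "\<kappa> > 0" unfolding \<kappa>_def e_def by (simp add: algebra_simps)
      have \<sigma>\<kappa>: "\<sigma> = - 1 - \<kappa>" unfolding \<sigma>_def \<kappa>_def by simp
      have "(\<integral>\<^sup>+t. ennreal (C * \<epsilon> powr q * t powr \<sigma>) * indicator {X..t1} t \<partial>lborel)
         = ennreal (C * \<epsilon> powr q) * (\<integral>\<^sup>+t. ennreal (t powr (-1 - \<kappa>)) * indicator {X..t1} t \<partial>lborel)"
        unfolding \<sigma>\<kappa> by (rule pull) auto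
      also have "\<dots> \<le> ennreal (C * \<epsilon> powr q) * ennreal (X powr (- \<kappa>) / \<kappa>)"
        by (intro mult_left_mono nn_integral_powr_Icc_le X \<kappa>) auto
      also have "\<dots> = ennreal (C / \<kappa> * (\<epsilon> powr q * X powr (1 + \<sigma>)))"
        using C \<kappa> by (simp add: ennreal_mult''[symmetric] \<sigma>\<kappa> field_simps)
      also have "\<dots> \<le> ennreal ((C / (d * (1 + s)) + C / \<bar>d * (1 + s) * q - 1 - s\<bar>) * sublevel_rate d q \<epsilon>)"
        unfolding Xq
      proof (intro ennreal_leI)
        have "C / \<kappa> \<le> C / (d * (1 + s)) + C / \<bar>d * (1 + s) * q - 1 - s\<bar>"
          using \<kappa> C e unfolding \<kappa>_def e_def by simp
        then show "C / \<kappa> * \<epsilon> powr (1 / d) \<le> (C / (d * (1 + s)) + C / \<bar>d * (1 + s) * q - 1 - s\<bar>) * sublevel_rate d q \<epsilon>"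
          using True mult_right_mono[of "C / \<kappa>" _ "\<epsilon> powr (1 / d)"] by (simp add: sublevel_rate_def)
      qed
      finally show ?thesis .
    next
      case False
      have "(1 + s) * (q * d) \<le> (1 + s) * 1" using False s by (intro mult_left_mono) auto
      then have \<sigma>: "\<sigma> \<ge> - 1" unfolding \<sigma>_def e_def by (simp add: algebra_simps)
      have "(\<integral>\<^sup>+t. ennreal (C * \<epsilon> powr q * t powr \<sigma>) * indicator {X..t1} t \<partial>lborel)
         \<le> (\<integral>\<^sup>+t. ennreal (C * \<epsilon> powr q * \<bar>1 / t\<bar>) * indicator {X..t1} t \<partial>lborel)"
      proof (intro nn_integral_mono)
        fix t :: real
        show "ennreal (C * \<epsilon> powr q * t powr \<sigma>) * indicator {X..t1} t \<le> ennreal (C * \<epsilon> powr q * \<bar>1 / t\<bar>) * indicator {X..t1} t"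
        proof (cases "t \<in> {X..t1}")
          case True
          then have "t > 0" "t \<le> 1" using X t1 by auto
          then have "t powr \<sigma> \<le> t powr (- 1)" using \<sigma> by (intro powr_mono') auto
          also have "\<dots> = \<bar>1 / t\<bar>" using \<open>t > 0\<close> by (simp add: powr_minus field_simps)
          finally show ?thesis using C by (intro mult_right_mono ennreal_leI mult_left_mono) auto
        qed simp
      qed
      also have "\<dots> = ennreal (C * \<epsilon> powr q) * (\<integral>\<^sup>+t. ennreal \<bar>1 / t\<bar> * indicator {X..t1} t \<partial>lborel)"
        by (rule pull) auto
      also have "\<dots> \<le> ennreal (C * \<epsilon> powr q) * ennreal (- ln X)"
      proof (intro mult_left_mono)
        show "(\<integral>\<^sup>+t. ennreal \<bar>1 / t\<bar> * indicator {X..t1} t \<partial>lborel) \<le> ennreal (- ln X)"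
      proof (cases "X \<le> t1")
        case True
        have "(\<integral>\<^sup>+t. ennreal \<bar>1 / t\<bar> * indicator {X..t1} t \<partial>lborel) = (\<integral>\<^sup>+t. ennreal (1 / t) * indicator {X..t1} t \<partial>lborel)"
          using X by (intro nn_integral_cong) (auto simp: indicator_def)
        also have "\<dots> = ennreal (ln t1 - ln X)" by (rule nn_integral_inverse_Icc[OF X(1) True])
        also have "\<dots> \<le> ennreal (- ln X)" using t1 by (intro ennreal_leI) auto
        finally show ?thesis .
      qed simp
      qed simp
      also have "\<dots> = ennreal (C * \<epsilon> powr q * (- ln X))"
        using C X by (simp add: ennreal_mult''[symmetric])
      also have "\<dots> \<le> ennreal (C * (1/e) * (\<epsilon> powr q * (1 - ln \<epsilon>)))"
      proof (intro ennreal_leI)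
        have "- ln X = (1/e) * (- ln \<epsilon>)" unfolding X_def using \<epsilon> by (simp add: ln_powr)
        also have "\<dots> \<le> (1/e) * (1 - ln \<epsilon>)" using e by (intro mult_left_mono) auto
        finally have "C * \<epsilon> powr q * (- ln X) \<le> C * \<epsilon> powr q * ((1/e) * (1 - ln \<epsilon>))"
          using C by (intro mult_left_mono) auto
        then show "C * \<epsilon> powr q * (- ln X) \<le> C * (1/e) * (\<epsilon> powr q * (1 - ln \<epsilon>))" by (simp add: mult_ac)
      qed
      also have "\<dots> \<le> ennreal ((C / (d * (1 + s)) + C / \<bar>d * (1 + s) * q - 1 - s\<bar>) * sublevel_rate d q \<epsilon>)"
      proof (intro ennreal_leI)
        have "C * (1/e) \<le> C / (d * (1 + s)) + C / \<bar>d * (1 + s) * q - 1 - s\<bar>"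
          using C unfolding e_def by simp
        then have "C * (1/e) * sublevel_rate d q \<epsilon> \<le>
            (C / (d * (1 + s)) + C / \<bar>d * (1 + s) * q - 1 - s\<bar>) * sublevel_rate d q \<epsilon>"
          by (rule mult_right_mono) (rule sublevel_rate_nonneg[OF \<epsilon>])
        then show "C * (1/e) * (\<epsilon> powr q * (1 - ln \<epsilon>)) \<le>
            (C / (d * (1 + s)) + C / \<bar>d * (1 + s) * q - 1 - s\<bar>) * sublevel_rate d q \<epsilon>"
          using False by (simp add: sublevel_rate_def)
      qed
      finally show ?thesis .
    qed
  qed
  define f1 f2 where "f1 t = ennreal (2 * r * t powr s) * indicator {0<..X} t"
    and "f2 t = ennreal (C * \<epsilon> powr q * t powr \<sigma>) * indicator {X..t1} t" for t :: real
  have [measurable]: "f1 \<in> borel_measurable borel" "f2 \<in> borel_measurable borel"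
    unfolding f1_def f2_def by measurable
  have "(\<integral>\<^sup>+t. m t * indicator {0<..t1} t \<partial>lborel) \<le> (\<integral>\<^sup>+t. f1 t + f2 t \<partial>lborel)"
  proof (intro nn_integral_mono)
    fix t :: real
    show "m t * indicator {0<..t1} t \<le> f1 t + f2 t"
    proof (cases "0 < t \<and> t \<le> t1")
      case True
      note mt = m[of t, folded e_def, folded \<sigma>_def]
      have m1: "m t \<le> ennreal (2 * r * t powr s)" and m2: "m t \<le> ennreal (C * \<epsilon> powr q * t powr \<sigma>)"
        using mt True by (auto elim!: order_trans intro!: ennreal_leI)
      show ?thesis
      proof (cases "t \<le> X")
        case True
        then have "f1 t = ennreal (2 * r * t powr s)" using \<open>0 < t \<and> t \<le> t1\<close> by (simp add: f1_def)
        then show ?thesis using m1 \<open>0 < t \<and> t \<le> t1\<close> by (simp add: add_increasing2)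
      next
        case False
        then have "f2 t = ennreal (C * \<epsilon> powr q * t powr \<sigma>)" using \<open>0 < t \<and> t \<le> t1\<close> by (simp add: f2_def)
        then show ?thesis using m2 \<open>0 < t \<and> t \<le> t1\<close> by (simp add: add_increasing)
      qed
    qed auto
  qed
  also have "\<dots> = (\<integral>\<^sup>+t. f1 t \<partial>lborel) + (\<integral>\<^sup>+t. f2 t \<partial>lborel)" by (rule nn_integral_add) auto
  also have "\<dots> \<le> ennreal (2 * r * \<epsilon> powr (1 / d)) +
      ennreal ((C / (d * (1 + s)) + C / \<bar>d * (1 + s) * q - 1 - s\<bar>) * sublevel_rate d q \<epsilon>)"
    using low high unfolding f1_def f2_def by (rule add_mono)
  also have "\<dots> \<le> ennreal (2 * r * sublevel_rate d q \<epsilon>) +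
      ennreal ((C / (d * (1 + s)) + C / \<bar>d * (1 + s) * q - 1 - s\<bar>) * sublevel_rate d q \<epsilon>)"
  proof (intro add_mono ennreal_leI mult_left_mono order_refl)
    show "\<epsilon> powr (1 / d) \<le> sublevel_rate d q \<epsilon>"
    proof (cases "q * d > 1")
      case False
      then have "q \<le> 1 / d" using d by (simp add: field_simps)
      then have "\<epsilon> powr (1 / d) \<le> \<epsilon> powr q" using \<epsilon> by (intro powr_mono') auto
      also have "\<dots> \<le> \<epsilon> powr q * (1 - ln \<epsilon>)" using \<epsilon> ln_less_zero[of \<epsilon>] by (simp add: mult_le_cancel_left1)
      finally show ?thesis using False by (simp add: sublevel_rate_def)
    qed (simp add: sublevel_rate_def)
  qed (use r C e in \<open>auto simp: e_def\<close>)
  also have "\<dots> = ennreal ((2 * r + (C / (d * (1 + s)) + C / \<bar>d * (1 + s) * q - 1 - s\<bar>)) * sublevel_rate d q \<epsilon>)"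
    using r C d s sublevel_rate_nonneg[OF \<epsilon>, of d q]
    by (subst ennreal_plus[symmetric]) (auto simp: distrib_right)
  finally show ?thesis .
qed

section \<open>Measure of sublevel sets of double power series\<close>

definition sector :: "(nat \<times> nat \<Rightarrow> real) \<Rightarrow> real \<Rightarrow> real \<Rightarrow> real \<Rightarrow> real \<Rightarrow> (real \<times> real) set" where
  "sector c r s \<delta> \<epsilon> = {(x, y). 0 < x \<and> x \<le> \<delta> \<and> \<bar>y\<bar> \<le> r * x powr s \<and> \<bar>double_sum c x y\<bar> < \<epsilon>}"

definition box_sublevel :: "(nat \<times> nat \<Rightarrow> real) \<Rightarrow> real \<Rightarrow> real \<Rightarrow> (real \<times> real) set" where
  "box_sublevel c \<delta> \<epsilon> = {(x, y). \<bar>x\<bar> \<le> \<delta> \<and> \<bar>y\<bar> \<le> \<delta> \<and> \<bar>double_sum c x y\<bar> < \<epsilon>}"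

context double_power_series
begin

text \<open>\<open>double_sum\<close> is an unordered sum; on the square it equals the iterated
  series of its columns, which is a limit of measurable functions.\<close>

lemma sublevel_measurable:
  assumes A: "A \<in> sets borel" and "A \<subseteq> {-R..R} \<times> {-R..R}"
  shows "{(x, y). (x, y) \<in> A \<and> \<bar>double_sum c x y\<bar> < \<epsilon>} \<in> sets borel"
proof -
  define g where "g p = (\<Sum>b. column_sum c b (fst p) * snd p ^ b)" for p :: "real \<times> real"
  have [measurable]: "column_sum c b \<in> borel_measurable borel" for b
    unfolding column_sum_def by measurable
  have [measurable]: "g \<in> borel_measurable borel"
    unfolding g_def borel_prod[symmetric] by measurable
  have "{(x, y). (x, y) \<in> A \<and> \<bar>double_sum c x y\<bar> < \<epsilon>} = A \<inter> {p \<in> space borel. \<bar>g p\<bar> < \<epsilon>}"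
    using assms(2) columns_sums_double_sum unfolding g_def by (auto simp: sums_iff abs_le_iff)
  also have "\<dots> \<in> sets borel" using A by measurable
  finally show ?thesis .
qed

lemma sector_measurable:
  assumes "\<delta> \<le> R" "r * \<delta> powr s \<le> R" "r \<ge> 0" "s \<ge> 0"
  shows "sector c r s \<delta> \<epsilon> \<in> sets borel"
proof -
  have "{p \<in> space (borel \<Otimes>\<^sub>M borel). 0 < fst p \<and> fst p \<le> \<delta> \<and> \<bar>snd p\<bar> \<le> r * fst p powr s} \<in> sets (borel \<Otimes>\<^sub>M borel)"
    by measurable
  then have "{p :: real \<times> real. 0 < fst p \<and> fst p \<le> \<delta> \<and> \<bar>snd p\<bar> \<le> r * fst p powr s} \<in> sets borel"
    by (simp only: borel_prod space_borel UNIV_I simp_thms)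
  moreover have "r * x powr s \<le> R" if "0 < x" "x \<le> \<delta>" for x
    using that assms mult_left_mono[OF powr_mono2[of s x \<delta>], of r] by auto
  then have "{p :: real \<times> real. 0 < fst p \<and> fst p \<le> \<delta> \<and> \<bar>snd p\<bar> \<le> r * fst p powr s} \<subseteq> {-R..R} \<times> {-R..R}"
    using assms R_pos by (force simp: abs_le_iff)
  ultimately have "{(x, y). (x, y) \<in> {p. 0 < fst p \<and> fst p \<le> \<delta> \<and> \<bar>snd p\<bar> \<le> r * fst p powr s} \<and> \<bar>double_sum c x y\<bar> < \<epsilon>} \<in> sets borel"
    by (rule sublevel_measurable)
  then show ?thesis unfolding sector_def by (simp add: conj_assoc)
qed

lemma box_sublevel_measurable:
  assumes "\<delta> \<le> R"
  shows "box_sublevel c \<delta> \<epsilon> \<in> sets borel"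
proof -
  have "{-\<delta>..\<delta>} \<times> {-\<delta>..\<delta>} \<in> sets (borel :: (real \<times> real) measure)"
    by (intro borel_closed closed_Times closed_atLeastAtMost)
  then have "{(x, y). (x, y) \<in> {-\<delta>..\<delta>} \<times> {-\<delta>..\<delta>} \<and> \<bar>double_sum c x y\<bar> < \<epsilon>} \<in> sets borel"
    by (rule sublevel_measurable) (use assms in auto)
  moreover have "box_sublevel c \<delta> \<epsilon> = {(x, y). (x, y) \<in> {-\<delta>..\<delta>} \<times> {-\<delta>..\<delta>} \<and> \<bar>double_sum c x y\<bar> < \<epsilon>}"
    unfolding box_sublevel_def by (auto simp: abs_le_iff)
  ultimately show ?thesis by simp
qed

lemma sector_estimate:
  assumes d: "d > 0" and s: "s \<ge> 0" and r: "r > 0" and "s = 0 \<Longrightarrow> r < R" and q: "q > 0"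
    and supp: "\<And>a b. c (a, b) \<noteq> 0 \<Longrightarrow> real a + s * real b \<ge> d * (1 + s)"
    and ord: "\<And>u. \<bar>u\<bar> \<le> r \<Longrightarrow> \<exists>k. (k = 0 \<or> q * real k \<le> 1) \<and> powser_deriv (edge_coeff c s (d * (1 + s))) k u \<noteq> 0"
  shows "\<exists>C\<ge>0. \<exists>\<delta>0>0. \<forall>\<delta> \<epsilon>. 0 < \<delta> \<longrightarrow> \<delta> \<le> \<delta>0 \<longrightarrow> 0 < \<epsilon> \<longrightarrow> \<epsilon> < 1 \<longrightarrow>
     sector c r s \<delta> \<epsilon> \<in> sets borel \<and> emeasure lborel (sector c r s \<delta> \<epsilon>) \<le> ennreal (C * sublevel_rate d q \<epsilon>)"
proof -
  define e where "e = d * (1 + s)"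
  have e: "e > 0" unfolding e_def using d s by simp
  have "\<exists>C\<ge>0. \<exists>t1>0. t1 \<le> 1 \<and> t1 \<le> R \<and> r * t1 powr s < R \<and> (\<forall>t \<epsilon>. 0 < t \<longrightarrow> t \<le> t1 \<longrightarrow> \<epsilon> > 0 \<longrightarrow>
     emeasure lborel {y. \<bar>y\<bar> \<le> r * t powr s \<and> \<bar>double_sum c t y\<bar> < \<epsilon>}
       \<le> ennreal (min (2 * r * t powr s) (C * \<epsilon> powr q * t powr (s - e * q))))"
    by (rule slice_sublevel_estimate[OF e s r _ q supp[folded e_def] ord[folded e_def]]) (use assms(4) in auto)
  then obtain C t1 where C: "C \<ge> 0" and t1: "t1 > 0" "t1 \<le> 1" "t1 \<le> R" "r * t1 powr s < R"
    and est: "\<forall>t \<epsilon>. 0 < t \<longrightarrow> t \<le> t1 \<longrightarrow> \<epsilon> > 0 \<longrightarrow>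
     emeasure lborel {y. \<bar>y\<bar> \<le> r * t powr s \<and> \<bar>double_sum c t y\<bar> < \<epsilon>}
       \<le> ennreal (min (2 * r * t powr s) (C * \<epsilon> powr q * t powr (s - e * q)))"
    by (elim exE conjE) (rule that)
  define C' where "C' = 2 * r + (C / (d * (1 + s)) + C / \<bar>d * (1 + s) * q - 1 - s\<bar>)"
  have C': "C' \<ge> 0" unfolding C'_def using C r e e_def by auto
  have "sector c r s \<delta> \<epsilon> \<in> sets borel \<and> emeasure lborel (sector c r s \<delta> \<epsilon>) \<le> ennreal (C' * sublevel_rate d q \<epsilon>)"
    if \<delta>: "0 < \<delta>" "\<delta> \<le> t1" and \<epsilon>: "0 < \<epsilon>" "\<epsilon> < 1" for \<delta> \<epsilon>
  proof
    have "\<delta> powr s \<le> t1 powr s" using \<delta> s by (intro powr_mono2) auto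
    then have "r * \<delta> powr s \<le> r * t1 powr s" using r by simp
    then have "r * \<delta> powr s \<le> R" using t1 by linarith
    then show meas: "sector c r s \<delta> \<epsilon> \<in> sets borel"
      using \<delta> t1 r s by (intro sector_measurable) auto
    have "emeasure lborel (sector c r s \<delta> \<epsilon>) = emeasure (lborel \<Otimes>\<^sub>M lborel) (sector c r s \<delta> \<epsilon>)"
      by (simp add: lborel_prod)
    also have "\<dots> = (\<integral>\<^sup>+x. emeasure lborel (Pair x -` sector c r s \<delta> \<epsilon>) \<partial>lborel)"
      by (rule lborel.emeasure_pair_measure_alt) (use meas in \<open>simp only: lborel_prod sets_lborel\<close>)
    also have "\<dots> \<le> (\<integral>\<^sup>+t. emeasure lborel {y. \<bar>y\<bar> \<le> r * t powr s \<and> \<bar>double_sum c t y\<bar> < \<epsilon>} * indicator {0<..t1} t \<partial>lborel)"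
    proof (intro nn_integral_mono)
      fix x :: real
      show "emeasure lborel (Pair x -` sector c r s \<delta> \<epsilon>) \<le>
          emeasure lborel {y. \<bar>y\<bar> \<le> r * x powr s \<and> \<bar>double_sum c x y\<bar> < \<epsilon>} * indicator {0<..t1} x"
      proof (cases "0 < x \<and> x \<le> \<delta>")
        case True
        then have "Pair x -` sector c r s \<delta> \<epsilon> = {y. \<bar>y\<bar> \<le> r * x powr s \<and> \<bar>double_sum c x y\<bar> < \<epsilon>}"
          unfolding sector_def by auto
        then show ?thesis using True \<delta> by simp
      next
        case False
        then have "Pair x -` sector c r s \<delta> \<epsilon> = {}" unfolding sector_def by auto
        then show ?thesis by simp
      qed
    qed
    also have "\<dots> \<le> ennreal (C' * sublevel_rate d q \<epsilon>)"
      unfolding C'_def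
      by (rule integrate_slice_bound[OF d s r q C t1(1,2) \<epsilon>]) (use est \<epsilon> in \<open>simp add: e_def\<close>)
    finally show "emeasure lborel (sector c r s \<delta> \<epsilon>) \<le> ennreal (C' * sublevel_rate d q \<epsilon>)" .
  qed
  then show ?thesis using C' t1(1) by blast
qed

end

section \<open>Reflection, exchange of variables and the upper bound on a full box\<close>

definition flip_x :: "(nat \<times> nat \<Rightarrow> real) \<Rightarrow> nat \<times> nat \<Rightarrow> real" where
  "flip_x c p = (-1) ^ fst p * c p"

lemma double_sum_flip_x: "double_sum (flip_x c) x y = double_sum c (- x) y"
  unfolding double_sum_def flip_x_def
  by (intro infsum_cong) (simp add: power_minus[of x] mult_ac)

lemma double_sum_swap: "double_sum (c \<circ> prod.swap) x y = double_sum c y x"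
proof -
  have "double_sum c y x = (\<Sum>\<^sub>\<infinity>p\<in>range prod.swap. c p * y ^ fst p * x ^ snd p)"
    unfolding double_sum_def by simp
  also have "\<dots> = (\<Sum>\<^sub>\<infinity>p. c (prod.swap p) * y ^ fst (prod.swap p) * x ^ snd (prod.swap p))"
    by (subst infsum_reindex) (auto simp: o_def)
  finally show ?thesis unfolding double_sum_def by (simp add: mult_ac)
qed

lemma double_power_series_flip_x: "double_power_series c R \<Longrightarrow> double_power_series (flip_x c) R"
  unfolding double_power_series_def flip_x_def by (simp add: abs_mult power_abs)

lemma double_power_series_swap:
  assumes "double_power_series c R"
  shows "double_power_series (c \<circ> prod.swap) R"
proof -
  have "(\<lambda>p. \<bar>c p\<bar> * R ^ (fst p + snd p)) summable_on range prod.swap"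
    using assms unfolding double_power_series_def by simp
  then have "((\<lambda>p. \<bar>c p\<bar> * R ^ (fst p + snd p)) \<circ> prod.swap) summable_on UNIV"
    by (subst (asm) summable_on_reindex) auto
  then show ?thesis using assms unfolding double_power_series_def by (simp add: o_def add.commute)
qed

lemma emeasure_lborel_reflect_x:
  fixes A :: "(real \<times> real) set"
  assumes "A \<in> sets borel"
  shows "{(x, y). (- x, y) \<in> A} \<in> sets borel" "emeasure lborel {(x, y). (- x, y) \<in> A} = emeasure lborel A"
proof -
  have "(\<lambda>p :: real \<times> real. (- fst p, snd p)) -` A \<inter> space borel \<in> sets borel"
    by (rule measurable_sets[OF _ assms]) (auto intro!: borel_measurable_continuous_onI continuous_intros)
  moreover have eq: "(\<lambda>p :: real \<times> real. (- fst p, snd p)) -` A \<inter> space borel = {(x, y). (- x, y) \<in> A}" by auto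
  ultimately show meas: "{(x, y). (- x, y) \<in> A} \<in> sets borel" by simp
  have lp: "pair_sigma_finite (lborel :: real measure) (lborel :: real measure)"
    by (intro pair_sigma_finite.intro lborel.sigma_finite_measure_axioms)
  have "emeasure lborel {(x, y). (- x, y) \<in> A} = emeasure (lborel \<Otimes>\<^sub>M lborel) {(x, y). (- x, y) \<in> A}"
    by (simp add: lborel_prod)
  also have "\<dots> = (\<integral>\<^sup>+y. emeasure lborel ((\<lambda>x. (x, y)) -` {(x, y). (- x, y) \<in> A}) \<partial>lborel)"
    by (rule pair_sigma_finite.emeasure_pair_measure_alt2[OF lp]) (use meas in \<open>simp only: lborel_prod sets_lborel\<close>)
  also have "\<dots> = (\<integral>\<^sup>+y. emeasure lborel ((\<lambda>x. (x, y)) -` A) \<partial>lborel)"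
  proof (intro nn_integral_cong)
    fix y :: real
    have m: "(\<lambda>x. (x, y)) -` A \<in> sets borel"
      using measurable_sets[OF _ assms, of "\<lambda>x. (x, y)" borel]
      by (auto intro!: borel_measurable_continuous_onI continuous_intros)
    have "emeasure lborel ((\<lambda>x. (x, y)) -` A) = emeasure (distr lborel borel uminus) ((\<lambda>x. (x, y)) -` A)"
      by (simp only: lborel_distr_uminus)
    also have "\<dots> = emeasure lborel (uminus -` ((\<lambda>x. (x, y)) -` A) \<inter> space lborel)"
      by (rule emeasure_distr) (use m in auto)
    also have "uminus -` ((\<lambda>x. (x, y)) -` A) \<inter> space lborel = (\<lambda>x. (x, y)) -` {(x, y). (- x, y) \<in> A}" by auto
    finally show "emeasure lborel ((\<lambda>x. (x, y)) -` {(x, y). (- x, y) \<in> A}) = emeasure lborel ((\<lambda>x. (x, y)) -` A)" ..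
  qed
  also have "\<dots> = emeasure (lborel \<Otimes>\<^sub>M lborel) A"
    by (rule pair_sigma_finite.emeasure_pair_measure_alt2[OF lp, symmetric]) (use assms in \<open>simp only: lborel_prod sets_lborel\<close>)
  finally show "emeasure lborel {(x, y). (- x, y) \<in> A} = emeasure lborel A" by (simp add: lborel_prod)
qed

lemma emeasure_lborel_swap:
  fixes A :: "(real \<times> real) set"
  assumes "A \<in> sets borel"
  shows "{(x, y). (y, x) \<in> A} \<in> sets borel" "emeasure lborel {(x, y). (y, x) \<in> A} = emeasure lborel A"
proof -
  have "(\<lambda>p :: real \<times> real. (snd p, fst p)) -` A \<inter> space borel \<in> sets borel"
    by (rule measurable_sets[OF _ assms]) (auto intro!: borel_measurable_continuous_onI continuous_intros)
  moreover have "(\<lambda>p :: real \<times> real. (snd p, fst p)) -` A \<inter> space borel = {(x, y). (y, x) \<in> A}" by auto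
  ultimately show meas: "{(x, y). (y, x) \<in> A} \<in> sets borel" by simp
  have lp: "pair_sigma_finite (lborel :: real measure) (lborel :: real measure)"
    by (intro pair_sigma_finite.intro lborel.sigma_finite_measure_axioms)
  have "emeasure lborel {(x, y). (y, x) \<in> A} = emeasure (lborel \<Otimes>\<^sub>M lborel) {(x, y). (y, x) \<in> A}"
    by (simp add: lborel_prod)
  also have "\<dots> = (\<integral>\<^sup>+y. emeasure lborel ((\<lambda>x. (x, y)) -` {(x, y). (y, x) \<in> A}) \<partial>lborel)"
    by (rule pair_sigma_finite.emeasure_pair_measure_alt2[OF lp]) (use meas in \<open>simp only: lborel_prod sets_lborel\<close>)
  also have "\<dots> = (\<integral>\<^sup>+y. emeasure lborel (Pair y -` A) \<partial>lborel)"
    by (intro nn_integral_cong arg_cong[of _ _ "emeasure lborel"]) auto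
  also have "\<dots> = emeasure (lborel \<Otimes>\<^sub>M lborel) A"
    by (rule lborel.emeasure_pair_measure_alt[symmetric]) (use assms in \<open>simp only: lborel_prod sets_lborel\<close>)
  finally show "emeasure lborel {(x, y). (y, x) \<in> A} = emeasure lborel A" by (simp add: lborel_prod)
qed

definition edge_order_ok :: "(nat \<times> nat \<Rightarrow> real) \<Rightarrow> real \<Rightarrow> real \<Rightarrow> real \<Rightarrow> real \<Rightarrow> bool" where
  "edge_order_ok c s e r q \<longleftrightarrow>
     (\<forall>u. \<bar>u\<bar> \<le> r \<longrightarrow> (\<exists>k. (k = 0 \<or> q * real k \<le> 1) \<and> powser_deriv (edge_coeff c s e) k u \<noteq> 0))"

text \<open>\<open>C\<close> is fixed before \<open>\<delta>\<close>, because the size of the box is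
  dictated only later, by the neighbourhood and the bump function of the growth integrals.\<close>

definition has_sublevel_bound :: "(nat \<times> nat \<Rightarrow> real) \<Rightarrow> real \<Rightarrow> real \<Rightarrow> bool" where
  "has_sublevel_bound c d q \<longleftrightarrow> (\<exists>C\<ge>0. \<exists>\<delta>0>0. \<forall>\<delta> \<epsilon>. 0 < \<delta> \<longrightarrow> \<delta> \<le> \<delta>0 \<longrightarrow> 0 < \<epsilon> \<longrightarrow> \<epsilon> < 1 \<longrightarrow>
     emeasure lborel (box_sublevel c \<delta> \<epsilon>) \<le> ennreal (C * sublevel_rate d q \<epsilon>))"

lemma emeasure_vertical_axis: "emeasure lborel ({0} \<times> UNIV :: (real \<times> real) set) = 0"
proof -
  have "emeasure (lborel \<Otimes>\<^sub>M lborel) ({0} \<times> UNIV :: (real \<times> real) set) = emeasure lborel {0::real} * emeasure lborel (UNIV :: real set)"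
    by (rule lborel.emeasure_pair_measure_Times) auto
  then show ?thesis by (simp add: lborel_prod)
qed

context double_power_series
begin

text \<open>The part with \<open>x < 0\<close> is the reflection of a sector of
  \<open>flip_x c\<close>. A measurable cover \<open>B\<close> is returned, which spares a
  measurability proof for the region itself.\<close>

lemma half_box_estimate:
  assumes d: "d > 0" and s: "s \<ge> 0" and r: "r > 0" and rR: "s = 0 \<Longrightarrow> r < R" and q: "q > 0"
    and supp: "\<And>a b. c (a, b) \<noteq> 0 \<Longrightarrow> real a + s * real b \<ge> d * (1 + s)"
    and ord: "edge_order_ok c s (d * (1 + s)) r q" "edge_order_ok (flip_x c) s (d * (1 + s)) r q"
  shows "\<exists>C\<ge>0. \<exists>\<delta>0>0. \<forall>\<delta> \<epsilon>. 0 < \<delta> \<longrightarrow> \<delta> \<le> \<delta>0 \<longrightarrow> 0 < \<epsilon> \<longrightarrow> \<epsilon> < 1 \<longrightarrow>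
     (\<exists>B\<in>sets borel. {(x, y). (x, y) \<in> box_sublevel c \<delta> \<epsilon> \<and> x \<noteq> 0 \<and> \<bar>y\<bar> \<le> r * \<bar>x\<bar> powr s} \<subseteq> B \<and>
       emeasure lborel B \<le> ennreal (C * sublevel_rate d q \<epsilon>))"
proof -
  interpret F: double_power_series "flip_x c" R
    by (rule double_power_series_flip_x) (rule double_power_series_axioms)
  obtain C1 \<delta>1 where 1: "C1 \<ge> 0" "\<delta>1 > 0" "\<forall>\<delta> \<epsilon>. 0 < \<delta> \<longrightarrow> \<delta> \<le> \<delta>1 \<longrightarrow> 0 < \<epsilon> \<longrightarrow> \<epsilon> < 1 \<longrightarrow>
     sector c r s \<delta> \<epsilon> \<in> sets borel \<and> emeasure lborel (sector c r s \<delta> \<epsilon>) \<le> ennreal (C1 * sublevel_rate d q \<epsilon>)"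
    using sector_estimate[OF d s r rR q supp] ord(1) unfolding edge_order_ok_def by blast
  have supp': "flip_x c (a, b) \<noteq> 0 \<Longrightarrow> real a + s * real b \<ge> d * (1 + s)" for a b
    using supp[of a b] unfolding flip_x_def by auto
  obtain C2 \<delta>2 where 2: "C2 \<ge> 0" "\<delta>2 > 0" "\<forall>\<delta> \<epsilon>. 0 < \<delta> \<longrightarrow> \<delta> \<le> \<delta>2 \<longrightarrow> 0 < \<epsilon> \<longrightarrow> \<epsilon> < 1 \<longrightarrow>
     sector (flip_x c) r s \<delta> \<epsilon> \<in> sets borel \<and> emeasure lborel (sector (flip_x c) r s \<delta> \<epsilon>) \<le> ennreal (C2 * sublevel_rate d q \<epsilon>)"
    using F.sector_estimate[OF d s r rR q supp'] ord(2) unfolding edge_order_ok_def by blast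
  have "\<exists>B\<in>sets borel. {(x, y). (x, y) \<in> box_sublevel c \<delta> \<epsilon> \<and> x \<noteq> 0 \<and> \<bar>y\<bar> \<le> r * \<bar>x\<bar> powr s} \<subseteq> B \<and>
       emeasure lborel B \<le> ennreal ((C1 + C2) * sublevel_rate d q \<epsilon>)"
    if a: "0 < \<delta>" "\<delta> \<le> min \<delta>1 \<delta>2" "0 < \<epsilon>" "\<epsilon> < 1" for \<delta> \<epsilon>
  proof -
    define B1 where "B1 = sector c r s \<delta> \<epsilon>"
    define B2 where "B2 = {(x, y). (- x, y) \<in> sector (flip_x c) r s \<delta> \<epsilon>}"
    have m1: "B1 \<in> sets borel" "emeasure lborel B1 \<le> ennreal (C1 * sublevel_rate d q \<epsilon>)"
      using 1(3) a unfolding B1_def by auto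
    have "sector (flip_x c) r s \<delta> \<epsilon> \<in> sets borel" using 2(3) a by auto
    note R = emeasure_lborel_reflect_x[OF this]
    have m2: "B2 \<in> sets borel" "emeasure lborel B2 \<le> ennreal (C2 * sublevel_rate d q \<epsilon>)"
      using 2(3) a R unfolding B2_def by auto
    have "emeasure lborel (B1 \<union> B2) \<le> emeasure lborel B1 + emeasure lborel B2"
      using m1 m2 by (intro emeasure_subadditive) auto
    also have "\<dots> \<le> ennreal (C1 * sublevel_rate d q \<epsilon>) + ennreal (C2 * sublevel_rate d q \<epsilon>)"
      using m1 m2 by (intro add_mono)
    also have "\<dots> = ennreal ((C1 + C2) * sublevel_rate d q \<epsilon>)"
      using 1 2 sublevel_rate_nonneg[OF a(3,4)] by (subst ennreal_plus[symmetric]) (auto simp: distrib_right)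
    finally have "emeasure lborel (B1 \<union> B2) \<le> ennreal ((C1 + C2) * sublevel_rate d q \<epsilon>)" .
    moreover have "{(x, y). (x, y) \<in> box_sublevel c \<delta> \<epsilon> \<and> x \<noteq> 0 \<and> \<bar>y\<bar> \<le> r * \<bar>x\<bar> powr s} \<subseteq> B1 \<union> B2"
    proof safe
      fix x y :: real
      assume *: "(x, y) \<in> box_sublevel c \<delta> \<epsilon>" "x \<noteq> 0" "\<bar>y\<bar> \<le> r * \<bar>x\<bar> powr s" "(x, y) \<notin> B2"
      show "(x, y) \<in> B1"
      proof (cases "x > 0")
        case True
        with * show ?thesis unfolding B1_def sector_def box_sublevel_def by simp
      next
        case False
        with * have "(x, y) \<in> B2" unfolding B2_def sector_def box_sublevel_def
          by (simp add: double_sum_flip_x)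
        with * show ?thesis by simp
      qed
    qed
    ultimately show ?thesis using m1 m2 by blast
  qed
  then show ?thesis using 1(1,2) 2(1,2)
    by (intro exI[of _ "C1 + C2"] conjI exI[of _ "min \<delta>1 \<delta>2"]) auto
qed

text \<open>For \<open>s = 0\<close> the sectors fill the strip \<open>\<bar>y\<bar> \<le> r\<close>
  near the axis \<open>x = 0\<close>, so they cover every small box up to that null axis, and no
  exchange of variables is necessary.\<close>

lemma box_estimate_vertical:
  assumes d: "d > 0" and r: "0 < r" "r < R" and q: "q > 0"
    and supp: "\<And>a b. c (a, b) \<noteq> 0 \<Longrightarrow> real a \<ge> d"
    and ord: "edge_order_ok c 0 d r q" "edge_order_ok (flip_x c) 0 d r q"
  shows "has_sublevel_bound c d q"
proof -
  obtain C \<delta>1 where 1: "C \<ge> 0" "\<delta>1 > 0" "\<forall>\<delta> \<epsilon>. 0 < \<delta> \<longrightarrow> \<delta> \<le> \<delta>1 \<longrightarrow> 0 < \<epsilon> \<longrightarrow> \<epsilon> < 1 \<longrightarrow>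
     (\<exists>B\<in>sets borel. {(x, y). (x, y) \<in> box_sublevel c \<delta> \<epsilon> \<and> x \<noteq> 0 \<and> \<bar>y\<bar> \<le> r * \<bar>x\<bar> powr 0} \<subseteq> B \<and>
       emeasure lborel B \<le> ennreal (C * sublevel_rate d q \<epsilon>))"
    using half_box_estimate[of d 0 r q] assms by auto
  have "emeasure lborel (box_sublevel c \<delta> \<epsilon>) \<le> ennreal (C * sublevel_rate d q \<epsilon>)"
    if a: "0 < \<delta>" "\<delta> \<le> min \<delta>1 r" "0 < \<epsilon>" "\<epsilon> < 1" for \<delta> \<epsilon>
  proof -
    obtain B where B: "B \<in> sets borel" "emeasure lborel B \<le> ennreal (C * sublevel_rate d q \<epsilon>)"
      "{(x, y). (x, y) \<in> box_sublevel c \<delta> \<epsilon> \<and> x \<noteq> 0 \<and> \<bar>y\<bar> \<le> r * \<bar>x\<bar> powr 0} \<subseteq> B"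
      using 1(3)[rule_format, of \<delta> \<epsilon>] a by (auto simp del: powr_zero_eq_one)
    have ax: "({0} \<times> UNIV :: (real \<times> real) set) \<in> sets borel"
      by (intro borel_closed closed_Times) auto
    have "box_sublevel c \<delta> \<epsilon> \<subseteq> B \<union> ({0} \<times> UNIV)"
    proof safe
      fix x y :: real assume *: "(x, y) \<in> box_sublevel c \<delta> \<epsilon>" "(x, y) \<notin> B"
      have "\<bar>y\<bar> \<le> r" using *(1) a unfolding box_sublevel_def by auto
      show "x = 0"
      proof (rule ccontr)
        assume "x \<noteq> 0"
        then have "\<bar>y\<bar> \<le> r * \<bar>x\<bar> powr 0" using \<open>\<bar>y\<bar> \<le> r\<close> by simp
        then have "(x, y) \<in> B" using *(1) \<open>x \<noteq> 0\<close> B(3) by blast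
        then show False using * by simp
      qed
    qed simp
    then have "emeasure lborel (box_sublevel c \<delta> \<epsilon>) \<le> emeasure lborel (B \<union> ({0} \<times> UNIV))"
      using B ax by (intro emeasure_mono) auto
    also have "\<dots> \<le> emeasure lborel B + emeasure lborel ({0} \<times> UNIV :: (real \<times> real) set)"
      using B ax by (intro emeasure_subadditive) auto
    finally show ?thesis using B(2) emeasure_vertical_axis by (auto intro: order_trans)
  qed
  then show ?thesis unfolding has_sublevel_bound_def using 1(1,2) r(1)
    by (intro exI[of _ C] conjI exI[of _ "min \<delta>1 r"]) auto
qed

text \<open>The curve \<open>\<bar>y\<bar> = \<bar>x\<bar> powr s\<close> divides the box. On one
  side the slices are indexed by \<open>x\<close>; on the other
  \<open>\<bar>x\<bar> \<le> \<bar>y\<bar> powr (1 / s)\<close>, the same situation with exchanged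
  variables and slope \<open>1 / s\<close>. Hence four order conditions: two signs for each of the
  two variables.\<close>

lemma box_estimate_slanted:
  assumes d: "d > 0" and s: "s > 0" and q: "q > 0"
    and supp: "\<And>a b. c (a, b) \<noteq> 0 \<Longrightarrow> real a + s * real b \<ge> d * (1 + s)"
    and ord: "edge_order_ok c s (d * (1 + s)) 1 q" "edge_order_ok (flip_x c) s (d * (1 + s)) 1 q"
      "edge_order_ok (c \<circ> prod.swap) (1 / s) (d * (1 + 1 / s)) 1 q"
      "edge_order_ok (flip_x (c \<circ> prod.swap)) (1 / s) (d * (1 + 1 / s)) 1 q"
  shows "has_sublevel_bound c d q"
proof -
  interpret W: double_power_series "c \<circ> prod.swap" R
    by (rule double_power_series_swap) (rule double_power_series_axioms)
  have supp': "real a + 1 / s * real b \<ge> d * (1 + 1 / s)" if "(c \<circ> prod.swap) (a, b) \<noteq> 0" for a b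
  proof -
    have "real b + s * real a \<ge> d * (1 + s)" using that supp[of b a] by simp
    then have "(real b + s * real a) / s \<ge> d * (1 + s) / s" using s by (intro divide_right_mono) auto
    then show ?thesis using s by (simp add: field_simps)
  qed
  obtain C1 \<delta>1 where 1: "C1 \<ge> 0" "\<delta>1 > 0" "\<forall>\<delta> \<epsilon>. 0 < \<delta> \<longrightarrow> \<delta> \<le> \<delta>1 \<longrightarrow> 0 < \<epsilon> \<longrightarrow> \<epsilon> < 1 \<longrightarrow>
     (\<exists>B\<in>sets borel. {(x, y). (x, y) \<in> box_sublevel c \<delta> \<epsilon> \<and> x \<noteq> 0 \<and> \<bar>y\<bar> \<le> 1 * \<bar>x\<bar> powr s} \<subseteq> B \<and>
       emeasure lborel B \<le> ennreal (C1 * sublevel_rate d q \<epsilon>))"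
    using half_box_estimate[OF d _ _ _ q supp ord(1,2)] s by auto
  obtain C2 \<delta>2 where 2: "C2 \<ge> 0" "\<delta>2 > 0" "\<forall>\<delta> \<epsilon>. 0 < \<delta> \<longrightarrow> \<delta> \<le> \<delta>2 \<longrightarrow> 0 < \<epsilon> \<longrightarrow> \<epsilon> < 1 \<longrightarrow>
     (\<exists>B\<in>sets borel. {(x, y). (x, y) \<in> box_sublevel (c \<circ> prod.swap) \<delta> \<epsilon> \<and> x \<noteq> 0 \<and> \<bar>y\<bar> \<le> 1 * \<bar>x\<bar> powr (1 / s)} \<subseteq> B \<and>
       emeasure lborel B \<le> ennreal (C2 * sublevel_rate d q \<epsilon>))"
    using W.half_box_estimate[OF d _ _ _ q supp' ord(3,4)] s by auto
  have "emeasure lborel (box_sublevel c \<delta> \<epsilon>) \<le> ennreal ((C1 + C2) * sublevel_rate d q \<epsilon>)"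
    if a: "0 < \<delta>" "\<delta> \<le> min \<delta>1 \<delta>2" "0 < \<epsilon>" "\<epsilon> < 1" for \<delta> \<epsilon>
  proof -
    obtain B1 where B1: "B1 \<in> sets borel" "emeasure lborel B1 \<le> ennreal (C1 * sublevel_rate d q \<epsilon>)"
      "{(x, y). (x, y) \<in> box_sublevel c \<delta> \<epsilon> \<and> x \<noteq> 0 \<and> \<bar>y\<bar> \<le> 1 * \<bar>x\<bar> powr s} \<subseteq> B1"
      using 1(3)[rule_format, of \<delta> \<epsilon>] a by auto
    obtain B2 where B2: "B2 \<in> sets borel" "emeasure lborel B2 \<le> ennreal (C2 * sublevel_rate d q \<epsilon>)"
      "{(x, y). (x, y) \<in> box_sublevel (c \<circ> prod.swap) \<delta> \<epsilon> \<and> x \<noteq> 0 \<and> \<bar>y\<bar> \<le> 1 * \<bar>x\<bar> powr (1 / s)} \<subseteq> B2"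
      using 2(3)[rule_format, of \<delta> \<epsilon>] a by auto
    define B2' where "B2' = {(x, y). (y, x) \<in> B2}"
    have B2': "B2' \<in> sets borel" "emeasure lborel B2' \<le> ennreal (C2 * sublevel_rate d q \<epsilon>)"
      using emeasure_lborel_swap[OF B2(1)] B2(2) unfolding B2'_def by auto
    have ax: "({0} \<times> UNIV :: (real \<times> real) set) \<in> sets borel"
      by (intro borel_closed closed_Times) auto
    have "box_sublevel c \<delta> \<epsilon> \<subseteq> (B1 \<union> B2') \<union> ({0} \<times> UNIV)"
    proof
      fix p assume p: "p \<in> box_sublevel c \<delta> \<epsilon>"
      obtain x y where xy: "p = (x, y)" by (cases p)
      show "p \<in> (B1 \<union> B2') \<union> ({0} \<times> UNIV)"
      proof (cases "x = 0")
        case False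
        show ?thesis
        proof (cases "\<bar>y\<bar> \<le> \<bar>x\<bar> powr s")
          case True
          then show ?thesis using B1(3) p xy False by auto
        next
          case False
          then have "\<bar>x\<bar> powr s \<le> \<bar>y\<bar>" by simp
          then have "(\<bar>x\<bar> powr s) powr (1 / s) \<le> \<bar>y\<bar> powr (1 / s)" using s by (intro powr_mono2) auto
          then have "\<bar>x\<bar> \<le> \<bar>y\<bar> powr (1 / s)" using s by (simp add: powr_powr)
          moreover have "y \<noteq> 0" using False \<open>x \<noteq> 0\<close> by auto
          moreover have "(y, x) \<in> box_sublevel (c \<circ> prod.swap) \<delta> \<epsilon>"
            using p unfolding xy box_sublevel_def double_sum_swap by auto
          ultimately have "(y, x) \<in> B2" using B2(3) by auto
          then show ?thesis unfolding xy B2'_def by auto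
        qed
      qed (simp add: xy)
    qed
    then have "emeasure lborel (box_sublevel c \<delta> \<epsilon>) \<le> emeasure lborel ((B1 \<union> B2') \<union> ({0} \<times> UNIV))"
      using B1 B2' ax by (intro emeasure_mono) auto
    also have "\<dots> \<le> emeasure lborel (B1 \<union> B2') + emeasure lborel ({0} \<times> UNIV :: (real \<times> real) set)"
      using B1 B2' ax by (intro emeasure_subadditive) auto
    also have "\<dots> = emeasure lborel (B1 \<union> B2')" using emeasure_vertical_axis by simp
    also have "\<dots> \<le> emeasure lborel B1 + emeasure lborel B2'"
      using B1 B2' by (intro emeasure_subadditive) auto
    also have "\<dots> \<le> ennreal (C1 * sublevel_rate d q \<epsilon>) + ennreal (C2 * sublevel_rate d q \<epsilon>)"
      using B1 B2' by (intro add_mono)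
    also have "\<dots> = ennreal ((C1 + C2) * sublevel_rate d q \<epsilon>)"
      using 1 2 sublevel_rate_nonneg[OF a(3,4)] by (subst ennreal_plus[symmetric]) (auto simp: distrib_right)
    finally show ?thesis .
  qed
  then show ?thesis unfolding has_sublevel_bound_def using 1(1,2) 2(1,2)
    by (intro exI[of _ "C1 + C2"] conjI exI[of _ "min \<delta>1 \<delta>2"]) auto
qed

section \<open>Lower bounds from boxes and from neighbourhoods of curves\<close>

lemma monomial_box_bound:
  assumes "0 < \<delta>" "\<delta> \<le> R" "0 < \<eta>" "\<eta> \<le> 1" "\<bar>x\<bar> \<le> \<delta> * \<eta> powr \<alpha>" "\<bar>y\<bar> \<le> \<delta> * \<eta> powr \<beta>"
    and "\<alpha> * real a + \<beta> * real b \<ge> 1"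
  shows "\<bar>x\<bar> ^ a * \<bar>y\<bar> ^ b \<le> \<eta> * R ^ (a + b)"
proof -
  have "\<bar>x\<bar> ^ a * \<bar>y\<bar> ^ b \<le> (\<delta> * \<eta> powr \<alpha>) ^ a * (\<delta> * \<eta> powr \<beta>) ^ b"
    using assms by (intro mult_mono power_mono) auto
  also have "\<dots> = \<delta> ^ (a + b) * (\<eta> powr \<alpha>) ^ a * (\<eta> powr \<beta>) ^ b"
    by (simp add: power_mult_distrib power_add mult_ac)
  also have "\<dots> = \<delta> ^ (a + b) * \<eta> powr (\<alpha> * real a + \<beta> * real b)"
    using assms by (simp add: powr_add powr_powr[symmetric] powr_realpow)
  also have "\<dots> \<le> R ^ (a + b) * \<eta> powr 1"
    using assms by (intro mult_mono power_mono powr_mono') auto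
  finally show ?thesis using assms by (simp add: mult.commute)
qed

lemma box_lower_bound:
  assumes w: "w1 \<ge> 0" "w2 \<ge> 0" "w1 + w2 = 1 / d"
    and supp: "\<And>a b. c (a, b) \<noteq> 0 \<Longrightarrow> w1 * real a + w2 * real b \<ge> 1"
    and \<delta>: "0 < \<delta>" "\<delta> \<le> R"
  shows "\<exists>C>0. \<forall>\<epsilon>. 0 < \<epsilon> \<longrightarrow> \<epsilon> < 1 \<longrightarrow> ennreal (C * \<epsilon> powr (1 / d)) \<le> emeasure lborel (box_sublevel c \<delta> \<epsilon>)"
proof -
  \<comment> \<open>\<open>T\<close> exceeds \<open>total\<close>, so
    \<open>\<eta> * total < \<epsilon>\<close> for \<open>\<eta> = \<epsilon> / T\<close>, with the
    strict inequality that the sublevel set demands.\<close>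
  define T where "T = total + 1"
  have T: "T \<ge> 1" unfolding T_def using total_nonneg by simp
  have "ennreal ((4 * \<delta>\<^sup>2 * (1 / T) powr (1 / d)) * \<epsilon> powr (1 / d)) \<le> emeasure lborel (box_sublevel c \<delta> \<epsilon>)"
    if \<epsilon>: "0 < \<epsilon>" "\<epsilon> < 1" for \<epsilon>
  proof -
    define \<eta> where "\<eta> = \<epsilon> / T"
    have \<eta>: "0 < \<eta>" "\<eta> \<le> 1" unfolding \<eta>_def using \<epsilon> T by (auto simp: field_simps)
    define X Y where "X = \<delta> * \<eta> powr w1" and "Y = \<delta> * \<eta> powr w2"
    have X: "0 < X" "X \<le> \<delta>" unfolding X_def using \<delta> \<eta> w powr_le1[of w1 \<eta>] by (auto simp: mult_le_cancel_left1)
    have Y: "0 < Y" "Y \<le> \<delta>" unfolding Y_def using \<delta> \<eta> w powr_le1[of w2 \<eta>] by (auto simp: mult_le_cancel_left1)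
    have "{-X..X} \<times> {-Y..Y} \<subseteq> box_sublevel c \<delta> \<epsilon>"
    proof safe
      fix x y assume xy: "x \<in> {-X..X}" "y \<in> {-Y..Y}"
      have "\<bar>double_sum c x y\<bar> \<le> \<eta> * total"
      proof (rule abs_double_sum_le_of_terms)
        fix a b assume "c (a, b) \<noteq> 0"
        from supp[OF this] show "\<bar>x\<bar> ^ a * \<bar>y\<bar> ^ b \<le> \<eta> * R ^ (a + b)"
          using monomial_box_bound[OF \<delta> \<eta>, of x w1 y w2 a b] xy unfolding X_def Y_def by (auto simp: abs_le_iff)
      qed (use xy X Y \<delta> \<eta> in auto)
      also have "\<dots> < \<epsilon>"
        unfolding \<eta>_def T_def using \<epsilon> total_nonneg by (simp add: field_simps)
      finally show "(x, y) \<in> box_sublevel c \<delta> \<epsilon>" using xy X Y unfolding box_sublevel_def by auto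
    qed
    then have "emeasure lborel ({-X..X} \<times> {-Y..Y}) \<le> emeasure lborel (box_sublevel c \<delta> \<epsilon>)"
      using box_sublevel_measurable[OF \<delta>(2)] by (intro emeasure_mono) auto
    moreover have "emeasure lborel ({-X..X} \<times> {-Y..Y}) = ennreal ((4 * \<delta>\<^sup>2 * (1 / T) powr (1 / d)) * \<epsilon> powr (1 / d))"
    proof -
      have "emeasure (lborel \<Otimes>\<^sub>M lborel) ({-X..X} \<times> {-Y..Y}) = emeasure lborel {-X..X} * emeasure lborel {-Y..Y}"
        by (rule lborel.emeasure_pair_measure_Times) auto
      also have "\<dots> = ennreal (2 * X * (2 * Y))" using X Y by (simp add: ennreal_mult''[symmetric])
      also have "2 * X * (2 * Y) = 4 * \<delta>\<^sup>2 * \<eta> powr (1 / d)"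
        unfolding X_def Y_def w(3)[symmetric] using \<eta> by (simp add: powr_add power2_eq_square)
      also have "\<eta> powr (1 / d) = (1 / T) powr (1 / d) * \<epsilon> powr (1 / d)"
        unfolding \<eta>_def using \<epsilon> T by (simp add: powr_mult[symmetric])
      finally show ?thesis by (simp add: lborel_prod mult_ac)
    qed
    ultimately show ?thesis by simp
  qed
  moreover have "4 * \<delta>\<^sup>2 * (1 / T) powr (1 / d) > 0" using \<delta> T by simp
  ultimately show ?thesis by blast
qed

lemma emeasure_ge_of_slices:
  fixes A :: "(real \<times> real) set"
  assumes A: "A \<in> sets borel" and "\<And>x. x \<in> {a..b} \<Longrightarrow> g x \<le> emeasure lborel (Pair x -` A)"
  shows "(\<integral>\<^sup>+x. g x * indicator {a..b} x \<partial>lborel) \<le> emeasure lborel A"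
proof -
  have "(\<integral>\<^sup>+x. g x * indicator {a..b} x \<partial>lborel) \<le> (\<integral>\<^sup>+x. emeasure lborel (Pair x -` A) \<partial>lborel)"
    using assms(2) by (intro nn_integral_mono) (auto simp: indicator_def)
  also have "\<dots> = emeasure (lborel \<Otimes>\<^sub>M lborel) A"
    by (rule lborel.emeasure_pair_measure_alt[symmetric]) (use A in \<open>simp only: lborel_prod sets_lborel\<close>)
  finally show ?thesis by (simp add: lborel_prod)
qed

lemma slice_measurable:
  fixes A :: "(real \<times> real) set"
  assumes "A \<in> sets borel"
  shows "Pair x -` A \<in> sets lborel"
  using measurable_sets[OF _ assms, of "Pair x" borel]
  by (auto intro!: borel_measurable_continuous_onI continuous_intros)

text \<open>For \<open>\<alpha>\<close> between \<open>v\<close> and \<open>v'\<close> the box with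
  sides \<open>\<delta> * \<eta> powr \<alpha>\<close> and
  \<open>\<delta> * \<eta> powr (1 / d - \<alpha>)\<close> lies in the sublevel set. All these
  corners lie on the hyperbola \<open>x * y = M\<close>, so the union has at least the area
  \<open>M\<close> times the integral of \<open>1 / x\<close> between two different powers of
  \<open>\<eta>\<close>.\<close>

lemma box_lower_bound_log:
  assumes v: "0 \<le> v" "v < v'" "v' \<le> 1 / d" and d: "d > 0"
    and supp: "\<And>a b. c (a, b) \<noteq> 0 \<Longrightarrow> v * real a + (1 / d - v) * real b \<ge> 1"
      "\<And>a b. c (a, b) \<noteq> 0 \<Longrightarrow> v' * real a + (1 / d - v') * real b \<ge> 1"
    and \<delta>: "0 < \<delta>" "\<delta> \<le> R"
  shows "\<exists>C>0. \<forall>\<epsilon>. 0 < \<epsilon> \<longrightarrow> \<epsilon> < 1 \<longrightarrow>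
     ennreal (C * (\<epsilon> powr (1 / d) * (- ln \<epsilon>))) \<le> emeasure lborel (box_sublevel c \<delta> \<epsilon>)"
proof -
  define T where "T = total + 1"
  have T: "T \<ge> 1" unfolding T_def using total_nonneg by simp
  have "ennreal ((\<delta>\<^sup>2 * (1 / T) powr (1 / d) * (v' - v)) * (\<epsilon> powr (1 / d) * (- ln \<epsilon>))) \<le> emeasure lborel (box_sublevel c \<delta> \<epsilon>)"
    if \<epsilon>: "0 < \<epsilon>" "\<epsilon> < 1" for \<epsilon>
  proof -
    define \<eta> where "\<eta> = \<epsilon> / T"
    have \<eta>: "0 < \<eta>" "\<eta> < 1" unfolding \<eta>_def using \<epsilon> T by (auto simp: field_simps)
    then have ln\<eta>: "ln \<eta> < 0" by (rule ln_less_zero)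
    define X0 X1 where "X0 = \<delta> * \<eta> powr v'" and "X1 = \<delta> * \<eta> powr v"
    have X0: "X0 > 0" unfolding X0_def using \<delta> \<eta> by simp
    have "X0 \<le> X1" unfolding X0_def X1_def using \<delta> \<eta> v by (intro mult_left_mono powr_mono') auto
    define M where "M = \<delta>\<^sup>2 * \<eta> powr (1 / d)"
    have M: "M > 0" unfolding M_def using \<delta> \<eta> by simp
    have slice: "ennreal (M * (1 / x)) \<le> emeasure lborel (Pair x -` box_sublevel c \<delta> \<epsilon>)"
      if x: "x \<in> {X0..X1}" for x
    proof -
      have x0: "x > 0" using x X0 by auto
      \<comment> \<open>The exponent of the box whose horizontal side is the given
        \<open>x\<close>.\<close>
      define \<alpha> where "\<alpha> = ln (x / \<delta>) / ln \<eta>"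
      have x\<alpha>: "x = \<delta> * \<eta> powr \<alpha>" unfolding \<alpha>_def powr_def using ln\<eta> x0 \<delta> \<eta> by simp
      have \<alpha>: "v \<le> \<alpha>" "\<alpha> \<le> v'"
      proof -
        have "\<eta> powr v' \<le> \<eta> powr \<alpha>" "\<eta> powr \<alpha> \<le> \<eta> powr v"
          using x \<delta> unfolding X0_def X1_def x\<alpha> by auto
        then show "v \<le> \<alpha>" "\<alpha> \<le> v'" using \<eta> powr_less_mono'[of \<eta>] by (force simp: not_le[symmetric])+
      qed
      have Mx: "M * (1 / x) = \<delta> * \<eta> powr (1 / d - \<alpha>)"
        unfolding M_def x\<alpha> using \<delta> \<eta> by (simp add: powr_diff power2_eq_square)
      have xd: "x \<le> \<delta>" unfolding x\<alpha> using \<delta> \<eta> \<alpha> v powr_le1[of \<alpha> \<eta>] by (auto simp: mult_le_cancel_left1)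
      have yd: "M * (1 / x) \<le> \<delta>" unfolding Mx using \<delta> \<eta> \<alpha> v powr_le1[of "1 / d - \<alpha>" \<eta>]
        by (auto simp: mult_le_cancel_left1)
      have "{0..M * (1 / x)} \<subseteq> Pair x -` box_sublevel c \<delta> \<epsilon>"
      proof
        fix y assume y: "y \<in> {0..M * (1 / x)}"
        have "\<bar>double_sum c x y\<bar> \<le> \<eta> * total"
        proof (rule abs_double_sum_le_of_terms)
          fix a b assume ab: "c (a, b) \<noteq> 0"
          have "\<alpha> * real a + (1 / d - \<alpha>) * real b \<ge> 1"
          proof -
            \<comment> \<open>\<open>\<alpha>\<close> is a convex combination of \<open>v\<close>
              and \<open>v'\<close>, so its inequality is the same combination of the two supporting
              inequalities.\<close>
            define t where "t = (\<alpha> - v) / (v' - v)"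
            have "t * (v' - v) = \<alpha> - v" unfolding t_def using v by simp
            then have t3: "\<alpha> = (1 - t) * v + t * v'" by (simp add: algebra_simps)
            have t: "0 \<le> t" "t \<le> 1" using \<alpha> v unfolding t_def by auto
            have mix: "(1 - t) * (v * A + (D - v) * B) + t * (v' * A + (D - v') * B) = \<alpha> * A + (D - \<alpha>) * B" for A B D
              unfolding t3 by (simp add: algebra_simps)
            have "1 = (1 - t) * 1 + t * 1" by simp
            also have "\<dots> \<le> (1 - t) * (v * real a + (1 / d - v) * real b) + t * (v' * real a + (1 / d - v') * real b)"
              using t supp[OF ab] by (intro add_mono mult_left_mono) auto
            also have "\<dots> = \<alpha> * real a + (1 / d - \<alpha>) * real b" by (rule mix)
            finally show ?thesis .
          qed
          then show "\<bar>x\<bar> ^ a * \<bar>y\<bar> ^ b \<le> \<eta> * R ^ (a + b)"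
            using monomial_box_bound[OF \<delta> \<eta>(1), of x \<alpha> y "1 / d - \<alpha>" a b] \<eta> y x0 unfolding Mx by (simp add: x\<alpha>[symmetric])
        qed (use xd yd x0 y \<delta> \<eta> in auto)
        also have "\<dots> < \<epsilon>" unfolding \<eta>_def T_def using \<epsilon> total_nonneg by (simp add: field_simps)
        finally show "y \<in> Pair x -` box_sublevel c \<delta> \<epsilon>" using xd yd x0 y unfolding box_sublevel_def by auto
      qed
      then have "emeasure lborel {0..M * (1 / x)} \<le> emeasure lborel (Pair x -` box_sublevel c \<delta> \<epsilon>)"
        by (intro emeasure_mono slice_measurable box_sublevel_measurable \<delta>)
      then show ?thesis using M x0 by simp
    qed
    have "(\<integral>\<^sup>+x. ennreal (M * (1 / x)) * indicator {X0..X1} x \<partial>lborel) \<le> emeasure lborel (box_sublevel c \<delta> \<epsilon>)"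
      by (intro emeasure_ge_of_slices box_sublevel_measurable \<delta> slice)
    moreover have "(\<integral>\<^sup>+x. ennreal (M * (1 / x)) * indicator {X0..X1} x \<partial>lborel) =
        ennreal M * (\<integral>\<^sup>+x. ennreal (1 / x) * indicator {X0..X1} x \<partial>lborel)"
      using M by (subst nn_integral_cmult[symmetric])
        (auto intro!: nn_integral_cong simp: ennreal_mult' mult.assoc simp del: times_divide_eq_right)
    moreover have "(\<integral>\<^sup>+x. ennreal (1 / x) * indicator {X0..X1} x \<partial>lborel) = ennreal (ln X1 - ln X0)"
      by (rule nn_integral_inverse_Icc) fact+
    moreover have "ln X1 - ln X0 = (v' - v) * (- ln \<eta>)"
      unfolding X0_def X1_def using \<delta> \<eta> by (simp add: ln_mult ln_powr algebra_simps)
    ultimately have "ennreal M * ennreal ((v' - v) * (- ln \<eta>)) \<le> emeasure lborel (box_sublevel c \<delta> \<epsilon>)" by simp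
    moreover have "ennreal M * ennreal ((v' - v) * (- ln \<eta>)) = ennreal (M * ((v' - v) * (- ln \<eta>)))"
      using M ln\<eta> v by (intro ennreal_mult[symmetric]) (auto intro!: mult_nonneg_nonneg simp: mult_nonneg_nonpos)
    moreover have "(\<delta>\<^sup>2 * (1 / T) powr (1 / d) * (v' - v)) * (\<epsilon> powr (1 / d) * (- ln \<epsilon>)) \<le> M * ((v' - v) * (- ln \<eta>))"
    proof -
      have Me: "M = \<delta>\<^sup>2 * (1 / T) powr (1 / d) * \<epsilon> powr (1 / d)"
        unfolding M_def \<eta>_def using \<epsilon> T by (simp add: powr_mult[symmetric])
      have "- ln \<epsilon> \<le> - ln \<eta>" unfolding \<eta>_def using \<epsilon> T by (simp add: ln_div)
      then have "M * (v' - v) * (- ln \<epsilon>) \<le> M * (v' - v) * (- ln \<eta>)" using M v by (intro mult_left_mono) auto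
      then show ?thesis unfolding Me by (simp add: mult_ac)
    qed
    ultimately show ?thesis using ennreal_leI order_trans by metis
  qed
  moreover have "\<delta>\<^sup>2 * (1 / T) powr (1 / d) * (v' - v) > 0" using \<delta> T v by simp
  ultimately show ?thesis by blast
qed

text \<open>Taylor's formula at a zero \<open>u0\<close> of order at least \<open>K\<close> bounds
  the limit by a multiple of \<open>v ^ K\<close>, and the rescaled series differs from the limit by
  a multiple of \<open>t powr \<theta>\<close>.\<close>

lemma near_curve_bound:
  fixes K :: nat
  assumes e: "e > 0" and s: "s > 0" and K: "K > 0"
    and supp: "\<And>a b. c (a, b) \<noteq> 0 \<Longrightarrow> real a + s * real b \<ge> e"
    and zero: "\<And>i. i < K \<Longrightarrow> powser_deriv (edge_coeff c s e) i u0 = 0"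
  shows "\<exists>M\<ge>1. \<exists>\<theta>>0. \<exists>t0>0. t0 \<le> 1 \<and> (\<forall>t v. 0 < t \<longrightarrow> t \<le> t0 \<longrightarrow> 0 \<le> v \<longrightarrow> v \<le> 1 \<longrightarrow>
     \<bar>double_sum c t (t powr s * (u0 + v))\<bar> \<le> M * t powr e * (v ^ K + t powr \<theta>))"
proof -
  obtain \<theta> where \<theta>: "\<theta> > 0" "\<And>a b :: nat. real a + s * real b > e \<Longrightarrow> real a + s * real b \<ge> e + \<theta>"
    using weight_gap[of s e] s e by auto
  define r where "r = \<bar>u0\<bar> + 1"
  have r: "r > 0" unfolding r_def by simp
  define t0 where "t0 = min (min 1 R) ((R / (2 * r)) powr (1 / s))"
  have t0: "t0 > 0" "t0 \<le> 1" "t0 \<le> R" unfolding t0_def using R_pos r by auto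
  have "t0 powr s \<le> ((R / (2 * r)) powr (1 / s)) powr s"
    using \<open>t0 > 0\<close> s by (intro powr_mono2) (auto simp: t0_def)
  also have "\<dots> = R / (2 * r)" using s R_pos r by (simp add: powr_powr)
  finally have rt0: "r * t0 powr s < R" using r R_pos by (simp add: field_simps)
  define \<rho> where "\<rho> = R / t0 powr s"
  define B where "B = t0 powr (- e - \<theta>) * total"
  have r\<rho>: "r < \<rho>" unfolding \<rho>_def using t0 rt0 by (simp add: field_simps)
  have B0: "B \<ge> 0" unfolding B_def using total_nonneg by simp
  define \<gamma> where "\<gamma> = edge_coeff c s e"
  have bnd: "\<bar>\<gamma> b\<bar> \<le> B / \<rho> ^ b" for b
    unfolding B_def \<rho>_def \<gamma>_def by (rule edge_coeff_bound[OF e less_imp_le[OF s] t0 \<theta>(1)])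
  have summ: "summable (\<lambda>b. \<gamma> b * z ^ b)" if "\<bar>z\<bar> < \<rho>" for z
    using that r r\<rho> by (intro summable_of_geometric_bound[OF bnd]) auto
  define M1 where "M1 = powser_deriv (\<lambda>b. B / \<rho> ^ b) K r"
  define M0 where "M0 = powser_deriv (\<lambda>b. B / \<rho> ^ b) 0 r"
  have zero_coeff: "(diffs ^^ k) (\<lambda>_. 0) = (\<lambda>_. 0 :: real)" for k
    by (induction k) (auto simp: diffs_def)
  \<comment> \<open>Comparison with the zero series at \<open>\<tau> = 1\<close> turns
    \<open>powser_deriv_perturb\<close> into a bound for the derivative itself.\<close>
  have derK: "\<bar>powser_deriv \<gamma> K u\<bar> \<le> M1" if "\<bar>u\<bar> \<le> r" for u
    using powser_deriv_perturb[of r \<rho> B "\<lambda>_. 0" 0 \<gamma> 1 u K] that r r\<rho> B0 bnd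
    unfolding M1_def by (simp add: powser_deriv_def[of "\<lambda>_. 0"] zero_coeff)
  have taylor: "\<bar>powser_deriv \<gamma> 0 (u0 + v)\<bar> \<le> M1 * v ^ K" if v: "0 < v" "v \<le> 1" for v
  proof -
    have "\<exists>t>u0. t < u0 + v \<and> powser_deriv \<gamma> 0 (u0 + v) =
      (\<Sum>m<K. powser_deriv \<gamma> m u0 / fact m * (u0 + v - u0) ^ m) + powser_deriv \<gamma> K t / fact K * (u0 + v - u0) ^ K"
    proof (rule Taylor_up[where a = u0])
      show "\<forall>m t. m < K \<and> u0 \<le> t \<and> t \<le> u0 + v \<longrightarrow> (powser_deriv \<gamma> m has_real_derivative powser_deriv \<gamma> (Suc m) t) (at t)"
        using v r\<rho> by (auto intro!: DERIV_powser_deriv[OF summ] simp: r_def)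
    qed (use K v in auto)
    then obtain t where t: "u0 < t" "t < u0 + v" "powser_deriv \<gamma> 0 (u0 + v) = powser_deriv \<gamma> K t / fact K * v ^ K"
      using zero unfolding \<gamma>_def by auto
    have "\<bar>powser_deriv \<gamma> K t / fact K\<bar> \<le> \<bar>powser_deriv \<gamma> K t\<bar>"
      using mult_right_mono[OF fact_ge_1[of K, where 'a = real], of "\<bar>powser_deriv \<gamma> K t\<bar>"]
      by (simp add: field_simps)
    also have "\<dots> \<le> M1" using t v by (intro derK) (auto simp: r_def)
    finally have "\<bar>powser_deriv \<gamma> K t / fact K\<bar> * v ^ K \<le> M1 * v ^ K"
      using v by (intro mult_right_mono) auto
    then show ?thesis unfolding t(3) abs_mult using v by simp
  qed
  define M where "M = \<bar>M1\<bar> + \<bar>M0\<bar> + 1"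
  have "\<bar>double_sum c t (t powr s * (u0 + v))\<bar> \<le> M * t powr e * (v ^ K + t powr \<theta>)"
    if t: "0 < t" "t \<le> t0" and v: "0 \<le> v" "v \<le> 1" for t v
  proof -
    define \<gamma>' where "\<gamma>' b = t powr (s * real b - e) * column_sum c b t" for b
    have close: "\<bar>\<gamma>' b - \<gamma> b\<bar> \<le> t powr \<theta> * (B / \<rho> ^ b)" for b
      unfolding \<gamma>'_def B_def \<rho>_def \<gamma>_def
      by (rule rescaled_coeff_close[OF e less_imp_le[OF s] t t0(3) \<theta>(1) supp \<theta>(2)])
    have ur: "\<bar>u0 + v\<bar> \<le> r" unfolding r_def using v by auto
    have "\<bar>t powr s * (u0 + v)\<bar> \<le> t0 powr s * r"
      unfolding abs_mult using ur t s by (intro mult_mono) (auto intro: powr_mono2)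
    then have "\<bar>t powr s * (u0 + v)\<bar> \<le> R" using rt0 by (simp add: mult.commute)
    from rescaled_double_sum[OF t(1) _ this, of e]
    have "(\<lambda>b. \<gamma>' b * (u0 + v) ^ b) sums (t powr (- e) * double_sum c t (t powr s * (u0 + v)))"
      unfolding \<gamma>'_def using t t0 by simp
    then have eq: "powser_deriv \<gamma>' 0 (u0 + v) = t powr (- e) * double_sum c t (t powr s * (u0 + v))"
      unfolding powser_deriv_def by (simp add: sums_iff)
    have "\<bar>powser_deriv \<gamma>' 0 (u0 + v) - powser_deriv \<gamma> 0 (u0 + v)\<bar> \<le> t powr \<theta> * M0"
      unfolding M0_def using r r\<rho> B0 bnd close ur by (intro powser_deriv_perturb) auto
    moreover have "\<bar>powser_deriv \<gamma> 0 (u0 + v)\<bar> \<le> M1 * v ^ K"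
    proof (cases "v = 0")
      case True
      then show ?thesis using zero[OF K] K by (simp add: \<gamma>_def zero_power)
    qed (use v taylor in auto)
    moreover have "t powr \<theta> * M0 \<le> M * t powr \<theta>" "M1 * v ^ K \<le> M * v ^ K"
      unfolding M_def using v mult_right_mono[of M0 "\<bar>M1\<bar> + \<bar>M0\<bar> + 1" "t powr \<theta>"]
        mult_right_mono[of M1 "\<bar>M1\<bar> + \<bar>M0\<bar> + 1" "v ^ K"]
      by (auto simp: mult.commute)
    ultimately have "\<bar>powser_deriv \<gamma>' 0 (u0 + v)\<bar> \<le> M * (v ^ K + t powr \<theta>)"
      unfolding distrib_left by linarith
    then have "t powr e * \<bar>t powr (- e) * double_sum c t (t powr s * (u0 + v))\<bar> \<le> t powr e * (M * (v ^ K + t powr \<theta>))"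
      unfolding eq by (intro mult_left_mono) auto
    moreover have "t powr e * \<bar>t powr (- e) * z\<bar> = \<bar>z\<bar>" for z
      using t by (simp add: abs_mult powr_minus field_simps)
    ultimately show ?thesis by (simp add: mult_ac)
  qed
  moreover have "M \<ge> 1" unfolding M_def by simp
  ultimately show ?thesis using \<theta>(1) t0(1,2) by blast
qed

text \<open>The width \<open>V\<close> in the variable \<open>u\<close> is chosen with
  \<open>t powr e * V ^ K = E\<close>. The lower end of the range of \<open>t\<close> ensures
  \<open>V \<le> 1\<close>, the upper end \<open>t powr (e + \<theta>) \<le> E\<close>, so both
  terms of \<open>near_curve_bound\<close> contribute at most a constant times
  \<open>E\<close>.\<close>

lemma curve_slice_lower_bound:
  fixes K :: nat
  assumes d: "d > 0" and s: "s > 0" and K: "K > 0"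
    and supp: "\<And>a b. c (a, b) \<noteq> 0 \<Longrightarrow> real a + s * real b \<ge> d * (1 + s)"
    and zero: "\<And>i. i < K \<Longrightarrow> powser_deriv (edge_coeff c s (d * (1 + s))) i u0 = 0"
    and \<delta>: "0 < \<delta>" "\<delta> \<le> R"
  shows "\<exists>M\<ge>1. \<exists>\<theta>>0. \<exists>E0>0. E0 < 1 \<and> (\<forall>E t. 0 < E \<longrightarrow> E \<le> E0 \<longrightarrow> E powr (1 / (d * (1 + s))) \<le> t \<longrightarrow>
     t \<le> E powr (1 / (d * (1 + s) + \<theta>)) \<longrightarrow>
     ennreal (E powr (1 / K) * t powr (s - d * (1 + s) / K)) \<le> emeasure lborel (Pair t -` box_sublevel c \<delta> (M * E)))"
proof -
  define e where "e = d * (1 + s)"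
  have e: "e > 0" unfolding e_def using d s by simp
  obtain M \<theta> t0 where M: "M \<ge> 1" and \<theta>: "\<theta> > 0" and t0: "t0 > 0" "t0 \<le> 1"
    and bnd: "\<forall>t v. 0 < t \<longrightarrow> t \<le> t0 \<longrightarrow> 0 \<le> v \<longrightarrow> v \<le> 1 \<longrightarrow>
     \<bar>double_sum c t (t powr s * (u0 + v))\<bar> \<le> M * t powr e * (v ^ K + t powr \<theta>)"
    using near_curve_bound[OF e s K supp[folded e_def] zero[folded e_def]] by blast
  define r where "r = \<bar>u0\<bar> + 1"
  have r: "r > 0" unfolding r_def by simp
  define t1 where "t1 = min (min t0 \<delta>) ((\<delta> / r) powr (1 / s))"
  have t1: "t1 > 0" "t1 \<le> t0" "t1 \<le> \<delta>" unfolding t1_def using t0 \<delta> r by auto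
  have "t1 powr s \<le> ((\<delta> / r) powr (1 / s)) powr s"
    using t1 s by (intro powr_mono2) (auto simp: t1_def)
  also have "\<dots> = \<delta> / r" using s \<delta> r by (simp add: powr_powr)
  finally have rt1: "r * t1 powr s \<le> \<delta>" using r by (simp add: field_simps)
  define E0 where "E0 = min (1/2) (t1 powr (e + \<theta>))"
  have E0: "0 < E0" "E0 < 1" unfolding E0_def using t1 by auto
  \<comment> \<open>The two terms add up to \<open>2 * M * E\<close>; the factor 3 makes the
    inequality strict.\<close>
  have "ennreal (E powr (1 / K) * t powr (s - e / K)) \<le> emeasure lborel (Pair t -` box_sublevel c \<delta> (3 * M * E))"
    if E: "0 < E" "E \<le> E0" and t: "E powr (1 / e) \<le> t" "t \<le> E powr (1 / (e + \<theta>))" for E t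
  proof -
    have tp: "t > 0" using t(1) E by (auto intro: less_le_trans[of _ "E powr (1 / e)"])
    have "E powr (1 / (e + \<theta>)) \<le> (t1 powr (e + \<theta>)) powr (1 / (e + \<theta>))"
      using E e \<theta> unfolding E0_def by (intro powr_mono2) auto
    then have tt1: "t \<le> t1" using t(2) e \<theta> t1 by (simp add: powr_powr)
    have Ete: "E \<le> t powr e"
    proof -
      have "(E powr (1 / e)) powr e \<le> t powr e" using t E e by (intro powr_mono2) auto
      then show ?thesis using E e by (simp add: powr_powr)
    qed
    have tE: "t powr (e + \<theta>) \<le> E"
    proof -
      have "t powr (e + \<theta>) \<le> (E powr (1 / (e + \<theta>))) powr (e + \<theta>)" using t tp e \<theta> by (intro powr_mono2) auto
      then show ?thesis using E e \<theta> by (simp add: powr_powr)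
    qed
    define V where "V = (E * t powr (- e)) powr (1 / K)"
    have V0: "0 < V" unfolding V_def using E tp by simp
    have Et1: "E * t powr (- e) \<le> 1" using Ete tp by (simp add: powr_minus field_simps)
    have V1: "V \<le> 1" unfolding V_def using Et1 E tp by (intro powr_le1) auto
    have VK: "V ^ K = E * t powr (- e)" unfolding V_def using K E tp by (simp add: powr_realpow[symmetric] powr_powr)
    have "{t powr s * u0..t powr s * (u0 + V)} \<subseteq> Pair t -` box_sublevel c \<delta> (3 * M * E)"
    proof
      fix y assume y: "y \<in> {t powr s * u0..t powr s * (u0 + V)}"
      define v where "v = y / t powr s - u0"
      have yv: "y = t powr s * (u0 + v)" unfolding v_def using tp by simp
      have v: "0 \<le> v" "v \<le> V" using y tp unfolding yv by auto
      have "\<bar>double_sum c t y\<bar> \<le> M * t powr e * (v ^ K + t powr \<theta>)"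
        unfolding yv using bnd tp tt1 t1 v V1 by auto
      also have "\<dots> \<le> M * t powr e * (E * t powr (- e) + t powr \<theta>)"
        using M v VK power_mono[OF v(2,1), of K] by (intro mult_left_mono add_right_mono) auto
      also have "\<dots> = M * (E + t powr (e + \<theta>))" using tp by (simp add: powr_add powr_minus field_simps)
      also have "\<dots> \<le> M * (E + E)" using M tE by (intro mult_left_mono) auto
      also have "\<dots> < 3 * M * E" using M E by simp
      finally have "\<bar>double_sum c t y\<bar> < 3 * M * E" .
      moreover have "\<bar>y\<bar> \<le> \<delta>"
      proof -
        have "\<bar>y\<bar> \<le> t1 powr s * r" unfolding yv abs_mult r_def using v V1 tp tt1 s
          by (intro mult_mono) (auto intro: powr_mono2)
        then show ?thesis using rt1 by (simp add: mult.commute)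
      qed
      ultimately show "y \<in> Pair t -` box_sublevel c \<delta> (3 * M * E)"
        unfolding box_sublevel_def using tp tt1 t1 by auto
    qed
    then have "emeasure lborel {t powr s * u0..t powr s * (u0 + V)} \<le> emeasure lborel (Pair t -` box_sublevel c \<delta> (3 * M * E))"
      by (intro emeasure_mono slice_measurable box_sublevel_measurable \<delta>)
    moreover have "emeasure lborel {t powr s * u0..t powr s * (u0 + V)} = ennreal (t powr s * V)"
      using V0 by (simp add: algebra_simps mult_nonneg_nonneg)
    moreover have "t powr s * V = E powr (1 / K) * t powr (s - e / K)"
    proof -
      have "V = E powr (1 / K) * t powr (- (e / K))" unfolding V_def using E tp by (simp add: powr_mult powr_powr)
      moreover have "t powr (s - e / K) = t powr s * t powr (- (e / K))" by (simp add: powr_add[symmetric])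
      ultimately show ?thesis by simp
    qed
    ultimately show ?thesis by simp
  qed
  then show ?thesis using M \<theta> E0 unfolding e_def
    by (intro exI[of _ "3 * M"] conjI exI[of _ \<theta>] exI[of _ E0] allI impI) auto
qed

text \<open>For \<open>K = d\<close> the slice length is \<open>E powr (1 / d) / t\<close>, and the
  range of \<open>t\<close> is bounded by two different powers of \<open>E\<close>; the integral of
  \<open>1 / t\<close> over it is the logarithm.\<close>

lemma curve_lower_bound_log:
  fixes K :: nat
  assumes d: "d > 0" and s: "s > 0" and K: "real K = d"
    and supp: "\<And>a b. c (a, b) \<noteq> 0 \<Longrightarrow> real a + s * real b \<ge> d * (1 + s)"
    and zero: "\<And>i. i < K \<Longrightarrow> powser_deriv (edge_coeff c s (d * (1 + s))) i u0 = 0"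
    and \<delta>: "0 < \<delta>" "\<delta> \<le> R"
  shows "\<exists>C>0. \<exists>\<epsilon>0>0. \<epsilon>0 < 1 \<and> (\<forall>\<epsilon>. 0 < \<epsilon> \<longrightarrow> \<epsilon> \<le> \<epsilon>0 \<longrightarrow>
     ennreal (C * (\<epsilon> powr (1 / d) * (- ln \<epsilon>))) \<le> emeasure lborel (box_sublevel c \<delta> \<epsilon>))"
proof -
  define e where "e = d * (1 + s)"
  have e: "e > 0" unfolding e_def using d s by simp
  have K0: "K > 0" using K d by auto
  obtain M \<theta> E0 where M: "M \<ge> 1" and \<theta>: "\<theta> > 0" and E0: "E0 > 0" "E0 < 1"
    and bnd: "\<forall>E t. 0 < E \<longrightarrow> E \<le> E0 \<longrightarrow> E powr (1 / e) \<le> t \<longrightarrow> t \<le> E powr (1 / (e + \<theta>)) \<longrightarrow>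
     ennreal (E powr (1 / K) * t powr (s - e / K)) \<le> emeasure lborel (Pair t -` box_sublevel c \<delta> (M * E))"
    using curve_slice_lower_bound[OF d s K0 supp zero \<delta>, folded e_def] by blast
  define \<kappa> where "\<kappa> = 1 / e - 1 / (e + \<theta>)"
  have \<kappa>: "\<kappa> > 0" unfolding \<kappa>_def using e \<theta> by (simp add: divide_strict_left_mono)
  have exponent: "s - e / K = -1" unfolding e_def K using d by simp
  have "ennreal ((1 / M) powr (1 / d) * \<kappa> * (\<epsilon> powr (1 / d) * (- ln \<epsilon>))) \<le> emeasure lborel (box_sublevel c \<delta> \<epsilon>)"
    if \<epsilon>: "0 < \<epsilon>" "\<epsilon> \<le> E0" for \<epsilon>
  proof -
    define E where "E = \<epsilon> / M"
    have "E \<le> \<epsilon> / 1" unfolding E_def using M \<epsilon> by (intro divide_left_mono) auto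
    then have E: "0 < E" "E \<le> E0" "E \<le> \<epsilon>" "M * E = \<epsilon>" unfolding E_def using M \<epsilon> by auto
    have lnE: "ln E \<le> ln \<epsilon>" "ln \<epsilon> < 0" using E \<epsilon> E0 by (auto intro: ln_less_zero)
    define X0 X1 where "X0 = E powr (1 / e)" and "X1 = E powr (1 / (e + \<theta>))"
    have X: "X0 > 0" "X0 \<le> X1" unfolding X0_def X1_def using E E0 e \<theta>
      by (auto intro!: powr_mono' simp: field_simps)
    have "(\<integral>\<^sup>+t. ennreal (E powr (1 / d) * (1 / t)) * indicator {X0..X1} t \<partial>lborel) \<le> emeasure lborel (box_sublevel c \<delta> \<epsilon>)"
    proof (intro emeasure_ge_of_slices box_sublevel_measurable \<delta>)
      fix t assume t: "t \<in> {X0..X1}"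
      then have "t > 0" using X by auto
      then have "t powr (s - e / K) = 1 / t" unfolding exponent by (simp add: powr_minus field_simps)
      then have "E powr (1 / d) * (1 / t) = E powr (1 / K) * t powr (s - e / K)" by (simp only: K)
      then show "ennreal (E powr (1 / d) * (1 / t)) \<le> emeasure lborel (Pair t -` box_sublevel c \<delta> \<epsilon>)"
        using bnd[rule_format, OF E(1,2), of t] t E(4) unfolding X0_def X1_def by simp
    qed
    moreover have "(\<integral>\<^sup>+t. ennreal (E powr (1 / d) * (1 / t)) * indicator {X0..X1} t \<partial>lborel) =
        ennreal (E powr (1 / d)) * (\<integral>\<^sup>+t. ennreal (1 / t) * indicator {X0..X1} t \<partial>lborel)"
      by (subst nn_integral_cmult[symmetric])
        (auto intro!: nn_integral_cong simp: ennreal_mult' mult.assoc simp del: times_divide_eq_right)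
    moreover have "(\<integral>\<^sup>+t. ennreal (1 / t) * indicator {X0..X1} t \<partial>lborel) = ennreal (ln X1 - ln X0)"
      by (rule nn_integral_inverse_Icc) fact+
    moreover have "ln X1 - ln X0 = \<kappa> * (- ln E)"
      unfolding X0_def X1_def \<kappa>_def using E by (simp add: ln_powr algebra_simps)
    ultimately have "ennreal (E powr (1 / d)) * ennreal (\<kappa> * (- ln E)) \<le> emeasure lborel (box_sublevel c \<delta> \<epsilon>)" by simp
    moreover have "ennreal (E powr (1 / d)) * ennreal (\<kappa> * (- ln E)) = ennreal (E powr (1 / d) * (\<kappa> * (- ln E)))"
      using lnE \<kappa> by (intro ennreal_mult[symmetric]) (auto simp: mult_nonneg_nonpos)
    moreover have "(1 / M) powr (1 / d) * \<kappa> * (\<epsilon> powr (1 / d) * (- ln \<epsilon>)) \<le> E powr (1 / d) * (\<kappa> * (- ln E))"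
    proof -
      have Ed: "E powr (1 / d) = (1 / M) powr (1 / d) * \<epsilon> powr (1 / d)"
        unfolding E_def using \<epsilon> M by (simp add: powr_mult[symmetric])
      have "E powr (1 / d) * \<kappa> * (- ln \<epsilon>) \<le> E powr (1 / d) * \<kappa> * (- ln E)"
        using \<kappa> lnE by (intro mult_left_mono) auto
      then show ?thesis unfolding Ed by (simp add: mult_ac)
    qed
    ultimately show ?thesis using ennreal_leI order_trans by metis
  qed
  moreover have "(1 / M) powr (1 / d) * \<kappa> > 0" using M \<kappa> by simp
  ultimately show ?thesis using E0 by blast
qed

text \<open>For \<open>K > d\<close> the power of \<open>t\<close> in the slice length exceeds
  \<open>- 1\<close>, so the upper end \<open>X\<close> of the range dominates and
  \<open>{X / 2..X}\<close> is enough. This gives the exponent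
  \<open>1 / K + \<kappa> / (e + \<theta>)\<close>, whereas \<open>1 / K + \<kappa> / e\<close>
  would equal \<open>1 / d\<close>: positivity of \<open>\<theta>\<close> makes the inequality
  strict.\<close>

lemma curve_lower_bound_powr:
  fixes K :: nat
  assumes d: "d > 0" and s: "s > 0" and K: "real K > d"
    and supp: "\<And>a b. c (a, b) \<noteq> 0 \<Longrightarrow> real a + s * real b \<ge> d * (1 + s)"
    and zero: "\<And>i. i < K \<Longrightarrow> powser_deriv (edge_coeff c s (d * (1 + s))) i u0 = 0"
    and \<delta>: "0 < \<delta>" "\<delta> \<le> R"
  shows "\<exists>\<sigma><1 / d. \<exists>C>0. \<exists>\<epsilon>0>0. \<epsilon>0 < 1 \<and> (\<forall>\<epsilon>. 0 < \<epsilon> \<longrightarrow> \<epsilon> \<le> \<epsilon>0 \<longrightarrow>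
     ennreal (C * \<epsilon> powr \<sigma>) \<le> emeasure lborel (box_sublevel c \<delta> \<epsilon>))"
proof -
  define e where "e = d * (1 + s)"
  have e: "e > 0" unfolding e_def using d s by simp
  have K0: "K > 0" using K d by (cases K) auto
  obtain M \<theta> E0 where M: "M \<ge> 1" and \<theta>: "\<theta> > 0" and E0: "E0 > 0" "E0 < 1"
    and bnd: "\<forall>E t. 0 < E \<longrightarrow> E \<le> E0 \<longrightarrow> E powr (1 / e) \<le> t \<longrightarrow> t \<le> E powr (1 / (e + \<theta>)) \<longrightarrow>
     ennreal (E powr (1 / K) * t powr (s - e / K)) \<le> emeasure lborel (Pair t -` box_sublevel c \<delta> (M * E))"
    using curve_slice_lower_bound[OF d s K0 supp zero \<delta>, folded e_def] by blast
  define \<kappa> where "\<kappa> = 1 + s - e / K"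
  have ed: "e / d = 1 + s" unfolding e_def using d by simp
  have "e / K < e / d" using K d e by (intro divide_strict_left_mono) auto
  then have \<kappa>: "\<kappa> > 0" unfolding \<kappa>_def ed by simp
  define \<sigma> where "\<sigma> = 1 / K + \<kappa> / (e + \<theta>)"
  have "\<kappa> / (e + \<theta>) < \<kappa> / e" using \<kappa> e \<theta> by (intro divide_strict_left_mono) auto
  also have "\<kappa> / e = 1 / d - 1 / K" unfolding \<kappa>_def ed[symmetric] using e by (simp add: diff_divide_distrib)
  finally have \<sigma>: "\<sigma> < 1 / d" unfolding \<sigma>_def by simp
  define \<omega> where "\<omega> = 1 / e - 1 / (e + \<theta>)"
  have \<omega>: "\<omega> > 0" unfolding \<omega>_def using e \<theta> by (simp add: divide_strict_left_mono)
  \<comment> \<open>The second term of the minimum yields \<open>E powr (1 / e) \<le> X / 2\<close>,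
    so that the half range consists of admissible \<open>t\<close>.\<close>
  define \<epsilon>0 where "\<epsilon>0 = min E0 ((1 / 2) powr (1 / \<omega>))"
  have \<epsilon>0: "\<epsilon>0 > 0" "\<epsilon>0 < 1" unfolding \<epsilon>0_def using E0 by auto
  define C where "C = (1 / 2) powr (\<kappa> + 1) * (1 / M) powr \<sigma>"
  have "ennreal (C * \<epsilon> powr \<sigma>) \<le> emeasure lborel (box_sublevel c \<delta> \<epsilon>)"
    if \<epsilon>: "0 < \<epsilon>" "\<epsilon> \<le> \<epsilon>0" for \<epsilon>
  proof -
    define E where "E = \<epsilon> / M"
    have "E \<le> \<epsilon> / 1" unfolding E_def using M \<epsilon> by (intro divide_left_mono) auto
    then have E: "0 < E" "E \<le> E0" "E \<le> (1 / 2) powr (1 / \<omega>)" "M * E = \<epsilon>"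
      unfolding E_def using M \<epsilon> by (auto simp: \<epsilon>0_def)
    define X where "X = E powr (1 / (e + \<theta>))"
    have X: "X > 0" unfolding X_def using E by simp
    have half: "E powr (1 / e) \<le> X / 2"
    proof -
      have "E powr (1 / e) = X * E powr \<omega>" unfolding X_def \<omega>_def by (simp add: powr_add[symmetric])
      also have "E powr \<omega> \<le> ((1 / 2) powr (1 / \<omega>)) powr \<omega>" using E \<omega> by (intro powr_mono2) auto
      then have "X * E powr \<omega> \<le> X * (1 / 2)" using X \<omega> by (simp add: powr_powr)
      finally show ?thesis by simp
    qed
    define g where "g = E powr (1 / K) * ((X / 2) powr \<kappa> / X)"
    have g0: "g \<ge> 0" unfolding g_def using X by simp
    have "(\<integral>\<^sup>+t. ennreal g * indicator {X / 2..X} t \<partial>lborel) \<le> emeasure lborel (box_sublevel c \<delta> \<epsilon>)"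
    proof (intro emeasure_ge_of_slices box_sublevel_measurable \<delta>)
      fix t assume t: "t \<in> {X / 2..X}"
      then have tp: "t > 0" using X by auto
      have "(X / 2) powr \<kappa> / X \<le> t powr \<kappa> / t"
        using t tp X \<kappa> by (intro frac_le powr_mono2) auto
      also have "t powr \<kappa> / t = t powr (s - e / K)"
        unfolding \<kappa>_def using tp by (simp add: powr_diff powr_add)
      finally have "g \<le> E powr (1 / K) * t powr (s - e / K)" unfolding g_def by (intro mult_left_mono) auto
      moreover have "ennreal (E powr (1 / K) * t powr (s - e / K)) \<le> emeasure lborel (Pair t -` box_sublevel c \<delta> \<epsilon>)"
        using bnd[rule_format, OF E(1,2), of t] t half E(4) unfolding X_def by simp
      ultimately show "ennreal g \<le> emeasure lborel (Pair t -` box_sublevel c \<delta> \<epsilon>)"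
        using ennreal_leI order_trans by blast
    qed
    moreover have "(\<integral>\<^sup>+t. ennreal g * indicator {X / 2..X} t \<partial>lborel) = ennreal (g * (X / 2))"
      using X g0 by (subst nn_integral_cmult_indicator) (auto simp: ennreal_mult''[symmetric])
    moreover have "g * (X / 2) = C * \<epsilon> powr \<sigma>"
    proof -
      have "g * (X / 2) = E powr (1 / K) * (X powr \<kappa> * (1 / 2) powr \<kappa>) * (1 / 2)"
        unfolding g_def using X powr_mult[of X "1 / 2" \<kappa>] by simp
      also have "\<dots> = (1 / 2) powr (\<kappa> + 1) * (E powr (1 / K) * X powr \<kappa>)" by (simp add: powr_add)
      also have "E powr (1 / K) * X powr \<kappa> = E powr \<sigma>"
        unfolding X_def \<sigma>_def by (simp add: powr_add powr_powr)
      also have "E powr \<sigma> = (1 / M) powr \<sigma> * \<epsilon> powr \<sigma>"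
        unfolding E_def using \<epsilon> M by (simp add: powr_mult[symmetric])
      finally show ?thesis unfolding C_def by simp
    qed
    ultimately show ?thesis by simp
  qed
  moreover have "C > 0" unfolding C_def using M by simp
  ultimately show ?thesis using \<epsilon>0 \<sigma> by blast
qed

end

section \<open>Bump functions and planar Lebesgue measure\<close>

text \<open>The powers of \<open>t\<close> in the denominator make the family closed under
  differentiation, up to linear combinations.\<close>

definition flat_exp :: "nat \<Rightarrow> real \<Rightarrow> real" where
  "flat_exp k t = (if t > 0 then exp (- 1 / t) / t ^ k else 0)"

text \<open>The upper bound comes from the single term of index \<open>k + 2\<close> of the
  exponential series. Being quadratic in \<open>t\<close>, it makes the difference quotient at 0
  vanish in the limit.\<close>

lemma flat_exp_bounds:
  assumes "t > 0"
  shows "0 < flat_exp k t" "flat_exp k t \<le> fact (k + 2) * t\<^sup>2"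
proof -
  show "0 < flat_exp k t" using assms by (simp add: flat_exp_def)
  have "(1 / t) ^ (k + 2) / fact (k + 2) \<le> exp (1 / t)"
  proof -
    have "(\<Sum>n\<in>{k + 2}. (1 / t) ^ n /\<^sub>R fact n) \<le> (\<Sum>n. (1 / t) ^ n /\<^sub>R fact n)"
      using assms summable_exp_generic[of "1 / t"] by (intro sum_le_suminf) auto
    then show ?thesis by (simp add: exp_def divide_inverse mult.commute)
  qed
  then have "1 / (fact (k + 2) * t ^ (k + 2)) \<le> exp (1 / t)"
    by (simp only: power_one_over divide_divide_eq_left mult.commute)
  then have "inverse (exp (1 / t)) \<le> inverse (1 / (fact (k + 2) * t ^ (k + 2)))"
    using assms by (intro le_imp_inverse_le) (simp_all only: zero_less_divide_iff, auto)
  then have "exp (- (1 / t)) \<le> fact (k + 2) * t ^ (k + 2)"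
    by (simp only: exp_minus inverse_eq_divide divide_divide_eq_right mult_1 div_by_1)
  then have "exp (- (1 / t)) / t ^ k \<le> fact (k + 2) * t ^ (k + 2) / t ^ k"
    using assms by (intro divide_right_mono) auto
  also have "\<dots> = fact (k + 2) * t\<^sup>2" using assms by (simp add: power_add power2_eq_square)
  finally show "flat_exp k t \<le> fact (k + 2) * t\<^sup>2" using assms by (simp add: flat_exp_def)
qed

lemma DERIV_flat_exp:
  "(flat_exp k has_real_derivative flat_exp (k + 2) t - real k * flat_exp (k + 1) t) (at t)"
proof (cases t "0 :: real" rule: linorder_cases)
  case less
  have "((\<lambda>_. 0) has_real_derivative 0) (at t)" by simp
  moreover have "\<forall>\<^sub>F x in nhds t. flat_exp k x = 0"
    using eventually_nhds_in_open[of "{..<0}" t] less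
    by (auto simp: flat_exp_def elim!: eventually_mono)
  ultimately have "(flat_exp k has_real_derivative 0) (at t)"
    by (subst DERIV_cong_ev[OF refl _ refl, of _ "\<lambda>_. 0"]) auto
  then show ?thesis using less by (simp add: flat_exp_def)
next
  case equal
  have "((\<lambda>h. (flat_exp k (0 + h) - flat_exp k 0) / h) \<longlongrightarrow> 0) (at 0)"
  proof (rule Lim_null_comparison)
    show "\<forall>\<^sub>F h in at 0. norm ((flat_exp k (0 + h) - flat_exp k 0) / h) \<le> fact (k + 2) * \<bar>h\<bar>"
    proof (intro always_eventually allI)
      fix h :: real
      show "norm ((flat_exp k (0 + h) - flat_exp k 0) / h) \<le> fact (k + 2) * \<bar>h\<bar>"
      proof (cases "h > 0")
        case True
        then show ?thesis using flat_exp_bounds[OF True, of k]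
          by (simp add: flat_exp_def[of k 0] divide_le_eq power2_eq_square mult.assoc del: fact_Suc)
      next
        case False
        then have "flat_exp k h = 0" by (simp add: flat_exp_def)
        then have "norm ((flat_exp k (0 + h) - flat_exp k 0) / h) = 0" by (simp add: flat_exp_def[of k 0])
        also have "0 \<le> fact (k + 2) * \<bar>h\<bar>" by (intro mult_nonneg_nonneg fact_ge_zero abs_ge_zero)
        finally show ?thesis .
      qed
    qed
    show "((\<lambda>h. fact (k + 2) * \<bar>h\<bar>) \<longlongrightarrow> (0::real)) (at 0)"
      by (intro tendsto_eq_intros) auto
  qed
  then have "(flat_exp k has_real_derivative 0) (at 0)" by (simp add: DERIV_def)
  then show ?thesis using equal by (simp add: flat_exp_def)
next
  case greater
  have "((\<lambda>t. exp (- 1 / t) / t ^ k) has_real_derivative flat_exp (k + 2) t - real k * flat_exp (k + 1) t) (at t)"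
  proof (cases "k = 0")
    case True
    then show ?thesis using greater
      by (auto intro!: derivative_eq_intros simp: flat_exp_def field_simps power2_eq_square)
  next
    case False
    define P where "P = t ^ (k - 1)"
    have P: "P > 0" "t ^ k = t * P" unfolding P_def using greater False power_eq_if[of t k] by auto
    have "((\<lambda>t. exp (- 1 / t) / t ^ k) has_real_derivative
        (exp (- 1 / t) * (1 / t\<^sup>2) * t ^ k - exp (- 1 / t) * (real k * t ^ (k - 1))) / (t ^ k * t ^ k)) (at t)"
      using greater by (auto intro!: derivative_eq_intros simp: power2_eq_square)
    moreover have "(exp (- 1 / t) * (1 / t\<^sup>2) * t ^ k - exp (- 1 / t) * (real k * t ^ (k - 1))) / (t ^ k * t ^ k)
        = flat_exp (k + 2) t - real k * flat_exp (k + 1) t"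
      unfolding P_def[symmetric] using greater P
      by (simp add: flat_exp_def field_simps power2_eq_square)
    ultimately show ?thesis by simp
  qed
  moreover have "\<forall>\<^sub>F x in nhds t. flat_exp k x = exp (- 1 / x) / x ^ k"
    using eventually_nhds_in_open[of "{0<..}" t] greater
    by (auto simp: flat_exp_def elim!: eventually_mono)
  ultimately show ?thesis by (subst DERIV_cong_ev[OF refl _ refl]) auto
qed

text \<open>A class of functions that contains the bump and is stable under differentiation.
  \<open>smooth\<close> asks for all iterated partial derivatives, and with such a class this
  becomes an induction.\<close>

inductive bump_sum :: "real \<Rightarrow> (real \<Rightarrow> real) \<Rightarrow> bool" for \<delta> where
  bump_sum_prod: "bump_sum \<delta> (\<lambda>x. a * flat_exp i (\<delta> + x) * flat_exp j (\<delta> - x))"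
| bump_sum_add: "bump_sum \<delta> f \<Longrightarrow> bump_sum \<delta> g \<Longrightarrow> bump_sum \<delta> (\<lambda>x. f x + g x)"

lemma bump_sum_derivative:
  assumes "bump_sum \<delta> f"
  shows "\<exists>g. bump_sum \<delta> g \<and> (\<forall>x. (f has_real_derivative g x) (at x))"
  using assms
proof induction
  case (bump_sum_prod a i j)
  let ?t = "\<lambda>a i j x. a * flat_exp i (\<delta> + x) * flat_exp j (\<delta> - x)"
  have "bump_sum \<delta> (\<lambda>x. (?t a (i + 2) j x + ?t (- a * real i) (i + 1) j x)
      + (?t (- a) i (j + 2) x + ?t (a * real j) i (j + 1) x))"
    by (intro bump_sum.intros)
  moreover have "(?t a i j has_real_derivative (?t a (i + 2) j x + ?t (- a * real i) (i + 1) j x)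
      + (?t (- a) i (j + 2) x + ?t (a * real j) i (j + 1) x)) (at x)" for x
  proof -
    have "((\<lambda>x. flat_exp i (\<delta> + x)) has_real_derivative
        (flat_exp (i + 2) (\<delta> + x) - real i * flat_exp (i + 1) (\<delta> + x)) * 1) (at x)"
      by (rule DERIV_chain2[OF DERIV_flat_exp]) (auto intro!: derivative_eq_intros)
    moreover have "((\<lambda>x. flat_exp j (\<delta> - x)) has_real_derivative
        (flat_exp (j + 2) (\<delta> - x) - real j * flat_exp (j + 1) (\<delta> - x)) * (- 1)) (at x)"
      by (rule DERIV_chain2[OF DERIV_flat_exp]) (auto intro!: derivative_eq_intros)
    ultimately show ?thesis
      by (auto intro!: derivative_eq_intros simp: algebra_simps)
  qed
  ultimately show ?case by blast
next
  case (bump_sum_add f g)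
  then obtain f' g' where "bump_sum \<delta> f'" "bump_sum \<delta> g'"
    "\<And>x. (f has_real_derivative f' x) (at x)" "\<And>x. (g has_real_derivative g' x) (at x)" by blast
  then show ?case
    by (intro exI[of _ "\<lambda>x. f' x + g' x"] conjI allI DERIV_add bump_sum.bump_sum_add)
qed

lemma bump_product_iter_partial:
  fixes js :: "2 list"
  assumes "bump_sum \<delta> f" "bump_sum \<delta> g"
  shows "\<exists>f' g'. bump_sum \<delta> f' \<and> bump_sum \<delta> g' \<and>
    iter_partial js (\<lambda>x :: real^2. f (x $ 1) * g (x $ 2)) = (\<lambda>x. f' (x $ 1) * g' (x $ 2))"
proof (induction js)
  case Nil
  then show ?case using assms by (auto simp: iter_partial_def)
next
  case (Cons j js)
  then obtain f1 g1 where 1: "bump_sum \<delta> f1" "bump_sum \<delta> g1"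
    "iter_partial js (\<lambda>x :: real^2. f (x $ 1) * g (x $ 2)) = (\<lambda>x. f1 (x $ 1) * g1 (x $ 2))" by blast
  obtain f2 where f2: "bump_sum \<delta> f2" "\<And>x. (f1 has_real_derivative f2 x) (at x)"
    using bump_sum_derivative[OF 1(1)] by blast
  obtain g2 where g2: "bump_sum \<delta> g2" "\<And>x. (g1 has_real_derivative g2 x) (at x)"
    using bump_sum_derivative[OF 1(2)] by blast
  have it: "iter_partial (j # js) (\<lambda>x :: real^2. f (x $ 1) * g (x $ 2)) = partial_deriv j (\<lambda>x. f1 (x $ 1) * g1 (x $ 2))"
    using 1(3) by (simp add: iter_partial_def)
  consider "j = 1" | "j = 2" using exhaust_2 by blast
  then show ?case
  proof cases
    case 1
    have "partial_deriv 1 (\<lambda>x :: real^2. f1 (x $ 1) * g1 (x $ 2)) x = f2 (x $ 1) * g1 (x $ 2)" for x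
    proof -
      have "((\<lambda>t. f1 (x $ 1 + t)) has_real_derivative f2 (x $ 1 + 0) * 1) (at 0)"
        by (rule DERIV_chain2[OF f2(2)]) (auto intro!: derivative_eq_intros)
      then have "((\<lambda>t. f1 (x $ 1 + t) * g1 (x $ 2)) has_real_derivative f2 (x $ 1) * g1 (x $ 2)) (at 0)"
        by (auto intro!: derivative_eq_intros)
      then show ?thesis unfolding partial_deriv_def by (intro DERIV_imp_deriv) (simp add: axis_def)
    qed
    then have "partial_deriv 1 (\<lambda>x :: real^2. f1 (x $ 1) * g1 (x $ 2)) = (\<lambda>x. f2 (x $ 1) * g1 (x $ 2))" by (rule ext)
    then have it2: "iter_partial (j # js) (\<lambda>x :: real^2. f (x $ 1) * g (x $ 2)) = (\<lambda>x. f2 (x $ 1) * g1 (x $ 2))"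
      unfolding it by (simp only: 1)
    show ?thesis
      by (rule exI[where x = f2], rule exI[where x = g1], intro conjI f2(1) \<open>bump_sum \<delta> g1\<close> it2)
  next
    case 2
    have "partial_deriv 2 (\<lambda>x :: real^2. f1 (x $ 1) * g1 (x $ 2)) x = f1 (x $ 1) * g2 (x $ 2)" for x
    proof -
      have "((\<lambda>t. g1 (x $ 2 + t)) has_real_derivative g2 (x $ 2 + 0) * 1) (at 0)"
        by (rule DERIV_chain2[OF g2(2)]) (auto intro!: derivative_eq_intros)
      then have "((\<lambda>t. f1 (x $ 1) * g1 (x $ 2 + t)) has_real_derivative f1 (x $ 1) * g2 (x $ 2)) (at 0)"
        by (auto intro!: derivative_eq_intros)
      then show ?thesis unfolding partial_deriv_def by (intro DERIV_imp_deriv) (simp add: axis_def)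
    qed
    then have "partial_deriv 2 (\<lambda>x :: real^2. f1 (x $ 1) * g1 (x $ 2)) = (\<lambda>x. f1 (x $ 1) * g2 (x $ 2))" by (rule ext)
    then have it2: "iter_partial (j # js) (\<lambda>x :: real^2. f (x $ 1) * g (x $ 2)) = (\<lambda>x. f1 (x $ 1) * g2 (x $ 2))"
      unfolding it by (simp only: 2)
    show ?thesis
      by (rule exI[where x = f1], rule exI[where x = g2], intro conjI g2(1) \<open>bump_sum \<delta> f1\<close> it2)
  qed
qed

lemma exists_smooth_bump:
  assumes "\<delta> > 0"
  shows "\<exists>\<phi> :: real^2 \<Rightarrow> real. smooth \<phi> \<and> (\<forall>x. \<phi> x \<ge> 0) \<and> \<phi> 0 > 0 \<and> {x. \<phi> x \<noteq> 0} \<subseteq> {x. \<forall>i. \<bar>x $ i\<bar> \<le> \<delta>}"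
proof -
  define b where "b = (\<lambda>x. 1 * flat_exp 0 (\<delta> + x) * flat_exp 0 (\<delta> - x))"
  have b: "bump_sum \<delta> b" unfolding b_def by (rule bump_sum_prod)
  define \<phi> where "\<phi> = (\<lambda>x :: real^2. b (x $ 1) * b (x $ 2))"
  have fl: "flat_exp 0 t \<ge> 0" for t by (simp add: flat_exp_def)
  have diff: "(\<lambda>x :: real^2. f (x $ 1) * g (x $ 2)) differentiable (at x)"
    if "bump_sum \<delta> f" "bump_sum \<delta> g" for f g x
  proof -
    have d: "f differentiable (at y)" "g differentiable (at y)" for y
      using bump_sum_derivative[OF that(1)] bump_sum_derivative[OF that(2)]
      by (auto simp: real_differentiable_def)
    have p: "(\<lambda>x :: real^2. x $ i) differentiable (at x)" for i
      by (rule bounded_linear_imp_differentiable[OF bounded_linear_vec_nth])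
    have "(\<lambda>x :: real^2. f (x $ 1)) differentiable (at x)" "(\<lambda>x :: real^2. g (x $ 2)) differentiable (at x)"
      using differentiable_chain_at[OF p d(1)] differentiable_chain_at[OF p d(2)] by (auto simp: o_def)
    then show ?thesis by (rule differentiable_mult)
  qed
  have "smooth \<phi>"
    unfolding smooth_def
  proof (intro allI)
    fix js :: "2 list" and x
    show "iter_partial js \<phi> differentiable (at x)"
      using bump_product_iter_partial[OF b b, of js] diff unfolding \<phi>_def by auto
  qed
  moreover have "\<phi> x \<ge> 0" for x unfolding \<phi>_def b_def using fl by simp
  moreover have "\<phi> 0 > 0" unfolding \<phi>_def b_def using flat_exp_bounds(1)[OF assms] by simp
  moreover have "\<bar>x $ i\<bar> \<le> \<delta>" if "\<phi> x \<noteq> 0" for x i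
  proof -
    have "b (x $ i) \<noteq> 0" using that exhaust_2[of i] unfolding \<phi>_def by auto
    then show ?thesis unfolding b_def flat_exp_def by (auto split: if_splits)
  qed
  ultimately show ?thesis by blast
qed

section \<open>Lebesgue measure on \<open>real^2\<close> as a product measure\<close>

definition vec2 :: "real \<times> real \<Rightarrow> real^2" where
  "vec2 p = (\<chi> i. if i = 1 then fst p else snd p)"

lemma vec2_nth [simp]: "vec2 p $ 1 = fst p" "vec2 p $ 2 = snd p"
  by (auto simp: vec2_def)

lemma vec2_measurable: "vec2 \<in> borel_measurable borel"
proof (rule borel_measurable_continuous_onI)
  show "continuous_on UNIV vec2"
    unfolding vec2_def
  proof (intro continuous_on_vec_lambda)
    fix i :: 2
    show "continuous_on UNIV (\<lambda>p :: real \<times> real. if i = 1 then fst p else snd p)"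
      by (cases "i = 1") (auto intro!: continuous_intros)
  qed
qed

lemma Basis_vec2: "(Basis :: (real^2) set) = {axis 1 1, axis 2 1}"
  unfolding Basis_vec_def by (auto simp: UNIV_2)

lemma lborel_vec2: "lborel = distr lborel borel vec2"
proof (rule lborel_eqI)
  fix l u :: "real^2"
  assume le: "\<And>b. b \<in> Basis \<Longrightarrow> l \<bullet> b \<le> u \<bullet> b"
  have ne: "(axis 1 1 :: real^2) \<noteq> axis 2 1" by (simp add: axis_eq_axis)
  have le': "l $ 1 \<le> u $ 1" "l $ 2 \<le> u $ 2"
    using le[of "axis 1 1"] le[of "axis 2 1"] unfolding Basis_vec2 by (auto simp: inner_axis)
  have "vec2 -` box l u = {l $ 1<..<u $ 1} \<times> {l $ 2<..<u $ 2}"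
    by (auto simp: mem_box_cart forall_2)
  then have "emeasure (distr lborel borel vec2) (box l u) = emeasure lborel ({l $ 1<..<u $ 1} \<times> {l $ 2<..<u $ 2})"
    using vec2_measurable by (subst emeasure_distr) auto
  also have "\<dots> = emeasure (lborel \<Otimes>\<^sub>M lborel) ({l $ 1<..<u $ 1} \<times> {l $ 2<..<u $ 2})"
    by (simp add: lborel_prod)
  also have "\<dots> = emeasure lborel {l $ 1<..<u $ 1} * emeasure lborel {l $ 2<..<u $ 2}"
    by (rule lborel.emeasure_pair_measure_Times) auto
  also have "\<dots> = ennreal (\<Prod>b\<in>Basis. (u - l) \<bullet> b)"
    using le' ne unfolding Basis_vec2 by (simp add: ennreal_mult''[symmetric] inner_axis)
  finally show "emeasure (distr lborel borel vec2) (box l u) = ennreal (\<Prod>b\<in>Basis. (u - l) \<bullet> b)" .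
qed simp

lemma emeasure_vec2:
  assumes "A \<in> sets borel"
  shows "vec2 -` A \<in> sets borel" "emeasure lborel A = emeasure lborel (vec2 -` A)"
proof -
  show "vec2 -` A \<in> sets borel" using measurable_sets[OF vec2_measurable assms] by simp
  have "emeasure lborel A = emeasure (distr lborel borel vec2) A" by (simp only: lborel_vec2[symmetric])
  also have "\<dots> = emeasure lborel (vec2 -` A)" using assms vec2_measurable by (subst emeasure_distr) auto
  finally show "emeasure lborel A = emeasure lborel (vec2 -` A)" .
qed

section \<open>Faces of planar Newton polyhedra\<close>

text \<open>Dickson's lemma in the plane. Besides an element with least first coordinate only
  finitely many smaller second coordinates matter, and one minimal element for each of them
  suffices. It makes the Newton polyhedron the sum of a polytope and the orthant, in particular
  closed.\<close>

lemma finite_dominating_subset: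
  fixes A :: "(2 \<Rightarrow> nat) set"
  shows "\<exists>A0\<subseteq>A. finite A0 \<and> (\<forall>\<alpha>\<in>A. \<exists>\<beta>\<in>A0. \<forall>i. \<beta> i \<le> \<alpha> i)"
proof (cases "A = {}")
  case False
  then obtain \<alpha>0 where \<alpha>0: "\<alpha>0 \<in> A" "\<And>\<alpha>. \<alpha> \<in> A \<Longrightarrow> \<alpha>0 1 \<le> \<alpha> 1"
    using ex_has_least_nat[of "\<lambda>\<alpha>. \<alpha> \<in> A" _ "\<lambda>\<alpha>. \<alpha> 1"] by blast
  define B where "B = {b. b < \<alpha>0 2 \<and> (\<exists>\<alpha>\<in>A. \<alpha> 2 = b)}"
  have "\<forall>b\<in>B. \<exists>\<beta>\<in>A. \<beta> 2 = b \<and> (\<forall>\<alpha>\<in>A. \<alpha> 2 = b \<longrightarrow> \<beta> 1 \<le> \<alpha> 1)"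
  proof
    fix b assume "b \<in> B"
    then obtain \<alpha> where "\<alpha> \<in> A \<and> \<alpha> 2 = b" unfolding B_def by auto
    then show "\<exists>\<beta>\<in>A. \<beta> 2 = b \<and> (\<forall>\<alpha>\<in>A. \<alpha> 2 = b \<longrightarrow> \<beta> 1 \<le> \<alpha> 1)"
      using ex_has_least_nat[of "\<lambda>\<alpha>. \<alpha> \<in> A \<and> \<alpha> 2 = b" \<alpha> "\<lambda>\<alpha>. \<alpha> 1"] by blast
  qed
  then obtain g where g: "\<And>b. b \<in> B \<Longrightarrow> g b \<in> A \<and> g b 2 = b \<and> (\<forall>\<alpha>\<in>A. \<alpha> 2 = b \<longrightarrow> g b 1 \<le> \<alpha> 1)"
    by metis
  have "finite B" unfolding B_def by simp
  moreover have "\<exists>\<beta>\<in>insert \<alpha>0 (g ` B). \<forall>i. \<beta> i \<le> \<alpha> i" if \<alpha>: "\<alpha> \<in> A" for \<alpha>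
  proof (cases "\<alpha>0 2 \<le> \<alpha> 2")
    case True
    then show ?thesis using \<alpha>0(2)[OF \<alpha>] by (auto simp: forall_2)
  next
    case False
    then have "\<alpha> 2 \<in> B" using \<alpha> unfolding B_def by auto
    then show ?thesis using g[of "\<alpha> 2"] \<alpha> by (auto simp: forall_2 intro!: bexI[of _ "g (\<alpha> 2)"])
  qed
  ultimately show ?thesis using \<alpha>0(1) g by (intro exI[of _ "insert \<alpha>0 (g ` B)"]) auto
qed auto

lemma exponent_point_nth [simp]: "exponent_point \<alpha> $ i = real (\<alpha> i)"
  by (simp add: exponent_point_def)

text \<open>\<open>A\<close> stands for the set of exponents of the series. That it omits the zero
  exponent reflects \<open>S 0 = 0\<close> and makes \<open>d\<close> positive.\<close>

locale newton_data =
  fixes A :: "(2 \<Rightarrow> nat) set" and N :: "(real^2) set" and d :: real and p :: "real^2"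
  assumes A_nonempty: "A \<noteq> {}" and A_zero: "(\<lambda>_. 0) \<notin> A"
    and N_def: "N = convex hull (\<Union>\<alpha>\<in>A. quadrant \<alpha>)"
    and d_def: "d = Inf {t. (\<chi> i. t) \<in> N}"
    and p_def: "p = (\<chi> i. d)"
begin

lemma N_convex: "convex N" unfolding N_def by simp

lemma quadrant_subset: "\<alpha> \<in> A \<Longrightarrow> quadrant \<alpha> \<subseteq> N"
  unfolding N_def using hull_subset[of "\<Union>\<alpha>\<in>A. quadrant \<alpha>" convex] by auto

lemma p_nth [simp]: "p $ i = d" by (simp add: p_def)

definition A0 :: "(2 \<Rightarrow> nat) set" where
  "A0 = (SOME A0. A0 \<subseteq> A \<and> finite A0 \<and> (\<forall>\<alpha>\<in>A. \<exists>\<beta>\<in>A0. \<forall>i. \<beta> i \<le> \<alpha> i))"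

lemma A0: "A0 \<subseteq> A" "finite A0" "\<And>\<alpha>. \<alpha> \<in> A \<Longrightarrow> \<exists>\<beta>\<in>A0. \<forall>i. \<beta> i \<le> \<alpha> i"
  unfolding A0_def using someI_ex[OF finite_dominating_subset[of A]] by blast+

lemma N_eq: "N = convex hull (exponent_point ` A0) + {x. \<forall>i. 0 \<le> x $ i}"
proof -
  have "(\<Union>\<alpha>\<in>A. quadrant \<alpha>) = exponent_point ` A0 + {x. \<forall>i. 0 \<le> x $ i}" (is "?L = ?R")
  proof
    show "?L \<subseteq> ?R"
    proof
      fix x assume "x \<in> ?L"
      then obtain \<alpha> where \<alpha>: "\<alpha> \<in> A" "\<And>i. x $ i \<ge> real (\<alpha> i)" by (auto simp: quadrant_def)
      obtain \<beta> where \<beta>: "\<beta> \<in> A0" "\<And>i. \<beta> i \<le> \<alpha> i" using A0(3)[OF \<alpha>(1)] by blast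
      have "0 \<le> (x - exponent_point \<beta>) $ i" for i
      proof -
        have "real (\<beta> i) \<le> real (\<alpha> i)" using \<beta>(2) by simp
        then show ?thesis using \<alpha>(2)[of i] by simp
      qed
      then have "exponent_point \<beta> + (x - exponent_point \<beta>) \<in> ?R" using \<beta>(1) by (intro set_plus_intro) auto
      then show "x \<in> ?R" by simp
    qed
    show "?R \<subseteq> ?L"
    proof
      fix x assume "x \<in> ?R"
      then obtain \<beta> h where "\<beta> \<in> A0" "\<And>i. 0 \<le> h $ i" "x = exponent_point \<beta> + h"
        by (auto simp: set_plus_def)
      then show "x \<in> ?L" using A0(1) by (auto simp: quadrant_def intro!: bexI[of _ \<beta>])
    qed
  qed
  moreover have "convex {x :: real^2. \<forall>i. 0 \<le> x $ i}" by (auto simp: convex_def)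
  then have "convex hull {x :: real^2. \<forall>i. 0 \<le> x $ i} = {x. \<forall>i. 0 \<le> x $ i}" by (simp add: hull_same)
  ultimately show ?thesis unfolding N_def by (simp add: convex_hull_set_plus)
qed

lemma N_decompose:
  assumes "z \<in> N"
  shows "\<exists>u h. (\<forall>\<alpha>\<in>A0. 0 \<le> u \<alpha>) \<and> sum u A0 = 1 \<and> (\<forall>i. 0 \<le> h $ i) \<and>
     (\<forall>i. z $ i = (\<Sum>\<alpha>\<in>A0. u \<alpha> * real (\<alpha> i)) + h $ i)"
proof -
  obtain y h where yh: "y \<in> convex hull (exponent_point ` A0)" "\<And>i. 0 \<le> h $ i" "z = y + h"
    using assms unfolding N_eq by (auto simp: set_plus_def)
  have inj: "inj_on exponent_point A0"
    by (auto simp: inj_on_def exponent_point_def vec_eq_iff fun_eq_iff)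
  obtain u where u: "\<forall>x\<in>exponent_point ` A0. 0 \<le> u x" "sum u (exponent_point ` A0) = 1"
    "(\<Sum>x\<in>exponent_point ` A0. u x *\<^sub>R x) = y"
    using yh(1) A0(2) by (auto simp: convex_hull_finite)
  have "y $ i = (\<Sum>\<alpha>\<in>A0. u (exponent_point \<alpha>) * real (\<alpha> i))" for i
    unfolding u(3)[symmetric] by (simp add: sum.reindex[OF inj])
  moreover have "(\<Sum>\<alpha>\<in>A0. u (exponent_point \<alpha>)) = 1" using u(2) by (simp add: sum.reindex[OF inj])
  ultimately show ?thesis using u(1) yh(2,3)
    by (intro exI[of _ "u \<circ> exponent_point"] exI[of _ h]) auto
qed

lemma N_upward:
  assumes "x \<in> N" "\<And>i. x $ i \<le> y $ i"
  shows "y \<in> N"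
proof -
  obtain a h where "a \<in> convex hull (exponent_point ` A0)" "\<And>i. 0 \<le> h $ i" "x = a + h"
    using assms unfolding N_eq by (auto simp: set_plus_def)
  moreover have "0 \<le> (h + (y - x)) $ i" for i using assms(2)[of i] calculation(2)[of i] by simp
  then have "a + (h + (y - x)) \<in> convex hull (exponent_point ` A0) + {x. \<forall>i. 0 \<le> x $ i}"
    using calculation(1) by (intro set_plus_intro) auto
  ultimately show ?thesis unfolding N_eq by simp
qed

lemma N_closed: "closed N"
proof -
  have "compact (convex hull (exponent_point ` A0))"
    using A0(2) by (intro finite_imp_compact_convex_hull) auto
  moreover have "closed {x :: real^2. \<forall>i. 0 \<le> x $ i}"
    by (intro closed_Collect_all closed_Collect_le continuous_intros)
  ultimately have "closed (\<Union>x\<in>convex hull (exponent_point ` A0). \<Union>y\<in>{x :: real^2. \<forall>i. 0 \<le> x $ i}. {x + y})"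
    by (rule compact_closed_sums)
  moreover have "(\<Union>x\<in>convex hull (exponent_point ` A0). \<Union>y\<in>{x :: real^2. \<forall>i. 0 \<le> x $ i}. {x + y}) = N"
    unfolding N_eq by (auto simp: set_plus_def)
  ultimately show ?thesis by simp
qed

lemma N_ge:
  assumes "\<And>\<alpha>. \<alpha> \<in> A \<Longrightarrow> w1 * real (\<alpha> 1) + w2 * real (\<alpha> 2) \<ge> (c :: real)" "w1 \<ge> 0" "w2 \<ge> 0" "z \<in> N"
  shows "w1 * z $ 1 + w2 * z $ 2 \<ge> c"
proof -
  have "convex {x :: real^2. w1 * x $ 1 + w2 * x $ 2 \<ge> c}"
  proof -
    have "{x :: real^2. w1 * x $ 1 + w2 * x $ 2 \<ge> c} = {x. (\<chi> i. if i = 1 then w1 else w2) \<bullet> x \<ge> c}"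
      by (simp add: inner_vec_def sum_2)
    then show ?thesis by (simp add: convex_halfspace_ge)
  qed
  moreover have "(\<Union>\<alpha>\<in>A. quadrant \<alpha>) \<subseteq> {x. w1 * x $ 1 + w2 * x $ 2 \<ge> c}"
  proof
    fix x assume "x \<in> (\<Union>\<alpha>\<in>A. quadrant \<alpha>)"
    then obtain \<alpha> where \<alpha>: "\<alpha> \<in> A" "\<And>i. real (\<alpha> i) \<le> x $ i" by (auto simp: quadrant_def)
    have "c \<le> w1 * real (\<alpha> 1) + w2 * real (\<alpha> 2)" by (rule assms(1)[OF \<alpha>(1)])
    also have "\<dots> \<le> w1 * x $ 1 + w2 * x $ 2" using assms \<alpha>(2) by (intro add_mono mult_left_mono) auto
    finally show "x \<in> {x. w1 * x $ 1 + w2 * x $ 2 \<ge> c}" by simp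
  qed
  ultimately have "N \<subseteq> {x. w1 * x $ 1 + w2 * x $ 2 \<ge> c}" unfolding N_def by (intro hull_minimal)
  then show ?thesis using assms by auto
qed

lemma N_sum_ge_1:
  assumes "z \<in> N"
  shows "z $ 1 + z $ 2 \<ge> 1"
proof -
  have "1 * real (\<alpha> 1) + 1 * real (\<alpha> 2) \<ge> 1" if "\<alpha> \<in> A" for \<alpha>
  proof -
    have "\<alpha> \<noteq> (\<lambda>_. 0)" using that A_zero by auto
    then have "\<alpha> 1 \<noteq> 0 \<or> \<alpha> 2 \<noteq> 0" by (auto simp: fun_eq_iff forall_2)
    then show ?thesis by linarith
  qed
  from N_ge[OF this _ _ assms] show ?thesis by simp
qed

lemma N_nonneg:
  assumes "z \<in> N"
  shows "z $ i \<ge> 0"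
proof -
  have "1 * z $ 1 + 0 * z $ 2 \<ge> 0" "0 * z $ 1 + 1 * z $ 2 \<ge> 0"
    by (rule N_ge[OF _ _ _ assms]; simp)+
  then show ?thesis using exhaust_2[of i] by auto
qed

lemma d_least: "(\<chi> i. t) \<in> N \<Longrightarrow> d \<le> t" and p_in_N: "p \<in> N" and d_pos: "d > 0"
proof -
  let ?T = "{t. (\<chi> i. t) \<in> N}"
  have bd: "t \<ge> 1/2" if "t \<in> ?T" for t using N_sum_ge_1[of "\<chi> i. t"] that by simp
  then have bdd: "bdd_below ?T" by (rule bdd_belowI)
  then show "(\<chi> i. t) \<in> N \<Longrightarrow> d \<le> t" unfolding d_def by (intro cInf_lower) auto
  obtain \<alpha> where \<alpha>: "\<alpha> \<in> A" using A_nonempty by auto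
  have "(\<chi> i. real (max (\<alpha> 1) (\<alpha> 2))) \<in> quadrant \<alpha>" by (auto simp: quadrant_def forall_2)
  then have ne: "?T \<noteq> {}" using quadrant_subset[OF \<alpha>] by auto
  have "closed ((\<lambda>t. (\<chi> i. t) :: real^2) -` N)"
    by (intro closed_vimage N_closed continuous_on_vec_lambda continuous_intros)
  then have "closed ?T" by (simp add: vimage_def)
  then have "d \<in> ?T" unfolding d_def using ne bdd by (intro closed_contains_Inf)
  then show "p \<in> N" "d > 0" using bd[of d] by (auto simp: p_def)
qed

text \<open>The open quadrant below \<open>p\<close> misses \<open>N\<close>, since \<open>N\<close>
  is upward closed and \<open>d\<close> is least on the diagonal. A separating line passes through
  \<open>p\<close>, its normal is nonnegative because \<open>N\<close> contains \<open>p\<close>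
  shifted along the axes, and scaling the normal to the value 1 at \<open>p\<close> gives
  \<open>w1 + w2 = 1 / d\<close>.\<close>

lemma supporting_weights:
  "\<exists>w1 w2. w1 \<ge> 0 \<and> w2 \<ge> 0 \<and> w1 + w2 = 1 / d \<and> (\<forall>z\<in>N. w1 * z $ 1 + w2 * z $ 2 \<ge> 1)"
proof -
  let ?S = "{x :: real^2. x $ 1 < d \<and> x $ 2 < d}"
  have "?S \<inter> N = {}"
  proof (rule ccontr)
    assume "?S \<inter> N \<noteq> {}"
    then obtain x where x: "x \<in> N" "x $ 1 < d" "x $ 2 < d" by auto
    have "x $ i \<le> max (x $ 1) (x $ 2)" for i using exhaust_2[of i] by auto
    then have "(\<chi> i. max (x $ 1) (x $ 2)) \<in> N" by (intro N_upward[OF x(1)]) simp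
    then have "d \<le> max (x $ 1) (x $ 2)" by (rule d_least)
    then show False using x by simp
  qed
  moreover have "convex ?S"
  proof -
    have "?S = {x. axis 1 1 \<bullet> x < d} \<inter> {x. axis 2 1 \<bullet> x < d}"
      by (auto simp: inner_axis' )
    then show ?thesis by (simp add: convex_Int convex_halfspace_lt)
  qed
  moreover have "(\<chi> i. d - 1) \<in> ?S" by simp
  ultimately obtain a b where ab: "a \<noteq> 0" "\<And>x. x \<in> ?S \<Longrightarrow> a \<bullet> x \<le> b" "\<And>x. x \<in> N \<Longrightarrow> a \<bullet> x \<ge> b"
    using separating_hyperplane_sets[of ?S N] N_convex p_in_N by blast
  have in2: "a \<bullet> x = a $ 1 * x $ 1 + a $ 2 * x $ 2" for x by (simp add: inner_vec_def sum_2)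
  have eq: "a \<bullet> p = b"
  proof (rule antisym)
    show "b \<le> a \<bullet> p" using ab(3) p_in_N by auto
    show "a \<bullet> p \<le> b"
    proof (rule field_le_epsilon)
      fix e :: real assume e: "e > 0"
      \<comment> \<open>The diagonal points with coordinates \<open>d - h\<close> lie in the open
        quadrant and approach \<open>p\<close>; with this \<open>h\<close> the error is at most
        \<open>e\<close>.\<close>
      define h where "h = e / (\<bar>a $ 1 + a $ 2\<bar> + 1)"
      have h: "h > 0" unfolding h_def using e by simp
      have "a \<bullet> (\<chi> i. d - h) \<le> b" using h by (intro ab(2)) simp
      then have "a \<bullet> p \<le> b + h * (a $ 1 + a $ 2)" unfolding in2 by (simp add: algebra_simps)
      also have "h * (a $ 1 + a $ 2) \<le> h * (\<bar>a $ 1 + a $ 2\<bar> + 1)" using h by (intro mult_left_mono) auto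
      also have "\<dots> = e" unfolding h_def by simp
      finally show "a \<bullet> p \<le> b + e" by simp
    qed
  qed
  have nonneg: "a $ i \<ge> 0" for i
  proof -
    have "p + axis i 1 \<in> N" by (rule N_upward[OF p_in_N]) (simp add: axis_def)
    then have "b \<le> a \<bullet> (p + axis i 1)" by (rule ab(3))
    then show ?thesis using eq by (simp add: inner_add_right inner_axis)
  qed
  have "a $ 1 + a $ 2 > 0"
  proof -
    have "a $ 1 \<noteq> 0 \<or> a $ 2 \<noteq> 0" using ab(1) by (auto simp: vec_eq_iff forall_2)
    then show ?thesis using nonneg[of 1] nonneg[of 2] by linarith
  qed
  moreover have b: "b = d * (a $ 1 + a $ 2)" using eq unfolding in2 by (simp add: algebra_simps)
  ultimately have bp: "b > 0" using d_pos by simp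
  have "a $ 1 / b + a $ 2 / b = 1 / d"
    unfolding add_divide_distrib[symmetric] b using \<open>a $ 1 + a $ 2 > 0\<close> by simp
  moreover have "a $ 1 / b * z $ 1 + a $ 2 / b * z $ 2 \<ge> 1" if "z \<in> N" for z
    using ab(3)[OF that] bp unfolding in2 by (simp add: add_divide_distrib[symmetric])
  ultimately show ?thesis using nonneg bp by (intro exI[of _ "a $ 1 / b"] exI[of _ "a $ 2 / b"]) auto
qed

text \<open>A point of \<open>N\<close> is a convex combination of exponents plus a nonnegative
  offset. If it lies on the supporting line, the exponents with positive coefficient have excess 0,
  and their average j-th coordinate is at most \<open>z $ j\<close>. So a point of the edge yields
  an actual exponent of the series there.\<close>

lemma support_attained:
  assumes w: "w1 \<ge> 0" "w2 \<ge> 0" and sup: "\<And>z. z \<in> N \<Longrightarrow> w1 * z $ 1 + w2 * z $ 2 \<ge> 1"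
    and z: "z \<in> N" "w1 * z $ 1 + w2 * z $ 2 = 1" "z $ j < t"
  shows "\<exists>\<alpha>\<in>A. w1 * real (\<alpha> 1) + w2 * real (\<alpha> 2) = 1 \<and> real (\<alpha> j) < t"
proof (rule ccontr)
  assume contra: "\<not> ?thesis"
  obtain u h where u: "\<forall>\<alpha>\<in>A0. 0 \<le> u \<alpha>" "sum u A0 = 1" and h: "\<And>i. 0 \<le> h $ i"
    and zi: "\<And>i. z $ i = (\<Sum>\<alpha>\<in>A0. u \<alpha> * real (\<alpha> i)) + h $ i"
    using N_decompose[OF z(1)] by blast
  define ex where "ex \<alpha> = w1 * real (\<alpha> 1) + w2 * real (\<alpha> 2) - 1" for \<alpha> :: "2 \<Rightarrow> nat"
  have ex0: "ex \<alpha> \<ge> 0" if "\<alpha> \<in> A0" for \<alpha>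
  proof -
    have "exponent_point \<alpha> \<in> quadrant \<alpha>" by (simp add: quadrant_def)
    then have "exponent_point \<alpha> \<in> N" using quadrant_subset[of \<alpha>] A0(1) that by auto
    from sup[OF this] show ?thesis unfolding ex_def by simp
  qed
  have "(\<Sum>\<alpha>\<in>A0. u \<alpha> * ex \<alpha>) = w1 * (\<Sum>\<alpha>\<in>A0. u \<alpha> * real (\<alpha> 1)) + w2 * (\<Sum>\<alpha>\<in>A0. u \<alpha> * real (\<alpha> 2)) - sum u A0"
    unfolding ex_def by (simp add: sum_distrib_left sum.distrib sum_subtractf algebra_simps)
  also have "\<dots> = w1 * (z $ 1 - h $ 1) + w2 * (z $ 2 - h $ 2) - 1" using zi u by simp
  also have "\<dots> = - (w1 * h $ 1 + w2 * h $ 2)" using z(2) by (simp add: algebra_simps)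
  also have "\<dots> \<le> 0" using mult_nonneg_nonneg[OF w(1) h[of 1]] mult_nonneg_nonneg[OF w(2) h[of 2]] by linarith
  finally have "(\<Sum>\<alpha>\<in>A0. u \<alpha> * ex \<alpha>) = 0"
    using u ex0 by (intro antisym sum_nonneg) auto
  then have zero: "u \<alpha> * ex \<alpha> = 0" if "\<alpha> \<in> A0" for \<alpha>
    using sum_nonneg_eq_0_iff[OF A0(2), of "\<lambda>\<alpha>. u \<alpha> * ex \<alpha>"] u ex0 that by auto
  have "t = (\<Sum>\<alpha>\<in>A0. u \<alpha> * t)" using u by (simp add: sum_distrib_right[symmetric])
  also have "\<dots> \<le> (\<Sum>\<alpha>\<in>A0. u \<alpha> * real (\<alpha> j))"
  proof (intro sum_mono)
    fix \<alpha> assume \<alpha>: "\<alpha> \<in> A0"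
    show "u \<alpha> * t \<le> u \<alpha> * real (\<alpha> j)"
    proof (cases "u \<alpha> = 0")
      case False
      then have "ex \<alpha> = 0" using zero[OF \<alpha>] by simp
      then have "t \<le> real (\<alpha> j)" using contra \<alpha> A0(1) unfolding ex_def by force
      then show ?thesis using u \<alpha> by (intro mult_left_mono) auto
    qed simp
  qed
  also have "\<dots> \<le> z $ j" using zi h by simp
  finally show False using z(3) by simp
qed

section \<open>Vertex or edge through the diagonal point\<close>

lemma central_unique:
  assumes "F face_of N" "p \<in> rel_interior F"
  shows "(THE F. F face_of N \<and> p \<in> rel_interior F) = F"
  using assms face_of_eq[of _ N F] by (intro the_equality) auto

lemma eq_p_iff: "z = p \<longleftrightarrow> z $ 1 = d \<and> z $ 2 = d"
  by (simp add: vec_eq_iff forall_2)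

text \<open>Otherwise the quadrant at \<open>\<alpha>\<close> would contain a segment in direction
  \<open>i\<close> with midpoint \<open>p\<close>.\<close>

lemma extreme_imp_quadrant_corner:
  assumes ext: "p extreme_point_of N" and \<alpha>: "\<alpha> \<in> A" and ij: "real (\<alpha> i) < d" "i \<noteq> j"
  shows "real (\<alpha> j) > d"
proof (rule ccontr)
  assume "\<not> ?thesis"
  then have le: "real (\<alpha> j) \<le> d" by simp
  define q r where "q = (\<chi> k. if k = i then real (\<alpha> i) else d)" and "r = (\<chi> k. if k = i then 2 * d - real (\<alpha> i) else d)"
  have k: "k = i \<or> k = j" for k :: 2 using exhaust_2[of i] exhaust_2[of j] exhaust_2[of k] ij by auto
  have "q \<in> quadrant \<alpha>" "r \<in> quadrant \<alpha>"
    using le ij k unfolding q_def r_def quadrant_def by (auto split: if_splits)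
  then have "q \<in> N" "r \<in> N" using quadrant_subset[OF \<alpha>] by auto
  moreover have "p \<in> open_segment q r"
  proof -
    have "q \<noteq> r" using ij unfolding q_def r_def by (auto simp: vec_eq_iff intro!: exI[of _ i])
    moreover have "p = (1 - 1/2) *\<^sub>R q + (1/2) *\<^sub>R r"
      unfolding q_def r_def p_def by (auto simp: vec_eq_iff field_simps)
    ultimately show ?thesis unfolding in_segment by (intro conjI exI[of _ "1/2"]) auto
  qed
  ultimately show False using ext unfolding extreme_point_of_def by blast
qed

text \<open>An extreme point of a convex hull belongs to the generating set, here a union of
  quadrants; by the preceding lemma it can only be the corner of its quadrant. In particular
  \<open>d\<close> is then an integer.\<close>

lemma extreme_imp_vertex:
  assumes ext: "p extreme_point_of N"
  shows "\<exists>n. d = real n \<and> (\<lambda>_. n) \<in> A"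
proof -
  have "p \<in> (\<Union>\<alpha>\<in>A. quadrant \<alpha>)" using ext unfolding N_def by (rule extreme_point_of_convex_hull)
  then obtain \<alpha> where \<alpha>: "\<alpha> \<in> A" "\<And>i. real (\<alpha> i) \<le> d" by (auto simp: quadrant_def)
  have eq: "real (\<alpha> i) = d" for i
  proof (rule ccontr)
    assume "real (\<alpha> i) \<noteq> d"
    then have "real (\<alpha> i) < d" using \<alpha>(2)[of i] by simp
    moreover obtain j where "i \<noteq> j" using exhaust_2[of i] using that[of "i + 1"] by simp
    ultimately have "real (\<alpha> j) > d" by (rule extreme_imp_quadrant_corner[OF ext \<alpha>(1)])
    then show False using \<alpha>(2)[of j] by simp
  qed
  have "\<alpha> = (\<lambda>_. \<alpha> 1)"
  proof
    fix i have "real (\<alpha> i) = real (\<alpha> 1)" using eq by simp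
    then show "\<alpha> i = \<alpha> 1" by simp
  qed
  then show ?thesis using \<alpha>(1) eq[of 1] by (intro exI[of _ "\<alpha> 1"]) auto
qed

text \<open>At a vertex the supporting lines form a nondegenerate pencil: the constraints from
  exponents left of \<open>p\<close> and those from exponents below \<open>p\<close> are kept apart
  by the strict convexity expressed in \<open>cross\<close>.\<close>

lemma vertex_weights:
  assumes ext: "p extreme_point_of N"
  shows "\<exists>v v'. 0 \<le> v \<and> v < v' \<and> v' \<le> 1 / d \<and>
     (\<forall>\<alpha>\<in>A. v * real (\<alpha> 1) + (1 / d - v) * real (\<alpha> 2) \<ge> 1 \<and> v' * real (\<alpha> 1) + (1 / d - v') * real (\<alpha> 2) \<ge> 1)"
proof -
  define L where "L = {\<alpha>\<in>A0. real (\<alpha> 1) < d}"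
  define K where "K = {\<beta>\<in>A0. real (\<beta> 2) < d}"
  have fin: "finite L" "finite K" unfolding L_def K_def using A0(2) by auto
  have L: "real (\<alpha> 1) < d" "real (\<alpha> 2) > d" if "\<alpha> \<in> L" for \<alpha>
    using that A0(1) extreme_imp_quadrant_corner[OF ext, of \<alpha> 1 2] unfolding L_def by auto
  have K: "real (\<beta> 2) < d" "real (\<beta> 1) > d" if "\<beta> \<in> K" for \<beta>
    using that A0(1) extreme_imp_quadrant_corner[OF ext, of \<beta> 2 1] unfolding K_def by auto
  have cross: "(real (\<alpha> 2) - d) * (real (\<beta> 1) - d) > (d - real (\<alpha> 1)) * (d - real (\<beta> 2))"
    if \<alpha>: "\<alpha> \<in> L" and \<beta>: "\<beta> \<in> K" for \<alpha> \<beta>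
  proof (rule ccontr)
    assume "\<not> ?thesis"
    then have le: "(real (\<alpha> 2) - d) * (real (\<beta> 1) - d) \<le> (d - real (\<alpha> 1)) * (d - real (\<beta> 2))" by simp
    define a b where "a = d - real (\<alpha> 1)" and "b = real (\<beta> 1) - d"
    have ab: "a > 0" "b > 0" unfolding a_def b_def using L[OF \<alpha>] K[OF \<beta>] by auto
    define t where "t = a / (a + b)"
    have t: "0 < t" "t < 1" unfolding t_def using ab by auto
    \<comment> \<open>The height over \<open>real (\<beta> 1)\<close> of the line through
      \<open>exponent_point \<alpha>\<close> and \<open>p\<close>. If \<open>cross\<close> fails, it
      is at least \<open>real (\<beta> 2)\<close>, and \<open>p\<close> is interior to a segment of
      \<open>N\<close>.\<close>
    define h where "h = d - b * (real (\<alpha> 2) - d) / a"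
    have ha: "a * (h - d) = - (b * (real (\<alpha> 2) - d))" unfolding h_def using ab by (simp add: field_simps)
    have "a * real (\<beta> 2) \<le> a * h" using ha le unfolding a_def b_def by (simp add: algebra_simps)
    then have hb: "real (\<beta> 2) \<le> h" using ab by simp
    define r :: "real^2" where "r = (\<chi> i. if i = 1 then real (\<beta> 1) else h)"
    have "exponent_point \<alpha> \<in> quadrant \<alpha>" "r \<in> quadrant \<beta>"
      using hb unfolding r_def by (auto simp: quadrant_def forall_2)
    then have N: "exponent_point \<alpha> \<in> N" "r \<in> N"
      using quadrant_subset \<alpha> \<beta> A0(1) unfolding L_def K_def by auto
    have "exponent_point \<alpha> \<noteq> r" using L[OF \<alpha>] K[OF \<beta>] unfolding r_def by (auto simp: vec_eq_iff forall_2)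
    moreover have "p = (1 - t) *\<^sub>R exponent_point \<alpha> + t *\<^sub>R r"
    proof -
      have tb: "1 - t = b / (a + b)" unfolding t_def using ab by (simp add: field_simps)
      have "b * real (\<alpha> 1) + a * real (\<beta> 1) = (a + b) * d" unfolding a_def b_def by (simp add: algebra_simps)
      then have 1: "(1 - t) * real (\<alpha> 1) + t * real (\<beta> 1) = d"
        unfolding tb using ab by (simp add: t_def add_divide_distrib[symmetric])
      have "b * real (\<alpha> 2) + a * h = (a + b) * d" using ha by (simp add: algebra_simps)
      then have 2: "(1 - t) * real (\<alpha> 2) + t * h = d"
        unfolding tb using ab by (simp add: t_def add_divide_distrib[symmetric])
      show ?thesis using 1 2 unfolding r_def by (simp add: vec_eq_iff forall_2)
    qed
    ultimately have "p \<in> open_segment (exponent_point \<alpha>) r" using t unfolding in_segment by blast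
    then show False using ext N unfolding extreme_point_of_def by blast
  qed
  txt \<open>
    A weight \<open>v\<close> on the first axis, with \<open>1/d - v\<close> on the second, supports the point \<open>\<alpha> \<in> L\<close> iff
    \<open>v \<le> u \<alpha>\<close>, and the point \<open>\<beta> \<in> K\<close> iff \<open>v \<ge> l \<beta>\<close>.
  \<close>
  define u where "u \<alpha> = (real (\<alpha> 2) - d) / (d * (real (\<alpha> 2) - real (\<alpha> 1)))" for \<alpha> :: "2 \<Rightarrow> nat"
  define l where "l \<beta> = (d - real (\<beta> 2)) / (d * (real (\<beta> 1) - real (\<beta> 2)))" for \<beta> :: "2 \<Rightarrow> nat"
  have u0: "u \<alpha> > 0" if "\<alpha> \<in> L" for \<alpha> unfolding u_def using L[OF that] d_pos by simp
  have l1: "l \<beta> < 1 / d" if "\<beta> \<in> K" for \<beta>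
    unfolding l_def using K[OF that] d_pos by (simp add: divide_less_eq less_divide_eq)
  have lu: "l \<beta> < u \<alpha>" if \<alpha>: "\<alpha> \<in> L" and \<beta>: "\<beta> \<in> K" for \<alpha> \<beta>
  proof -
    have "(d - real (\<beta> 2)) * (real (\<alpha> 2) - real (\<alpha> 1)) < (real (\<alpha> 2) - d) * (real (\<beta> 1) - real (\<beta> 2))"
      using cross[OF that] by (simp add: algebra_simps)
    then have "(d - real (\<beta> 2)) / (real (\<beta> 1) - real (\<beta> 2)) < (real (\<alpha> 2) - d) / (real (\<alpha> 2) - real (\<alpha> 1))"
      using L[OF \<alpha>] K[OF \<beta>] by (simp add: divide_less_eq less_divide_eq mult.commute)
    then have "(d - real (\<beta> 2)) / (real (\<beta> 1) - real (\<beta> 2)) / d < (real (\<alpha> 2) - d) / (real (\<alpha> 2) - real (\<alpha> 1)) / d"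
      using d_pos by (rule divide_strict_right_mono)
    then show ?thesis unfolding l_def u_def by (simp add: mult.commute)
  qed
  define v where "v = Max (insert 0 (l ` K))"
  define v' where "v' = Min (insert (1 / d) (u ` L))"
  have v0: "v \<ge> 0" unfolding v_def using fin by auto
  have v1: "v' \<le> 1 / d" unfolding v'_def using fin by auto
  have "v \<in> insert 0 (l ` K)" unfolding v_def using fin by (intro Max_in) auto
  moreover have "v' \<in> insert (1 / d) (u ` L)" unfolding v'_def using fin by (intro Min_in) auto
  ultimately have vv: "v < v'" using u0 l1 lu d_pos by auto
  have supp0: "w * real (\<alpha> 1) + (1 / d - w) * real (\<alpha> 2) \<ge> 1" if w: "v \<le> w" "w \<le> v'" and \<alpha>: "\<alpha> \<in> A0" for w \<alpha>
  proof -
    have goal: "w * d * (real (\<alpha> 1) - real (\<alpha> 2)) + real (\<alpha> 2) \<ge> d \<Longrightarrow> ?thesis"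
      using d_pos by (simp add: field_simps)
    consider "\<alpha> \<in> L" | "\<alpha> \<in> K" | "real (\<alpha> 1) \<ge> d" "real (\<alpha> 2) \<ge> d"
      using \<alpha> unfolding L_def K_def by force
    then show ?thesis
    proof cases
      case 1
      have "w \<le> u \<alpha>" using w(2) fin 1 unfolding v'_def by (auto elim!: order_trans)
      then have "w * (d * (real (\<alpha> 2) - real (\<alpha> 1))) \<le> real (\<alpha> 2) - d"
        unfolding u_def using L[OF 1] d_pos by (simp add: pos_le_divide_eq)
      then show ?thesis by (intro goal) (simp add: algebra_simps)
    next
      case 2
      have "l \<alpha> \<le> w" using w(1) fin 2 unfolding v_def by (auto elim: order_trans[rotated])
      then have "d - real (\<alpha> 2) \<le> w * (d * (real (\<alpha> 1) - real (\<alpha> 2)))"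
        unfolding l_def using K[OF 2] d_pos by (simp add: pos_divide_le_eq)
      then show ?thesis by (intro goal) (simp add: algebra_simps)
    next
      case 3
      have "w * d + (1 / d - w) * d \<le> w * real (\<alpha> 1) + (1 / d - w) * real (\<alpha> 2)"
        using 3 w v0 v1 by (intro add_mono mult_left_mono) auto
      then show ?thesis using d_pos by (simp add: algebra_simps)
    qed
  qed
  have supp: "w * real (\<alpha> 1) + (1 / d - w) * real (\<alpha> 2) \<ge> 1" if w: "v \<le> w" "w \<le> v'" and \<alpha>: "\<alpha> \<in> A" for w \<alpha>
  proof -
    obtain \<beta> where \<beta>: "\<beta> \<in> A0" "\<And>i. \<beta> i \<le> \<alpha> i" using A0(3)[OF \<alpha>] by blast
    have "1 \<le> w * real (\<beta> 1) + (1 / d - w) * real (\<beta> 2)" by (rule supp0[OF w \<beta>(1)])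
    also have "\<dots> \<le> w * real (\<alpha> 1) + (1 / d - w) * real (\<alpha> 2)"
      using w v0 v1 \<beta>(2) by (intro add_mono mult_left_mono) auto
    finally show ?thesis .
  qed
  show ?thesis using v0 v1 vv supp by (intro exI[of _ v] exI[of _ v']) auto
qed

text \<open>A segment of \<open>N\<close> around \<open>p\<close> lies in every supporting line
  through \<open>p\<close>; hence the face cut out by such a line has dimension 1 and
  \<open>p\<close> in its relative interior, which identifies the central face. The last two
  conclusions hold because \<open>p\<close> is strictly between two points of the edge: a coordinate
  that varies along it falls below \<open>d\<close> on one side.\<close>

lemma edge_of_not_extreme:
  assumes notext: "\<not> p extreme_point_of N"
    and w: "w1 \<ge> 0" "w2 \<ge> 0" "w1 + w2 = 1 / d" and sup: "\<And>z. z \<in> N \<Longrightarrow> w1 * z $ 1 + w2 * z $ 2 \<ge> 1"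
  defines "F \<equiv> {z\<in>N. w1 * z $ 1 + w2 * z $ 2 = 1}"
  shows "(THE F. F face_of N \<and> p \<in> rel_interior F) = F" "aff_dim F = 1"
    "w2 > 0 \<Longrightarrow> \<exists>z\<in>F. z $ 1 < d" "w1 > 0 \<Longrightarrow> \<exists>z\<in>F. z $ 2 < d"
proof -
  define a :: "real^2" where "a = (\<chi> i. if i = 1 then w1 else w2)"
  have a: "a \<bullet> x = w1 * x $ 1 + w2 * x $ 2" for x by (simp add: a_def inner_vec_def sum_2)
  have F: "F = N \<inter> {x. a \<bullet> x = 1}" unfolding F_def a by auto
  have face: "F face_of N" unfolding F
    by (rule face_of_Int_supporting_hyperplane_ge[OF N_convex]) (simp add: a sup)
  have pF: "p \<in> F" unfolding F_def using p_in_N w(3) d_pos by (simp add: distrib_right[symmetric])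
  obtain q r where qr: "q \<in> N" "r \<in> N" "p \<in> open_segment q r"
    using notext p_in_N unfolding extreme_point_of_def by blast
  have qrF: "q \<in> F" "r \<in> F" using face qr pF unfolding face_of_def by blast+
  have ne: "q \<noteq> r" using qr(3) by auto
  obtain t where t: "0 < t" "t < 1" "p = (1 - t) *\<^sub>R q + t *\<^sub>R r" using qr(3) unfolding in_segment by auto
  have qp: "q \<noteq> p" using qr(3) by (auto simp: open_segment_def)
  have "a \<noteq> 0"
  proof
    assume "a = 0"
    then have "w1 = 0" "w2 = 0" using a[of "axis 1 1"] a[of "axis 2 1"] by (auto simp: axis_def)
    then show False using w(3) d_pos by simp
  qed
  then have "aff_dim {x. a \<bullet> x = 1} = 1" by (simp add: aff_dim_hyperplane)
  then have le1: "aff_dim F \<le> 1" using aff_dim_subset[of F "{x. a \<bullet> x = 1}"] F by auto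
  have "closed_segment q r \<subseteq> F"
    using qrF face_of_imp_convex[OF face] by (simp add: closed_segment_subset)
  moreover have ad: "aff_dim (closed_segment q r) = 1"
  proof -
    have "aff_dim (convex hull {q, r}) = aff_dim {q, r}" by (rule aff_dim_convex_hull)
    then show ?thesis using ne by (simp add: segment_convex_hull)
  qed
  ultimately have ge1: "1 \<le> aff_dim F" using aff_dim_subset by metis
  show dim: "aff_dim F = 1" using le1 ge1 by simp
  have "affine hull closed_segment q r = affine hull F"
  proof (rule affine_dim_equal)
    show "affine hull closed_segment q r \<subseteq> affine hull F"
      by (rule hull_mono) fact
    show "aff_dim (affine hull closed_segment q r) = aff_dim (affine hull F)"
      unfolding aff_dim_affine_hull using ad dim by simp
    have "q \<in> affine hull closed_segment q r" by (rule hull_inc) simp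
    then show "affine hull closed_segment q r \<noteq> {}" by blast
  qed (rule affine_affine_hull)+
  then have "rel_interior (closed_segment q r) \<subseteq> rel_interior F"
    by (rule subset_rel_interior[OF \<open>closed_segment q r \<subseteq> F\<close>])
  then have "p \<in> rel_interior F" using qr(3) ne by (auto simp: rel_interior_closed_segment)
  then show "(THE F. F face_of N \<and> p \<in> rel_interior F) = F" using central_unique[OF face] by simp
  have comb: "d = (1 - t) * q $ i + t * r $ i" for i
    using arg_cong[OF t(3), of "\<lambda>x. x $ i"] by simp
  have low: "q $ i < d \<or> r $ i < d" if "q $ i \<noteq> d" for i
  proof (rule ccontr)
    assume "\<not> ?thesis"
    then have "q $ i > d" "r $ i \<ge> d" using that by auto
    then have "(1 - t) * q $ i > (1 - t) * d" "t * r $ i \<ge> t * d" using t by auto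
    then show False using comb[of i] by (simp add: algebra_simps)
  qed
  have line: "w1 * (q $ 1 - d) + w2 * (q $ 2 - d) = 0"
    using qrF(1) pF unfolding F_def by (simp add: algebra_simps)
  show "\<exists>z\<in>F. z $ 1 < d" if "w2 > 0"
  proof -
    have "q $ 1 \<noteq> d" using line that qp eq_p_iff[of q] by auto
    then show ?thesis using low[of 1] qrF by blast
  qed
  show "\<exists>z\<in>F. z $ 2 < d" if "w1 > 0"
  proof -
    have "q $ 2 \<noteq> d" using line that qp eq_p_iff[of q] by auto
    then show ?thesis using low[of 2] qrF by blast
  qed
qed

lemma compact_slanted_edge:
  assumes w: "w1 > 0" "w2 > 0"
  shows "compact {z\<in>N. w1 * z $ 1 + w2 * z $ 2 = 1}"
proof -
  have "closed {z :: real^2. w1 * z $ 1 + w2 * z $ 2 = 1}"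
    by (intro closed_Collect_eq continuous_intros)
  then have "closed (N \<inter> {z. w1 * z $ 1 + w2 * z $ 2 = 1})" using N_closed by (rule closed_Int[rotated])
  moreover have "N \<inter> {z. w1 * z $ 1 + w2 * z $ 2 = 1} \<subseteq> cbox 0 (\<chi> i. if i = 1 then 1 / w1 else 1 / w2)"
  proof
    fix z assume z: "z \<in> N \<inter> {z. w1 * z $ 1 + w2 * z $ 2 = 1}"
    then have "0 \<le> z $ 1" "0 \<le> z $ 2" using N_nonneg by auto
    moreover from this have "0 \<le> w1 * z $ 1" "0 \<le> w2 * z $ 2" using w by simp_all
    then have "w1 * z $ 1 \<le> 1" "w2 * z $ 2 \<le> 1" using z by auto
    ultimately show "z \<in> cbox 0 (\<chi> i. if i = 1 then 1 / w1 else 1 / w2)"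
      using w by (simp add: mem_box_cart forall_2 field_simps)
  qed
  then have "bounded (N \<inter> {z. w1 * z $ 1 + w2 * z $ 2 = 1})" using bounded_cbox bounded_subset by blast
  ultimately have "compact (N \<inter> {z. w1 * z $ 1 + w2 * z $ 2 = 1})" by (simp add: compact_eq_bounded_closed)
  then show ?thesis by (simp add: Int_def)
qed

text \<open>A supporting line parallel to an axis contains a ray from \<open>p\<close>, because
  \<open>N\<close> is upward closed.\<close>

lemma not_compact_axis_edge:
  assumes w: "w1 + w2 = 1 / d" "w1 = 0 \<or> w2 = 0"
  shows "\<not> compact {z\<in>N. w1 * z $ 1 + w2 * z $ 2 = 1}"
proof
  assume "compact {z\<in>N. w1 * z $ 1 + w2 * z $ 2 = 1}"
  then have "bounded {z\<in>N. w1 * z $ 1 + w2 * z $ 2 = 1}" by (rule compact_imp_bounded)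
  then obtain B where B: "\<forall>z\<in>{z\<in>N. w1 * z $ 1 + w2 * z $ 2 = 1}. norm z \<le> B"
    unfolding bounded_iff by (elim exE)
  define j :: 2 where "j = (if w1 = 0 then 1 else 2)"
  define z where "z = p + axis j (\<bar>B\<bar> + 1)"
  have "z \<in> N" unfolding z_def by (rule N_upward[OF p_in_N]) (simp add: axis_def)
  moreover have "w1 * z $ 1 + w2 * z $ 2 = 1"
  proof (cases "w1 = 0")
    case True
    then have "z $ 2 = d" "w2 = 1 / d" using w unfolding z_def j_def by (auto simp: axis_def)
    then show ?thesis using True d_pos by simp
  next
    case False
    then have "z $ 1 = d" "w1 = 1 / d" "w2 = 0" using w unfolding z_def j_def by (auto simp: axis_def)
    then show ?thesis using d_pos by simp
  qed
  ultimately have "norm z \<le> B" using B by simp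
  moreover have "\<bar>z $ j\<bar> \<le> norm z" by (rule component_le_norm_cart)
  moreover have "z $ j \<ge> \<bar>B\<bar> + 1" using d_pos unfolding z_def by (simp add: axis_def)
  ultimately show False by linarith
qed

end

section \<open>Leading terms of asymptotic expansions\<close>

text \<open>\<open>- ln\<close> in place of \<open>ln\<close> keeps the scale positive near 0; the
  sign is moved into the leading constant.\<close>

definition growth_scale :: "real \<Rightarrow> nat \<Rightarrow> real \<Rightarrow> real" where
  "growth_scale r m \<epsilon> = \<epsilon> powr r * (- ln \<epsilon>) ^ m"

lemma eventually_small_right: "e > 0 \<Longrightarrow> \<forall>\<^sub>F \<epsilon> :: real in at_right 0. 0 < \<epsilon> \<and> \<epsilon> < e"
  using eventually_at_right_real[of 0 e] by (auto elim: eventually_mono)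

lemma growth_scale_pos: "0 < \<epsilon> \<Longrightarrow> \<epsilon> < 1 \<Longrightarrow> growth_scale r m \<epsilon> > 0"
  unfolding growth_scale_def by simp

lemma tendsto_powr_at_right_0:
  assumes "s > 0"
  shows "((\<lambda>\<epsilon>::real. \<epsilon> powr s) \<longlongrightarrow> 0) (at_right 0)"
proof -
  have "((\<lambda>\<epsilon>::real. \<epsilon> powr s) \<longlongrightarrow> 0 powr s) (at_right 0)"
    by (rule tendsto_powr'[OF tendsto_ident_at tendsto_const]) (use assms in \<open>auto simp: eventually_at_filter\<close>)
  then show ?thesis by simp
qed

text \<open>A gap \<open>s\<close> between the exponents is split in two: one factor
  \<open>\<epsilon> powr (s / 2)\<close> absorbs the logarithm, the other tends to 0.\<close>

lemma growth_scale_quotient_tendsto_0: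
  assumes "r < r' \<or> (r = r' \<and> m' < m)" "m' \<le> 1"
  shows "((\<lambda>\<epsilon>. growth_scale r' m' \<epsilon> / growth_scale r m \<epsilon>) \<longlongrightarrow> 0) (at_right 0)"
  using assms(1)
proof
  assume r: "r < r'"
  define s where "s = r' - r"
  have s: "s > 0" unfolding s_def using r by simp
  show ?thesis
  proof (rule tendsto_0_le[where K = 1])
    show "((\<lambda>\<epsilon>::real. (1 + 2 / s) * \<epsilon> powr (s / 2)) \<longlongrightarrow> 0) (at_right 0)"
      using s by (intro tendsto_mult_right_zero tendsto_powr_at_right_0) auto
    show "\<forall>\<^sub>F \<epsilon> in at_right 0. norm (growth_scale r' m' \<epsilon> / growth_scale r m \<epsilon>) \<le> norm ((1 + 2 / s) * \<epsilon> powr (s / 2)) * 1"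
      \<comment> \<open>Below \<open>exp (- 1)\<close> one has
        \<open>- ln \<epsilon> \<ge> 1\<close>, so powers of the logarithm are at least 1 and may be
        dropped from a denominator.\<close>
      using eventually_small_right[of "exp (- 1)", OF exp_gt_zero]
    proof eventually_elim
      case (elim \<epsilon>)
      have e1: "\<epsilon> < 1" using elim by (smt (verit) exp_less_one_iff)
      have "ln \<epsilon> < ln (exp (- 1))" using elim by (subst ln_less_cancel_iff) auto
      then have l: "- ln \<epsilon> \<ge> 1" by simp
      have "ln (1 / \<epsilon>) \<le> (1 / \<epsilon>) powr (s / 2) / (s / 2)"
        using elim e1 s by (intro ln_powr_bound) auto
      then have "- ln \<epsilon> \<le> \<epsilon> powr (- s / 2) * (2 / s)"
        using elim by (simp add: ln_div powr_divide powr_minus field_simps)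
      moreover have "(- ln \<epsilon>) ^ m' \<le> 1 + (- ln \<epsilon>)" using assms(2) l by (cases m') auto
      ultimately have "(- ln \<epsilon>) ^ m' \<le> 1 + \<epsilon> powr (- s / 2) * (2 / s)" by simp
      also have "1 \<le> \<epsilon> powr (- s / 2)" using elim e1 s powr_mono'[of "- s / 2" 0 \<epsilon>] by simp
      then have "1 + \<epsilon> powr (- s / 2) * (2 / s) \<le> (1 + 2 / s) * \<epsilon> powr (- s / 2)"
        by (simp add: algebra_simps)
      finally have up: "(- ln \<epsilon>) ^ m' \<le> (1 + 2 / s) * \<epsilon> powr (- s / 2)" .
      have "growth_scale r' m' \<epsilon> / growth_scale r m \<epsilon> = \<epsilon> powr s * (- ln \<epsilon>) ^ m' / (- ln \<epsilon>) ^ m"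
        unfolding growth_scale_def s_def using elim by (simp add: powr_diff)
      also have "\<dots> \<le> \<epsilon> powr s * (- ln \<epsilon>) ^ m' / 1"
      proof (intro frac_le mult_nonneg_nonneg)
        show "0 \<le> (- ln \<epsilon>) ^ m'" using l by (intro zero_le_power) simp
        show "1 \<le> (- ln \<epsilon>) ^ m" using l by (intro one_le_power)
      qed auto
      also have "\<dots> \<le> \<epsilon> powr s * ((1 + 2 / s) * \<epsilon> powr (- s / 2))" using up by (simp add: mult_left_mono)
      also have "\<dots> = (1 + 2 / s) * (\<epsilon> powr s * \<epsilon> powr (- s / 2))" by simp
      also have "\<epsilon> powr s * \<epsilon> powr (- s / 2) = \<epsilon> powr (s / 2)" by (simp add: powr_add[symmetric])
      finally show ?case using growth_scale_pos[of \<epsilon> r m] growth_scale_pos[of \<epsilon> r' m'] elim e1 s by simp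
    qed
  qed
next
  assume rm: "r = r' \<and> m' < m"
  show ?thesis
  proof (rule tendsto_0_le[where K = 1])
    have "filterlim (\<lambda>\<epsilon>::real. - ln \<epsilon>) at_top (at_right 0)"
      using ln_at_0 by (simp add: filterlim_uminus_at_top)
    then show "((\<lambda>\<epsilon>::real. inverse (- ln \<epsilon>)) \<longlongrightarrow> 0) (at_right 0)"
      by (rule tendsto_inverse_0_at_top)
    show "\<forall>\<^sub>F \<epsilon> in at_right 0. norm (growth_scale r' m' \<epsilon> / growth_scale r m \<epsilon>) \<le> norm (inverse (- ln \<epsilon>)) * 1"
      using eventually_small_right[of "exp (- 1)", OF exp_gt_zero]
    proof eventually_elim
      case (elim \<epsilon>)
      have e1: "\<epsilon> < 1" using elim by (smt (verit) exp_less_one_iff)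
      have "ln \<epsilon> < ln (exp (- 1))" using elim by (subst ln_less_cancel_iff) auto
      then have l: "- ln \<epsilon> \<ge> 1" by simp
      have "growth_scale r' m' \<epsilon> / growth_scale r m \<epsilon> = (- ln \<epsilon>) ^ m' / (- ln \<epsilon>) ^ m"
        unfolding growth_scale_def using rm elim by simp
      also have "(- ln \<epsilon>) ^ m = (- ln \<epsilon>) ^ m' * (- ln \<epsilon>) ^ (m - m')"
        using rm by (simp add: power_add[symmetric])
      also have "(- ln \<epsilon>) ^ m' / ((- ln \<epsilon>) ^ m' * (- ln \<epsilon>) ^ (m - m')) = 1 / (- ln \<epsilon>) ^ (m - m')"
        using l by simp
      also have "\<dots> \<le> 1 / (- ln \<epsilon>) ^ 1"
        using l rm power_increasing[of 1 "m - m'" "- ln \<epsilon>"] by (intro frac_le) auto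
      finally show ?case using growth_scale_pos[of \<epsilon> r m] growth_scale_pos[of \<epsilon> r' m'] elim e1 l
        by (simp add: inverse_eq_divide)
    qed
  qed
qed

text \<open>What is extracted from the asymptotic expansion. In the plane the multiplicity is at
  most 1, and \<open>L\<close> is positive because the integrals are nonnegative. For index infinity
  the integral is smaller than every power.\<close>

definition growth_limit :: "(real \<Rightarrow> real) \<Rightarrow> ereal \<Rightarrow> nat \<Rightarrow> bool" where
  "growth_limit J \<rho> m \<longleftrightarrow>
     (\<rho> = \<infinity> \<and> (\<forall>r. ((\<lambda>\<epsilon>. J \<epsilon> / \<epsilon> powr r) \<longlongrightarrow> 0) (at_right 0))) \<or>
     (\<exists>r L. \<rho> = ereal r \<and> L > 0 \<and> m \<le> 1 \<and> ((\<lambda>\<epsilon>. J \<epsilon> / growth_scale r m \<epsilon>) \<longlongrightarrow> L) (at_right 0))"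

lemma growth_limit_negligible:
  assumes K: "growth_limit K \<sigma> k" and lt: "ereal r < \<sigma> \<or> ereal r = \<sigma> \<and> k < m"
  shows "((\<lambda>\<epsilon>. K \<epsilon> / growth_scale r m \<epsilon>) \<longlongrightarrow> 0) (at_right 0)"
proof -
  from K consider (inf) "\<forall>r. ((\<lambda>\<epsilon>. K \<epsilon> / \<epsilon> powr r) \<longlongrightarrow> 0) (at_right 0)"
    | (fin) s L where "\<sigma> = ereal s" "k \<le> 1" "((\<lambda>\<epsilon>. K \<epsilon> / growth_scale s k \<epsilon>) \<longlongrightarrow> L) (at_right 0)"
    unfolding growth_limit_def by blast
  then show ?thesis
  proof cases
    case inf
    have "((\<lambda>\<epsilon>. K \<epsilon> / \<epsilon> powr r) \<longlongrightarrow> 0) (at_right 0)" using inf by blast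
    then show ?thesis
    proof (rule tendsto_0_le[where K = 1])
      show "\<forall>\<^sub>F \<epsilon> in at_right 0. norm (K \<epsilon> / growth_scale r m \<epsilon>) \<le> norm (K \<epsilon> / \<epsilon> powr r) * 1"
        using eventually_small_right[of "exp (- 1)", OF exp_gt_zero]
      proof eventually_elim
        case (elim \<epsilon>)
        have "ln \<epsilon> < ln (exp (- 1))" using elim by (subst ln_less_cancel_iff) auto
        then have "1 \<le> \<bar>(- ln \<epsilon>) ^ m\<bar>" unfolding power_abs by (intro one_le_power) simp
        then have "\<epsilon> powr r * 1 \<le> \<bar>growth_scale r m \<epsilon>\<bar>"
          unfolding growth_scale_def abs_mult using elim by (intro mult_mono) simp_all
        then show ?case using elim by (simp add: frac_le)
      qed
    qed
  next
    case fin
    have "r < s \<or> r = s \<and> k < m" using lt fin(1) by auto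
    then have "((\<lambda>\<epsilon>. growth_scale s k \<epsilon> / growth_scale r m \<epsilon>) \<longlongrightarrow> 0) (at_right 0)"
      using fin(2) by (rule growth_scale_quotient_tendsto_0)
    from tendsto_mult[OF fin(3) this]
    have "((\<lambda>\<epsilon>. K \<epsilon> / growth_scale s k \<epsilon> * (growth_scale s k \<epsilon> / growth_scale r m \<epsilon>)) \<longlongrightarrow> 0) (at_right 0)"
      by simp
    then show ?thesis
    proof (rule Lim_transform_eventually)
      show "\<forall>\<^sub>F \<epsilon> in at_right 0. K \<epsilon> / growth_scale s k \<epsilon> * (growth_scale s k \<epsilon> / growth_scale r m \<epsilon>) = K \<epsilon> / growth_scale r m \<epsilon>"
        using eventually_small_right[of 1, OF zero_less_one]
      proof eventually_elim
        case (elim \<epsilon>)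
        then show ?case using growth_scale_pos[of \<epsilon> s k] by simp
      qed
    qed
  qed
qed

lemma growth_limit_lower:
  assumes J: "growth_limit J \<rho> m" and c: "c > 0"
    and low: "\<forall>\<^sub>F \<epsilon> in at_right 0. c * growth_scale r0 m0 \<epsilon> \<le> J \<epsilon>"
  shows "\<rho> < ereal r0 \<or> \<rho> = ereal r0 \<and> m0 \<le> m"
proof (rule ccontr)
  assume "\<not> ?thesis"
  then have "ereal r0 < \<rho> \<or> ereal r0 = \<rho> \<and> m < m0" by auto
  from growth_limit_negligible[OF J this] have "c \<le> 0"
  proof (rule tendsto_lowerbound)
    show "\<forall>\<^sub>F \<epsilon> in at_right 0. c \<le> J \<epsilon> / growth_scale r0 m0 \<epsilon>"
      using low eventually_small_right[of 1, OF zero_less_one]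
      by eventually_elim (simp add: growth_scale_pos pos_le_divide_eq)
  qed simp
  then show False using c by simp
qed

lemma growth_limit_upper:
  assumes J: "growth_limit J (ereal r) m" and m0: "m0 \<le> 1"
    and up: "\<forall>\<^sub>F \<epsilon> in at_right 0. J \<epsilon> \<le> C * growth_scale r0 m0 \<epsilon>"
  shows "r > r0 \<or> r = r0 \<and> m \<le> m0"
proof (rule ccontr)
  assume "\<not> ?thesis"
  then have "r < r0 \<or> r = r0 \<and> m0 < m" by auto
  then have q: "((\<lambda>\<epsilon>. growth_scale r0 m0 \<epsilon> / growth_scale r m \<epsilon>) \<longlongrightarrow> 0) (at_right 0)"
    using m0 by (rule growth_scale_quotient_tendsto_0)
  obtain L where L: "L > 0" "((\<lambda>\<epsilon>. J \<epsilon> / growth_scale r m \<epsilon>) \<longlongrightarrow> L) (at_right 0)"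
    using J unfolding growth_limit_def by auto
  have "((\<lambda>\<epsilon>. C * (growth_scale r0 m0 \<epsilon> / growth_scale r m \<epsilon>)) \<longlongrightarrow> C * 0) (at_right 0)"
    by (intro tendsto_mult_left q)
  then have "L \<le> C * 0"
  proof (rule tendsto_le[rotated, OF _ L(2)])
    show "\<forall>\<^sub>F \<epsilon> in at_right 0. J \<epsilon> / growth_scale r m \<epsilon> \<le> C * (growth_scale r0 m0 \<epsilon> / growth_scale r m \<epsilon>)"
      using up eventually_small_right[of 1, OF zero_less_one]
    proof eventually_elim
      case (elim \<epsilon>)
      then show ?case using growth_scale_pos[of \<epsilon> r m] by (simp add: divide_right_mono)
    qed
  qed simp
  then show False using L(1) by simp
qed

text \<open>Positive leading constants cannot cancel, so the sum obeys the rule by which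
  \<open>has_abs_growth_index\<close> combines the data of \<open>f\<close> and
  \<open>- f\<close>.\<close>

lemma growth_limit_sum:
  assumes 1: "growth_limit J1 \<rho>1 m1" and 2: "growth_limit J2 \<rho>2 m2"
  shows "growth_limit (\<lambda>\<epsilon>. J1 \<epsilon> + J2 \<epsilon>) (min \<rho>1 \<rho>2)
     (if \<rho>1 < \<rho>2 then m1 else if \<rho>2 < \<rho>1 then m2 else max m1 m2)"
proof -
  have dominant: "growth_limit (\<lambda>\<epsilon>. K1 \<epsilon> + K2 \<epsilon>) \<sigma>1 k1"
    if K1: "growth_limit K1 \<sigma>1 k1" and K2: "growth_limit K2 \<sigma>2 k2" and lt: "\<sigma>1 < \<sigma>2 \<or> \<sigma>1 = \<sigma>2 \<and> \<sigma>1 \<noteq> \<infinity> \<and> k2 < k1"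
    for K1 K2 \<sigma>1 \<sigma>2 k1 k2
  proof -
    obtain r L where r: "\<sigma>1 = ereal r" "L > 0" "k1 \<le> 1" "((\<lambda>\<epsilon>. K1 \<epsilon> / growth_scale r k1 \<epsilon>) \<longlongrightarrow> L) (at_right 0)"
      using K1 lt unfolding growth_limit_def by auto
    have "((\<lambda>\<epsilon>. K2 \<epsilon> / growth_scale r k1 \<epsilon>) \<longlongrightarrow> 0) (at_right 0)"
      using lt r(1) by (intro growth_limit_negligible[OF K2]) auto
    from tendsto_add[OF r(4) this] show ?thesis
      unfolding growth_limit_def using r(1-3) by (auto simp: add_divide_distrib)
  qed
  have comm: "(\<lambda>\<epsilon>. J1 \<epsilon> + J2 \<epsilon>) = (\<lambda>\<epsilon>. J2 \<epsilon> + J1 \<epsilon>)" by (simp add: add.commute)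
  consider "\<rho>1 < \<rho>2" | "\<rho>2 < \<rho>1" | "\<rho>1 = \<rho>2" "\<rho>1 = \<infinity>" | "\<rho>1 = \<rho>2" "\<rho>1 \<noteq> \<infinity>" by force
  then show ?thesis
  proof cases
    case 1
    then show ?thesis using dominant[OF assms(1,2)] by (simp add: min_def less_imp_le)
  next
    case 2
    then show ?thesis using dominant[OF assms(2,1)] unfolding comm by (auto simp: min_def)
  next
    case 3
    have "\<forall>r. ((\<lambda>\<epsilon>. J1 \<epsilon> / \<epsilon> powr r) \<longlongrightarrow> 0) (at_right 0)" "\<forall>r. ((\<lambda>\<epsilon>. J2 \<epsilon> / \<epsilon> powr r) \<longlongrightarrow> 0) (at_right 0)"
      using assms 3 unfolding growth_limit_def by auto
    then have "\<forall>r. ((\<lambda>\<epsilon>. (J1 \<epsilon> + J2 \<epsilon>) / \<epsilon> powr r) \<longlongrightarrow> 0) (at_right 0)"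
      by (auto simp: add_divide_distrib intro: tendsto_add_zero)
    then show ?thesis using 3 unfolding growth_limit_def by simp
  next
    case 4
    consider "m2 < m1" | "m1 < m2" | "m1 = m2" by force
    then show ?thesis
    proof cases
      case 1
      then show ?thesis using dominant[OF assms(1,2)] 4 by simp
    next
      case 2
      then show ?thesis using dominant[OF assms(2,1)] 4 unfolding comm by simp
    next
      case 3
      obtain r L1 where 1: "\<rho>1 = ereal r" "L1 > 0" "m1 \<le> 1" "((\<lambda>\<epsilon>. J1 \<epsilon> / growth_scale r m1 \<epsilon>) \<longlongrightarrow> L1) (at_right 0)"
        using assms(1) 4 unfolding growth_limit_def by auto
      obtain L2 where 2: "L2 > 0" "((\<lambda>\<epsilon>. J2 \<epsilon> / growth_scale r m1 \<epsilon>) \<longlongrightarrow> L2) (at_right 0)"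
        using assms(2) 4 3 1(1) unfolding growth_limit_def by auto
      from tendsto_add[OF 1(4) 2(2)] have "growth_limit (\<lambda>\<epsilon>. J1 \<epsilon> + J2 \<epsilon>) \<rho>1 m1"
        unfolding growth_limit_def using 1(1-3) 2(1)
        by (intro disjI2 exI[of _ r] exI[of _ "L1 + L2"]) (auto simp: add_divide_distrib)
      then show ?thesis using 3 4 by simp
    qed
  qed
qed

lemma growth_integral_nonneg: "(\<And>x. \<phi> x \<ge> 0) \<Longrightarrow> growth_integral f \<phi> \<epsilon> \<ge> 0"
  unfolding growth_integral_def set_lebesgue_integral_def
  by (intro Bochner_Integration.integral_nonneg) (auto simp: indicator_def)

lemma pos_rat_progression_strict_mono: "pos_rat_progression r \<Longrightarrow> i < j \<Longrightarrow> r i < r j"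
  unfolding pos_rat_progression_def by auto

text \<open>Truncation at the first \<open>j\<close> with a nonzero coefficient isolates the leading
  term, and nonnegativity of the integral fixes its sign. If all coefficients vanish, the remainder
  beats every power, since the progression \<open>r\<close> is unbounded.\<close>

lemma growth_limit_of_expansion:
  fixes f :: "real^2 \<Rightarrow> real"
  assumes r: "pos_rat_progression r" and exp: "growth_expansion f \<phi> r c" and nn: "\<And>x. \<phi> x \<ge> 0"
  shows "growth_limit (growth_integral f \<phi>) (leading_exponent CARD(2) r c) (leading_multiplicity CARD(2) r c)"
proof -
  define P where "P j \<longleftrightarrow> (\<exists>i<2. c i j \<noteq> 0)" for j
  define I where "I = growth_integral f \<phi>"
  have exp': "((\<lambda>\<epsilon>. (I \<epsilon> - (\<Sum>j\<le>n. (c 0 j + c 1 j * ln \<epsilon>) * \<epsilon> powr r j)) / \<epsilon> powr r n) \<longlongrightarrow> 0) (at_right 0)" for n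
    using smalloD_tendsto[OF exp[unfolded growth_expansion_def, rule_format, of n]]
    by (simp add: I_def numeral_2_eq_2 distrib_right mult.assoc)
  have inj: "r i = r j \<longleftrightarrow> i = j" for i j
    using pos_rat_progression_strict_mono[OF r, of i j] pos_rat_progression_strict_mono[OF r, of j i]
    by (cases i j rule: linorder_cases) auto
  show ?thesis
  proof (cases "\<exists>j. P j")
    case False
    then have c0: "c i j = 0" if "i < 2" for i j using that unfolding P_def by auto
    have lead: "leading_exponent CARD(2) r c = \<infinity>"
      unfolding leading_exponent_def using c0 by (auto simp: top_ereal_def[symmetric])
    have "((\<lambda>\<epsilon>. I \<epsilon> / \<epsilon> powr t) \<longlongrightarrow> 0) (at_right 0)" for t
    proof -
      obtain a b where ab: "b > 0" "\<And>j. r j = a + real j * b" using r unfolding pos_rat_progression_def by blast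
      obtain n where "real n > (t - a) / b" using reals_Archimedean2 by blast
      then have n: "r n > t" using ab by (simp add: field_simps)
      have "((\<lambda>\<epsilon>. I \<epsilon> / \<epsilon> powr r n) \<longlongrightarrow> 0) (at_right 0)" using exp'[of n] c0 by simp
      then show ?thesis
      proof (rule tendsto_0_le[where K = 1])
        show "\<forall>\<^sub>F \<epsilon> in at_right 0. norm (I \<epsilon> / \<epsilon> powr t) \<le> norm (I \<epsilon> / \<epsilon> powr r n) * 1"
          using eventually_small_right[of 1, OF zero_less_one]
        proof eventually_elim
          case (elim \<epsilon>)
          have "\<epsilon> powr r n \<le> \<epsilon> powr t" using elim n by (intro powr_mono') auto
          then show ?case using elim by (simp add: divide_left_mono)
        qed
      qed
    qed
    then show ?thesis unfolding growth_limit_def lead I_def[symmetric] by simp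
  next
    case True
    define j0 where "j0 = (LEAST j. P j)"
    have j0: "P j0" unfolding j0_def using True by (rule LeastI_ex)
    have before: "c i j = 0" if "j < j0" "i < 2" for i j
      using not_less_Least[of j P] that unfolding j0_def P_def by auto
    have lead: "leading_exponent CARD(2) r c = ereal (r j0)"
      unfolding leading_exponent_def
    proof (rule antisym)
      show "Inf {ereal (r j) |i j. i < CARD(2) \<and> c i j \<noteq> 0} \<le> ereal (r j0)"
        using j0 unfolding P_def by (intro Inf_lower) auto
      show "ereal (r j0) \<le> Inf {ereal (r j) |i j. i < CARD(2) \<and> c i j \<noteq> 0}"
      proof (rule Inf_greatest)
        fix x assume "x \<in> {ereal (r j) |i j. i < CARD(2) \<and> c i j \<noteq> 0}"
        then obtain i j where ij: "x = ereal (r j)" "i < 2" "c i j \<noteq> 0" by auto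
        then have "j0 \<le> j" using before by (meson not_le)
        then show "ereal (r j0) \<le> x" using ij(1) pos_rat_progression_strict_mono[OF r, of j0 j]
          by (cases "j = j0") auto
      qed
    qed
    define k where "k = (if c 1 j0 \<noteq> 0 then 1 else 0 :: nat)"
    have mult: "leading_multiplicity CARD(2) r c = k"
    proof -
      have "{i. i < CARD(2) \<and> (\<exists>j. ereal (r j) = leading_exponent CARD(2) r c \<and> c i j \<noteq> 0)} = {i. i < 2 \<and> c i j0 \<noteq> 0}"
        unfolding lead by (auto simp: inj)
      moreover have "Max {i. i < 2 \<and> c i j0 \<noteq> 0} = k"
      proof (rule Max_eqI)
        show "finite {i. i < 2 \<and> c i j0 \<noteq> 0}" by simp
        show "y \<le> k" if "y \<in> {i. i < 2 \<and> c i j0 \<noteq> 0}" for y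
          using that unfolding k_def by (auto simp: less_2_cases_iff)
        show "k \<in> {i. i < 2 \<and> c i j0 \<noteq> 0}"
          using j0 unfolding k_def P_def by (auto simp: less_2_cases_iff)
      qed
      ultimately show ?thesis unfolding leading_multiplicity_def lead by simp
    qed
    \<comment> \<open>The sign converts \<open>ln \<epsilon> ^ k\<close> into the positive
      \<open>(- ln \<epsilon>) ^ k\<close> of \<open>growth_scale\<close>.\<close>
    define L where "L = c k j0 * (- 1) ^ k"
    have L0: "L \<noteq> 0" using j0 unfolding L_def k_def P_def by (auto simp: less_2_cases_iff)
    have rem: "((\<lambda>\<epsilon>. (I \<epsilon> - (c 0 j0 + c 1 j0 * ln \<epsilon>) * \<epsilon> powr r j0) / \<epsilon> powr r j0) \<longlongrightarrow> 0) (at_right 0)"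
    proof -
      have "(\<Sum>j\<le>j0. (c 0 j + c 1 j * ln \<epsilon>) * \<epsilon> powr r j) = (c 0 j0 + c 1 j0 * ln \<epsilon>) * \<epsilon> powr r j0" for \<epsilon>
        using before by (simp add: lessThan_Suc_atMost[symmetric])
      then show ?thesis using exp'[of j0] by simp
    qed
    have inv_ln: "((\<lambda>\<epsilon>::real. inverse (- ln \<epsilon>)) \<longlongrightarrow> 0) (at_right 0)"
    proof -
      have "filterlim (\<lambda>\<epsilon>::real. - ln \<epsilon>) at_top (at_right 0)"
        using ln_at_0 by (simp add: filterlim_uminus_at_top)
      then show ?thesis by (rule tendsto_inverse_0_at_top)
    qed
    have lim: "((\<lambda>\<epsilon>. I \<epsilon> / growth_scale (r j0) k \<epsilon>) \<longlongrightarrow> L) (at_right 0)"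
    proof (cases "c 1 j0 = 0")
      case True
      have k0: "k = 0" unfolding k_def using True by simp
      have "((\<lambda>\<epsilon>. (I \<epsilon> - c 0 j0 * \<epsilon> powr r j0) / \<epsilon> powr r j0 + c 0 j0) \<longlongrightarrow> 0 + c 0 j0) (at_right 0)"
        using rem True by (intro tendsto_add tendsto_const) simp
      then have "((\<lambda>\<epsilon>. (I \<epsilon> - c 0 j0 * \<epsilon> powr r j0) / \<epsilon> powr r j0 + c 0 j0) \<longlongrightarrow> L) (at_right 0)"
        unfolding L_def k_def using True by simp
      then show ?thesis
      proof (rule Lim_transform_eventually)
        show "\<forall>\<^sub>F \<epsilon> in at_right 0. (I \<epsilon> - c 0 j0 * \<epsilon> powr r j0) / \<epsilon> powr r j0 + c 0 j0 = I \<epsilon> / growth_scale (r j0) k \<epsilon>"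
          using eventually_small_right[of 1, OF zero_less_one]
          by eventually_elim (simp add: growth_scale_def k0 diff_divide_distrib)
      qed
    next
      case False
      have "((\<lambda>\<epsilon>. ((I \<epsilon> - (c 0 j0 + c 1 j0 * ln \<epsilon>) * \<epsilon> powr r j0) / \<epsilon> powr r j0 + c 0 j0) * inverse (- ln \<epsilon>) - c 1 j0)
          \<longlongrightarrow> (0 + c 0 j0) * 0 - c 1 j0) (at_right 0)"
        by (intro tendsto_diff tendsto_mult tendsto_add tendsto_const rem inv_ln)
      then have "((\<lambda>\<epsilon>. ((I \<epsilon> - (c 0 j0 + c 1 j0 * ln \<epsilon>) * \<epsilon> powr r j0) / \<epsilon> powr r j0 + c 0 j0) * inverse (- ln \<epsilon>) - c 1 j0)
          \<longlongrightarrow> L) (at_right 0)"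
        unfolding L_def k_def using False by simp
      then show ?thesis
      proof (rule Lim_transform_eventually)
        show "\<forall>\<^sub>F \<epsilon> in at_right 0. ((I \<epsilon> - (c 0 j0 + c 1 j0 * ln \<epsilon>) * \<epsilon> powr r j0) / \<epsilon> powr r j0 + c 0 j0) * inverse (- ln \<epsilon>) - c 1 j0
            = I \<epsilon> / growth_scale (r j0) k \<epsilon>"
          using eventually_small_right[of 1, OF zero_less_one]
        proof eventually_elim
          case (elim \<epsilon>)
          then have "ln \<epsilon> < 0" by simp
          with elim False show ?case
            by (simp add: growth_scale_def k_def divide_simps) (simp add: algebra_simps)?
        qed
      qed
    qed
    have "L \<ge> 0"
    proof (rule tendsto_lowerbound[OF lim])
      show "\<forall>\<^sub>F \<epsilon> in at_right 0. 0 \<le> I \<epsilon> / growth_scale (r j0) k \<epsilon>"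
        using eventually_small_right[of 1, OF zero_less_one]
      proof eventually_elim
        case (elim \<epsilon>)
        then show ?case using growth_scale_pos[of \<epsilon> "r j0" k] growth_integral_nonneg[of \<phi> f \<epsilon>] nn
          unfolding I_def by simp
      qed
    qed simp
    moreover have "k \<le> 1" unfolding k_def by simp
    ultimately show ?thesis unfolding growth_limit_def lead mult I_def[symmetric] using L0 lim
      by (intro disjI2 exI[of _ "r j0"] exI[of _ L]) auto
  qed
qed

lemma growth_limit_of_abs_growth_index:
  fixes f :: "real^2 \<Rightarrow> real"
  assumes "has_abs_growth_index f \<rho> m"
  shows "\<exists>V. open V \<and> 0 \<in> V \<and> (\<forall>\<phi>. test_function V \<phi> \<longrightarrow>
     growth_limit (\<lambda>\<epsilon>. growth_integral f \<phi> \<epsilon> + growth_integral (\<lambda>x. - f x) \<phi> \<epsilon>) \<rho> m)"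
proof -
  have single: "\<exists>V. open V \<and> 0 \<in> V \<and> (\<forall>\<phi>. test_function V \<phi> \<longrightarrow> growth_limit (growth_integral g \<phi>) \<sigma> k)"
    if g: "has_growth_index g \<sigma> k" for g :: "real^2 \<Rightarrow> real" and \<sigma> k
  proof -
    obtain V r where V: "open V" "0 \<in> V" "pos_rat_progression r"
      and c: "\<And>\<phi>. test_function V \<phi> \<Longrightarrow> \<exists>c. growth_expansion g \<phi> r c \<and>
          \<sigma> = leading_exponent CARD(2) r c \<and> k = leading_multiplicity CARD(2) r c"
      using g unfolding has_growth_index_def by blast
    have "growth_limit (growth_integral g \<phi>) \<sigma> k" if "test_function V \<phi>" for \<phi>
      using c[OF that] growth_limit_of_expansion[OF V(3)] that unfolding test_function_def by blast
    then show ?thesis using V by blast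
  qed
  obtain \<rho>1 m1 \<rho>2 m2 where idx: "has_growth_index f \<rho>1 m1" "has_growth_index (\<lambda>x. - f x) \<rho>2 m2"
    "\<rho> = min \<rho>1 \<rho>2" "m = (if \<rho>1 < \<rho>2 then m1 else if \<rho>2 < \<rho>1 then m2 else max m1 m2)"
    using assms unfolding has_abs_growth_index_def by blast
  obtain V1 where V1: "open V1" "0 \<in> V1" "\<And>\<phi>. test_function V1 \<phi> \<Longrightarrow> growth_limit (growth_integral f \<phi>) \<rho>1 m1"
    using single[OF idx(1)] by blast
  obtain V2 where V2: "open V2" "0 \<in> V2" "\<And>\<phi>. test_function V2 \<phi> \<Longrightarrow> growth_limit (growth_integral (\<lambda>x. - f x) \<phi>) \<rho>2 m2"
    using single[OF idx(2)] by blast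
  have "growth_limit (\<lambda>\<epsilon>. growth_integral f \<phi> \<epsilon> + growth_integral (\<lambda>x. - f x) \<phi> \<epsilon>) \<rho> m"
    if \<phi>: "test_function (V1 \<inter> V2) \<phi>" for \<phi>
  proof -
    have "test_function V1 \<phi>" "test_function V2 \<phi>" using \<phi> unfolding test_function_def by auto
    then show ?thesis unfolding idx(3,4) by (intro growth_limit_sum V1(3) V2(3))
  qed
  then show ?thesis using V1(1,2) V2(1,2) by (intro exI[of _ "V1 \<inter> V2"]) auto
qed

section \<open>Growth integrals and sublevel sets\<close>

locale power_series_germ = double_power_series c R for c R +
  fixes S :: "real^2 \<Rightarrow> real"
  assumes S_eq: "\<And>x. (\<And>i. \<bar>x $ i\<bar> \<le> R) \<Longrightarrow> S x = double_sum c (x $ 1) (x $ 2)"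
begin

definition sup_box :: "real \<Rightarrow> (real^2) set" where
  "sup_box \<delta> = {x. \<forall>i. \<bar>x $ i\<bar> \<le> \<delta>}"

lemma sup_box_eq_cbox: "sup_box \<delta> = cbox (\<chi> i. - \<delta>) (\<chi> i. \<delta>)"
  unfolding sup_box_def by (auto simp: mem_box_cart abs_le_iff) (metis minus_le_iff)+

lemma sup_box_borel: "sup_box \<delta> \<in> sets borel"
  unfolding sup_box_eq_cbox by simp

lemma vec2_box_sublevel:
  assumes "\<delta> \<le> R"
  shows "vec2 -` {x\<in>sup_box \<delta>. \<bar>S x\<bar> < \<epsilon>} = box_sublevel c \<delta> \<epsilon>"
proof -
  have "p \<in> vec2 -` {x\<in>sup_box \<delta>. \<bar>S x\<bar> < \<epsilon>} \<longleftrightarrow> p \<in> box_sublevel c \<delta> \<epsilon>" for p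
  proof -
    have "S (vec2 p) = double_sum c (fst p) (snd p)" if "\<bar>fst p\<bar> \<le> \<delta>" "\<bar>snd p\<bar> \<le> \<delta>"
      using S_eq[of "vec2 p"] that assms by (simp add: forall_2 vec2_def)
    then show ?thesis unfolding sup_box_def box_sublevel_def by (cases p) (auto simp: forall_2)
  qed
  then show ?thesis by blast
qed

lemma S_measurable_on_box:
  assumes "\<delta> \<le> R"
  shows "\<exists>G\<in>borel_measurable borel. \<forall>x\<in>sup_box \<delta>. S x = G x"
proof -
  define G where "G x = (\<Sum>b. column_sum c b (x $ 1) * (x $ 2) ^ b)" for x :: "real^2"
  have [measurable]: "column_sum c b \<in> borel_measurable borel" for b
    unfolding column_sum_def by measurable
  have [measurable]: "(\<lambda>x :: real^2. x $ i) \<in> borel_measurable borel" for i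
    by (intro borel_measurable_continuous_onI continuous_intros)
  have "G \<in> borel_measurable borel" unfolding G_def by measurable
  moreover have "S x = G x" if "x \<in> sup_box \<delta>" for x
  proof -
    have le: "\<bar>x $ i\<bar> \<le> R" for i using that assms unfolding sup_box_def by (auto intro: order_trans)
    show ?thesis using S_eq[OF le] columns_sums_double_sum[OF le[of 1] le[of 2]]
      unfolding G_def by (simp add: sums_iff)
  qed
  ultimately show ?thesis by blast
qed

lemma box_level_measurable:
  assumes "\<delta> \<le> R"
  shows "{x\<in>sup_box \<delta>. 0 < S x \<and> S x < \<epsilon>} \<in> sets borel" "{x\<in>sup_box \<delta>. 0 < - S x \<and> - S x < \<epsilon>} \<in> sets borel"
    "{x\<in>sup_box \<delta>. \<bar>S x\<bar> < \<epsilon>} \<in> sets borel" "{x\<in>sup_box \<delta>. S x = 0} \<in> sets borel"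
proof -
  obtain G where G [measurable]: "G \<in> borel_measurable borel" and eq: "\<And>x. x \<in> sup_box \<delta> \<Longrightarrow> S x = G x"
    using S_measurable_on_box[OF assms] by blast
  have [measurable]: "sup_box \<delta> \<in> sets borel" by (rule sup_box_borel)
  have "{x\<in>sup_box \<delta>. 0 < S x \<and> S x < \<epsilon>} = sup_box \<delta> \<inter> {x\<in>space borel. 0 < G x \<and> G x < \<epsilon>}" using eq by auto
  also have "\<dots> \<in> sets borel" by measurable
  finally show "{x\<in>sup_box \<delta>. 0 < S x \<and> S x < \<epsilon>} \<in> sets borel" .
  have "{x\<in>sup_box \<delta>. 0 < - S x \<and> - S x < \<epsilon>} = sup_box \<delta> \<inter> {x\<in>space borel. 0 < - G x \<and> - G x < \<epsilon>}" using eq by auto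
  also have "\<dots> \<in> sets borel" by measurable
  finally show "{x\<in>sup_box \<delta>. 0 < - S x \<and> - S x < \<epsilon>} \<in> sets borel" .
  have "{x\<in>sup_box \<delta>. \<bar>S x\<bar> < \<epsilon>} = sup_box \<delta> \<inter> {x\<in>space borel. \<bar>G x\<bar> < \<epsilon>}" using eq by auto
  also have "\<dots> \<in> sets borel" by measurable
  finally show "{x\<in>sup_box \<delta>. \<bar>S x\<bar> < \<epsilon>} \<in> sets borel" .
  have "{x\<in>sup_box \<delta>. S x = 0} = sup_box \<delta> \<inter> {x\<in>space borel. G x = 0}" using eq by auto
  also have "\<dots> \<in> sets borel" by measurable
  finally show "{x\<in>sup_box \<delta>. S x = 0} \<in> sets borel" .
qed

lemma emeasure_box_finite: "emeasure lborel (sup_box \<delta>) < \<infinity>"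
  unfolding sup_box_eq_cbox by (rule emeasure_lborel_cbox_finite)

lemma fmeasurable_box_subset: "A \<subseteq> sup_box \<delta> \<Longrightarrow> A \<in> sets borel \<Longrightarrow> A \<in> fmeasurable lborel"
  using emeasure_box_finite[of \<delta>] emeasure_mono[of A "sup_box \<delta>" lborel] sup_box_borel[of \<delta>]
  by (intro fmeasurableI) (auto intro: le_less_trans)

lemma emeasure_box_level:
  assumes "\<delta> \<le> R"
  shows "emeasure lborel {x\<in>sup_box \<delta>. \<bar>S x\<bar> < \<epsilon>} = emeasure lborel (box_sublevel c \<delta> \<epsilon>)"
  using emeasure_vec2(2)[OF box_level_measurable(3)[OF assms]] vec2_box_sublevel[OF assms] by simp

text \<open>The bump vanishes outside the larger box, is at most a constant on it and at least
  \<open>a\<close> on the smaller one, so the sum of the two growth integrals is squeezed between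
  sublevel measures. The integrals leave out the points with \<open>S = 0\<close>; the lower bound
  therefore needs the zero set to be null.\<close>

lemma growth_limit_box_bounds:
  assumes idx: "has_abs_growth_index S \<rho> m" and \<delta>1: "\<delta>1 > 0"
    and null: "\<delta>2 > 0" "emeasure lborel {x\<in>sup_box \<delta>2. S x = 0} = 0" "\<delta>2 \<le> R"
  shows "\<exists>\<delta> \<delta>' a M J. 0 < \<delta>' \<and> \<delta>' \<le> \<delta> \<and> \<delta> \<le> R \<and> \<delta> \<le> \<delta>1 \<and> a > 0 \<and> M > 0 \<and> growth_limit J \<rho> m \<and>
     (\<forall>\<epsilon>>0. ennreal a * emeasure lborel (box_sublevel c \<delta>' \<epsilon>) \<le> ennreal (J \<epsilon>) \<and>
        ennreal (J \<epsilon>) \<le> ennreal M * emeasure lborel (box_sublevel c \<delta> \<epsilon>))"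
proof -
  obtain V where V: "open V" "0 \<in> V" and lim: "\<And>\<phi>. test_function V \<phi> \<Longrightarrow>
     growth_limit (\<lambda>\<epsilon>. growth_integral S \<phi> \<epsilon> + growth_integral (\<lambda>x. - S x) \<phi> \<epsilon>) \<rho> m"
    using growth_limit_of_abs_growth_index[OF idx] by blast
  obtain \<eta> where \<eta>: "\<eta> > 0" "ball 0 \<eta> \<subseteq> V" using V by (meson open_contains_ball)
  \<comment> \<open>The norm is at most \<open>2 * \<delta>\<close> on the box, so
    \<open>\<eta> / 4\<close> keeps the box inside the ball.\<close>
  define \<delta> where "\<delta> = min (min R \<delta>1) (\<eta> / 4)"
  have \<delta>: "\<delta> > 0" "\<delta> \<le> R" "\<delta> \<le> \<delta>1" unfolding \<delta>_def using R_pos \<delta>1 \<eta> by auto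
  have "sup_box \<delta> \<subseteq> ball 0 \<eta>"
  proof
    fix x assume x: "x \<in> sup_box \<delta>"
    have "norm x \<le> (\<Sum>i\<in>UNIV. \<bar>x $ i\<bar>)" by (rule norm_le_l1_cart)
    also have "\<dots> \<le> 2 * \<delta>" using x unfolding sup_box_def by (simp add: sum_2) (metis add_mono mult_2)
    also have "\<dots> < \<eta>" unfolding \<delta>_def using \<eta> by (auto simp: min_def)
    finally show "x \<in> ball 0 \<eta>" by simp
  qed
  then have boxV: "sup_box \<delta> \<subseteq> V" using \<eta> by blast
  obtain \<phi> :: "real^2 \<Rightarrow> real" where \<phi>: "smooth \<phi>" "\<And>x. \<phi> x \<ge> 0" "\<phi> 0 > 0" "{x. \<phi> x \<noteq> 0} \<subseteq> sup_box \<delta>"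
    using exists_smooth_bump[OF \<delta>(1)] unfolding sup_box_def by blast
  have comp: "compact (sup_box \<delta>)" unfolding sup_box_eq_cbox by (rule compact_cbox)
  have clo: "closure {x. \<phi> x \<noteq> 0} \<subseteq> sup_box \<delta>"
    using \<phi>(4) compact_imp_closed[OF comp] by (rule closure_minimal)
  have "compact (closure {x. \<phi> x \<noteq> 0})"
    using bounded_subset[OF compact_imp_bounded[OF comp] clo] by (simp add: compact_eq_bounded_closed)
  then have test: "test_function V \<phi>" unfolding test_function_def using \<phi> clo boxV by auto
  have "\<phi> differentiable (at x)" for x
    using \<phi>(1)[unfolded smooth_def, rule_format, of "[]" x] by (simp add: iter_partial_def)
  then have cont: "continuous_on UNIV \<phi>"
    by (simp add: continuous_at_imp_continuous_on differentiable_imp_continuous_within)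
  then have [measurable]: "\<phi> \<in> borel_measurable borel" by (rule borel_measurable_continuous_onI)
  have "bounded (\<phi> ` sup_box \<delta>)"
    by (intro compact_imp_bounded compact_continuous_image comp continuous_on_subset[OF cont]) auto
  then obtain B where B: "\<And>x. x \<in> sup_box \<delta> \<Longrightarrow> \<bar>\<phi> x\<bar> \<le> B" unfolding bounded_iff by auto
  define M where "M = \<bar>B\<bar> + 1"
  have M: "M > 0" "\<And>x. \<phi> x \<le> M * indicator (sup_box \<delta>) x"
  proof -
    show "M > 0" unfolding M_def by simp
    show "\<phi> x \<le> M * indicator (sup_box \<delta>) x" for x
    proof (cases "x \<in> sup_box \<delta>")
      case True
      then show ?thesis using B[of x] unfolding M_def by simp
    next
      case False
      then have "\<phi> x = 0" using \<phi>(4) by blast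
      then show ?thesis using False by simp
    qed
  qed
  obtain \<eta>' where \<eta>': "\<eta>' > 0" "\<And>x. norm x < \<eta>' \<Longrightarrow> \<bar>\<phi> x - \<phi> 0\<bar> < \<phi> 0 / 2"
    using cont[unfolded continuous_on_eq_continuous_at[OF open_UNIV], rule_format, of 0] \<phi>(3)
    unfolding continuous_at_eps_delta by (metis UNIV_I dist_0_norm dist_commute dist_real_def half_gt_zero)
  define a where "a = \<phi> 0 / 2"
  define \<delta>' where "\<delta>' = min (min \<delta> \<delta>2) (\<eta>' / 4)"
  have \<delta>': "\<delta>' > 0" "\<delta>' \<le> \<delta>" "\<delta>' \<le> \<delta>2" "\<delta>' \<le> R" unfolding \<delta>'_def using \<delta> null \<eta>' by auto
  have a: "a > 0" "\<And>x. x \<in> sup_box \<delta>' \<Longrightarrow> a \<le> \<phi> x"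
  proof -
    show "a > 0" unfolding a_def using \<phi>(3) by simp
    fix x assume x: "x \<in> sup_box \<delta>'"
    have "norm x \<le> (\<Sum>i\<in>UNIV. \<bar>x $ i\<bar>)" by (rule norm_le_l1_cart)
    also have "\<dots> \<le> 2 * \<delta>'" using x unfolding sup_box_def by (simp add: sum_2) (metis add_mono mult_2)
    also have "\<dots> < \<eta>'" unfolding \<delta>'_def using \<eta>' by (auto simp: min_def)
    finally show "a \<le> \<phi> x" using \<eta>'(2)[of x] unfolding a_def by linarith
  qed
  define J where "J \<epsilon> = growth_integral S \<phi> \<epsilon> + growth_integral (\<lambda>x. - S x) \<phi> \<epsilon>" for \<epsilon>
  have integral_eq: "growth_integral f \<phi> \<epsilon> = (LINT x|lborel. indicator {x\<in>sup_box \<delta>. 0 < f x \<and> f x < \<epsilon>} x * \<phi> x)" for f \<epsilon>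
    unfolding growth_integral_def set_lebesgue_integral_def
    by (intro Bochner_Integration.integral_cong) (use \<phi>(4) in \<open>auto simp: indicator_def\<close>)
  have integrable: "integrable lborel (\<lambda>x. indicator A x * \<phi> x)" if "A \<subseteq> sup_box \<delta>" "A \<in> sets borel" for A
  proof (rule Bochner_Integration.integrable_bound)
    show "integrable lborel (\<lambda>x. M * indicator (sup_box \<delta>) x)"
      using fmeasurable_box_subset[OF order_refl sup_box_borel, of \<delta>]
      by (intro integrable_mult_right integrable_real_indicator) (auto simp: fmeasurable_def)
    show "(\<lambda>x. indicator A x * \<phi> x) \<in> borel_measurable lborel" using that(2) by measurable
    show "AE x in lborel. norm (indicator A x * \<phi> x) \<le> norm (M * indicator (sup_box \<delta>) x)"
    proof (intro AE_I2)
      fix x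
      show "norm (indicator A x * \<phi> x) \<le> norm (M * indicator (sup_box \<delta>) x)"
        using M(1) M(2)[of x] \<phi>(2)[of x] by (cases "x \<in> A"; cases "x \<in> sup_box \<delta>") auto
    qed
  qed
  have up: "(LINT x|lborel. indicator A x * \<phi> x) \<le> M * measure lborel A'"
    if "A \<subseteq> A'" "A' \<subseteq> sup_box \<delta>" "A \<in> sets borel" "A' \<in> sets borel" for A A'
  proof -
    have "(LINT x|lborel. indicator A x * \<phi> x) \<le> (LINT x|lborel. M * indicator A' x)"
    proof (rule integral_mono)
      show "integrable lborel (\<lambda>x. indicator A x * \<phi> x)" using that by (intro integrable) auto
      show "integrable lborel (\<lambda>x. M * indicator A' x)"
        using fmeasurable_box_subset[OF that(2,4)]
        by (intro integrable_mult_right integrable_real_indicator) (auto simp: fmeasurable_def)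
      show "indicator A x * \<phi> x \<le> M * indicator A' x" for x
        using that(1,2) M(2)[of x] M(1) by (auto simp: indicator_def split: if_splits)
    qed
    then show ?thesis by simp
  qed
  have low: "a * measure lborel A' \<le> (LINT x|lborel. indicator A x * \<phi> x)"
    if "A' \<subseteq> A" "A' \<subseteq> sup_box \<delta>'" "A \<subseteq> sup_box \<delta>" "A \<in> sets borel" "A' \<in> sets borel" for A A'
  proof -
    have "(LINT x|lborel. a * indicator A' x) \<le> (LINT x|lborel. indicator A x * \<phi> x)"
    proof (rule integral_mono)
      show "integrable lborel (\<lambda>x. indicator A x * \<phi> x)" using that by (intro integrable) auto
      show "integrable lborel (\<lambda>x. a * indicator A' x)"
        using fmeasurable_box_subset[OF that(2,5)]
        by (intro integrable_mult_right integrable_real_indicator) (auto simp: fmeasurable_def)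
      show "a * indicator A' x \<le> indicator A x * \<phi> x" for x
        using that(1,2) a(2)[of x] \<phi>(2)[of x] by (auto simp: indicator_def)
    qed
    then show ?thesis by simp
  qed
  have sub: "sup_box \<delta>' \<subseteq> sup_box \<delta>" using \<delta>'(2) unfolding sup_box_def by (auto intro: order_trans)
  have "ennreal a * emeasure lborel (box_sublevel c \<delta>' \<epsilon>) \<le> ennreal (J \<epsilon>) \<and>
        ennreal (J \<epsilon>) \<le> ennreal (2 * M) * emeasure lborel (box_sublevel c \<delta> \<epsilon>)" if \<epsilon>: "\<epsilon> > 0" for \<epsilon>
  proof
    define A where "A = {x\<in>sup_box \<delta>. \<bar>S x\<bar> < \<epsilon>}"
    define A1 where "A1 = {x\<in>sup_box \<delta>. 0 < S x \<and> S x < \<epsilon>}"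
    define A2 where "A2 = {x\<in>sup_box \<delta>. 0 < - S x \<and> - S x < \<epsilon>}"
    note meas = box_level_measurable(1-3)[OF \<delta>(2), of \<epsilon>, folded A_def A1_def A2_def]
    have Jeq: "J \<epsilon> = (LINT x|lborel. indicator A1 x * \<phi> x) + (LINT x|lborel. indicator A2 x * \<phi> x)"
      unfolding J_def integral_eq A1_def A2_def ..
    have fA: "A \<in> fmeasurable lborel" by (rule fmeasurable_box_subset[OF _ meas(3)]) (auto simp: A_def)
    \<comment> \<open>Each sign of \<open>S\<close> is estimated by the whole sublevel set, whence
      the factor \<open>2 * M\<close>.\<close>
    have "J \<epsilon> \<le> M * measure lborel A + M * measure lborel A"
      unfolding Jeq by (intro add_mono up meas) (auto simp: A_def A1_def A2_def)
    then have "ennreal (J \<epsilon>) \<le> ennreal (2 * M * measure lborel A)" by (intro ennreal_leI) simp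
    also have "\<dots> = ennreal (2 * M) * emeasure lborel A"
      using M(1) fA by (simp add: ennreal_mult' emeasure_eq_measure2)
    finally show "ennreal (J \<epsilon>) \<le> ennreal (2 * M) * emeasure lborel (box_sublevel c \<delta> \<epsilon>)"
      unfolding A_def emeasure_box_level[OF \<delta>(2)] .
    define B where "B = {x\<in>sup_box \<delta>'. \<bar>S x\<bar> < \<epsilon>}"
    define B1 where "B1 = {x\<in>sup_box \<delta>'. 0 < S x \<and> S x < \<epsilon>}"
    define B2 where "B2 = {x\<in>sup_box \<delta>'. 0 < - S x \<and> - S x < \<epsilon>}"
    define Z where "Z = {x\<in>sup_box \<delta>'. S x = 0}"
    note meas' = box_level_measurable(1-3)[OF \<delta>'(4), of \<epsilon>, folded B_def B1_def B2_def]
      box_level_measurable(4)[OF \<delta>'(4), folded Z_def]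
    have fB: "B \<in> fmeasurable lborel" by (rule fmeasurable_box_subset[OF _ meas'(3)]) (auto simp: B_def)
    have "emeasure lborel Z \<le> emeasure lborel {x\<in>sup_box \<delta>2. S x = 0}"
      by (rule emeasure_mono)
        (use box_level_measurable(4)[OF null(3)] \<delta>'(3) in \<open>auto simp: Z_def sup_box_def intro: order_trans\<close>)
    then have Z0: "measure lborel Z = 0" using null(2) by (simp add: measure_def)
    have "B = (B1 \<union> B2) \<union> Z" unfolding B_def B1_def B2_def Z_def using \<epsilon> by auto
    moreover have "measure lborel ((B1 \<union> B2) \<union> Z) \<le> measure lborel (B1 \<union> B2) + measure lborel Z"
      by (rule measure_Un_le) (use meas' in auto)
    ultimately have "measure lborel B \<le> measure lborel (B1 \<union> B2) + measure lborel Z" by (simp only:)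
    also have "measure lborel (B1 \<union> B2) \<le> measure lborel B1 + measure lborel B2"
      by (rule measure_Un_le) (use meas' in auto)
    finally have "measure lborel B \<le> measure lborel B1 + measure lborel B2" using Z0 by simp
    then have "a * measure lborel B \<le> a * measure lborel B1 + a * measure lborel B2"
      using a(1) by (simp add: distrib_left[symmetric])
    also have "\<dots> \<le> J \<epsilon>"
      unfolding Jeq by (intro add_mono low meas meas') (use sub in \<open>auto simp: A1_def A2_def B1_def B2_def\<close>)
    finally have "ennreal (a * measure lborel B) \<le> ennreal (J \<epsilon>)" by (rule ennreal_leI)
    moreover have "ennreal (a * measure lborel B) = ennreal a * emeasure lborel B"
      using a(1) fB by (simp add: ennreal_mult' emeasure_eq_measure2)
    ultimately show "ennreal a * emeasure lborel (box_sublevel c \<delta>' \<epsilon>) \<le> ennreal (J \<epsilon>)"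
      unfolding B_def emeasure_box_level[OF \<delta>'(4)] by simp
  qed
  moreover have "growth_limit J \<rho> m" using lim[OF test] unfolding J_def[abs_def] .
  ultimately show ?thesis using \<delta> \<delta>'(1,2) a(1) M(1)
    by (intro exI[of _ \<delta>] exI[of _ \<delta>'] exI[of _ a] exI[of _ "2 * M"] exI[of _ J]) auto
qed

lemma sublevel_rate_tendsto_0:
  assumes "d > 0" "q > 0"
  shows "((\<lambda>\<epsilon>. sublevel_rate d q \<epsilon>) \<longlongrightarrow> 0) (at_right 0)"
proof (cases "q * d > 1")
  case True
  then show ?thesis unfolding sublevel_rate_def using assms by (simp add: tendsto_powr_at_right_0)
next
  case False
  have "((\<lambda>\<epsilon>. growth_scale q 1 \<epsilon> / growth_scale 0 0 \<epsilon>) \<longlongrightarrow> 0) (at_right 0)"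
    using assms by (intro growth_scale_quotient_tendsto_0) auto
  then have "((\<lambda>\<epsilon>. \<epsilon> powr q * (- ln \<epsilon>)) \<longlongrightarrow> 0) (at_right 0)"
  proof (rule Lim_transform_eventually)
    show "\<forall>\<^sub>F \<epsilon> in at_right 0. growth_scale q 1 \<epsilon> / growth_scale 0 0 \<epsilon> = \<epsilon> powr q * (- ln \<epsilon>)"
      using eventually_small_right[of 1, OF zero_less_one] by eventually_elim (simp add: growth_scale_def)
  qed
  from tendsto_add[OF tendsto_powr_at_right_0[OF assms(2)] this]
  have "((\<lambda>\<epsilon>. \<epsilon> powr q * (1 - ln \<epsilon>)) \<longlongrightarrow> 0) (at_right 0)" by (simp add: algebra_simps)
  then show ?thesis unfolding sublevel_rate_def using False by simp
qed

text \<open>The predicate \<open>P\<close> is there because the exponents of the lower bound may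
  depend on the box, which is fixed only inside the proof. The upper bound enters twice: it bounds
  the index from below, and, its rate tending to 0, it shows that the zero set is null.\<close>

lemma growth_index_bounds:
  assumes idx: "has_abs_growth_index S \<rho> m" and dq: "d > 0" "q > 0"
    and est: "has_sublevel_bound c d q"
    and low: "\<And>\<delta>. 0 < \<delta> \<Longrightarrow> \<delta> \<le> R \<Longrightarrow> \<exists>\<sigma> k. P \<sigma> k \<and> (\<exists>C>0. \<exists>\<epsilon>0>0. \<forall>\<epsilon>. 0 < \<epsilon> \<longrightarrow> \<epsilon> \<le> \<epsilon>0 \<longrightarrow>
       ennreal (C * growth_scale \<sigma> k \<epsilon>) \<le> emeasure lborel (box_sublevel c \<delta> \<epsilon>))"
  shows "\<exists>\<sigma> k. P \<sigma> k \<and> (\<rho> < ereal \<sigma> \<or> \<rho> = ereal \<sigma> \<and> k \<le> m)" "m \<le> 1 \<or> \<rho> = \<infinity>"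
    "q * d > 1 \<Longrightarrow> ereal (1 / d) < \<rho> \<or> \<rho> = ereal (1 / d) \<and> m = 0"
    "q * d \<le> 1 \<Longrightarrow> ereal q \<le> \<rho>"
proof -
  obtain C \<delta>0 where C: "C \<ge> 0" "\<delta>0 > 0" "\<And>\<delta> \<epsilon>. 0 < \<delta> \<Longrightarrow> \<delta> \<le> \<delta>0 \<Longrightarrow> 0 < \<epsilon> \<Longrightarrow> \<epsilon> < 1 \<Longrightarrow>
       emeasure lborel (box_sublevel c \<delta> \<epsilon>) \<le> ennreal (C * sublevel_rate d q \<epsilon>)"
    using est unfolding has_sublevel_bound_def by blast
  define \<delta>2 where "\<delta>2 = min \<delta>0 R"
  have \<delta>2: "\<delta>2 > 0" "\<delta>2 \<le> R" "\<delta>2 \<le> \<delta>0" unfolding \<delta>2_def using C R_pos by auto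
  have null: "emeasure lborel {x\<in>sup_box \<delta>2. S x = 0} = 0"
  proof -
    have "((\<lambda>\<epsilon>. ennreal (C * sublevel_rate d q \<epsilon>)) \<longlongrightarrow> ennreal (C * 0)) (at_right 0)"
      by (intro tendsto_ennrealI tendsto_mult_left sublevel_rate_tendsto_0 dq)
    then have "emeasure lborel {x\<in>sup_box \<delta>2. S x = 0} \<le> ennreal (C * 0)"
    proof (rule tendsto_lowerbound)
      show "\<forall>\<^sub>F \<epsilon> in at_right 0. emeasure lborel {x\<in>sup_box \<delta>2. S x = 0} \<le> ennreal (C * sublevel_rate d q \<epsilon>)"
        using eventually_small_right[of 1, OF zero_less_one]
      proof eventually_elim
        case (elim \<epsilon>)
        have "emeasure lborel {x\<in>sup_box \<delta>2. S x = 0} \<le> emeasure lborel {x\<in>sup_box \<delta>2. \<bar>S x\<bar> < \<epsilon>}"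
          using box_level_measurable(3)[OF \<delta>2(2)] elim by (intro emeasure_mono) auto
        also have "\<dots> \<le> ennreal (C * sublevel_rate d q \<epsilon>)"
          unfolding emeasure_box_level[OF \<delta>2(2)] using C(3) \<delta>2 elim by auto
        finally show ?case .
      qed
    qed simp
    then show ?thesis by simp
  qed
  obtain \<delta> \<delta>' a M J where \<delta>: "0 < \<delta>'" "\<delta>' \<le> \<delta>" "\<delta> \<le> R" "\<delta> \<le> \<delta>0" and aM: "a > 0" "M > 0"
    and J: "growth_limit J \<rho> m"
    and bnd: "\<And>\<epsilon>. \<epsilon> > 0 \<Longrightarrow> ennreal a * emeasure lborel (box_sublevel c \<delta>' \<epsilon>) \<le> ennreal (J \<epsilon>) \<and>
        ennreal (J \<epsilon>) \<le> ennreal M * emeasure lborel (box_sublevel c \<delta> \<epsilon>)"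
    using growth_limit_box_bounds[OF idx C(2) \<delta>2(1) null \<delta>2(2)] by blast
  obtain \<sigma> k C' \<epsilon>0 where low': "P \<sigma> k" "C' > 0" "\<epsilon>0 > 0" "\<And>\<epsilon>. 0 < \<epsilon> \<Longrightarrow> \<epsilon> \<le> \<epsilon>0 \<Longrightarrow>
       ennreal (C' * growth_scale \<sigma> k \<epsilon>) \<le> emeasure lborel (box_sublevel c \<delta>' \<epsilon>)"
    using low[of \<delta>'] \<delta> by (meson order_trans)
  have J_lower: "\<forall>\<^sub>F \<epsilon> in at_right 0. (a * C') * growth_scale \<sigma> k \<epsilon> \<le> J \<epsilon>"
    using eventually_small_right[OF low'(3)] eventually_small_right[of 1, OF zero_less_one]
  proof eventually_elim
    case (elim \<epsilon>)
    have g: "growth_scale \<sigma> k \<epsilon> > 0" using elim by (intro growth_scale_pos) auto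
    have "ennreal (a * (C' * growth_scale \<sigma> k \<epsilon>)) = ennreal a * ennreal (C' * growth_scale \<sigma> k \<epsilon>)"
      using aM low'(2) g by (intro ennreal_mult) auto
    also have "\<dots> \<le> ennreal a * emeasure lborel (box_sublevel c \<delta>' \<epsilon>)"
      using low'(4)[of \<epsilon>] elim by (intro mult_left_mono) auto
    also have "\<dots> \<le> ennreal (J \<epsilon>)" using bnd[of \<epsilon>] elim by auto
    finally have "a * (C' * growth_scale \<sigma> k \<epsilon>) \<le> J \<epsilon>"
      using aM low'(2) g by (simp add: ennreal_le_iff2 mult_le_0_iff)
    then show ?case by (simp add: mult.assoc)
  qed
  show "\<exists>\<sigma> k. P \<sigma> k \<and> (\<rho> < ereal \<sigma> \<or> \<rho> = ereal \<sigma> \<and> k \<le> m)"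
    using growth_limit_lower[OF J _ J_lower] aM low'(1,2) by auto
  show "m \<le> 1 \<or> \<rho> = \<infinity>" using J unfolding growth_limit_def by auto
  have J_upper: "\<forall>\<^sub>F \<epsilon> in at_right 0. J \<epsilon> \<le> (M * C) * sublevel_rate d q \<epsilon>"
    using eventually_small_right[of 1, OF zero_less_one]
  proof eventually_elim
    case (elim \<epsilon>)
    have "ennreal (J \<epsilon>) \<le> ennreal M * emeasure lborel (box_sublevel c \<delta> \<epsilon>)" using bnd[of \<epsilon>] elim by auto
    also have "\<dots> \<le> ennreal M * ennreal (C * sublevel_rate d q \<epsilon>)"
      using C(3)[of \<delta> \<epsilon>] \<delta> elim by (intro mult_left_mono) auto
    also have "\<dots> = ennreal (M * (C * sublevel_rate d q \<epsilon>))"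
      using aM C(1) sublevel_rate_nonneg[of \<epsilon> d q] elim by (intro ennreal_mult[symmetric]) auto
    finally have "J \<epsilon> \<le> M * (C * sublevel_rate d q \<epsilon>)"
      using aM C(1) sublevel_rate_nonneg[of \<epsilon> d q] elim by (subst (asm) ennreal_le_iff) auto
    then show ?case by (simp add: mult.assoc)
  qed
  have fin: "\<exists>r. \<rho> = ereal r" if "\<rho> \<noteq> \<infinity>" using J that unfolding growth_limit_def by auto
  show "ereal (1 / d) < \<rho> \<or> \<rho> = ereal (1 / d) \<and> m = 0" if "q * d > 1"
  proof (cases "\<rho> = \<infinity>")
    case False
    then obtain r where r: "\<rho> = ereal r" using fin by blast
    have "\<forall>\<^sub>F \<epsilon> in at_right 0. J \<epsilon> \<le> (M * C) * growth_scale (1 / d) 0 \<epsilon>"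
      using J_upper that by (simp add: sublevel_rate_def growth_scale_def)
    then show ?thesis using growth_limit_upper[of J r m 0] J r by auto
  qed simp
  show "ereal q \<le> \<rho>" if "q * d \<le> 1"
  proof (cases "\<rho> = \<infinity>")
    case False
    then obtain r where r: "\<rho> = ereal r" using fin by blast
    have "\<forall>\<^sub>F \<epsilon> in at_right 0. J \<epsilon> \<le> (M * C * 2) * growth_scale q 1 \<epsilon>"
      using J_upper eventually_small_right[of "exp (- 1)", OF exp_gt_zero]
    proof eventually_elim
      case (elim \<epsilon>)
      have "ln \<epsilon> < ln (exp (- 1))" using elim by (subst ln_less_cancel_iff) auto
      then have "1 - ln \<epsilon> \<le> 2 * (- ln \<epsilon>)" by simp
      then have "(M * C * \<epsilon> powr q) * (1 - ln \<epsilon>) \<le> (M * C * \<epsilon> powr q) * (2 * (- ln \<epsilon>))"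
        using aM C(1) by (intro mult_left_mono) auto
      then show ?case using elim that by (simp add: sublevel_rate_def growth_scale_def mult_ac)
    qed
    from growth_limit_upper[OF J[unfolded r] order_refl this] show ?thesis using r by auto
  qed simp
qed

end

section \<open>Zeros of edge polynomials\<close>

definition falling :: "nat \<Rightarrow> nat \<Rightarrow> real" where
  "falling a m = (\<Prod>i<m. real a - real i)"

lemma falling_0 [simp]: "falling a 0 = 1"
  by (simp add: falling_def)

lemma falling_Suc: "falling a (Suc m) = falling a m * (real a - real m)"
  by (simp add: falling_def)

lemma falling_eq_0: "a < m \<Longrightarrow> falling a m = 0"
  unfolding falling_def by (rule prod_zero) auto

lemma falling_self_pos: "falling a a > 0"
  unfolding falling_def by (rule prod_pos) auto

lemma DERIV_falling_power:
  "((\<lambda>x. falling a m * x ^ (a - m)) has_real_derivative falling a (Suc m) * x ^ (a - Suc m)) (at x)"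
proof (cases "a \<le> m")
  case True
  then have "falling a (Suc m) = 0" by (intro falling_eq_0) simp
  then show ?thesis using True by simp
next
  case False
  then show ?thesis by (auto intro!: derivative_eq_intros simp: falling_Suc of_nat_diff)
qed

text \<open>Mixed partial derivative of order \<open>m\<close> in \<open>x\<close> and
  \<open>n\<close> in \<open>y\<close>, written so that differentiation merely raises an index.
  Where truncated subtraction cuts off an exponent, the factor \<open>falling\<close>
  vanishes.\<close>

definition edge_poly :: "(nat \<times> nat \<Rightarrow> real) \<Rightarrow> (nat \<times> nat) set \<Rightarrow> nat \<Rightarrow> nat \<Rightarrow> real \<Rightarrow> real \<Rightarrow> real" where
  "edge_poly c E m n x y =
     (\<Sum>p\<in>E. c p * (falling (fst p) m * x ^ (fst p - m)) * (falling (snd p) n * y ^ (snd p - n)))"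

lemma DERIV_edge_poly_x:
  "((\<lambda>x. edge_poly c E m n x y) has_real_derivative edge_poly c E (Suc m) n x y) (at x)"
  unfolding edge_poly_def
  by (intro DERIV_sum DERIV_cmult DERIV_cmult_right DERIV_falling_power)

lemma DERIV_edge_poly_y:
  "((\<lambda>y. edge_poly c E m n x y) has_real_derivative edge_poly c E m (Suc n) x y) (at y)"
  unfolding edge_poly_def
  by (intro DERIV_sum DERIV_cmult DERIV_falling_power)

lemma iter_partial_edge_poly:
  "iter_partial js (\<lambda>p :: real^2. edge_poly c E 0 0 (p $ 1) (p $ 2)) =
   (\<lambda>p. edge_poly c E (count_list js 1) (count_list js 2) (p $ 1) (p $ 2))"
proof (induction js)
  case Nil
  then show ?case by (simp add: iter_partial_def)
next
  case (Cons j js)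
  let ?m = "count_list js (1 :: 2)" and ?n = "count_list js (2 :: 2)"
  have it: "iter_partial (j # js) (\<lambda>p :: real^2. edge_poly c E 0 0 (p $ 1) (p $ 2)) =
      partial_deriv j (\<lambda>p. edge_poly c E ?m ?n (p $ 1) (p $ 2))"
    using Cons.IH by (simp add: iter_partial_def)
  consider "j = 1" | "j = 2" using exhaust_2 by blast
  then show ?case
  proof cases
    case 1
    have "partial_deriv 1 (\<lambda>p :: real^2. edge_poly c E ?m ?n (p $ 1) (p $ 2)) p = edge_poly c E (Suc ?m) ?n (p $ 1) (p $ 2)" for p
    proof -
      have "((\<lambda>t. edge_poly c E ?m ?n (p $ 1 + t) (p $ 2)) has_real_derivative edge_poly c E (Suc ?m) ?n (p $ 1 + 0) (p $ 2) * 1) (at 0)"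
        by (rule DERIV_chain2[OF DERIV_edge_poly_x]) (auto intro!: derivative_eq_intros)
      then show ?thesis unfolding partial_deriv_def by (intro DERIV_imp_deriv) (simp add: axis_def)
    qed
    then show ?thesis unfolding it unfolding 1 by (intro ext) simp
  next
    case 2
    have "partial_deriv 2 (\<lambda>p :: real^2. edge_poly c E ?m ?n (p $ 1) (p $ 2)) p = edge_poly c E ?m (Suc ?n) (p $ 1) (p $ 2)" for p
    proof -
      have "((\<lambda>t. edge_poly c E ?m ?n (p $ 1) (p $ 2 + t)) has_real_derivative edge_poly c E ?m (Suc ?n) (p $ 1) (p $ 2 + 0) * 1) (at 0)"
        by (rule DERIV_chain2[OF DERIV_edge_poly_y]) (auto intro!: derivative_eq_intros)
      then show ?thesis unfolding partial_deriv_def by (intro DERIV_imp_deriv) (simp add: axis_def)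
    qed
    then show ?thesis unfolding it unfolding 2 by (intro ext) simp
  qed
qed

lemma count_list_sum_2: "count_list js (1 :: 2) + count_list js 2 = length js"
proof (induction js)
  case (Cons j js)
  then show ?case using exhaust_2[of j] by auto
qed simp

lemma count_list_replicate: "count_list (replicate n x) y = (if x = y then n else 0)"
  by (induction n) auto

lemma edge_poly_swap:
  "edge_poly (c \<circ> prod.swap) (prod.swap ` E) m n x y = edge_poly c E n m y x"
  unfolding edge_poly_def by (subst sum.reindex) (auto intro!: sum.cong simp: mult_ac)

lemma edge_poly_flip_x: "edge_poly (flip_x c) E 0 n x y = edge_poly c E 0 n (- x) y"
  unfolding edge_poly_def flip_x_def by (intro sum.cong) (auto simp: power_minus[of x] mult_ac)

text \<open>Euler's identity, applied to the mixed derivative, which is quasihomogeneous of degree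
  \<open>e - m - s * n\<close> for the weights \<open>(1, s)\<close>.\<close>

lemma edge_poly_euler:
  assumes "\<And>a b. (a, b) \<in> E \<Longrightarrow> real a + s * real b = e"
  shows "x * edge_poly c E (Suc m) n x y + s * y * edge_poly c E m (Suc n) x y
    = (e - real m - s * real n) * edge_poly c E m n x y"
proof -
  have fp: "falling a (Suc m) * x ^ (a - Suc m) * x = (real a - real m) * (falling a m * x ^ (a - m))" for a m and x :: real
  proof (cases "a > m")
    case True
    then have "x ^ (a - m) = x ^ (a - Suc m) * x" by (metis Suc_diff_Suc power_Suc2)
    then show ?thesis by (simp add: falling_Suc)
  next
    case False
    then have "falling a (Suc m) = 0" by (intro falling_eq_0) simp
    moreover have "(real a - real m) * falling a m = 0" using False falling_eq_0[of a m] by (cases "a = m") auto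
    ultimately show ?thesis by (simp only: mult.assoc[symmetric] mult_zero_left)
  qed
  have "x * edge_poly c E (Suc m) n x y + s * y * edge_poly c E m (Suc n) x y =
    (\<Sum>p\<in>E. c p * (falling (fst p) (Suc m) * x ^ (fst p - Suc m) * x) * (falling (snd p) n * y ^ (snd p - n))
      + s * (c p * (falling (fst p) m * x ^ (fst p - m)) * (falling (snd p) (Suc n) * y ^ (snd p - Suc n) * y)))"
    unfolding edge_poly_def sum_distrib_left sum.distrib[symmetric] by (intro sum.cong) (auto simp: mult_ac)
  also have "\<dots> = (\<Sum>p\<in>E. (e - real m - s * real n) *
      (c p * (falling (fst p) m * x ^ (fst p - m)) * (falling (snd p) n * y ^ (snd p - n))))"
  proof (intro sum.cong refl)
    fix p assume "p \<in> E"
    then have e: "real (fst p) + s * real (snd p) = e" using assms[of "fst p" "snd p"] by simp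
    show "c p * (falling (fst p) (Suc m) * x ^ (fst p - Suc m) * x) * (falling (snd p) n * y ^ (snd p - n))
      + s * (c p * (falling (fst p) m * x ^ (fst p - m)) * (falling (snd p) (Suc n) * y ^ (snd p - Suc n) * y))
      = (e - real m - s * real n) * (c p * (falling (fst p) m * x ^ (fst p - m)) * (falling (snd p) n * y ^ (snd p - n)))"
      unfolding fp e[symmetric] by (simp add: algebra_simps)
  qed
  also have "\<dots> = (e - real m - s * real n) * edge_poly c E m n x y"
    unfolding edge_poly_def sum_distrib_left ..
  finally show ?thesis .
qed

text \<open>As \<open>x \<noteq> 0\<close>, Euler's identity expresses the derivative of index
  \<open>(Suc m, n)\<close> by those of index \<open>(m, n)\<close> and \<open>(m, Suc n)\<close>;
  so the vanishing of pure y-derivatives propagates by induction on \<open>m\<close>.\<close>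

lemma edge_poly_mixed_vanish:
  assumes E: "\<And>a b. (a, b) \<in> E \<Longrightarrow> real a + s * real b = e" and x: "x \<noteq> 0"
    and zero: "\<And>i. i < K \<Longrightarrow> edge_poly c E 0 i x y = 0"
  shows "m + n < K \<Longrightarrow> edge_poly c E m n x y = 0"
proof (induction m arbitrary: n)
  case (Suc m)
  then have "edge_poly c E m n x y = 0" "edge_poly c E m (Suc n) x y = 0" by auto
  then show ?case using edge_poly_euler[where E = E and s = s and e = e and x = x and c = c and m = m and n = n and y = y, OF E] x by simp
qed (use zero in simp)

lemma zero_order_edge_poly:
  fixes p :: "real^2"
  assumes f_def: "f = (\<lambda>p :: real^2. edge_poly c E 0 0 (p $ 1) (p $ 2))"
    and vanish: "\<And>m n. m + n < K \<Longrightarrow> edge_poly c E m n (p $ 1) (p $ 2) = 0"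
    and nz: "m0 + n0 = K" "edge_poly c E m0 n0 (p $ 1) (p $ 2) \<noteq> 0"
  shows "zero_order f p = K"
  unfolding zero_order_def
proof (rule Least_equality)
  have "count_list (replicate m0 1 @ replicate n0 (2 :: 2)) 1 = m0" "count_list (replicate m0 1 @ replicate n0 (2 :: 2)) 2 = n0"
    by (auto simp: count_list_append count_list_replicate)
  then have "iter_partial (replicate m0 1 @ replicate n0 2) f p \<noteq> 0"
    unfolding f_def iter_partial_edge_poly using nz(2) by simp
  then show "\<exists>js. length js = K \<and> iter_partial js f p \<noteq> 0"
    using nz(1) by (intro exI[of _ "replicate m0 1 @ replicate n0 2"]) simp
  fix k assume "\<exists>js. length js = k \<and> iter_partial js f p \<noteq> 0"
  then obtain js where js: "length js = k" "iter_partial js f p \<noteq> 0" by blast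
  then have "edge_poly c E (count_list js 1) (count_list js 2) (p $ 1) (p $ 2) \<noteq> 0"
    unfolding f_def iter_partial_edge_poly by simp
  then have "\<not> count_list js (1 :: 2) + count_list js 2 < K" using vanish by blast
  then show "K \<le> k" using js(1) count_list_sum_2[of js] by simp
qed

lemma edge_poly_vanish_below_zero_order:
  fixes p :: "real^2"
  assumes "i < zero_order (\<lambda>p :: real^2. edge_poly c E 0 0 (p $ 1) (p $ 2)) p"
  shows "edge_poly c E 0 i (p $ 1) (p $ 2) = 0"
proof -
  let ?f = "\<lambda>p :: real^2. edge_poly c E 0 0 (p $ 1) (p $ 2)"
  have cl: "count_list (replicate i (2 :: 2)) 1 = 0" "count_list (replicate i (2 :: 2)) 2 = i"
    by (auto simp: count_list_replicate)
  have "iter_partial (replicate i 2) ?f p = 0"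
    using not_less_Least[OF assms[unfolded zero_order_def]] by (auto dest: spec[of _ "replicate i (2::2)"])
  then show ?thesis unfolding iter_partial_edge_poly cl .
qed

definition edge_support :: "(nat \<times> nat \<Rightarrow> real) \<Rightarrow> real \<Rightarrow> real \<Rightarrow> (nat \<times> nat) set" where
  "edge_support c s e = {p. c p \<noteq> 0 \<and> real (fst p) + s * real (snd p) = e}"

lemma finite_line_points:
  assumes "s > 0"
  shows "finite {p :: nat \<times> nat. real (fst p) + s * real (snd p) = e}"
proof (rule finite_subset)
  show "{p :: nat \<times> nat. real (fst p) + s * real (snd p) = e} \<subseteq> {..nat \<lfloor>e\<rfloor>} \<times> {..nat \<lfloor>e / s\<rfloor>}"
  proof
    fix p :: "nat \<times> nat" assume p: "p \<in> {p. real (fst p) + s * real (snd p) = e}"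
    then have "real (fst p) \<le> e" "s * real (snd p) \<le> e" using assms by auto
    then have "real (fst p) \<le> e" "real (snd p) \<le> e / s" using assms by (auto simp: field_simps)
    then show "p \<in> {..nat \<lfloor>e\<rfloor>} \<times> {..nat \<lfloor>e / s\<rfloor>}" by (cases p) (auto simp: le_nat_floor)
  qed
qed simp

lemma finite_edge_support: "s > 0 \<Longrightarrow> finite (edge_support c s e)"
  unfolding edge_support_def by (rule finite_subset[OF _ finite_line_points[of s e]]) auto

lemma edge_support_flip_x: "edge_support (flip_x c) s e = edge_support c s e"
  unfolding edge_support_def flip_x_def by auto

lemma edge_support_swap:
  assumes "s > 0"
  shows "edge_support (c \<circ> prod.swap) (1 / s) (e / s) = prod.swap ` edge_support c s e"
proof -
  have "p \<in> edge_support (c \<circ> prod.swap) (1 / s) (e / s) \<longleftrightarrow> prod.swap p \<in> edge_support c s e" for p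
  proof -
    have "real (fst p) + 1 / s * real (snd p) = e / s \<longleftrightarrow> real (snd p) + s * real (fst p) = e"
      using assms by (auto simp: field_simps)
    then show ?thesis unfolding edge_support_def by simp
  qed
  moreover have "p \<in> prod.swap ` X \<longleftrightarrow> prod.swap p \<in> X" for p and X :: "(nat \<times> nat) set"
    by (metis image_iff swap_swap)
  ultimately show ?thesis by blast
qed

lemma edge_coeff_zero_outside:
  "b \<notin> snd ` edge_support c s e \<Longrightarrow> edge_coeff c s e b = 0"
  unfolding edge_coeff_def edge_support_def by (intro sum.neutral) force

text \<open>Connects the edge series, for which slices are estimated, with the polynomial, for which
  orders of zeros are defined. Uniqueness of derivatives passes from \<open>k\<close> to
  \<open>Suc k\<close>.\<close>

lemma powser_deriv_edge_coeff:
  assumes s: "s > 0"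
  shows "powser_deriv (edge_coeff c s e) k u = edge_poly c (edge_support c s e) 0 k 1 u"
proof -
  define E where "E = edge_support c s e"
  have fin: "finite E" unfolding E_def by (rule finite_edge_support[OF s])
  define \<gamma> where "\<gamma> = edge_coeff c s e"
  have \<gamma>0: "b \<notin> snd ` E \<Longrightarrow> \<gamma> b = 0" for b unfolding \<gamma>_def E_def by (rule edge_coeff_zero_outside)
  have summ: "summable (\<lambda>b. \<gamma> b * z ^ b)" for z
    using fin \<gamma>0 by (intro summable_finite[of "snd ` E"]) auto
  have "powser_deriv \<gamma> k = edge_poly c E 0 k 1"
  proof (induction k)
    case 0
    show ?case
    proof
      fix u
      have inj: "inj_on snd E" unfolding E_def edge_support_def by (auto simp: inj_on_def)
      have "powser_deriv \<gamma> 0 u = (\<Sum>b\<in>snd ` E. \<gamma> b * u ^ b)"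
        unfolding powser_deriv_def using fin \<gamma>0 by (simp add: suminf_finite[of "snd ` E"])
      also have "\<dots> = (\<Sum>p\<in>E. \<gamma> (snd p) * u ^ snd p)" by (simp add: sum.reindex[OF inj])
      also have "\<dots> = (\<Sum>p\<in>E. c p * u ^ snd p)"
      proof (intro sum.cong refl)
        fix p assume p: "p \<in> E"
        then have "{a. real a + s * real (snd p) = e} = {fst p}" unfolding E_def edge_support_def by auto
        then show "\<gamma> (snd p) * u ^ snd p = c p * u ^ snd p" unfolding \<gamma>_def edge_coeff_def by simp
      qed
      finally show "powser_deriv \<gamma> 0 u = edge_poly c E 0 0 1 u" unfolding edge_poly_def by simp
    qed
  next
    case (Suc k)
    show ?case
    proof
      fix u
      have "(powser_deriv \<gamma> k has_real_derivative powser_deriv \<gamma> (Suc k) u) (at u)"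
        by (rule DERIV_powser_deriv[of "\<bar>u\<bar> + 1"]) (use summ in auto)
      moreover have "(powser_deriv \<gamma> k has_real_derivative edge_poly c E 0 (Suc k) 1 u) (at u)"
        unfolding Suc.IH by (rule DERIV_edge_poly_y)
      ultimately show "powser_deriv \<gamma> (Suc k) u = edge_poly c E 0 (Suc k) 1 u" by (rule DERIV_unique)
    qed
  qed
  then show ?thesis unfolding \<gamma>_def E_def by simp
qed

text \<open>Differentiating as often as the y-degree leaves a single monomial; hence the order of
  vanishing in \<open>y\<close> never exceeds that degree.\<close>

lemma edge_poly_top_order:
  assumes fin: "finite E" and p: "p \<in> E" "\<And>p'. p' \<in> E \<Longrightarrow> p' \<noteq> p \<Longrightarrow> snd p' < snd p" and c: "c p \<noteq> 0" and x: "x \<noteq> 0"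
  shows "edge_poly c E 0 (snd p) x y \<noteq> 0"
proof -
  have "edge_poly c E 0 (snd p) x y = (\<Sum>p'\<in>{p}. c p' * (falling (fst p') 0 * x ^ (fst p' - 0)) * (falling (snd p') (snd p) * y ^ (snd p' - snd p)))"
    unfolding edge_poly_def
  proof (rule sum.mono_neutral_right[OF fin])
    show "\<forall>p'\<in>E - {p}. c p' * (falling (fst p') 0 * x ^ (fst p' - 0)) * (falling (snd p') (snd p) * y ^ (snd p' - snd p)) = 0"
      using p(2) falling_eq_0 by auto
  qed (use p(1) in auto)
  then show ?thesis using c x falling_self_pos[of "snd p"] by simp
qed

text \<open>At \<open>y = 0\<close>, differentiating as often as the lowest y-exponent leaves only
  its monomial.\<close>

lemma edge_poly_bottom_order:
  assumes fin: "finite E" and p: "p \<in> E" "\<And>p'. p' \<in> E \<Longrightarrow> p' \<noteq> p \<Longrightarrow> snd p < snd p'" and c: "c p \<noteq> 0" and x: "x \<noteq> 0"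
  shows "edge_poly c E 0 (snd p) x 0 \<noteq> 0"
proof -
  have "edge_poly c E 0 (snd p) x 0 = (\<Sum>p'\<in>{p}. c p' * (falling (fst p') 0 * x ^ (fst p' - 0)) * (falling (snd p') (snd p) * 0 ^ (snd p' - snd p)))"
    unfolding edge_poly_def
  proof (rule sum.mono_neutral_right[OF fin])
    show "\<forall>p'\<in>E - {p}. c p' * (falling (fst p') 0 * x ^ (fst p' - 0)) * (falling (snd p') (snd p) * 0 ^ (snd p' - snd p)) = 0"
    proof
      fix p' assume "p' \<in> E - {p}"
      then have "snd p' - snd p \<noteq> 0" using p(2)[of p'] by auto
      then show "c p' * (falling (fst p') 0 * x ^ (fst p' - 0)) * (falling (snd p') (snd p) * 0 ^ (snd p' - snd p)) = 0"
        by simp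
    qed
  qed (use p(1) in auto)
  then show ?thesis using c x falling_self_pos[of "snd p"] by simp
qed

lemma edge_support_extremes:
  assumes s: "s > 0" and ne: "edge_support c s e \<noteq> {}"
  shows "\<exists>p\<in>edge_support c s e. \<forall>p'\<in>edge_support c s e. p' \<noteq> p \<longrightarrow> snd p' < snd p"
    "q \<in> edge_support c s e \<Longrightarrow> \<exists>p\<in>edge_support c s e. snd p \<le> snd q \<and> (\<forall>p'\<in>edge_support c s e. p' \<noteq> p \<longrightarrow> snd p < snd p')"
proof -
  let ?E = "edge_support c s e"
  have fin: "finite ?E" by (rule finite_edge_support[OF s])
  have inj: "p = p'" if "p \<in> ?E" "p' \<in> ?E" "snd p = snd p'" for p p'
    using that unfolding edge_support_def by (auto simp: prod_eq_iff)
  have "Max (snd ` ?E) \<in> snd ` ?E" using fin ne by (intro Max_in) auto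
  then obtain p where p: "p \<in> ?E" "snd p = Max (snd ` ?E)" by (metis imageE)
  have "snd p' < snd p" if "p' \<in> ?E" "p' \<noteq> p" for p'
    using Max_ge[of "snd ` ?E" "snd p'"] fin that p inj[of p' p] by (auto simp: less_le)
  then show "\<exists>p\<in>?E. \<forall>p'\<in>?E. p' \<noteq> p \<longrightarrow> snd p' < snd p" using p(1) by blast
  assume q: "q \<in> ?E"
  have "Min (snd ` ?E) \<in> snd ` ?E" using fin ne by (intro Min_in) auto
  then obtain p where p: "p \<in> ?E" "snd p = Min (snd ` ?E)" by (metis imageE)
  have le: "snd p \<le> snd p'" if "p' \<in> ?E" for p' using p(2) fin that by simp
  have "snd p < snd p'" if "p' \<in> ?E" "p' \<noteq> p" for p'
    using le[OF that(1)] inj[OF that(1) p(1)] that(2) by (auto simp: less_le)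
  then show "\<exists>p\<in>?E. snd p \<le> snd q \<and> (\<forall>p'\<in>?E. p' \<noteq> p \<longrightarrow> snd p < snd p')" using p(1) le[OF q] by blast
qed

text \<open>The point \<open>u = 0\<close> lies on an axis, where hypotheses on zeros off the axes
  say nothing. There the order is the least y-exponent on the edge, and the exponent
  \<open>p0\<close> bounds it.\<close>

lemma edge_order_okI:
  assumes s: "s > 0" and p0: "p0 \<in> edge_support c s e" "q * real (snd p0) \<le> 1" and q: "q > 0"
    and ord: "\<And>u. u \<noteq> 0 \<Longrightarrow> \<exists>k. (k = 0 \<or> q * real k \<le> 1) \<and> edge_poly c (edge_support c s e) 0 k 1 u \<noteq> 0"
  shows "edge_order_ok c s e 1 q"
  unfolding edge_order_ok_def
proof (intro allI impI)
  fix u :: real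
  show "\<exists>k. (k = 0 \<or> q * real k \<le> 1) \<and> powser_deriv (edge_coeff c s e) k u \<noteq> 0"
  proof (cases "u = 0")
    case True
    obtain p where p: "p \<in> edge_support c s e" "snd p \<le> snd p0" "\<forall>p'\<in>edge_support c s e. p' \<noteq> p \<longrightarrow> snd p < snd p'"
      using edge_support_extremes(2)[OF s _ p0(1)] p0(1) by blast
    have "edge_poly c (edge_support c s e) 0 (snd p) 1 0 \<noteq> 0"
      using p by (intro edge_poly_bottom_order finite_edge_support[OF s]) (auto simp: edge_support_def)
    moreover have "q * real (snd p) \<le> q * real (snd p0)" using p(2) q by (intro mult_left_mono) auto
    ultimately show ?thesis unfolding powser_deriv_edge_coeff[OF s] True using p0(2) by (intro exI[of _ "snd p"]) auto
  next
    case False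
    then show ?thesis unfolding powser_deriv_edge_coeff[OF s] by (rule ord)
  qed
qed

text \<open>\<open>pb\<close> controls the zero on the axis \<open>y = 0\<close> and
  \<open>pa\<close> the one on \<open>x = 0\<close>; reflection and exchange of variables reduce all
  four conditions to pure derivatives of one polynomial.\<close>

lemma edge_order_ok_all:
  assumes s: "s > 0" and q: "q > 0"
    and pb: "pb \<in> edge_support c s e" "q * real (snd pb) \<le> 1"
    and pa: "pa \<in> edge_support c s e" "q * real (fst pa) \<le> 1"
    and ord_y: "\<And>x y. x \<noteq> 0 \<Longrightarrow> y \<noteq> 0 \<Longrightarrow> \<exists>k. (k = 0 \<or> q * real k \<le> 1) \<and> edge_poly c (edge_support c s e) 0 k x y \<noteq> 0"
    and ord_x: "\<And>x y. x \<noteq> 0 \<Longrightarrow> y \<noteq> 0 \<Longrightarrow> \<exists>k. (k = 0 \<or> q * real k \<le> 1) \<and> edge_poly c (edge_support c s e) k 0 x y \<noteq> 0"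
  shows "edge_order_ok c s e 1 q" "edge_order_ok (flip_x c) s e 1 q"
    "edge_order_ok (c \<circ> prod.swap) (1 / s) (e / s) 1 q" "edge_order_ok (flip_x (c \<circ> prod.swap)) (1 / s) (e / s) 1 q"
proof -
  note sw = edge_support_swap[OF s, of c e]
  have pa': "prod.swap pa \<in> edge_support (c \<circ> prod.swap) (1 / s) (e / s)" unfolding sw using pa(1) by auto
  show "edge_order_ok c s e 1 q" by (rule edge_order_okI[OF s pb q]) (rule ord_y, auto)
  show "edge_order_ok (flip_x c) s e 1 q"
    by (rule edge_order_okI[OF s _ pb(2) q])
      (use pb ord_y in \<open>simp_all add: edge_support_flip_x edge_poly_flip_x\<close>)
  show "edge_order_ok (c \<circ> prod.swap) (1 / s) (e / s) 1 q"
    by (rule edge_order_okI[OF _ pa' _ q]) (use s pa ord_x in \<open>simp_all add: sw edge_poly_swap\<close>)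
  show "edge_order_ok (flip_x (c \<circ> prod.swap)) (1 / s) (e / s) 1 q"
    by (rule edge_order_okI[OF _ _ _ q, of _ "prod.swap pa"])
      (use s pa pa' ord_x in \<open>simp_all add: edge_support_flip_x sw edge_poly_flip_x edge_poly_swap\<close>)
qed

text \<open>The first nonvanishing pure y-derivative has order \<open>zero_order\<close>: by Euler's
  identity the vanishing of the lower ones forces all mixed derivatives of smaller total order to
  vanish. Pure x-derivatives are treated by exchanging the variables.\<close>

lemma edge_order_le_of_zero_order:
  assumes s: "s > 0" and ne: "edge_support c s e \<noteq> {}"
    and f: "f = (\<lambda>p :: real^2. edge_poly c (edge_support c s e) 0 0 (p $ 1) (p $ 2))"
    and zero: "\<And>p. (\<forall>i. p $ i \<noteq> 0) \<Longrightarrow> f p = 0 \<Longrightarrow> q * real (zero_order f p) \<le> 1"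
    and xy: "x \<noteq> 0" "y \<noteq> 0"
  shows "\<exists>k. (k = 0 \<or> q * real k \<le> 1) \<and> edge_poly c (edge_support c s e) 0 k x y \<noteq> 0"
    "\<exists>k. (k = 0 \<or> q * real k \<le> 1) \<and> edge_poly c (edge_support c s e) k 0 x y \<noteq> 0"
proof -
  let ?E = "edge_support c s e"
  have fin: "finite ?E" by (rule finite_edge_support[OF s])
  have line: "real a + s * real b = e" if "(a, b) \<in> ?E" for a b using that unfolding edge_support_def by simp
  define p where "p = vec2 (x, y)"
  have p: "p $ 1 = x" "p $ 2 = y" "\<forall>i. p $ i \<noteq> 0" unfolding p_def using xy by (auto simp: forall_2)
  show "\<exists>k. (k = 0 \<or> q * real k \<le> 1) \<and> edge_poly c ?E 0 k x y \<noteq> 0"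
  proof -
    obtain pt where pt: "pt \<in> ?E" "\<forall>p'\<in>?E. p' \<noteq> pt \<longrightarrow> snd p' < snd pt"
      using edge_support_extremes(1)[OF s ne] by blast
    have "edge_poly c ?E 0 (snd pt) x y \<noteq> 0"
      using pt xy by (intro edge_poly_top_order fin) (auto simp: edge_support_def)
    then have "edge_poly c ?E 0 (LEAST k. edge_poly c ?E 0 k x y \<noteq> 0) x y \<noteq> 0" by (rule LeastI)
    moreover define K where "K = (LEAST k. edge_poly c ?E 0 k x y \<noteq> 0)"
    ultimately have K: "edge_poly c ?E 0 K x y \<noteq> 0" by simp
    have below: "edge_poly c ?E 0 i x y = 0" if "i < K" for i
      using not_less_Least[OF that[unfolded K_def]] by simp
    show ?thesis
    proof (cases "K = 0")
      case False
      have "zero_order f p = K"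
      proof (rule zero_order_edge_poly[OF f, of K p 0 K])
        show "edge_poly c ?E m n (p $ 1) (p $ 2) = 0" if "m + n < K" for m n
          unfolding p by (rule edge_poly_mixed_vanish[OF line xy(1) below that])
      qed (use K in \<open>auto simp: p\<close>)
      moreover have "f p = 0" unfolding f using below[of 0] False by (simp add: p)
      ultimately have "q * real K \<le> 1" using zero[OF p(3)] by simp
      then show ?thesis using K by blast
    qed (use K in auto)
  qed
  show "\<exists>k. (k = 0 \<or> q * real k \<le> 1) \<and> edge_poly c ?E k 0 x y \<noteq> 0"
  proof -
    let ?c = "c \<circ> prod.swap" and ?F = "edge_support (c \<circ> prod.swap) (1 / s) (e / s)"
    have s': "1 / s > 0" using s by simp
    note sw = edge_support_swap[OF s, of c e]
    have ne': "?F \<noteq> {}" unfolding sw using ne by simp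
    have finF: "finite ?F" by (rule finite_edge_support[OF s'])
    have lineF: "real a + 1 / s * real b = e / s" if "(a, b) \<in> ?F" for a b using that unfolding edge_support_def by simp
    have swp: "edge_poly ?c ?F m n y x = edge_poly c ?E n m x y" for m n unfolding sw by (rule edge_poly_swap)
    obtain pt where pt: "pt \<in> ?F" "\<forall>p'\<in>?F. p' \<noteq> pt \<longrightarrow> snd p' < snd pt"
      using edge_support_extremes(1)[OF s' ne'] by blast
    have "edge_poly ?c ?F 0 (snd pt) y x \<noteq> 0"
      using pt xy by (intro edge_poly_top_order finF) (auto simp: edge_support_def)
    then have "edge_poly ?c ?F 0 (LEAST k. edge_poly ?c ?F 0 k y x \<noteq> 0) y x \<noteq> 0" by (rule LeastI)
    moreover define K where "K = (LEAST k. edge_poly ?c ?F 0 k y x \<noteq> 0)"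
    ultimately have K: "edge_poly ?c ?F 0 K y x \<noteq> 0" by simp
    have below: "edge_poly ?c ?F 0 i y x = 0" if "i < K" for i
      using not_less_Least[OF that[unfolded K_def]] by simp
    show ?thesis
    proof (cases "K = 0")
      case False
      have "edge_poly c ?E m n x y = 0" if "m + n < K" for m n
      proof -
        have "edge_poly ?c ?F n m y x = 0"
          by (rule edge_poly_mixed_vanish[OF lineF xy(2) below]) (use that in auto)
        then show ?thesis unfolding swp .
      qed
      then have "zero_order f p = K"
        by (intro zero_order_edge_poly[OF f, of K p K 0]) (use K swp in \<open>auto simp: p\<close>)
      moreover have "f p = 0" unfolding f using below[of 0] False swp by (simp add: p)
      ultimately have "q * real K \<le> 1" using zero[OF p(3)] by simp
      then show ?thesis using K swp by auto
    qed (use K swp in auto)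
  qed
qed

lemma edge_poly_scale:
  assumes line: "\<And>a b. (a, b) \<in> E \<Longrightarrow> real a + s * real b = e" and t: "t > 0"
  shows "edge_poly c E 0 n (t * x) (t powr s * y) = t powr (e - s * real n) * edge_poly c E 0 n x y"
proof -
  have "c p * (falling (fst p) 0 * (t * x) ^ (fst p - 0)) * (falling (snd p) n * (t powr s * y) ^ (snd p - n)) =
     t powr (e - s * real n) * (c p * (falling (fst p) 0 * x ^ (fst p - 0)) * (falling (snd p) n * y ^ (snd p - n)))"
    if p: "p \<in> E" for p
  proof (cases "snd p < n")
    case True
    then show ?thesis by (simp add: falling_eq_0)
  next
    case False
    have "t ^ fst p * (t powr s) ^ (snd p - n) = t powr (real (fst p) + s * real (snd p - n))"
      using t by (simp add: powr_add powr_powr[symmetric] powr_realpow)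
    also have "real (fst p) + s * real (snd p - n) = e - s * real n"
      using False line[of "fst p" "snd p"] p by (simp add: of_nat_diff algebra_simps)
    finally have eq: "t ^ fst p * (t powr s) ^ (snd p - n) = t powr (e - s * real n)" .
    have "c p * (falling (fst p) 0 * (t * x) ^ (fst p - 0)) * (falling (snd p) n * (t powr s * y) ^ (snd p - n)) =
       (t ^ fst p * (t powr s) ^ (snd p - n)) * (c p * (falling (fst p) 0 * x ^ (fst p - 0)) * (falling (snd p) n * y ^ (snd p - n)))"
      by (simp add: power_mult_distrib mult_ac)
    then show ?thesis unfolding eq .
  qed
  then show ?thesis unfolding edge_poly_def sum_distrib_left by (intro sum.cong) auto
qed

section \<open>Determination of the growth index\<close>

definition bi_index :: "nat \<times> nat \<Rightarrow> 2 \<Rightarrow> nat" where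
  "bi_index p = (\<lambda>i. if i = 1 then fst p else snd p)"

lemma bi_index_simps [simp]: "bi_index p 1 = fst p" "bi_index p 2 = snd p"
  by (auto simp: bi_index_def)

lemma bi_index_surj: "\<alpha> = bi_index (\<alpha> 1, \<alpha> 2)"
  by (auto simp: fun_eq_iff forall_2)

lemma bij_bi_index: "bij bi_index"
proof (rule bijI)
  show "inj bi_index" by (rule injI) (metis bi_index_simps prod_eq_iff)
  show "surj bi_index"
    by (rule surjI[of bi_index "\<lambda>\<alpha>. (\<alpha> 1, \<alpha> 2)"]) (rule bi_index_surj[symmetric])
qed

lemma monomial_bi_index: "monomial (bi_index p) x = x $ 1 ^ fst p * x $ 2 ^ snd p"
  by (simp add: monomial_def UNIV_2)

lemma iterated_diffs_at_0: "(diffs ^^ k) \<gamma> 0 = fact k * (\<gamma> k :: real)"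
proof -
  have "(diffs ^^ k) \<gamma> b * fact b = fact (b + k) * \<gamma> (b + k)" for b
  proof (induction k arbitrary: b)
    case (Suc k)
    have "(diffs ^^ Suc k) \<gamma> b * fact b = (diffs ^^ k) \<gamma> (Suc b) * fact (Suc b)"
      by (simp add: diffs_def[of "(diffs ^^ k) \<gamma>"] algebra_simps)
    then show ?case using Suc.IH[of "Suc b"] by simp
  qed simp
  from this[of 0] show ?thesis by simp
qed

lemma powser_zero_imp_coeff_zero:
  fixes \<gamma> :: "nat \<Rightarrow> real"
  assumes R: "R > 0" and zero: "\<And>y. \<bar>y\<bar> < R \<Longrightarrow> (\<lambda>b. \<gamma> b * y ^ b) sums 0"
  shows "\<gamma> k = 0"
proof -
  have summ: "summable (\<lambda>b. \<gamma> b * y ^ b)" if "\<bar>y\<bar> < R" for y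
    using zero[OF that] by (rule sums_summable)
  have "\<forall>y. \<bar>y\<bar> < R \<longrightarrow> powser_deriv \<gamma> k y = 0"
  proof (induction k)
    case 0
    then show ?case using zero by (auto simp: powser_deriv_def sums_iff)
  next
    case (Suc k)
    show ?case
    proof (intro allI impI)
      fix y assume y: "\<bar>y\<bar> < R"
      have "((\<lambda>_. 0) has_real_derivative powser_deriv \<gamma> (Suc k) y) (at y)"
      proof (subst DERIV_cong_ev[OF refl _ refl])
        have "\<forall>\<^sub>F z in nhds y. z \<in> {-R<..<R}"
          by (rule eventually_nhds_in_open) (use y in auto)
        then show "\<forall>\<^sub>F z in nhds y. 0 = powser_deriv \<gamma> k z"
          by eventually_elim (use Suc.IH in auto)
        show "(powser_deriv \<gamma> k has_real_derivative powser_deriv \<gamma> (Suc k) y) (at y)"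
          by (rule DERIV_powser_deriv[OF summ y])
      qed
      then show "powser_deriv \<gamma> (Suc k) y = 0" using DERIV_unique DERIV_const by blast
    qed
  qed
  then have "powser_deriv \<gamma> k 0 = 0" using R by simp
  moreover have "powser_deriv \<gamma> k 0 = (diffs ^^ k) \<gamma> 0"
    unfolding powser_deriv_def by (rule powser_zero)
  ultimately show ?thesis by (simp add: iterated_diffs_at_0)
qed

text \<open>Uniqueness in one variable is used twice: for the series in \<open>y\<close>, then for
  each column as a series in \<open>x\<close>.\<close>

lemma (in double_power_series) double_sum_zero_imp_coeff_zero:
  assumes "\<And>x y. \<bar>x\<bar> \<le> R \<Longrightarrow> \<bar>y\<bar> \<le> R \<Longrightarrow> double_sum c x y = 0"
  shows "c p = 0"
proof -
  have col: "column_sum c b x = 0" if x: "\<bar>x\<bar> < R" for b x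
  proof (rule powser_zero_imp_coeff_zero[OF R_pos])
    fix y assume "\<bar>y\<bar> < R"
    then show "(\<lambda>b. column_sum c b x * y ^ b) sums 0"
      using columns_sums_double_sum[of x y] assms[of x y] x by simp
  qed
  have "c (fst p, snd p) = 0"
  proof (rule powser_zero_imp_coeff_zero[OF R_pos, of "\<lambda>a. c (a, snd p)"])
    fix x assume x: "\<bar>x\<bar> < R"
    have "((\<lambda>a. c (a, snd p) * x ^ a) has_sum column_sum c (snd p) x) UNIV"
      using x by (intro column_has_sum) simp
    then show "(\<lambda>a. c (a, snd p) * x ^ a) sums 0" using col[OF x] by (auto dest: has_sum_imp_sums)
  qed
  then show ?thesis by simp
qed

lemma power_series_germ_of_has_power_series:
  assumes "has_power_series_at S k 0"
  shows "\<exists>R0>0. \<forall>R. 0 < R \<longrightarrow> R \<le> R0 \<longrightarrow> power_series_germ (k \<circ> bi_index) R S"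
proof -
  obtain e where e: "e > 0" "\<And>h. h \<in> ball 0 e \<Longrightarrow> ((\<lambda>\<alpha>. k \<alpha> * monomial \<alpha> h) has_sum S h) UNIV"
    using assms unfolding has_power_series_at_def by auto
  have "power_series_germ (k \<circ> bi_index) R S" if R: "0 < R" "R \<le> e / 4" for R
  proof -
    have hs: "((\<lambda>p. (k \<circ> bi_index) p * x $ 1 ^ fst p * x $ 2 ^ snd p) has_sum S x) UNIV"
      if x: "\<And>i. \<bar>x $ i\<bar> \<le> R" for x
    proof -
      have "norm x \<le> (\<Sum>i\<in>UNIV. \<bar>x $ i\<bar>)" by (rule norm_le_l1_cart)
      also have "\<dots> \<le> 2 * R" using x[of 1] x[of 2] by (simp add: sum_2)
      also have "\<dots> < e" using R by simp
      finally have "((\<lambda>\<alpha>. k \<alpha> * monomial \<alpha> x) has_sum S x) UNIV" by (intro e(2)) simp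
      then have "((\<lambda>p. k (bi_index p) * monomial (bi_index p) x) has_sum S x) UNIV"
        using has_sum_reindex_bij_betw[OF bij_bi_index, of "\<lambda>\<alpha>. k \<alpha> * monomial \<alpha> x" "S x"] by simp
      then show ?thesis by (simp add: monomial_bi_index mult.assoc)
    qed
    have "(\<lambda>p. (k \<circ> bi_index) p * R ^ fst p * R ^ snd p) summable_on UNIV"
      using hs[of "\<chi> i. R"] R unfolding summable_on_def by auto
    then have "(\<lambda>p. norm ((k \<circ> bi_index) p * R ^ fst p * R ^ snd p)) summable_on UNIV"
      by (rule iffD1[OF summable_on_iff_abs_summable_on_real])
    moreover have "(\<lambda>p. norm ((k \<circ> bi_index) p * R ^ fst p * R ^ snd p)) = (\<lambda>p. \<bar>(k \<circ> bi_index) p\<bar> * R ^ (fst p + snd p))"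
      using R by (intro ext) (simp add: abs_mult power_add)
    ultimately have dps: "double_power_series (k \<circ> bi_index) R"
      using R(1) by (intro double_power_series.intro) (simp_all only:)
    interpret double_power_series "k \<circ> bi_index" R by (rule dps)
    show ?thesis
    proof
      fix x :: "real^2" assume x: "\<And>i. \<bar>x $ i\<bar> \<le> R"
      from has_sum_double_sum[OF x x] hs[OF x] show "S x = double_sum (k \<circ> bi_index) (x $ 1) (x $ 2)"
        by (rule has_sum_unique[symmetric])
    qed
  qed
  then show ?thesis using e(1) by (intro exI[of _ "e / 4"]) auto
qed

lemma has_power_series_at_unique:
  fixes S :: "real^2 \<Rightarrow> real"
  assumes 1: "has_power_series_at S k 0" and 2: "has_power_series_at S l 0"
  shows "k = l"
proof -
  obtain R1 where R1: "R1 > 0" "\<And>R. 0 < R \<Longrightarrow> R \<le> R1 \<Longrightarrow> power_series_germ (k \<circ> bi_index) R S"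
    using power_series_germ_of_has_power_series[OF 1] by blast
  obtain R2 where R2: "R2 > 0" "\<And>R. 0 < R \<Longrightarrow> R \<le> R2 \<Longrightarrow> power_series_germ (l \<circ> bi_index) R S"
    using power_series_germ_of_has_power_series[OF 2] by blast
  define R where "R = min R1 R2"
  interpret K: power_series_germ "k \<circ> bi_index" R S using R1 R2 by (intro R1(2)) (auto simp: R_def)
  interpret L: power_series_germ "l \<circ> bi_index" R S using R1 R2 by (intro R2(2)) (auto simp: R_def)
  define c where "c p = (k \<circ> bi_index) p - (l \<circ> bi_index) p" for p
  have "(\<lambda>p. \<bar>c p\<bar> * R ^ (fst p + snd p)) summable_on UNIV"
  proof (rule summable_on_comparison_test)
    show "(\<lambda>p. \<bar>(k \<circ> bi_index) p\<bar> * R ^ (fst p + snd p) + \<bar>(l \<circ> bi_index) p\<bar> * R ^ (fst p + snd p)) summable_on UNIV"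
      by (intro summable_on_add K.abs_summable L.abs_summable)
    show "\<bar>c p\<bar> * R ^ (fst p + snd p) \<le> \<bar>(k \<circ> bi_index) p\<bar> * R ^ (fst p + snd p) + \<bar>(l \<circ> bi_index) p\<bar> * R ^ (fst p + snd p)" for p
      unfolding c_def distrib_right[symmetric] using K.R_pos by (intro mult_right_mono) auto
    show "0 \<le> \<bar>c p\<bar> * R ^ (fst p + snd p)" for p using K.R_pos by simp
  qed
  then interpret C: double_power_series c R by unfold_locales (rule K.R_pos)
  have "double_sum c x y = 0" if xy: "\<bar>x\<bar> \<le> R" "\<bar>y\<bar> \<le> R" for x y
  proof -
    have "((\<lambda>p. c p * x ^ fst p * y ^ snd p) has_sum (double_sum (k \<circ> bi_index) x y - double_sum (l \<circ> bi_index) x y)) UNIV"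
      using has_sum_add[OF K.has_sum_double_sum[OF xy] has_sum_uminusI[OF L.has_sum_double_sum[OF xy]]]
      by (simp add: c_def left_diff_distrib)
    moreover have "double_sum (k \<circ> bi_index) x y = double_sum (l \<circ> bi_index) x y"
      using K.S_eq[of "vec2 (x, y)"] L.S_eq[of "vec2 (x, y)"] xy by (simp add: forall_2 vec2_def)
    ultimately show ?thesis using C.has_sum_double_sum[OF xy] has_sum_unique by fastforce
  qed
  then have "c p = 0" for p by (rule C.double_sum_zero_imp_coeff_zero)
  then have eq: "k (bi_index p) = l (bi_index p)" for p unfolding c_def by simp
  show ?thesis
  proof
    fix \<alpha> show "k \<alpha> = l \<alpha>" using eq[of "(\<alpha> 1, \<alpha> 2)"] bi_index_surj[of \<alpha>] by simp
  qed
qed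

lemma has_power_series_taylor_coeff:
  fixes S :: "real^2 \<Rightarrow> real"
  assumes "has_power_series_at S k 0"
  shows "taylor_coeff S = k"
  unfolding taylor_coeff_def using assms has_power_series_at_unique by blast

text \<open>The largest integer \<open>k0\<close> below \<open>d\<close> leaves room for an exponent
  strictly above \<open>1 / d\<close>, for which the upper bound carries no logarithm.\<close>

lemma exists_exponent_above_inverse:
  fixes d :: real
  assumes "d > 0"
  shows "\<exists>q>0. q * d > 1 \<and> (\<forall>k::nat. real k < d \<longrightarrow> q * real k \<le> 1)"
proof -
  define k0 where "k0 = nat (\<lceil>d\<rceil> - 1)"
  have k0: "real k0 < d" unfolding k0_def using assms by linarith
  have le: "k \<le> k0" if "real k < d" for k :: nat unfolding k0_def using that by linarith
  \<comment> \<open>\<open>1 / q\<close> is the midpoint of \<open>k0\<close> and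
    \<open>d\<close>.\<close>
  define q where "q = 2 / (d + real k0)"
  have p: "d + real k0 > 0" using assms by simp
  have "q * d > 1" unfolding q_def using k0 p by (simp add: field_simps)
  moreover have "q * real k \<le> 1" if "real k < d" for k
    unfolding q_def using le[OF that] k0 p by (simp add: field_simps)
  ultimately show ?thesis using p by (intro exI[of _ q]) (auto simp: q_def)
qed

lemma emeasure_box_sublevel_swap:
  assumes "double_power_series c R" "\<delta> \<le> R"
  shows "emeasure lborel (box_sublevel (c \<circ> prod.swap) \<delta> \<epsilon>) = emeasure lborel (box_sublevel c \<delta> \<epsilon>)"
proof -
  have "box_sublevel (c \<circ> prod.swap) \<delta> \<epsilon> = {(x, y). (y, x) \<in> box_sublevel c \<delta> \<epsilon>}"
    unfolding box_sublevel_def double_sum_swap by auto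
  then show ?thesis
    using emeasure_lborel_swap(2)[OF double_power_series.box_sublevel_measurable[OF assms]] by simp
qed

lemma emeasure_box_sublevel_flip_x:
  assumes "double_power_series c R" "\<delta> \<le> R"
  shows "emeasure lborel (box_sublevel (flip_x c) \<delta> \<epsilon>) = emeasure lborel (box_sublevel c \<delta> \<epsilon>)"
proof -
  have "box_sublevel (flip_x c) \<delta> \<epsilon> = {(x, y). (- x, y) \<in> box_sublevel c \<delta> \<epsilon>}"
    unfolding box_sublevel_def double_sum_flip_x by auto
  then show ?thesis
    using emeasure_lborel_reflect_x(2)[OF double_power_series.box_sublevel_measurable[OF assms]] by simp
qed

text \<open>The supporting line is vertical, so the slices converge to a power series in
  \<open>u\<close> that need not be a polynomial. Only a neighbourhood of \<open>u = 0\<close>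
  matters, and there \<open>c (n, b) \<noteq> 0\<close> with \<open>b < d\<close> keeps the b-th
  derivative away from 0.\<close>

lemma (in double_power_series) box_estimate_vertical_edge:
  assumes d: "d = real n" "d > 0" and supp: "\<And>a b. c (a, b) \<noteq> 0 \<Longrightarrow> real a \<ge> d"
    and b: "c (n, b) \<noteq> 0" "real b < d"
  shows "\<exists>q>0. q * d > 1 \<and> has_sublevel_bound c d q"
proof -
  obtain q where q: "q > 0" "q * d > 1" "\<And>k::nat. real k < d \<Longrightarrow> q * real k \<le> 1"
    using exists_exponent_above_inverse[OF d(2)] by blast
  define \<gamma> where "\<gamma> = edge_coeff c 0 d"
  have \<gamma>: "\<gamma> k = c (n, k)" for k
  proof -
    have "{a. real a + 0 * real k = d} = {n}" using d(1) by auto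
    then show ?thesis unfolding \<gamma>_def edge_coeff_def by simp
  qed
  have flip: "edge_coeff (flip_x c) 0 d = (\<lambda>k. (- 1) ^ n * \<gamma> k)"
  proof
    fix k
    have "{a. real a + 0 * real k = d} = {n}" using d(1) by auto
    then show "edge_coeff (flip_x c) 0 d k = (- 1) ^ n * \<gamma> k"
      unfolding \<gamma> edge_coeff_def flip_x_def by simp
  qed
  have bnd: "\<bar>\<gamma> k\<bar> \<le> (total / R ^ n) / R ^ k" for k
  proof -
    have "(\<Sum>p\<in>{(n, k)}. \<bar>c p\<bar> * R ^ (fst p + snd p)) \<le> total" unfolding total_def
      using abs_summable R_pos by (intro finite_sum_le_infsum) auto
    then show ?thesis unfolding \<gamma> using R_pos by (simp add: power_add field_simps)
  qed
  have summ: "summable (\<lambda>k. \<gamma> k * z ^ k)" if "\<bar>z\<bar> < R" for z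
    by (rule summable_of_geometric_bound[OF bnd R_pos that])
  have "powser_deriv \<gamma> b 0 = fact b * \<gamma> b"
    unfolding powser_deriv_def powser_zero by (rule iterated_diffs_at_0)
  then have nz: "powser_deriv \<gamma> b 0 \<noteq> 0" using b(1) \<gamma> by simp
  have "isCont (powser_deriv \<gamma> b) 0"
    by (rule DERIV_isCont[OF DERIV_powser_deriv[OF summ]]) (use R_pos in auto)
  then obtain r0 where r0: "r0 > 0" "\<And>u. \<bar>u\<bar> < r0 \<Longrightarrow> \<bar>powser_deriv \<gamma> b u - powser_deriv \<gamma> b 0\<bar> < \<bar>powser_deriv \<gamma> b 0\<bar>"
    using nz unfolding continuous_at_eps_delta by (metis diff_zero dist_real_def zero_less_abs_iff)
  define r where "r = min (r0 / 2) (R / 2)"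
  have r: "0 < r" "r < R" unfolding r_def using r0 R_pos by auto
  have nz': "powser_deriv \<gamma> b u \<noteq> 0" if "\<bar>u\<bar> \<le> r" for u
    using r0(2)[of u] that r0(1) nz unfolding r_def by auto
  have ok: "b = 0 \<or> q * real b \<le> 1" using q(3)[OF b(2)] by simp
  have ok1: "edge_order_ok c 0 d r q"
    unfolding edge_order_ok_def \<gamma>_def[symmetric] using nz' ok by blast
  have ok2: "edge_order_ok (flip_x c) 0 d r q"
  proof -
    have "powser_deriv (\<lambda>k. (- 1) ^ n * \<gamma> k) b u = (- 1) ^ n * powser_deriv \<gamma> b u" if "\<bar>u\<bar> \<le> r" for u
    proof -
      have "summable (\<lambda>k. (diffs ^^ b) \<gamma> k * u ^ k)"
        by (rule summable_powser_deriv[OF summ]) (use that r in auto)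
      from suminf_mult[OF this, of "(- 1) ^ n"] show ?thesis
        unfolding powser_deriv_def iterated_diffs_scale by (simp add: mult.assoc)
    qed
    then show ?thesis unfolding edge_order_ok_def flip using nz' ok by (intro allI impI exI[of _ b]) auto
  qed
  have "has_sublevel_bound c d q"
    by (rule box_estimate_vertical[OF d(2) r q(1) supp ok1 ok2])
  then show ?thesis using q by blast
qed

section \<open>Growth index for each type of central face\<close>

context power_series_germ
begin

lemma low_of_box_lower_bound:
  assumes w: "w1 \<ge> 0" "w2 \<ge> 0" "w1 + w2 = 1 / d"
    and supp: "\<And>a b. c (a, b) \<noteq> 0 \<Longrightarrow> w1 * real a + w2 * real b \<ge> 1"
    and \<delta>: "0 < \<delta>" "\<delta> \<le> R"
  shows "\<exists>\<sigma> k. (\<sigma> = 1 / d \<and> k = 0) \<and> (\<exists>C>0. \<exists>\<epsilon>0>0. \<forall>\<epsilon>. 0 < \<epsilon> \<longrightarrow> \<epsilon> \<le> \<epsilon>0 \<longrightarrow>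
       ennreal (C * growth_scale \<sigma> k \<epsilon>) \<le> emeasure lborel (box_sublevel c \<delta> \<epsilon>))"
proof -
  obtain C where "C > 0" "\<And>\<epsilon>. 0 < \<epsilon> \<Longrightarrow> \<epsilon> < 1 \<Longrightarrow> ennreal (C * \<epsilon> powr (1 / d)) \<le> emeasure lborel (box_sublevel c \<delta> \<epsilon>)"
    using box_lower_bound[OF w supp \<delta>] by blast
  then show ?thesis
    by (intro exI[of _ "1 / d"] exI[of _ 0] exI[of _ C] exI[of _ "1 / 2"] conjI) (auto simp: growth_scale_def)
qed

lemma growth_index_of_sharp_estimate:
  assumes idx: "has_abs_growth_index S \<rho> m" and d: "d > 0" and q: "q > 0" "q * d > 1"
    and est: "has_sublevel_bound c d q"
    and w: "w1 \<ge> 0" "w2 \<ge> 0" "w1 + w2 = 1 / d"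
    and supp: "\<And>a b. c (a, b) \<noteq> 0 \<Longrightarrow> w1 * real a + w2 * real b \<ge> 1"
  shows "\<rho> = ereal (1 / d) \<and> m = 0"
proof -
  have low: "\<exists>\<sigma> k. (\<sigma> = 1 / d \<and> k = 0) \<and> (\<exists>C>0. \<exists>\<epsilon>0>0. \<forall>\<epsilon>. 0 < \<epsilon> \<longrightarrow> \<epsilon> \<le> \<epsilon>0 \<longrightarrow>
       ennreal (C * growth_scale \<sigma> k \<epsilon>) \<le> emeasure lborel (box_sublevel c \<delta> \<epsilon>))" if "0 < \<delta>" "\<delta> \<le> R" for \<delta>
    by (rule low_of_box_lower_bound[OF w supp that])
  note B = growth_index_bounds[OF idx d q(1) est low]
  have "\<rho> < ereal (1 / d) \<or> \<rho> = ereal (1 / d)" using B(1) by blast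
  then show ?thesis using B(3) q(2) by auto
qed

text \<open>The upper bound excludes an index below \<open>1 / d\<close>; the logarithm in the lower
  bound forces multiplicity at least 1, and more is impossible in the plane.\<close>

lemma growth_index_of_log_estimate:
  assumes idx: "has_abs_growth_index S \<rho> m" and d: "d > 0"
    and est: "has_sublevel_bound c d (1 / d)"
    and low: "\<And>\<delta>. 0 < \<delta> \<Longrightarrow> \<delta> \<le> R \<Longrightarrow> \<exists>C>0. \<exists>\<epsilon>0>0. \<forall>\<epsilon>. 0 < \<epsilon> \<longrightarrow> \<epsilon> \<le> \<epsilon>0 \<longrightarrow>
       ennreal (C * (\<epsilon> powr (1 / d) * (- ln \<epsilon>))) \<le> emeasure lborel (box_sublevel c \<delta> \<epsilon>)"
  shows "\<rho> = ereal (1 / d) \<and> m = 1"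
proof -
  have q: "1 / d > 0" using d by simp
  have low': "\<exists>\<sigma> k. (\<sigma> = 1 / d \<and> k = (1::nat)) \<and> (\<exists>C>0. \<exists>\<epsilon>0>0. \<forall>\<epsilon>. 0 < \<epsilon> \<longrightarrow> \<epsilon> \<le> \<epsilon>0 \<longrightarrow>
       ennreal (C * growth_scale \<sigma> k \<epsilon>) \<le> emeasure lborel (box_sublevel c \<delta> \<epsilon>))" if "0 < \<delta>" "\<delta> \<le> R" for \<delta>
    using low[OF that] by (simp add: growth_scale_def)
  note B = growth_index_bounds[OF idx d q est low']
  have "\<rho> < ereal (1 / d) \<or> \<rho> = ereal (1 / d) \<and> 1 \<le> m" using B(1) by blast
  moreover have "ereal (1 / d) \<le> \<rho>" using d by (intro B(4)) auto
  moreover have "m \<le> 1 \<or> \<rho> = \<infinity>" using B(2) by blast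
  ultimately show ?thesis by auto
qed

text \<open>A weight strictly between \<open>v\<close> and \<open>v'\<close> gives a supporting line
  that meets the support only in \<open>(n, n)\<close>. Its edge polynomial is a monomial, without
  zeros off the axes and of order \<open>n = d\<close> in each variable; hence the upper bound for
  \<open>q = 1 / d\<close>, whose logarithm is matched by the union of the intermediate
  boxes.\<close>

lemma vertex_growth:
  assumes idx: "has_abs_growth_index S \<rho> m" and d: "d = real n" "d > 0" and cn: "c (n, n) \<noteq> 0"
    and v: "0 \<le> v" "v < v'" "v' \<le> 1 / d"
    and supp: "\<And>a b. c (a, b) \<noteq> 0 \<Longrightarrow> v * real a + (1 / d - v) * real b \<ge> 1"
      "\<And>a b. c (a, b) \<noteq> 0 \<Longrightarrow> v' * real a + (1 / d - v') * real b \<ge> 1"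
  shows "\<rho> = ereal (1 / d) \<and> m = 1"
proof (rule growth_index_of_log_estimate[OF idx d(2)])
  define w where "w = (v + v') / 2"
  have w: "0 < w" "w < 1 / d" unfolding w_def using v by auto
  define s where "s = (1 / d - w) / w"
  have s: "s > 0" unfolding s_def using w by simp
  define e where "e = d * (1 + s)"
  have ew: "e = 1 / w" unfolding e_def s_def using w d(2) by (simp add: field_simps)
  have line: "real a + s * real b - e = (w * real a + (1 / d - w) * real b - 1) / w" for a b :: nat
    unfolding s_def ew using w by (simp add: field_simps)
  \<comment> \<open>The excess over the intermediate line is the mean of the excesses over the two
    outer ones, so on the support it vanishes only if both do.\<close>
  have avg: "w * real a + (1 / d - w) * real b - 1 =
      ((v * real a + (1 / d - v) * real b - 1) + (v' * real a + (1 / d - v') * real b - 1)) / 2" for a b :: nat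
    unfolding w_def by (simp add: field_simps)
  have supp_w: "real a + s * real b \<ge> d * (1 + s)" if "c (a, b) \<noteq> 0" for a b
  proof -
    have "w * real a + (1 / d - w) * real b - 1 \<ge> 0" unfolding avg using supp[OF that] by simp
    then have "real a + s * real b - e \<ge> 0" unfolding line using w by simp
    then show ?thesis unfolding e_def by simp
  qed
  have E: "edge_support c s e = {(n, n)}"
  proof
    show "edge_support c s e \<subseteq> {(n, n)}"
    proof
      fix p assume "p \<in> edge_support c s e"
      then obtain a b where ab: "p = (a, b)" "c (a, b) \<noteq> 0" "real a + s * real b = e"
        unfolding edge_support_def by (cases p) auto
      then have "w * real a + (1 / d - w) * real b - 1 = 0" using line[of a b] w by simp
      then have 1: "v * real a + (1 / d - v) * real b = 1" "v' * real a + (1 / d - v') * real b = 1"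
        using avg[of a b] supp[OF ab(2)] by auto
      then have "(v' - v) * (real a - real b) = 0" by (simp add: algebra_simps)
      then have "real a = real b" using v by simp
      moreover from this 1(1) have "real b / d = 1" by (simp add: algebra_simps)
      ultimately show "p \<in> {(n, n)}" using ab(1) d by simp
    qed
    have "real n + s * real n = e" unfolding e_def d(1) by (simp add: algebra_simps)
    then show "{(n, n)} \<subseteq> edge_support c s e" unfolding edge_support_def using cn by simp
  qed
  have nz: "edge_poly c (edge_support c s e) 0 0 x y \<noteq> 0" if "x \<noteq> 0" "y \<noteq> 0" for x y
    unfolding E edge_poly_def using that cn by simp
  have nn: "(n, n) \<in> edge_support c s e" using E by simp
  have qn: "1 / d * real (snd (n, n)) \<le> 1" "1 / d * real (fst (n, n)) \<le> 1" "1 / d > 0" using d by auto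
  have ord: "\<exists>k. (k = 0 \<or> 1 / d * real k \<le> 1) \<and> edge_poly c (edge_support c s e) 0 k x y \<noteq> 0"
    "\<exists>k. (k = 0 \<or> 1 / d * real k \<le> 1) \<and> edge_poly c (edge_support c s e) k 0 x y \<noteq> 0" if "x \<noteq> 0" "y \<noteq> 0" for x y
    using nz[OF that] by (auto intro!: exI[of _ 0])
  note ok = edge_order_ok_all[OF s qn(3) nn qn(1) nn qn(2) ord]
  have es: "e / s = d * (1 + 1 / s)" unfolding e_def using s by (simp add: field_simps)
  show "has_sublevel_bound c d (1 / d)"
    by (rule box_estimate_slanted[OF d(2) s _ supp_w ok[unfolded es, unfolded e_def]]) (use d(2) in auto)
  fix \<delta> assume \<delta>: "0 < \<delta>" "\<delta> \<le> R"
  show "\<exists>C>0. \<exists>\<epsilon>0>0. \<forall>\<epsilon>. 0 < \<epsilon> \<longrightarrow> \<epsilon> \<le> \<epsilon>0 \<longrightarrow>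
       ennreal (C * (\<epsilon> powr (1 / d) * (- ln \<epsilon>))) \<le> emeasure lborel (box_sublevel c \<delta> \<epsilon>)"
  proof -
    obtain C where "C > 0" "\<forall>\<epsilon>. 0 < \<epsilon> \<longrightarrow> \<epsilon> < 1 \<longrightarrow>
        ennreal (C * (\<epsilon> powr (1 / d) * (- ln \<epsilon>))) \<le> emeasure lborel (box_sublevel c \<delta> \<epsilon>)"
      using box_lower_bound_log[OF v d(2) supp \<delta>] by blast
    then show ?thesis by (intro exI[of _ C] conjI exI[of _ "1 / 2"]) auto
  qed
qed

text \<open>Quasihomogeneous scaling moves \<open>p\<close> to abscissa 1 or - 1; the second case is
  the first one for \<open>flip_x c\<close>.\<close>

lemma zero_on_unit_curve:
  assumes s: "s > 0"
    and p: "\<forall>i. p $ i \<noteq> 0"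
    and f: "f = (\<lambda>p :: real^2. edge_poly c (edge_support c s e) 0 0 (p $ 1) (p $ 2))"
  shows "\<exists>u0. (\<forall>i<zero_order f p. powser_deriv (edge_coeff c s e) i u0 = 0) \<or>
     (\<forall>i<zero_order f p. powser_deriv (edge_coeff (flip_x c) s e) i u0 = 0)"
proof -
  define t where "t = 1 / \<bar>p $ 1\<bar>"
  have t: "t > 0" unfolding t_def using p by simp
  define u0 where "u0 = t powr s * p $ 2"
  have line: "real a + s * real b = e" if "(a, b) \<in> edge_support c s e" for a b
    using that unfolding edge_support_def by simp
  have zero: "edge_poly c (edge_support c s e) 0 i (t * p $ 1) u0 = 0" if "i < zero_order f p" for i
  proof -
    have "edge_poly c (edge_support c s e) 0 i (p $ 1) (p $ 2) = 0"
      using that unfolding f by (rule edge_poly_vanish_below_zero_order)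
    then show ?thesis unfolding u0_def using edge_poly_scale[where E = "edge_support c s e", OF line t] by simp
  qed
  show ?thesis
  proof (cases "p $ 1 > 0")
    case True
    then have "t * p $ 1 = 1" unfolding t_def by simp
    then show ?thesis using zero unfolding powser_deriv_edge_coeff[OF s] by (intro exI[of _ u0] disjI1) simp
  next
    case False
    then have "t * p $ 1 = - 1" unfolding t_def using p[rule_format, of 1] by (simp add: field_simps)
    then show ?thesis using zero
      unfolding powser_deriv_edge_coeff[OF s] edge_support_flip_x edge_poly_flip_x by (intro exI[of _ u0] disjI2) simp
  qed
qed

text \<open>By \<open>pa\<close> and \<open>pb\<close> the zeros on the axes have order below
  \<open>d\<close>, so the zeros off the axes alone decide: an order above \<open>d\<close> lowers
  the index, a largest order equal to \<open>d\<close> produces the logarithm, and otherwise there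
  is none.\<close>

lemma slanted_edge_growth:
  assumes idx: "has_abs_growth_index S \<rho> m" and d: "d > 0" and s: "s > 0"
    and supp: "\<And>a b. c (a, b) \<noteq> 0 \<Longrightarrow> real a + s * real b \<ge> d * (1 + s)"
    and pa: "pa \<in> edge_support c s (d * (1 + s))" "real (fst pa) < d"
    and pb: "pb \<in> edge_support c s (d * (1 + s))" "real (snd pb) < d"
    and f: "f = (\<lambda>p :: real^2. edge_poly c (edge_support c s (d * (1 + s))) 0 0 (p $ 1) (p $ 2))"
  shows "(\<exists>p. (\<forall>i. p $ i \<noteq> 0) \<and> f p = 0 \<and> real (zero_order f p) > d) \<Longrightarrow> \<rho> < ereal (1 / d)"
    "\<not> (\<exists>p. (\<forall>i. p $ i \<noteq> 0) \<and> f p = 0 \<and> real (zero_order f p) > d) \<Longrightarrow>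
      \<rho> = ereal (1 / d) \<and> m = (if \<exists>p. (\<forall>i. p $ i \<noteq> 0) \<and> f p = 0 \<and> real (zero_order f p) = d then 1 else 0)"
proof -
  define e where "e = d * (1 + s)"
  have e: "e > 0" unfolding e_def using d s by simp
  let ?E = "edge_support c s e"
  have ne: "?E \<noteq> {}" using pa(1) unfolding e_def by auto
  have fin: "finite ?E" by (rule finite_edge_support[OF s])
  have es: "e / s = d * (1 + 1 / s)" unfolding e_def using s by (simp add: field_simps)
  note pa' = pa(1)[folded e_def] and pb' = pb(1)[folded e_def] and f' = f[folded e_def]
  have estimate: "has_sublevel_bound c d q"
    if q: "q > 0" "q * real (snd pb) \<le> 1" "q * real (fst pa) \<le> 1"
      and oy: "\<And>x y. x \<noteq> 0 \<Longrightarrow> y \<noteq> 0 \<Longrightarrow> \<exists>k. (k = 0 \<or> q * real k \<le> 1) \<and> edge_poly c ?E 0 k x y \<noteq> 0"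
      and ox: "\<And>x y. x \<noteq> 0 \<Longrightarrow> y \<noteq> 0 \<Longrightarrow> \<exists>k. (k = 0 \<or> q * real k \<le> 1) \<and> edge_poly c ?E k 0 x y \<noteq> 0" for q
    by (rule box_estimate_slanted[OF d s q(1) supp
          edge_order_ok_all[OF s q(1) pb' q(2) pa' q(3) oy ox, unfolded es, unfolded e_def]])
  have estimate_zero: "has_sublevel_bound c d q"
    if q: "q > 0" "q * real (snd pb) \<le> 1" "q * real (fst pa) \<le> 1"
      and z: "\<And>p. (\<forall>i. p $ i \<noteq> 0) \<Longrightarrow> f p = 0 \<Longrightarrow> q * real (zero_order f p) \<le> 1" for q
    using edge_order_le_of_zero_order[OF s ne f' z] by (intro estimate[OF q]) blast+
  interpret F: double_power_series "flip_x c" R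
    by (rule double_power_series_flip_x) (rule double_power_series_axioms)
  note flip = emeasure_box_sublevel_flip_x[OF double_power_series_axioms]
  have suppF: "flip_x c (a, b) \<noteq> 0 \<Longrightarrow> real a + s * real b \<ge> d * (1 + s)" for a b
    using supp[of a b] unfolding flip_x_def by auto
  show "\<rho> < ereal (1 / d)" if "\<exists>p. (\<forall>i. p $ i \<noteq> 0) \<and> f p = 0 \<and> real (zero_order f p) > d"
  proof -
    obtain p where p: "\<forall>i. p $ i \<noteq> 0" "real (zero_order f p) > d" using \<open>\<exists>p. _ p\<close> by blast
    obtain u0 where u0: "(\<forall>i<zero_order f p. powser_deriv (edge_coeff c s e) i u0 = 0) \<or>
       (\<forall>i<zero_order f p. powser_deriv (edge_coeff (flip_x c) s e) i u0 = 0)"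
      using zero_on_unit_curve[OF s p(1) f'] by blast
    define M where "M = (\<Sum>p\<in>?E. fst p + snd p)"
    have M: "fst p \<le> M" "snd p \<le> M" if "p \<in> ?E" for p
    proof -
      have "fst p + snd p \<le> M" unfolding M_def
        by (rule member_le_sum[OF that _ fin, where f = "\<lambda>p. fst p + snd p"]) simp
      then show "fst p \<le> M" "snd p \<le> M" by auto
    qed
    \<comment> \<open>With \<open>1 / q\<close> above all degrees of the edge polynomial every order
      is admissible. The bound is far from sharp, but here it only has to make the zero set
      null.\<close>
    define q where "q = 1 / (real M + 1)"
    have q0: "q > 0" unfolding q_def by simp
    have qM: "q * real k \<le> 1" if "k \<le> M" for k unfolding q_def using that by (simp add: field_simps)
    have est: "has_sublevel_bound c d q"
    proof (rule estimate[OF q0])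
      show "q * real (snd pb) \<le> 1" "q * real (fst pa) \<le> 1" using M[OF pa'] M[OF pb'] qM by auto
      fix x y :: real assume xy: "x \<noteq> 0" "y \<noteq> 0"
      obtain pt where pt: "pt \<in> ?E" "\<forall>p'\<in>?E. p' \<noteq> pt \<longrightarrow> snd p' < snd pt"
        using edge_support_extremes(1)[OF s ne] by blast
      have "edge_poly c ?E 0 (snd pt) x y \<noteq> 0"
        using pt xy by (intro edge_poly_top_order fin) (auto simp: edge_support_def)
      then show "\<exists>k. (k = 0 \<or> q * real k \<le> 1) \<and> edge_poly c ?E 0 k x y \<noteq> 0"
        using qM[OF M(2)[OF pt(1)]] by blast
      have s': "1 / s > 0" using s by simp
      note sw = edge_support_swap[OF s, of c e]
      obtain pt where pt: "pt \<in> edge_support (c \<circ> prod.swap) (1 / s) (e / s)"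
          "\<forall>p'\<in>edge_support (c \<circ> prod.swap) (1 / s) (e / s). p' \<noteq> pt \<longrightarrow> snd p' < snd pt"
        using edge_support_extremes(1)[OF s', of "c \<circ> prod.swap" "e / s"] ne unfolding sw by auto
      have "edge_poly (c \<circ> prod.swap) (edge_support (c \<circ> prod.swap) (1 / s) (e / s)) 0 (snd pt) y x \<noteq> 0"
        using pt xy by (intro edge_poly_top_order finite_edge_support[OF s']) (auto simp: edge_support_def)
      then have "edge_poly c ?E (snd pt) 0 x y \<noteq> 0" unfolding sw edge_poly_swap .
      moreover have "snd pt \<le> M" using pt(1) M(1) unfolding sw by auto
      ultimately show "\<exists>k. (k = 0 \<or> q * real k \<le> 1) \<and> edge_poly c ?E k 0 x y \<noteq> 0" using qM by blast
    qed
    have low: "\<exists>\<sigma> k. (\<sigma> < 1 / d \<and> k = 0) \<and> (\<exists>C>0. \<exists>\<epsilon>0>0. \<forall>\<epsilon>. 0 < \<epsilon> \<longrightarrow> \<epsilon> \<le> \<epsilon>0 \<longrightarrow>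
       ennreal (C * growth_scale \<sigma> k \<epsilon>) \<le> emeasure lborel (box_sublevel c \<delta> \<epsilon>))" if \<delta>: "0 < \<delta>" "\<delta> \<le> R" for \<delta>
    proof -
      have "\<exists>\<sigma><1 / d. \<exists>C>0. \<exists>\<epsilon>0>0. \<epsilon>0 < 1 \<and> (\<forall>\<epsilon>. 0 < \<epsilon> \<longrightarrow> \<epsilon> \<le> \<epsilon>0 \<longrightarrow>
         ennreal (C * \<epsilon> powr \<sigma>) \<le> emeasure lborel (box_sublevel c \<delta> \<epsilon>))"
        using u0
      proof
        assume "\<forall>i<zero_order f p. powser_deriv (edge_coeff c s e) i u0 = 0"
        then show ?thesis unfolding e_def
          by (intro curve_lower_bound_powr[OF d s p(2) supp _ \<delta>, of u0]) auto
      next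
        assume "\<forall>i<zero_order f p. powser_deriv (edge_coeff (flip_x c) s e) i u0 = 0"
        then show ?thesis unfolding e_def flip[OF \<delta>(2), symmetric]
          by (intro F.curve_lower_bound_powr[OF d s p(2) suppF _ \<delta>, of u0]) auto
      qed
      then obtain \<sigma> C \<epsilon>0 where "\<sigma> < 1 / d" "C > 0" "\<epsilon>0 > 0" "\<forall>\<epsilon>. 0 < \<epsilon> \<longrightarrow> \<epsilon> \<le> \<epsilon>0 \<longrightarrow>
         ennreal (C * \<epsilon> powr \<sigma>) \<le> emeasure lborel (box_sublevel c \<delta> \<epsilon>)" by blast
      then show ?thesis
        by (intro exI[of _ \<sigma>] exI[of _ 0] conjI exI[of _ C] exI[of _ \<epsilon>0]) (auto simp: growth_scale_def)
    qed
    obtain \<sigma> k where "\<sigma> < 1 / d" "\<rho> < ereal \<sigma> \<or> \<rho> = ereal \<sigma>"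
      using growth_index_bounds(1)[OF idx d q0 est low] by blast
    then show ?thesis by (auto intro: less_trans[of _ "ereal \<sigma>"])
  qed
  assume no: "\<not> (\<exists>p. (\<forall>i. p $ i \<noteq> 0) \<and> f p = 0 \<and> real (zero_order f p) > d)"
  show "\<rho> = ereal (1 / d) \<and> m = (if \<exists>p. (\<forall>i. p $ i \<noteq> 0) \<and> f p = 0 \<and> real (zero_order f p) = d then 1 else 0)"
  proof (cases "\<exists>p. (\<forall>i. p $ i \<noteq> 0) \<and> f p = 0 \<and> real (zero_order f p) = d")
    case True
    then obtain p where p: "\<forall>i. p $ i \<noteq> 0" "real (zero_order f p) = d" by blast
    obtain u0 where u0: "(\<forall>i<zero_order f p. powser_deriv (edge_coeff c s e) i u0 = 0) \<or>
       (\<forall>i<zero_order f p. powser_deriv (edge_coeff (flip_x c) s e) i u0 = 0)"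
      using zero_on_unit_curve[OF s p(1) f'] by blast
    have "\<rho> = ereal (1 / d) \<and> m = 1"
    proof (rule growth_index_of_log_estimate[OF idx d])
      show "has_sublevel_bound c d (1 / d)"
      proof (rule estimate_zero)
        fix p :: "real^2" assume "\<forall>i. p $ i \<noteq> 0" "f p = 0"
        then have "real (zero_order f p) \<le> d" using no by force
        then show "1 / d * real (zero_order f p) \<le> 1" using d by (simp add: field_simps)
      qed (use d pa(2) pb(2) in auto)
      fix \<delta> assume \<delta>: "0 < \<delta>" "\<delta> \<le> R"
      have "\<exists>C>0. \<exists>\<epsilon>0>0. \<epsilon>0 < 1 \<and> (\<forall>\<epsilon>. 0 < \<epsilon> \<longrightarrow> \<epsilon> \<le> \<epsilon>0 \<longrightarrow>
         ennreal (C * (\<epsilon> powr (1 / d) * (- ln \<epsilon>))) \<le> emeasure lborel (box_sublevel c \<delta> \<epsilon>))"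
        using u0
      proof
        assume "\<forall>i<zero_order f p. powser_deriv (edge_coeff c s e) i u0 = 0"
        then show ?thesis unfolding e_def
          by (intro curve_lower_bound_log[OF d s p(2) supp _ \<delta>, of u0]) auto
      next
        assume "\<forall>i<zero_order f p. powser_deriv (edge_coeff (flip_x c) s e) i u0 = 0"
        then show ?thesis unfolding e_def flip[OF \<delta>(2), symmetric]
          by (intro F.curve_lower_bound_log[OF d s p(2) suppF _ \<delta>, of u0]) auto
      qed
      then show "\<exists>C>0. \<exists>\<epsilon>0>0. \<forall>\<epsilon>. 0 < \<epsilon> \<longrightarrow> \<epsilon> \<le> \<epsilon>0 \<longrightarrow>
         ennreal (C * (\<epsilon> powr (1 / d) * (- ln \<epsilon>))) \<le> emeasure lborel (box_sublevel c \<delta> \<epsilon>)" by blast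
    qed
    then show ?thesis using True by simp
  next
    case False
    \<comment> \<open>All orders are integers below \<open>d\<close>, so an exponent above
      \<open>1 / d\<close> is available and no logarithm appears.\<close>
    obtain q where q: "q > 0" "q * d > 1" "\<And>k::nat. real k < d \<Longrightarrow> q * real k \<le> 1"
      using exists_exponent_above_inverse[OF d] by blast
    have est: "has_sublevel_bound c d q"
    proof (rule estimate_zero[OF q(1)])
      fix p :: "real^2" assume "\<forall>i. p $ i \<noteq> 0" "f p = 0"
      then have "real (zero_order f p) < d" using no False by force
      then show "q * real (zero_order f p) \<le> 1" by (rule q(3))
    qed (use q(3) pa(2) pb(2) in auto)
    have "1 / e * real a + s / e * real b \<ge> 1" if "c (a, b) \<noteq> 0" for a b
      using supp[OF that] e unfolding e_def[symmetric] by (simp add: add_divide_distrib[symmetric])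
    moreover have "1 / e + s / e = 1 / d" unfolding e_def add_divide_distrib[symmetric] using d s by simp
    ultimately have "\<rho> = ereal (1 / d) \<and> m = 0"
      using e s by (intro growth_index_of_sharp_estimate[OF idx d q(1,2) est, of "1 / e" "s / e"]) auto
    then show ?thesis using False by simp
  qed
qed

end

text \<open>\<open>face_part\<close> sums over all lattice points of the face, including those with
  coefficient 0; dropping these leaves the sum over the support.\<close>

lemma face_part_slanted_edge:
  fixes S :: "real^2 \<Rightarrow> real"
  assumes w: "w1 > 0" "w2 > 0"
    and N: "\<And>\<alpha>. taylor_coeff S \<alpha> \<noteq> 0 \<Longrightarrow> exponent_point \<alpha> \<in> N"
    and F: "F = {z\<in>N. w1 * z $ 1 + w2 * z $ 2 = 1}"
  shows "face_part S F = (\<lambda>x. edge_poly (taylor_coeff S \<circ> bi_index)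
     (edge_support (taylor_coeff S \<circ> bi_index) (w2 / w1) (1 / w1)) 0 0 (x $ 1) (x $ 2))"
proof
  fix x :: "real^2"
  let ?c = "taylor_coeff S \<circ> bi_index"
  define B where "B = {p. exponent_point (bi_index p) \<in> F}"
  have line: "real (fst p) + w2 / w1 * real (snd p) = 1 / w1 \<longleftrightarrow> w1 * real (fst p) + w2 * real (snd p) = 1" for p :: "nat \<times> nat"
    using w by (simp add: field_simps)
  have sub: "B \<subseteq> {p. real (fst p) + w2 / w1 * real (snd p) = 1 / w1}"
    unfolding B_def F line by auto
  have fin: "finite B" by (rule finite_subset[OF sub finite_line_points]) (use w in simp)
  have img: "{\<alpha>. exponent_point \<alpha> \<in> F} = bi_index ` B"
    unfolding B_def using bi_index_surj by (auto simp: image_iff) metis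
  have "face_part S F x = (\<Sum>p\<in>B. ?c p * monomial (bi_index p) x)"
    unfolding face_part_def img
    by (subst sum.reindex) (auto intro: inj_on_subset[OF bij_is_inj[OF bij_bi_index]])
  also have "\<dots> = (\<Sum>p\<in>edge_support ?c (w2 / w1) (1 / w1). ?c p * monomial (bi_index p) x)"
  proof (rule sum.mono_neutral_right[OF fin])
    show "edge_support ?c (w2 / w1) (1 / w1) \<subseteq> B"
      unfolding edge_support_def line B_def F using N by auto
    show "\<forall>p\<in>B - edge_support ?c (w2 / w1) (1 / w1). ?c p * monomial (bi_index p) x = 0"
      unfolding edge_support_def line B_def F by auto
  qed
  also have "\<dots> = edge_poly ?c (edge_support ?c (w2 / w1) (1 / w1)) 0 0 (x $ 1) (x $ 2)"
    unfolding edge_poly_def by (simp add: monomial_bi_index mult.assoc)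
  finally show "face_part S F x = edge_poly ?c (edge_support ?c (w2 / w1) (1 / w1)) 0 0 (x $ 1) (x $ 2)" .
qed

theorem theorem1p5:
  fixes S :: "real^2 \<Rightarrow> real" and U :: "(real^2) set"
    and d :: real and C :: "(real^2) set" and k :: int
    and \<rho> :: ereal and m :: nat
  assumes "open U" and "0 \<in> U" and "real_analytic_on S U"
    and "\<not> (\<forall>\<^sub>F x in nhds 0. S x = 0)"
    and "S 0 = 0" and "GDERIV S 0 :> 0"
    and "d = newton_distance S" and "C = central_face S" and "k = aff_dim C"
    and "has_abs_growth_index S \<rho> m"
  shows
    "(\<rho> = ereal (1 / d) \<longleftrightarrow>
        \<not> (compact C \<and> k = 1 \<and>
           (\<exists>p. (\<forall>i. p $ i \<noteq> 0) \<and> face_part S C p = 0 \<and>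
                real (zero_order (face_part S C) p) > d))) \<and>
     (compact C \<and> k = 1 \<and>
        (\<exists>p. (\<forall>i. p $ i \<noteq> 0) \<and> face_part S C p = 0 \<and>
             real (zero_order (face_part S C) p) > d) \<longrightarrow>
        \<rho> < ereal (1 / d)) \<and>
     (\<rho> = ereal (1 / d) \<longrightarrow>
        (if compact C \<and>
            (\<exists>p. (\<forall>i. p $ i \<noteq> 0) \<and> face_part S C p = 0 \<and>
                 real (zero_order (face_part S C) p) = d)
         then m = 1 else int m = 1 - k))"
proof -
  obtain k' where k': "has_power_series_at S k' 0" using assms(2,3) unfolding real_analytic_on_def by blast
  define c where "c = taylor_coeff S \<circ> bi_index"
  have ck: "c = k' \<circ> bi_index" unfolding c_def has_power_series_taylor_coeff[OF k'] ..
  obtain R where "power_series_germ c R S"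
    using power_series_germ_of_has_power_series[OF k'] unfolding ck by blast
  then interpret G: power_series_germ c R S .
  define A where "A = {\<alpha>. taylor_coeff S \<alpha> \<noteq> 0}"
  define N where "N = newton_polyhedron S"
  have cA: "c p \<noteq> 0 \<longleftrightarrow> bi_index p \<in> A" for p unfolding c_def A_def by simp
  have A_nonempty: "A \<noteq> {}"
  proof
    assume "A = {}"
    then have c0: "c p = 0" for p using cA by blast
    have "S x = 0" if "x \<in> ball 0 R" for x
    proof -
      have "\<bar>x $ i\<bar> \<le> R" for i using that component_le_norm_cart[of x i] by simp
      then have "S x = double_sum c (x $ 1) (x $ 2)" by (rule G.S_eq)
      then show ?thesis by (simp add: double_sum_def c0)
    qed
    then have "\<forall>\<^sub>F x in nhds 0. S x = 0"
      using eventually_nhds_in_open[of "ball 0 R" "0 :: real^2"] G.R_pos by (auto elim: eventually_mono)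
    then show False using assms(4) by simp
  qed
  have A_zero: "(\<lambda>_. 0) \<notin> A"
  proof -
    have "S 0 = double_sum c 0 0" using G.S_eq[of 0] G.R_pos by simp
    also have "\<dots> = (\<Sum>\<^sub>\<infinity>p\<in>{(0, 0)}. c p * 0 ^ fst p * 0 ^ snd p)"
      unfolding double_sum_def by (rule infsum_cong_neutral) (auto simp: power_0_left)
    finally have "c (0, 0) = 0" using assms(5) by simp
    moreover have "bi_index (0, 0) = (\<lambda>_. 0)" by (auto simp: bi_index_def)
    ultimately show ?thesis using cA by metis
  qed
  interpret D: newton_data A N d "\<chi> i. d"
  proof
    show "N = convex hull (\<Union>\<alpha>\<in>A. quadrant \<alpha>)" unfolding N_def A_def newton_polyhedron_def ..
    show "d = Inf {t. (\<chi> i. t) \<in> N}" unfolding N_def assms(7) newton_distance_def ..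
  qed (use A_nonempty A_zero in auto)
  have C: "C = (THE F. F face_of N \<and> (\<chi> i. d) \<in> rel_interior F)"
    unfolding assms(8) central_face_def N_def assms(7) ..
  have expN: "exponent_point \<alpha> \<in> N" if "\<alpha> \<in> A" for \<alpha>
    using D.quadrant_subset[OF that] by (auto simp: quadrant_def)
  show ?thesis
  proof (cases "(\<chi> i. d) extreme_point_of N")
    case True
    then have face: "{\<chi> i. d} face_of N" by (simp add: face_of_singleton)
    have "C = {\<chi> i. d}" unfolding C by (rule D.central_unique[OF face]) simp
    then have k: "k = 0" using assms(9) by simp
    obtain n where n: "d = real n" "(\<lambda>_. n) \<in> A" using D.extreme_imp_vertex[OF True] by blast
    obtain v v' where v: "0 \<le> v" "v < v'" "v' \<le> 1 / d" "\<forall>\<alpha>\<in>A. v * real (\<alpha> 1) + (1 / d - v) * real (\<alpha> 2) \<ge> 1 \<and>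
        v' * real (\<alpha> 1) + (1 / d - v') * real (\<alpha> 2) \<ge> 1"
      using D.vertex_weights[OF True] by blast
    have "bi_index (n, n) = (\<lambda>_. n)" by (auto simp: bi_index_def)
    then have "c (n, n) \<noteq> 0" using n(2) cA[of "(n, n)"] by simp
    then have "\<rho> = ereal (1 / d) \<and> m = 1"
    proof (rule G.vertex_growth[OF assms(10) n(1) D.d_pos _ v(1-3)])
      fix a b assume "c (a, b) \<noteq> 0"
      then have "bi_index (a, b) \<in> A" using cA by blast
      then show "v * real a + (1 / d - v) * real b \<ge> 1" "v' * real a + (1 / d - v') * real b \<ge> 1"
        using v(4) by force+
    qed
    \<comment> \<open>As \<open>k = 0\<close>, both branches of the multiplicity claim ask for
      \<open>m = 1\<close>, so it need not be decided which one applies.\<close>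
    then show ?thesis using k by simp
  next
    case False
    obtain w1 w2 where w: "w1 \<ge> 0" "w2 \<ge> 0" "w1 + w2 = 1 / d" "\<And>z. z \<in> N \<Longrightarrow> w1 * z $ 1 + w2 * z $ 2 \<ge> 1"
      using D.supporting_weights by blast
    define F where "F = {z\<in>N. w1 * z $ 1 + w2 * z $ 2 = 1}"
    note edge = D.edge_of_not_extreme[OF False w, folded F_def]
    have CF: "C = F" unfolding C by (rule edge(1))
    have k: "k = 1" using assms(9) edge(2) CF by simp
    have supp: "w1 * real a + w2 * real b \<ge> 1" if "c (a, b) \<noteq> 0" for a b
      using w(4)[OF expN, of "bi_index (a, b)"] that cA by simp
    \<comment> \<open>A point of the edge with a coordinate below \<open>d\<close> need not be an
      exponent; it is replaced by one that occurs in the series.\<close>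
    have attained: "\<exists>p. c p \<noteq> 0 \<and> w1 * real (fst p) + w2 * real (snd p) = 1 \<and> real (bi_index p j) < d"
      if low: "\<exists>z\<in>F. z $ j < d" for j
    proof -
      obtain z where z: "z \<in> N" "w1 * z $ 1 + w2 * z $ 2 = 1" "z $ j < d" using low unfolding F_def by blast
      obtain \<alpha> where "\<alpha> \<in> A" "w1 * real (\<alpha> 1) + w2 * real (\<alpha> 2) = 1" "real (\<alpha> j) < d"
        using D.support_attained[OF w(1,2,4) z] by blast
      then show ?thesis using cA[of "(\<alpha> 1, \<alpha> 2)"] bi_index_surj[of \<alpha>]
        by (intro exI[of _ "(\<alpha> 1, \<alpha> 2)"]) auto
    qed
    consider "w1 > 0" "w2 > 0" | "w2 = 0" | "w1 = 0" using w(1,2) by fastforce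
    then show ?thesis
    proof cases
      case 1
      have comp: "compact C" unfolding CF F_def by (rule D.compact_slanted_edge[OF 1])
      \<comment> \<open>Division by \<open>w1\<close> normalizes the first weight to 1; since
        \<open>w1 + w2 = 1 / d\<close>, the level of the line becomes
        \<open>d * (1 + s)\<close>.\<close>
      define s where "s = w2 / w1"
      have s: "s > 0" unfolding s_def using 1 by simp
      have de: "d * (1 + s) = 1 / w1"
      proof -
        have "1 + s = (w1 + w2) / w1" unfolding s_def using 1 by (simp add: add_divide_distrib)
        then show ?thesis using w(3) D.d_pos by simp
      qed
      have line: "real a + s * real b = (w1 * real a + w2 * real b) / w1" for a b :: nat
        unfolding s_def using 1 by (simp add: field_simps)
      have supp': "real a + s * real b \<ge> d * (1 + s)" if "c (a, b) \<noteq> 0" for a b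
        unfolding de line using supp[OF that] 1 by (intro divide_right_mono) auto
      obtain pa where pa: "pa \<in> edge_support c s (d * (1 + s))" "real (fst pa) < d"
        using attained[of 1] edge(3) 1 unfolding edge_support_def de line by auto
      obtain pb where pb: "pb \<in> edge_support c s (d * (1 + s))" "real (snd pb) < d"
        using attained[of 2] edge(4) 1 unfolding edge_support_def de line by auto
      have f: "face_part S C = (\<lambda>p. edge_poly c (edge_support c s (d * (1 + s))) 0 0 (p $ 1) (p $ 2))"
        unfolding c_def s_def[symmetric] de
        by (rule face_part_slanted_edge[OF 1 _ CF[unfolded F_def], folded s_def]) (use expN A_def in auto)
      note E = G.slanted_edge_growth[OF assms(10) D.d_pos s supp' pa pb f]
      show ?thesis
      proof (cases "\<exists>p. (\<forall>i. p $ i \<noteq> 0) \<and> face_part S C p = 0 \<and> real (zero_order (face_part S C) p) > d")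
        case True
        then show ?thesis using E(1)[OF _ True] comp k by auto
      next
        case False
        have "\<rho> = ereal (1 / d)"
          "m = (if \<exists>p. (\<forall>i. p $ i \<noteq> 0) \<and> face_part S C p = 0 \<and> real (zero_order (face_part S C) p) = d then 1 else 0)"
          using E(2)[OF _ False] by auto
        then show ?thesis using False comp k by auto
      qed
    next
      case 2
      \<comment> \<open>The edge is vertical and unbounded, so the exceptional conditions fail and
        the claim is \<open>m = 0 = 1 - k\<close>.\<close>
      have ncomp: "\<not> compact C" unfolding CF F_def using D.not_compact_axis_edge[OF w(3)] 2 by simp
      have w1: "w1 = 1 / d" using w(3) 2 by simp
      have supp': "real a \<ge> d" if "c (a, b) \<noteq> 0" for a b
        using supp[OF that] D.d_pos unfolding w1 2 by (simp add: field_simps)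
      obtain p where p: "c p \<noteq> 0" "w1 * real (fst p) + w2 * real (snd p) = 1" "real (snd p) < d"
        using attained[of 2] edge(4) w1 D.d_pos by auto
      have dn: "d = real (fst p)" using p(2) D.d_pos unfolding w1 2 by (simp add: field_simps)
      have cn: "c (fst p, snd p) \<noteq> 0" using p(1) by simp
      have "\<exists>q>0. q * d > 1 \<and> has_sublevel_bound c d q"
        by (rule G.box_estimate_vertical_edge[OF dn D.d_pos supp' cn p(3)])
      then obtain q where q: "q > 0" "q * d > 1" and est: "has_sublevel_bound c d q"
        by - (erule exE, (erule conjE)+, rule that)
      have "\<rho> = ereal (1 / d) \<and> m = 0"
        by (rule G.growth_index_of_sharp_estimate[OF assms(10) D.d_pos q est w(1-3) supp])
      then show ?thesis using ncomp k by simp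
    next
      case 3
      have ncomp: "\<not> compact C" unfolding CF F_def using D.not_compact_axis_edge[OF w(3)] 3 by simp
      have w2: "w2 = 1 / d" using w(3) 3 by simp
      \<comment> \<open>The edge is horizontal: the upper bound is proved for the exchanged
        variables and carried back, as the exchange preserves the measure of sublevel sets of a
        square box.\<close>
      interpret W: double_power_series "c \<circ> prod.swap" R
        by (rule double_power_series_swap) (rule G.double_power_series_axioms)
      have supp': "real a \<ge> d" if "(c \<circ> prod.swap) (a, b) \<noteq> 0" for a b
        using supp[of b a] that D.d_pos unfolding w2 3 by (simp add: field_simps)
      obtain p where p: "c p \<noteq> 0" "w1 * real (fst p) + w2 * real (snd p) = 1" "real (fst p) < d"
        using attained[of 1] edge(3) w2 D.d_pos by auto
      have dn: "d = real (snd p)" using p(2) D.d_pos unfolding w2 3 by (simp add: field_simps)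
      have cn: "(c \<circ> prod.swap) (snd p, fst p) \<noteq> 0" using p(1) by simp
      have "\<exists>q>0. q * d > 1 \<and> has_sublevel_bound (c \<circ> prod.swap) d q"
        by (rule W.box_estimate_vertical_edge[OF dn D.d_pos supp' cn p(3)])
      then obtain q where q: "q > 0" "q * d > 1" and est: "has_sublevel_bound (c \<circ> prod.swap) d q"
        by - (erule exE, (erule conjE)+, rule that)
      obtain K \<delta>0 where K: "K \<ge> 0" "\<delta>0 > 0" "\<And>\<delta> \<epsilon>. 0 < \<delta> \<Longrightarrow> \<delta> \<le> \<delta>0 \<Longrightarrow> 0 < \<epsilon> \<Longrightarrow> \<epsilon> < 1 \<Longrightarrow>
          emeasure lborel (box_sublevel (c \<circ> prod.swap) \<delta> \<epsilon>) \<le> ennreal (K * sublevel_rate d q \<epsilon>)"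
        using est unfolding has_sublevel_bound_def by blast
      have "emeasure lborel (box_sublevel c \<delta> \<epsilon>) \<le> ennreal (K * sublevel_rate d q \<epsilon>)"
        if "0 < \<delta>" "\<delta> \<le> min \<delta>0 R" "0 < \<epsilon>" "\<epsilon> < 1" for \<delta> \<epsilon>
        using K(3)[of \<delta> \<epsilon>] that emeasure_box_sublevel_swap[OF G.double_power_series_axioms, of \<delta> \<epsilon>] by simp
      then have est': "has_sublevel_bound c d q"
        unfolding has_sublevel_bound_def using K(1,2) G.R_pos by (intro exI[of _ K] conjI exI[of _ "min \<delta>0 R"]) auto
      have "\<rho> = ereal (1 / d) \<and> m = 0"
        by (rule G.growth_index_of_sharp_estimate[OF assms(10) D.d_pos q est' w(1-3) supp])
      then show ?thesis using ncomp k by simp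
    qed
  qed
qed

end
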